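(* Let $1<p<\infty$, $p\ne2$, and let $\mathcal{U}$ be a selective nonprincipal ultrafilter on $\mathbb{N}$. Then there are exactly four closed subspaces of $(L^{p})^{\mathcal{U}}$, other than $\{0\}$ and $(L^{p})^{\mathcal{U}}$, that are invariant under $T^{\mathcal{U}}$ for all $T\in B(L^{p})$, namely $L^{p}$, $\widehat{L^{p}}$, $M$ and $L^{p}\oplus M$. Here $M$ is the unique complemented closed subspace of $\widehat{L^{p}}$ such that an operator $S\in B((L^{p})^{\mathcal{U}})$ lies in the WOT closure of $\{T^{\mathcal{U}}:T\in B(L^{p})\}$ iff $S$ leaves $L^{p}$, $\widehat{L^{p}}$ and $M$ invariant; for $p>2$ one has $M=\{(f_n)_{n,\mathcal{U}}\in(L^{p})^{\mathcal{U}}:\lim_{n,\mathcal{U}}\|f_n\|_2=0\}$.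
   Context: $L^{p}=L^{p}([0,1],\mu)$, $\mu$ Lebesgue measure. $(L^{p})^{\mathcal{U}}$ is the ultrapower (bounded sequences modulo those with $\lim_{n,\mathcal{U}}\|f_n\|_p=0$), $(f_n)_{n,\mathcal{U}}$ the class of $(f_n)$, $T^{\mathcal{U}}(f_n)_{n,\mathcal{U}}=(Tf_n)_{n,\mathcal{U}}$. $L^p$ is identified with constant classes, $\widehat{L^{p}}=\{(f_n)_{n,\mathcal{U}}:w\text{-}\lim_{n,\mathcal{U}}f_n=0\}$, and $(L^{p})^{\mathcal{U}}=L^{p}\oplus\widehat{L^{p}}$. An ultrafilter $\mathcal{U}$ on $\mathbb{N}$ is selective if (1) for every sequence $A_1,A_2,\dots$ in $\mathcal{U}$ there is $A\in\mathcal{U}$ with $A\setminus A_k$ finite for each $k$; and (2) for every partition of $\mathbb{N}$ into finite sets $A_1,A_2,\dots$ there is $A\in\mathcal{U}$ with $A\cap A_k$ a singleton for each $k$. *)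

theory Defs
  imports "HOL-Analysis.Analysis"
begin

definition nonprincipal_ultrafilter :: "nat filter \<Rightarrow> bool" where
  "nonprincipal_ultrafilter U \<longleftrightarrow>
     U \<noteq> bot \<and>
     (\<forall>A. eventually (\<lambda>n. n \<in> A) U \<or> eventually (\<lambda>n. n \<notin> A) U) \<and>
     (\<forall>k. \<not> eventually (\<lambda>n. n = k) U)"

definition selective_ultrafilter :: "nat filter \<Rightarrow> bool" where
  "selective_ultrafilter U \<longleftrightarrow>
     nonprincipal_ultrafilter U \<and>
     (\<forall>As :: nat \<Rightarrow> nat set. (\<forall>k. eventually (\<lambda>n. n \<in> As k) U) \<longrightarrow>
        (\<exists>A. eventually (\<lambda>n. n \<in> A) U \<and> (\<forall>k. finite (A - As k)))) \<and>
     (\<forall>As :: nat \<Rightarrow> nat set.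
        ((\<forall>k. finite (As k) \<and> As k \<noteq> {}) \<and> (\<forall>k l. k \<noteq> l \<longrightarrow> As k \<inter> As l = {}) \<and>
         (\<Union>k. As k) = UNIV) \<longrightarrow>
        (\<exists>A. eventually (\<lambda>n. n \<in> A) U \<and> (\<forall>k. \<exists>m. A \<inter> As k = {m})))"

definition M01 :: "real measure" where
  "M01 = restrict_space lborel {0..1}"

definition Lp :: "real \<Rightarrow> (real \<Rightarrow> real) set" where
  "Lp p = {f. f \<in> borel_measurable M01 \<and> integrable M01 (\<lambda>x. \<bar>f x\<bar> powr p)}"

definition lpnorm :: "real \<Rightarrow> (real \<Rightarrow> real) \<Rightarrow> real" where
  "lpnorm p f = (\<integral>x. \<bar>f x\<bar> powr p \<partial>M01) powr (1 / p)"

text \<open>Bounded linear operators on L^p (acting on representatives, linear modulo a.e. equality).\<close>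
definition bop_Lp :: "real \<Rightarrow> ((real \<Rightarrow> real) \<Rightarrow> (real \<Rightarrow> real)) \<Rightarrow> bool" where
  "bop_Lp p T \<longleftrightarrow>
     (\<forall>f \<in> Lp p. T f \<in> Lp p) \<and>
     (\<forall>f \<in> Lp p. \<forall>g \<in> Lp p. \<forall>a b :: real.
        AE x in M01. T (\<lambda>y. a * f y + b * g y) x = a * T f x + b * T g x) \<and>
     (\<forall>f \<in> Lp p. \<forall>g \<in> Lp p. (AE x in M01. f x = g x) \<longrightarrow> (AE x in M01. T f x = T g x)) \<and>
     (\<exists>C. \<forall>f \<in> Lp p. lpnorm p (T f) \<le> C * lpnorm p f)"

definition dual_Lp :: "real \<Rightarrow> ((real \<Rightarrow> real) \<Rightarrow> real) \<Rightarrow> bool" where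
  "dual_Lp p \<phi> \<longleftrightarrow>
     (\<forall>f \<in> Lp p. \<forall>g \<in> Lp p. \<forall>a b :: real.
        \<phi> (\<lambda>y. a * f y + b * g y) = a * \<phi> f + b * \<phi> g) \<and>
     (\<exists>C. \<forall>f \<in> Lp p. \<bar>\<phi> f\<bar> \<le> C * lpnorm p f)"

type_synonym useq = "nat \<Rightarrow> real \<Rightarrow> real"

text \<open>Bounded sequences in L^p (representatives of elements of the ultrapower).\<close>
definition UP :: "real \<Rightarrow> useq set" where
  "UP p = {F. (\<forall>n. F n \<in> Lp p) \<and> (\<exists>C. \<forall>n. lpnorm p (F n) \<le> C)}"

definition uminus_seq :: "useq \<Rightarrow> useq \<Rightarrow> useq" where
  "uminus_seq F G = (\<lambda>n x. F n x - G n x)"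

definition unorm :: "real \<Rightarrow> nat filter \<Rightarrow> useq \<Rightarrow> real" where
  "unorm p U F = Lim U (\<lambda>n. lpnorm p (F n))"

text \<open>Two representatives define the same element of the ultrapower.\<close>
definition ueq :: "real \<Rightarrow> nat filter \<Rightarrow> useq \<Rightarrow> useq \<Rightarrow> bool" where
  "ueq p U F G \<longleftrightarrow> ((\<lambda>n. lpnorm p (F n - G n)) \<longlongrightarrow> 0) U"

text \<open>A closed linear subspace of (L^p)^U, represented as the (saturated) set of all
  representing sequences of its elements.\<close>
definition closed_usub :: "real \<Rightarrow> nat filter \<Rightarrow> useq set \<Rightarrow> bool" where
  "closed_usub p U X \<longleftrightarrow>
     X \<subseteq> UP p \<and>
     (\<forall>F \<in> X. \<forall>G \<in> UP p. ueq p U F G \<longrightarrow> G \<in> X) \<and>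
     (\<lambda>n x. 0) \<in> X \<and>
     (\<forall>F \<in> X. \<forall>G \<in> X. \<forall>a b :: real. (\<lambda>n x. a * F n x + b * G n x) \<in> X) \<and>
     (\<forall>G \<in> UP p. (\<forall>\<epsilon>>0. \<exists>F \<in> X. unorm p U (uminus_seq G F) < \<epsilon>) \<longrightarrow> G \<in> X)"

definition uzero :: "real \<Rightarrow> nat filter \<Rightarrow> useq set" where
  "uzero p U = {F \<in> UP p. ueq p U F (\<lambda>n x. 0)}"

definition LpC :: "real \<Rightarrow> nat filter \<Rightarrow> useq set" where
  "LpC p U = {F \<in> UP p. \<exists>f \<in> Lp p. ueq p U F (\<lambda>n. f)}"

definition Lhat :: "real \<Rightarrow> nat filter \<Rightarrow> useq set" where
  "Lhat p U = {F \<in> UP p. \<forall>\<phi>. dual_Lp p \<phi> \<longrightarrow> ((\<lambda>n. \<phi> (F n)) \<longlongrightarrow> 0) U}"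

definition subspace_sum :: "real \<Rightarrow> nat filter \<Rightarrow> useq set \<Rightarrow> useq set \<Rightarrow> useq set" where
  "subspace_sum p U X Y = {F \<in> UP p. \<exists>G \<in> X. \<exists>H \<in> Y. ueq p U F (\<lambda>n x. G n x + H n x)}"

definition ultra_op :: "((real \<Rightarrow> real) \<Rightarrow> (real \<Rightarrow> real)) \<Rightarrow> useq \<Rightarrow> useq" where
  "ultra_op T F = (\<lambda>n. T (F n))"

definition invariant_under :: "(useq \<Rightarrow> useq) \<Rightarrow> useq set \<Rightarrow> bool" where
  "invariant_under S X \<longleftrightarrow> (\<forall>F \<in> X. S F \<in> X)"

definition bop_U :: "real \<Rightarrow> nat filter \<Rightarrow> (useq \<Rightarrow> useq) \<Rightarrow> bool" where
  "bop_U p U S \<longleftrightarrow>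
     (\<forall>F \<in> UP p. S F \<in> UP p) \<and>
     (\<forall>F \<in> UP p. \<forall>G \<in> UP p. ueq p U F G \<longrightarrow> ueq p U (S F) (S G)) \<and>
     (\<forall>F \<in> UP p. \<forall>G \<in> UP p. \<forall>a b :: real.
        ueq p U (S (\<lambda>n x. a * F n x + b * G n x)) (\<lambda>n x. a * S F n x + b * S G n x)) \<and>
     (\<exists>C. \<forall>F \<in> UP p. unorm p U (S F) \<le> C * unorm p U F)"

definition dual_U :: "real \<Rightarrow> nat filter \<Rightarrow> (useq \<Rightarrow> real) \<Rightarrow> bool" where
  "dual_U p U \<Phi> \<longleftrightarrow>
     (\<forall>F \<in> UP p. \<forall>G \<in> UP p. ueq p U F G \<longrightarrow> \<Phi> F = \<Phi> G) \<and>
     (\<forall>F \<in> UP p. \<forall>G \<in> UP p. \<forall>a b :: real.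
        \<Phi> (\<lambda>n x. a * F n x + b * G n x) = a * \<Phi> F + b * \<Phi> G) \<and>
     (\<exists>C. \<forall>F \<in> UP p. \<bar>\<Phi> F\<bar> \<le> C * unorm p U F)"

text \<open>S lies in the weak operator topology closure of the set of all T^U, T in B(L^p):
  every basic WOT neighbourhood of S (given by finitely many vectors and functionals)
  contains some T^U.\<close>
definition in_wot_closure :: "real \<Rightarrow> nat filter \<Rightarrow> (useq \<Rightarrow> useq) \<Rightarrow> bool" where
  "in_wot_closure p U S \<longleftrightarrow>
     (\<forall>P :: (useq \<times> (useq \<Rightarrow> real)) set. finite P \<longrightarrow>
        (\<forall>(F, \<Phi>) \<in> P. F \<in> UP p \<and> dual_U p U \<Phi>) \<longrightarrow>
        (\<forall>\<epsilon>>0. \<exists>T. bop_Lp p T \<and>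
            (\<forall>(F, \<Phi>) \<in> P. \<bar>\<Phi> (S F) - \<Phi> (ultra_op T F)\<bar> < \<epsilon>)))"

definition M_char :: "real \<Rightarrow> nat filter \<Rightarrow> useq set \<Rightarrow> bool" where
  "M_char p U M \<longleftrightarrow>
     closed_usub p U M \<and> M \<subseteq> Lhat p U \<and>
     (\<exists>N. closed_usub p U N \<and> N \<subseteq> Lhat p U \<and> M \<inter> N = uzero p U \<and>
          subspace_sum p U M N = Lhat p U) \<and>
     (\<forall>S. bop_U p U S \<longrightarrow>
        (in_wot_closure p U S \<longleftrightarrow>
           invariant_under S (LpC p U) \<and> invariant_under S (Lhat p U) \<and> invariant_under S M))"

definition inv_subspaces :: "real \<Rightarrow> nat filter \<Rightarrow> useq set set" where
  "inv_subspaces p U =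
     {X. closed_usub p U X \<and> X \<noteq> uzero p U \<and> X \<noteq> UP p \<and>
         (\<forall>T. bop_Lp p T \<longrightarrow> invariant_under (ultra_op T) X)}"

end

theory Submission
  imports Defs
begin

text \<open>
  Every bounded sequence in $L^p$ splits, along the ultrafilter, into its weak limit, a part that
  tends to zero in $L^1$ (hence is asymptotically disjoint) and a uniformly $p$-integrable weakly
  null part; the uniformly $p$-integrable sequences are exactly those annihilated by the sequences of
  the dual space that tend to zero in $L^1$. A first-order expansion of $|x + y|^q$ with error
  $|x|^{q-r} |y|^r + |y|^q$, $r = \min(q, 2)$, shows that a weakly null sequence in $L^q$ satisfies,
  on a set of the ultrafilter, an upper $r$-estimate, and one tending to zero in $L^1$ an upper
  $q$-estimate. Selectivity is what allows one to pass to a subsequence indexed by a member of the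
  ultrafilter.

  If $(G_m)$ in $L^{p'}$ and $(H_m)$ in $L^p$ are weakly null with dual upper estimates, then
  $f \mapsto \sum_m \langle f, G_m\rangle H_m$ is bounded, and its ultrapower is close to the rank one
  operator $G \otimes H$ on any given finite set of vectors. Such operators are available exactly
  when $G$ annihilates $M$ or $H$ lies in $M$, where $M$ consists of the sequences tending to zero
  in $L^1$ if $p > 2$, and of the uniformly $p$-integrable weakly null ones if $p < 2$. Finite sums of
  them agree with any operator leaving $L^p$, $\widehat{L^p}$ and $M$ invariant on any given finite
  set, and they force every invariant closed subspace to be one of the listed ones. Conversely $M$ is
  invariant: comparing $\langle \sum_{n\in s} T F_n, \sum_{n\in s} G_n\rangle$, which grows like
  $|s|$, with the upper estimates for both factors gives a contradiction.
\<close>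

section \<open>The spaces $L^p$ on the unit interval\<close>

lemma space_M01 [simp]: "space M01 = {0..1}"
  by (simp add: M01_def space_restrict_space)

lemma emeasure_M01_space [simp]: "emeasure M01 {0..1} = 1"
  by (simp add: M01_def emeasure_restrict_space)

lemma measure_M01_space [simp]: "measure M01 {0..1} = 1"
  by (simp add: measure_def)

interpretation M01: finite_measure M01
  by (intro finite_measureI) simp

lemma borel_measurable_M01: "f \<in> borel_measurable borel \<Longrightarrow> f \<in> borel_measurable M01"
  unfolding M01_def by (simp add: measurable_restrict_space1)

lemma abs_add_powr_le:
  fixes a b p :: real
  assumes "0 \<le> p"
  shows "\<bar>a + b\<bar> powr p \<le> 2 powr p * (\<bar>a\<bar> powr p + \<bar>b\<bar> powr p)"
proof -
  have "\<bar>a + b\<bar> powr p \<le> (2 * max \<bar>a\<bar> \<bar>b\<bar>) powr p"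
    using assms by (intro powr_mono2) auto
  also have "\<dots> = 2 powr p * (max \<bar>a\<bar> \<bar>b\<bar>) powr p"
    by (simp add: powr_mult)
  also have "(max \<bar>a\<bar> \<bar>b\<bar>) powr p \<le> \<bar>a\<bar> powr p + \<bar>b\<bar> powr p"
    by (simp add: max_def)
  finally show ?thesis by simp
qed

lemma powr_mult_le:
  fixes s x p :: real
  assumes "1 \<le> p" "0 \<le> s" "s \<le> 1" "0 \<le> x"
  shows "(s * x) powr p \<le> s * x powr p"
proof (cases "s = 0")
  case False
  then have "s powr p \<le> s" using assms by (intro powr_le_one_le) auto
  then show ?thesis using assms by (simp add: powr_mult mult_right_mono)
qed simp

lemma powr_convex_combination_le:
  fixes a b p t :: real
  assumes "1 \<le> p" "0 \<le> a" "0 \<le> b" "0 \<le> t" "t \<le> 1"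
  shows "(t * a + (1 - t) * b) powr p \<le> t * a powr p + (1 - t) * b powr p"
proof -
  consider "a = 0" | "b = 0" | "a > 0" "b > 0" using assms by linarith
  then show ?thesis
  proof cases
    assume "a = 0"
    then show ?thesis using powr_mult_le[of p "1 - t" b] assms by simp
  next
    assume "b = 0"
    then show ?thesis using powr_mult_le[of p t a] assms by simp
  next
    assume "a > 0" "b > 0"
    then show ?thesis
      using convex_onD[OF powr_convex[OF assms(1)], of "1 - t" a b] assms by simp
  qed
qed

lemma abs_add_powr_le_weighted:
  fixes x y A B p :: real
  assumes p: "1 \<le> p" and A: "0 < A" and B: "0 < B"
  shows "\<bar>x + y\<bar> powr p \<le> (A + B) powr (p - 1) * (\<bar>x\<bar> powr p / A powr (p - 1) + \<bar>y\<bar> powr p / B powr (p - 1))"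
proof -
  define t where "t = A / (A + B)"
  have t: "0 \<le> t" "t \<le> 1" "1 - t = B / (A + B)" using A B by (auto simp: t_def field_simps)
  have base: "c powr p = c * c powr (p - 1)" if "0 < c" for c :: real
    using that powr_mult_base[of c "p - 1"] by simp
  have "t * (\<bar>x\<bar> / A) = \<bar>x\<bar> / (A + B)" "(1 - t) * (\<bar>y\<bar> / B) = \<bar>y\<bar> / (A + B)"
    using A B unfolding t(3) by (simp_all add: t_def)
  then have "\<bar>x\<bar> + \<bar>y\<bar> = (A + B) * (t * (\<bar>x\<bar> / A) + (1 - t) * (\<bar>y\<bar> / B))"
    using A B by (simp add: add_divide_distrib[symmetric])
  then have "\<bar>x + y\<bar> powr p \<le> ((A + B) * (t * (\<bar>x\<bar> / A) + (1 - t) * (\<bar>y\<bar> / B))) powr p"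
    using p by (intro powr_mono2) auto
  also have "\<dots> = (A + B) powr p * (t * (\<bar>x\<bar> / A) + (1 - t) * (\<bar>y\<bar> / B)) powr p"
    by (simp add: powr_mult)
  also have "\<dots> \<le> (A + B) powr p * (t * (\<bar>x\<bar> / A) powr p + (1 - t) * (\<bar>y\<bar> / B) powr p)"
    using p A B t by (intro mult_left_mono powr_convex_combination_le) auto
  also have "\<dots> = (A + B) powr (p - 1) * ((A + B) * (t * (\<bar>x\<bar> powr p / (A * A powr (p - 1)))
      + (1 - t) * (\<bar>y\<bar> powr p / (B * B powr (p - 1)))))"
    using A B by (simp add: powr_divide base)
  also have "(A + B) * (t * (\<bar>x\<bar> powr p / (A * A powr (p - 1))) + (1 - t) * (\<bar>y\<bar> powr p / (B * B powr (p - 1))))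
      = \<bar>x\<bar> powr p / A powr (p - 1) + \<bar>y\<bar> powr p / B powr (p - 1)"
    unfolding t(3) using A B by (simp add: t_def distrib_left)
  finally show ?thesis .
qed

lemma LpI: "f \<in> borel_measurable M01 \<Longrightarrow> integrable M01 (\<lambda>x. \<bar>f x\<bar> powr p) \<Longrightarrow> f \<in> Lp p"
  by (simp add: Lp_def)

lemma Lp_measurable: "f \<in> Lp p \<Longrightarrow> f \<in> borel_measurable M01"
  by (simp add: Lp_def)

lemma Lp_integrable_powr: "f \<in> Lp p \<Longrightarrow> integrable M01 (\<lambda>x. \<bar>f x\<bar> powr p)"
  by (simp add: Lp_def)

lemma Lp_mono:
  assumes f [measurable]: "f \<in> borel_measurable M01" and "g \<in> Lp p" "0 \<le> p"
    and "\<And>x. x \<in> {0..1} \<Longrightarrow> \<bar>f x\<bar> \<le> \<bar>g x\<bar>"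
  shows "f \<in> Lp p"
proof (rule LpI[OF f])
  show "integrable M01 (\<lambda>x. \<bar>f x\<bar> powr p)"
  proof (rule Bochner_Integration.integrable_bound[OF Lp_integrable_powr[OF assms(2)]])
    show "AE x in M01. norm (\<bar>f x\<bar> powr p) \<le> norm (\<bar>g x\<bar> powr p)"
      using assms by (intro AE_I2) (auto intro!: powr_mono2)
  qed measurable
qed

lemma Lp_bounded:
  assumes "f \<in> borel_measurable M01" "0 \<le> p" "\<And>x. x \<in> {0..1} \<Longrightarrow> \<bar>f x\<bar> \<le> K"
  shows "f \<in> Lp p"
proof (rule Lp_mono[OF assms(1)])
  show "(\<lambda>x. K) \<in> Lp p" by (rule LpI) auto
  show "\<bar>f x\<bar> \<le> \<bar>K\<bar>" if "x \<in> {0..1}" for x using assms(3)[OF that] by simp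
qed fact

lemma Lp_const [simp]: "0 \<le> p \<Longrightarrow> (\<lambda>x. c) \<in> Lp p"
  by (rule Lp_bounded[where K = "\<bar>c\<bar>"]) auto

lemma Lp_scale: "f \<in> Lp p \<Longrightarrow> (\<lambda>x. a * f x) \<in> Lp p"
  by (auto simp: Lp_def abs_mult powr_mult)

lemma Lp_add:
  assumes "f \<in> Lp p" "g \<in> Lp p" "0 \<le> p"
  shows "(\<lambda>x. f x + g x) \<in> Lp p"
proof (rule LpI)
  note [measurable] = Lp_measurable[OF assms(1)] Lp_measurable[OF assms(2)]
  show "(\<lambda>x. f x + g x) \<in> borel_measurable M01" by measurable
  show "integrable M01 (\<lambda>x. \<bar>f x + g x\<bar> powr p)"
  proof (rule Bochner_Integration.integrable_bound)
    show "integrable M01 (\<lambda>x. 2 powr p * (\<bar>f x\<bar> powr p + \<bar>g x\<bar> powr p))"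
      using assms by (intro integrable_mult_right Bochner_Integration.integrable_add Lp_integrable_powr)
    show "AE x in M01. norm (\<bar>f x + g x\<bar> powr p) \<le> norm (2 powr p * (\<bar>f x\<bar> powr p + \<bar>g x\<bar> powr p))"
      using abs_add_powr_le[OF assms(3)] by (intro AE_I2) (simp add: abs_mult)
  qed measurable
qed

lemma Lp_lin:
  assumes "f \<in> Lp p" "g \<in> Lp p" "0 \<le> p"
  shows "(\<lambda>x. a * f x + b * g x) \<in> Lp p"
  using assms by (intro Lp_add Lp_scale)

lemma Lp_uminus: "f \<in> Lp p \<Longrightarrow> (\<lambda>x. - f x) \<in> Lp p"
  using Lp_scale[of f p "-1"] by simp

lemma Lp_diff:
  assumes "f \<in> Lp p" "g \<in> Lp p" "0 \<le> p"
  shows "(\<lambda>x. f x - g x) \<in> Lp p"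
  using Lp_add[OF assms(1) Lp_uminus[OF assms(2)] assms(3)] by simp

lemma Lp_sum:
  assumes "\<And>i. i \<in> s \<Longrightarrow> f i \<in> Lp p" "0 \<le> p"
  shows "(\<lambda>x. \<Sum>i\<in>s. f i x) \<in> Lp p"
  using assms by (induction s rule: infinite_finite_induct) (auto intro!: Lp_add)

lemma integral_powr_cong_AE:
  fixes f g :: "real \<Rightarrow> real"
  assumes [measurable]: "f \<in> borel_measurable M01" "g \<in> borel_measurable M01"
    and "AE x in M01. f x = g x"
  shows "integrable M01 (\<lambda>x. \<bar>f x\<bar> powr p) \<longleftrightarrow> integrable M01 (\<lambda>x. \<bar>g x\<bar> powr p)"
    and "(LINT x|M01. \<bar>f x\<bar> powr p) = (LINT x|M01. \<bar>g x\<bar> powr p)"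
proof -
  have measurable: "(\<lambda>x. \<bar>f x\<bar> powr p) \<in> borel_measurable M01" "(\<lambda>x. \<bar>g x\<bar> powr p) \<in> borel_measurable M01"
    by measurable
  have "AE x in M01. \<bar>f x\<bar> powr p = \<bar>g x\<bar> powr p" using assms(3) by eventually_elim simp
  then show "integrable M01 (\<lambda>x. \<bar>f x\<bar> powr p) \<longleftrightarrow> integrable M01 (\<lambda>x. \<bar>g x\<bar> powr p)"
    "(LINT x|M01. \<bar>f x\<bar> powr p) = (LINT x|M01. \<bar>g x\<bar> powr p)"
    by (rule integrable_cong_AE[OF measurable], rule integral_cong_AE[OF measurable])
qed

lemma Lp_cong_AE:
  assumes "f \<in> Lp p" "g \<in> borel_measurable M01" "AE x in M01. f x = g x"
  shows "g \<in> Lp p"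
  using integral_powr_cong_AE(1)[OF Lp_measurable[OF assms(1)] assms(2,3)] assms
  by (simp add: Lp_def)

lemma lpnorm_cong_AE:
  assumes "f \<in> borel_measurable M01" "g \<in> borel_measurable M01" "AE x in M01. f x = g x"
  shows "lpnorm p f = lpnorm p g"
  unfolding lpnorm_def integral_powr_cong_AE(2)[OF assms] ..

lemma lpnorm_nonneg [simp]: "0 \<le> lpnorm p f"
  by (simp add: lpnorm_def)

lemma lpnorm_powr: "0 < p \<Longrightarrow> lpnorm p f powr p = (LINT x|M01. \<bar>f x\<bar> powr p)"
  by (simp add: lpnorm_def powr_powr)

lemma lpnorm_le_iff:
  assumes "0 < p" "0 \<le> A"
  shows "lpnorm p f \<le> A \<longleftrightarrow> (LINT x|M01. \<bar>f x\<bar> powr p) \<le> A powr p"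
proof -
  have "lpnorm p f \<le> A \<longleftrightarrow> lpnorm p f powr p \<le> A powr p"
    using assms by (smt (verit) lpnorm_nonneg powr_less_mono2 powr_mono2)
  then show ?thesis using assms by (simp add: lpnorm_powr)
qed

lemma lpnorm_mono:
  assumes "f \<in> borel_measurable M01" "g \<in> Lp p" "0 < p"
    and "\<And>x. x \<in> {0..1} \<Longrightarrow> \<bar>f x\<bar> \<le> \<bar>g x\<bar>"
  shows "lpnorm p f \<le> lpnorm p g"
proof -
  have "f \<in> Lp p" using Lp_mono[OF assms(1,2) _ assms(4)] assms(3) by simp
  then have "(LINT x|M01. \<bar>f x\<bar> powr p) \<le> (LINT x|M01. \<bar>g x\<bar> powr p)"
    using assms by (intro integral_mono Lp_integrable_powr) (auto intro!: powr_mono2)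
  then show ?thesis unfolding lpnorm_def using assms by (intro powr_mono2) auto
qed

lemma lpnorm_zero [simp]: "lpnorm p (\<lambda>x. 0) = 0"
  by (simp add: lpnorm_def)

lemma lpnorm_bounded:
  assumes "f \<in> borel_measurable M01" "0 < p" "\<And>x. x \<in> {0..1} \<Longrightarrow> \<bar>f x\<bar> \<le> K" "0 \<le> K"
  shows "lpnorm p f \<le> K"
proof -
  have "lpnorm p f \<le> lpnorm p (\<lambda>x. K)" using assms by (intro lpnorm_mono) auto
  also have "\<dots> = K" using assms by (simp add: lpnorm_def powr_powr)
  finally show ?thesis .
qed

lemma lpnorm_scale:
  assumes "0 < p"
  shows "lpnorm p (\<lambda>x. a * f x) = \<bar>a\<bar> * lpnorm p f"
proof -
  have "(LINT x|M01. \<bar>a * f x\<bar> powr p) = \<bar>a\<bar> powr p * (LINT x|M01. \<bar>f x\<bar> powr p)"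
    by (simp add: abs_mult powr_mult)
  then show ?thesis using assms by (simp add: lpnorm_def powr_mult powr_powr)
qed

lemma lpnorm_minus_commute: "lpnorm p (\<lambda>x. f x - g x) = lpnorm p (\<lambda>x. g x - f x)"
  by (simp add: lpnorm_def abs_minus_commute)

lemma lpnorm_eq_0_iff:
  assumes "f \<in> Lp p" "0 < p"
  shows "lpnorm p f = 0 \<longleftrightarrow> (AE x in M01. f x = 0)"
proof -
  have "lpnorm p f = 0 \<longleftrightarrow> (LINT x|M01. \<bar>f x\<bar> powr p) = 0"
    using assms by (simp add: lpnorm_def)
  also have "\<dots> \<longleftrightarrow> (AE x in M01. \<bar>f x\<bar> powr p = 0)"
    by (rule integral_nonneg_eq_0_iff_AE[OF Lp_integrable_powr[OF assms(1)]]) simp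
  finally show ?thesis using assms by simp
qed

theorem lpnorm_triangle:
  assumes f: "f \<in> Lp p" and g: "g \<in> Lp p" and p: "1 \<le> p"
  shows "lpnorm p (\<lambda>x. f x + g x) \<le> lpnorm p f + lpnorm p g"
proof -
  note [measurable] = Lp_measurable[OF f] Lp_measurable[OF g]
  consider "lpnorm p f = 0" | "lpnorm p g = 0" | "0 < lpnorm p f" "0 < lpnorm p g"
    by (metis lpnorm_nonneg less_eq_real_def)
  then show ?thesis
  proof cases
    assume "lpnorm p f = 0"
    then have "AE x in M01. f x = 0" using f p by (simp add: lpnorm_eq_0_iff)
    then have "lpnorm p (\<lambda>x. f x + g x) = lpnorm p g" by (intro lpnorm_cong_AE) auto
    then show ?thesis by simp
  next
    assume "lpnorm p g = 0"
    then have "AE x in M01. g x = 0" using g p by (simp add: lpnorm_eq_0_iff)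
    then have "lpnorm p (\<lambda>x. f x + g x) = lpnorm p f" by (intro lpnorm_cong_AE) auto
    then show ?thesis by simp
  next
    define A where "A = lpnorm p f"
    define B where "B = lpnorm p g"
    assume "0 < lpnorm p f" "0 < lpnorm p g"
    then have A: "0 < A" and B: "0 < B" by (auto simp: A_def B_def)
    have base: "c powr p / c powr (p - 1) = c" if "0 < c" for c :: real
      using that by (simp add: powr_diff[symmetric])
    have "(LINT x|M01. \<bar>f x + g x\<bar> powr p)
        \<le> (LINT x|M01. (A + B) powr (p - 1)
          * (\<bar>f x\<bar> powr p / A powr (p - 1) + \<bar>g x\<bar> powr p / B powr (p - 1)))"
      using p abs_add_powr_le_weighted[OF p A B] Lp_integrable_powr[OF f] Lp_integrable_powr[OF g]
      by (intro integral_mono Lp_integrable_powr[OF Lp_add[OF f g]]) auto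
    also have "\<dots> = (A + B) powr (p - 1) * (A powr p / A powr (p - 1) + B powr p / B powr (p - 1))"
      using Lp_integrable_powr[OF f] Lp_integrable_powr[OF g] p
      by (simp add: A_def B_def lpnorm_powr)
    also have "\<dots> = (A + B) powr p"
      using A B powr_mult_base[of "A + B" "p - 1"] by (simp add: base mult.commute)
    finally show ?thesis using A B p by (subst lpnorm_le_iff) (auto simp: A_def B_def)
  qed
qed

lemma lpnorm_diff_trans:
  assumes "f \<in> Lp p" "g \<in> Lp p" "h \<in> Lp p" "1 \<le> p"
  shows "lpnorm p (\<lambda>x. f x - h x) \<le> lpnorm p (\<lambda>x. f x - g x) + lpnorm p (\<lambda>x. g x - h x)"
  using lpnorm_triangle[OF Lp_diff[OF assms(1,2)] Lp_diff[OF assms(2,3)]] assms(4) by simp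

lemma lpnorm_reverse_triangle:
  assumes "f \<in> Lp p" "g \<in> Lp p" "1 \<le> p"
  shows "\<bar>lpnorm p f - lpnorm p g\<bar> \<le> lpnorm p (\<lambda>x. f x - g x)"
  using lpnorm_triangle[OF Lp_diff[OF assms(1,2)] assms(2)]
    lpnorm_triangle[OF Lp_diff[OF assms(2,1)] assms(1)] assms(3)
    lpnorm_minus_commute[of p f g] by simp

lemma lpnorm_lin_le:
  assumes "f \<in> Lp p" "g \<in> Lp p" "1 \<le> p"
  shows "lpnorm p (\<lambda>x. a * f x + b * g x) \<le> \<bar>a\<bar> * lpnorm p f + \<bar>b\<bar> * lpnorm p g"
  using lpnorm_triangle[OF Lp_scale[OF assms(1)] Lp_scale[OF assms(2)] assms(3), of a b] assms(3)
  by (simp add: lpnorm_scale)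

lemma lpnorm_sum_le:
  assumes "\<And>i. i \<in> s \<Longrightarrow> f i \<in> Lp p" "1 \<le> p"
  shows "lpnorm p (\<lambda>x. \<Sum>i\<in>s. c i * f i x) \<le> (\<Sum>i\<in>s. \<bar>c i\<bar> * lpnorm p (f i))"
  using assms
proof (induction s rule: infinite_finite_induct)
  case (insert i s)
  have "lpnorm p (\<lambda>x. c i * f i x + 1 * (\<Sum>i\<in>s. c i * f i x))
      \<le> \<bar>c i\<bar> * lpnorm p (f i) + \<bar>1\<bar> * lpnorm p (\<lambda>x. \<Sum>i\<in>s. c i * f i x)"
    using insert by (intro lpnorm_lin_le Lp_sum Lp_scale) auto
  then show ?case using insert by simp
qed auto

definition conjugate_exponents :: "real \<Rightarrow> real \<Rightarrow> bool" where
  "conjugate_exponents p q \<longleftrightarrow> 1 < p \<and> 1 < q \<and> 1 / p + 1 / q = 1"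

lemma conjugate_exponents_sym: "conjugate_exponents p q \<Longrightarrow> conjugate_exponents q p"
  by (auto simp: conjugate_exponents_def)

lemma conjugate_exponentsD:
  assumes "conjugate_exponents p q"
  shows "1 < p" "1 < q" "p * q = p + q" "(p - 1) * q = p" "1 / p = 1 - 1 / q" "p / q = p - 1"
  using assms unfolding conjugate_exponents_def by (auto simp: field_simps)

lemma conjugate_exponentsI: "1 < p \<Longrightarrow> conjugate_exponents p (p / (p - 1))"
  by (auto simp: conjugate_exponents_def field_simps)

lemma abs_mult_le_weighted_Young:
  fixes x y A B p q :: real
  assumes pq: "conjugate_exponents p q" and "0 < A" "0 < B"
  shows "\<bar>x * y\<bar> \<le> A * B * ((\<bar>x\<bar> powr p / A powr p) / p + (\<bar>y\<bar> powr q / B powr q) / q)"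
proof -
  have "\<bar>x * y\<bar> = A * B * ((\<bar>x\<bar> / A) * (\<bar>y\<bar> / B))" using assms by (simp add: abs_mult)
  also have "\<dots> \<le> A * B * ((\<bar>x\<bar> / A) powr p / p + (\<bar>y\<bar> / B) powr q / q)"
    using assms by (intro mult_left_mono Youngs_inequality) (auto simp: conjugate_exponents_def)
  finally show ?thesis by (simp add: powr_divide)
qed

lemma Lp_mult_integrable:
  assumes pq: "conjugate_exponents p q" and f: "f \<in> Lp p" and g: "g \<in> Lp q"
  shows "integrable M01 (\<lambda>x. f x * g x)"
proof (rule Bochner_Integration.integrable_bound)
  note [measurable] = Lp_measurable[OF f] Lp_measurable[OF g]
  show "integrable M01 (\<lambda>x. \<bar>f x\<bar> powr p / p + \<bar>g x\<bar> powr q / q)"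
    using Lp_integrable_powr[OF f] Lp_integrable_powr[OF g] by auto
  show "(\<lambda>x. f x * g x) \<in> borel_measurable M01" by measurable
  show "AE x in M01. norm (f x * g x) \<le> norm (\<bar>f x\<bar> powr p / p + \<bar>g x\<bar> powr q / q)"
    using abs_mult_le_weighted_Young[OF pq, of 1 1] conjugate_exponentsD(1,2)[OF pq]
    by (intro AE_I2) (simp add: abs_mult)
qed

theorem Holder_inequality_abs:
  assumes pq: "conjugate_exponents p q" and f: "f \<in> Lp p" and g: "g \<in> Lp q"
  shows "(LINT x|M01. \<bar>f x * g x\<bar>) \<le> lpnorm p f * lpnorm q g"
proof -
  note pq' = conjugate_exponentsD(1,2)[OF pq]
  note [measurable] = Lp_measurable[OF f] Lp_measurable[OF g]
  consider "lpnorm p f = 0 \<or> lpnorm q g = 0" | "0 < lpnorm p f" "0 < lpnorm q g"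
    by (metis lpnorm_nonneg less_eq_real_def)
  then show ?thesis
  proof cases
    assume zero: "lpnorm p f = 0 \<or> lpnorm q g = 0"
    then have "(AE x in M01. f x = 0) \<or> (AE x in M01. g x = 0)"
      using f g pq' by (auto simp: lpnorm_eq_0_iff)
    then have "AE x in M01. \<bar>f x * g x\<bar> = 0" by auto
    then have "(LINT x|M01. \<bar>f x * g x\<bar>) = (LINT x|M01. 0)" by (intro integral_cong_AE) auto
    then show ?thesis using zero by auto
  next
    define A where "A = lpnorm p f"
    define B where "B = lpnorm q g"
    assume "0 < lpnorm p f" "0 < lpnorm q g"
    then have AB: "0 < A" "0 < B" by (auto simp: A_def B_def)
    have "(LINT x|M01. \<bar>f x * g x\<bar>)
        \<le> (LINT x|M01. A * B * ((\<bar>f x\<bar> powr p / A powr p) / p + (\<bar>g x\<bar> powr q / B powr q) / q))"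
      using abs_mult_le_weighted_Young[OF pq AB] Lp_mult_integrable[OF pq f g]
        Lp_integrable_powr[OF f] Lp_integrable_powr[OF g]
      by (intro integral_mono) auto
    also have "\<dots> = A * B * ((A powr p / A powr p) / p + (B powr q / B powr q) / q)"
      using Lp_integrable_powr[OF f] Lp_integrable_powr[OF g] pq'
      by (simp add: A_def B_def lpnorm_powr)
    also have "\<dots> = A * B" using AB pq by (simp add: conjugate_exponents_def)
    finally show ?thesis by (simp add: A_def B_def)
  qed
qed

corollary Holder_inequality:
  assumes "conjugate_exponents p q" "f \<in> Lp p" "g \<in> Lp q"
  shows "\<bar>LINT x|M01. f x * g x\<bar> \<le> lpnorm p f * lpnorm q g"
  using integral_abs_bound Holder_inequality_abs[OF assms] by (rule order_trans)

lemma lpnorm_one [simp]: "lpnorm p (\<lambda>x. 1) = 1"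
  by (simp add: lpnorm_def)

lemma
  assumes "f \<in> Lp p" "1 < p"
  shows Lp_integrable: "integrable M01 f"
    and integral_abs_le_lpnorm: "(LINT x|M01. \<bar>f x\<bar>) \<le> lpnorm p f"
proof -
  note holder = Lp_mult_integrable Holder_inequality_abs
  show "integrable M01 f" "(LINT x|M01. \<bar>f x\<bar>) \<le> lpnorm p f"
    using holder[OF conjugate_exponentsI[OF assms(2)] assms(1), of "\<lambda>x. 1"] assms by auto
qed

lemma
  assumes f: "f \<in> Lp p" and r: "1 < r" "r \<le> p"
  shows Lp_exponent_antimono: "f \<in> Lp r" and lpnorm_exponent_mono: "lpnorm r f \<le> lpnorm p f"
proof -
  note [measurable] = Lp_measurable[OF f]
  have "f \<in> Lp r \<and> lpnorm r f \<le> lpnorm p f"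
  proof (cases "r = p")
    case False
    then have quotient: "1 < p / r" using r by (simp add: field_simps)
    have powr_Lp: "(\<lambda>x. \<bar>f x\<bar> powr r) \<in> Lp (p / r)"
      using Lp_integrable_powr[OF f] r by (intro LpI) (auto simp: powr_powr)
    have "(LINT x|M01. \<bar>f x\<bar> powr r) \<le> lpnorm (p / r) (\<lambda>x. \<bar>f x\<bar> powr r)"
      using integral_abs_le_lpnorm[OF powr_Lp quotient] by simp
    also have "\<dots> = lpnorm p f powr r"
      using r by (simp add: lpnorm_def powr_powr)
    finally have "lpnorm r f \<le> lpnorm p f" using r by (subst lpnorm_le_iff) auto
    moreover have "f \<in> Lp r" using Lp_integrable[OF powr_Lp quotient] by (intro LpI) auto
    ultimately show ?thesis by simp
  qed (use f in simp)
  then show "f \<in> Lp r" "lpnorm r f \<le> lpnorm p f" by auto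
qed

definition duality_map :: "real \<Rightarrow> real \<Rightarrow> real" where
  "duality_map p x = sgn x * \<bar>x\<bar> powr (p - 1)"

lemma duality_map_measurable [measurable]: "duality_map p \<in> borel_measurable borel"
  unfolding duality_map_def by measurable

lemma abs_duality_map: "\<bar>duality_map p x\<bar> = \<bar>x\<bar> powr (p - 1)"
  by (cases "x = 0") (auto simp: duality_map_def abs_mult abs_sgn_eq)

lemma mult_duality_map: "x * duality_map p x = \<bar>x\<bar> powr p"
  using powr_mult_base[of "\<bar>x\<bar>" "p - 1"]
  by (cases "x > 0"; cases "x = 0") (auto simp: duality_map_def sgn_real_def)

lemma
  assumes pq: "conjugate_exponents p q" and f: "f \<in> Lp p"
  shows duality_map_Lp: "(\<lambda>x. duality_map p (f x)) \<in> Lp q"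
    and lpnorm_duality_map: "lpnorm q (\<lambda>x. duality_map p (f x)) = lpnorm p f powr (p - 1)"
    and integral_mult_duality_map: "(LINT x|M01. f x * duality_map p (f x)) = lpnorm p f powr p"
proof -
  note [measurable] = Lp_measurable[OF f]
  note pq' = conjugate_exponentsD[OF pq]
  show "(\<lambda>x. duality_map p (f x)) \<in> Lp q"
    using Lp_integrable_powr[OF f] pq' by (intro LpI) (auto simp: abs_duality_map powr_powr)
  show "lpnorm q (\<lambda>x. duality_map p (f x)) = lpnorm p f powr (p - 1)"
    using pq' by (simp add: lpnorm_def abs_duality_map powr_powr) (simp add: field_simps)
  show "(LINT x|M01. f x * duality_map p (f x)) = lpnorm p f powr p"
    using pq' by (simp add: mult_duality_map lpnorm_powr)
qed

lemma lpnorm_le_dual: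
  assumes pq: "conjugate_exponents p q" and f: "f \<in> Lp p"
    and bound: "\<And>g. g \<in> Lp q \<Longrightarrow> (LINT x|M01. f x * g x) \<le> C * lpnorm q g" and C: "0 \<le> C"
  shows "lpnorm p f \<le> C"
proof (cases "lpnorm p f = 0")
  case False
  have "lpnorm p f powr p \<le> C * lpnorm p f powr (p - 1)"
    using bound[OF duality_map_Lp[OF pq f]]
    by (simp add: lpnorm_duality_map[OF pq f] integral_mult_duality_map[OF pq f])
  moreover have "lpnorm p f powr p = lpnorm p f * lpnorm p f powr (p - 1)"
    by (simp add: powr_mult_base)
  ultimately show ?thesis using False by auto
qed (use C in simp)

lemma lpnorm_eq_0_dual:
  assumes "conjugate_exponents p q" "f \<in> Lp p"
    and "\<And>g. g \<in> Lp q \<Longrightarrow> (LINT x|M01. f x * g x) = 0"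
  shows "lpnorm p f = 0"
  using lpnorm_le_dual[OF assms(1,2), of 0] assms(3) lpnorm_nonneg[of p f] by simp

lemma Lp_dominated_convergence:
  assumes g: "g \<in> Lp p" and p: "0 < p"
    and [measurable]: "f \<in> borel_measurable M01" "\<And>i. s i \<in> borel_measurable M01"
    and lim: "\<And>x. x \<in> {0..1} \<Longrightarrow> (\<lambda>i. s i x) \<longlonglongrightarrow> f x"
    and dominated: "\<And>i x. x \<in> {0..1} \<Longrightarrow> \<bar>f x - s i x\<bar> \<le> \<bar>g x\<bar>"
  shows "(\<lambda>i. lpnorm p (\<lambda>x. f x - s i x)) \<longlonglongrightarrow> 0"
proof -
  have "(\<lambda>i. LINT x|M01. \<bar>f x - s i x\<bar> powr p) \<longlonglongrightarrow> (LINT x|M01. 0)"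
  proof (rule integral_dominated_convergence)
    show "integrable M01 (\<lambda>x. \<bar>g x\<bar> powr p)" by (rule Lp_integrable_powr[OF g])
    show "AE x in M01. (\<lambda>i. \<bar>f x - s i x\<bar> powr p) \<longlonglongrightarrow> 0"
    proof (rule AE_I2)
      fix x assume "x \<in> space M01"
      then have "(\<lambda>i. \<bar>f x - s i x\<bar>) \<longlonglongrightarrow> \<bar>f x - f x\<bar>"
        using lim[of x] by (intro tendsto_intros) auto
      then show "(\<lambda>i. \<bar>f x - s i x\<bar> powr p) \<longlonglongrightarrow> 0"
        using p by (intro tendsto_zero_powrI[where b = p]) auto
    qed
    show "AE x in M01. norm (\<bar>f x - s i x\<bar> powr p) \<le> \<bar>g x\<bar> powr p" for i
      using dominated p by (intro AE_I2) (auto intro!: powr_mono2)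
  qed measurable
  then have "(\<lambda>i. (LINT x|M01. \<bar>f x - s i x\<bar> powr p) powr (1 / p)) \<longlonglongrightarrow> 0"
    using p by (intro tendsto_zero_powrI[where b = "1/p"]) auto
  then show ?thesis by (simp add: lpnorm_def)
qed

lemma Lp_simple_dense:
  assumes f: "f \<in> Lp p" and p: "1 \<le> p" and "0 < e"
  obtains s where "simple_function M01 s" "s \<in> Lp p" "lpnorm p (\<lambda>x. f x - s x) < e"
proof -
  obtain s where simple: "\<And>i. simple_function M01 (s i)"
    and lim: "\<And>x. x \<in> space M01 \<Longrightarrow> (\<lambda>i. s i x) \<longlonglongrightarrow> f x"
    and dist_le: "\<And>i x. x \<in> space M01 \<Longrightarrow> dist (s i x) 0 \<le> 2 * dist (f x) 0"
    using borel_measurable_implies_sequence_metric[OF Lp_measurable[OF f], of 0] by metis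
  note measurable = borel_measurable_simple_function[OF simple]
  have bound: "\<bar>s i x\<bar> \<le> 2 * \<bar>f x\<bar>" if "x \<in> {0..1}" for i x
    using dist_le[of x i] that by (simp add: dist_real_def)
  have "\<bar>f x - s i x\<bar> \<le> \<bar>3 * f x\<bar>" if "x \<in> {0..1}" for i x
    using bound[OF that, of i] by linarith
  then have "(\<lambda>i. lpnorm p (\<lambda>x. f x - s i x)) \<longlonglongrightarrow> 0"
    using lim p by (intro Lp_dominated_convergence[OF Lp_scale[OF f]] Lp_measurable[OF f] measurable) auto
  then have "\<forall>\<^sub>F i in sequentially. lpnorm p (\<lambda>x. f x - s i x) < e"
    using \<open>0 < e\<close> by (rule order_tendstoD)
  then obtain i where "lpnorm p (\<lambda>x. f x - s i x) < e" by (auto simp: eventually_sequentially)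
  moreover have "s i \<in> Lp p"
    using bound p by (intro Lp_mono[OF measurable Lp_scale[OF f, of 2]]) (auto simp: abs_mult)
  ultimately show thesis using that simple by blast
qed
section \<open>The dual of $L^p$\<close>

context finite_measure
begin

lemma countably_additive_if_le_powr_measure:
  fixes \<nu> :: "'a set \<Rightarrow> real"
  assumes nonneg: "\<And>A. A \<in> sets M \<Longrightarrow> 0 \<le> \<nu> A"
    and additive: "\<And>A B. A \<in> sets M \<Longrightarrow> B \<in> sets M \<Longrightarrow> A \<inter> B = {} \<Longrightarrow> \<nu> (A \<union> B) = \<nu> A + \<nu> B"
    and le: "\<And>A. A \<in> sets M \<Longrightarrow> \<nu> A \<le> C * measure M A powr \<alpha>" and \<alpha>: "0 < \<alpha>"
  shows "positive (sets M) (\<lambda>A. ennreal (\<nu> A))" "countably_additive (sets M) (\<lambda>A. ennreal (\<nu> A))"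
proof -
  show positive: "positive (sets M) (\<lambda>A. ennreal (\<nu> A))"
    using additive[of "{}" "{}"] by (simp add: positive_def)
  show "countably_additive (sets M) (\<lambda>A. ennreal (\<nu> A))"
  proof (rule sets.empty_continuous_imp_countably_additive[OF positive])
    show "additive (sets M) (\<lambda>A. ennreal (\<nu> A))"
      by (auto simp: additive_def additive nonneg ennreal_plus)
    fix A :: "nat \<Rightarrow> 'a set" assume A: "range A \<subseteq> sets M" "decseq A" "(\<Inter>i. A i) = {}"
    have "(\<lambda>i. measure M (A i)) \<longlonglongrightarrow> measure M (\<Inter>i. A i)"
      using A by (intro finite_Lim_measure_decseq)
    then have "(\<lambda>i. measure M (A i) powr \<alpha>) \<longlonglongrightarrow> 0"
      using A(3) \<alpha> by (intro tendsto_zero_powrI[where b = \<alpha>]) auto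
    then have "(\<lambda>i. C * measure M (A i) powr \<alpha>) \<longlonglongrightarrow> 0" by (rule tendsto_mult_right_zero)
    from tendsto_sandwich[OF _ _ tendsto_const this, of "\<lambda>i. \<nu> (A i)"] have "(\<lambda>i. \<nu> (A i)) \<longlonglongrightarrow> 0"
      using A nonneg le by (auto intro!: always_eventually)
    then show "(\<lambda>i. ennreal (\<nu> (A i))) \<longlonglongrightarrow> 0"
      using tendsto_ennrealI by fastforce
  qed simp
qed

lemma Radon_Nikodym_real:
  assumes "finite_measure N" "absolutely_continuous M N" "sets N = sets M"
  obtains g where "g \<in> borel_measurable M" "integrable M g"
    "\<And>A. A \<in> sets M \<Longrightarrow> measure N A = (LINT x|M. indicator A x * g x)"
proof -
  interpret N: finite_measure N by fact
  obtain g where g [measurable]: "g \<in> borel_measurable M"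
    and RN: "AE x in M. RN_deriv M N x = ennreal (g x)" and nonneg: "\<And>x. 0 \<le> g x"
    using real_RN_deriv[OF assms] by blast
  have "density M (RN_deriv M N) = density M (\<lambda>x. ennreal (g x))"
    using RN by (intro density_cong) auto
  then have N: "N = density M (\<lambda>x. ennreal (g x))"
    using density_RN_deriv[OF assms(2,3)] by simp
  have "measure N A = (LINT x|M. indicator A x * g x)" if A: "A \<in> sets M" for A
  proof -
    have "measure N A = (LINT x|N. indicator A x)" using A assms(3) by simp
    also have "\<dots> = (LINT x|M. g x *\<^sub>R indicator A x)"
      unfolding N using A nonneg by (intro integral_density) auto
    finally show ?thesis by (simp add: mult.commute)
  qed
  moreover have "integrable N (\<lambda>x. 1 :: real)" by simp
  then have "integrable M g"
    unfolding N using nonneg by (subst (asm) integrable_density) auto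
  ultimately show thesis using that g by blast
qed

lemma density_of_set_function:
  fixes \<nu> :: "'a set \<Rightarrow> real"
  assumes nonneg: "\<And>A. A \<in> sets M \<Longrightarrow> 0 \<le> \<nu> A"
    and additive: "\<And>A B. A \<in> sets M \<Longrightarrow> B \<in> sets M \<Longrightarrow> A \<inter> B = {} \<Longrightarrow> \<nu> (A \<union> B) = \<nu> A + \<nu> B"
    and le: "\<And>A. A \<in> sets M \<Longrightarrow> \<nu> A \<le> C * measure M A powr \<alpha>" and \<alpha>: "0 < \<alpha>"
  obtains g where "g \<in> borel_measurable M" "integrable M g"
    "\<And>A. A \<in> sets M \<Longrightarrow> \<nu> A = (LINT x|M. indicator A x * g x)"
proof -
  define N where "N = measure_of (space M) (sets M) (\<lambda>A. ennreal (\<nu> A))"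
  have sets_N: "sets N = sets M"
    unfolding N_def by (rule sets.sets_measure_of_eq)
  have emeasure_N: "emeasure N A = ennreal (\<nu> A)" if "A \<in> sets M" for A
    unfolding N_def
    by (rule emeasure_measure_of_sigma[OF sets.sigma_algebra_axioms
          countably_additive_if_le_powr_measure[OF nonneg additive le \<alpha>] that])
  have finite: "finite_measure N"
    by (rule finite_measureI) (simp add: sets_eq_imp_space_eq[OF sets_N] emeasure_N)
  have continuous: "absolutely_continuous M N"
    unfolding absolutely_continuous_def
  proof
    fix A assume "A \<in> null_sets M"
    then have A: "A \<in> sets M" "measure M A = 0" by (auto simp: measure_def null_setsD1)
    then have "\<nu> A = 0" using nonneg[OF A(1)] le[OF A(1)] by simp
    then show "A \<in> null_sets N" using emeasure_N[OF A(1)] A(1) sets_N by (intro null_setsI) auto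
  qed
  obtain g where g: "g \<in> borel_measurable M" "integrable M g"
    "\<And>A. A \<in> sets M \<Longrightarrow> measure N A = (LINT x|M. indicator A x * g x)"
    using Radon_Nikodym_real[OF finite continuous sets_N] by blast
  have "\<nu> A = measure N A" if "A \<in> sets M" for A
    using emeasure_N[OF that] nonneg[OF that] by (simp add: measure_def)
  then show thesis using g by (intro that) simp_all
qed

end

definition positive_variation :: "'a measure \<Rightarrow> ('a set \<Rightarrow> real) \<Rightarrow> 'a set \<Rightarrow> real" where
  "positive_variation M \<nu> A = (SUP B \<in> {B \<in> sets M. B \<subseteq> A}. \<nu> B)"

lemma positive_variation_le:
  assumes "\<And>B. B \<in> sets M \<Longrightarrow> B \<subseteq> A \<Longrightarrow> \<nu> B \<le> c"
  shows "positive_variation M \<nu> A \<le> c"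
  unfolding positive_variation_def using assms by (intro cSUP_least) auto

lemma le_positive_variation:
  assumes "\<And>B. B \<in> sets M \<Longrightarrow> \<nu> B \<le> K" "B \<in> sets M" "B \<subseteq> A"
  shows "\<nu> B \<le> positive_variation M \<nu> A"
  unfolding positive_variation_def using assms by (intro cSUP_upper bdd_aboveI[where M = K]) auto

lemma positive_variation_additive:
  assumes additive: "\<And>A B. A \<in> sets M \<Longrightarrow> B \<in> sets M \<Longrightarrow> A \<inter> B = {} \<Longrightarrow> \<nu> (A \<union> B) = \<nu> A + \<nu> B"
    and bounded: "\<And>B. B \<in> sets M \<Longrightarrow> \<nu> B \<le> K"
    and A: "A \<in> sets M" and B: "B \<in> sets M" and disjoint: "A \<inter> B = {}"
  shows "positive_variation M \<nu> (A \<union> B) = positive_variation M \<nu> A + positive_variation M \<nu> B"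
    (is "?P (A \<union> B) = ?P A + ?P B")
proof (rule antisym)
  note upper = le_positive_variation[where \<nu> = \<nu> and K = K, OF bounded]
  show "?P (A \<union> B) \<le> ?P A + ?P B"
  proof (rule positive_variation_le)
    fix E assume E: "E \<in> sets M" "E \<subseteq> A \<union> B"
    have "\<nu> ((E \<inter> A) \<union> (E \<inter> B)) = \<nu> (E \<inter> A) + \<nu> (E \<inter> B)"
      using E A B disjoint by (intro additive) auto
    moreover have "(E \<inter> A) \<union> (E \<inter> B) = E" using E by auto
    moreover have "\<nu> (E \<inter> A) \<le> ?P A" "\<nu> (E \<inter> B) \<le> ?P B" using E A B by (auto intro!: upper)
    ultimately show "\<nu> E \<le> ?P A + ?P B" by simp
  qed
  have "?P A \<le> ?P (A \<union> B) - ?P B"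
  proof (rule positive_variation_le)
    fix E assume E: "E \<in> sets M" "E \<subseteq> A"
    have "?P B \<le> ?P (A \<union> B) - \<nu> E"
    proof (rule positive_variation_le)
      fix F assume F: "F \<in> sets M" "F \<subseteq> B"
      have "\<nu> (E \<union> F) = \<nu> E + \<nu> F" using E F disjoint by (intro additive) auto
      moreover have "\<nu> (E \<union> F) \<le> ?P (A \<union> B)" using E F by (intro upper) auto
      ultimately show "\<nu> F \<le> ?P (A \<union> B) - \<nu> E" by simp
    qed
    then show "\<nu> E \<le> ?P (A \<union> B) - ?P B" by simp
  qed
  then show "?P A + ?P B \<le> ?P (A \<union> B)" by simp
qed

lemma (in finite_measure) le_powr_measure_mono:
  assumes le: "\<And>A. A \<in> sets M \<Longrightarrow> \<nu> A \<le> C * measure M A powr \<alpha>" and C: "0 \<le> C" and \<alpha>: "0 < \<alpha>"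
    and "B \<subseteq> A" "A \<in> sets M" "B \<in> sets M"
  shows "\<nu> B \<le> C * measure M A powr \<alpha>"
proof -
  have "\<nu> B \<le> C * measure M B powr \<alpha>" using le assms(6) .
  also have "\<dots> \<le> C * measure M A powr \<alpha>"
    using assms by (intro mult_left_mono powr_mono2 finite_measure_mono) auto
  finally show ?thesis .
qed

theorem (in finite_measure) density_of_signed_set_function:
  fixes \<nu> :: "'a set \<Rightarrow> real"
  assumes additive: "\<And>A B. A \<in> sets M \<Longrightarrow> B \<in> sets M \<Longrightarrow> A \<inter> B = {} \<Longrightarrow> \<nu> (A \<union> B) = \<nu> A + \<nu> B"
    and bound: "\<And>A. A \<in> sets M \<Longrightarrow> \<bar>\<nu> A\<bar> \<le> C * measure M A powr \<alpha>" and C: "0 \<le> C" and \<alpha>: "0 < \<alpha>"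
  obtains g where "g \<in> borel_measurable M" "integrable M g"
    "\<And>A. A \<in> sets M \<Longrightarrow> \<nu> A = (LINT x|M. indicator A x * g x)"
proof -
  note mono = le_powr_measure_mono[of \<nu>, OF order_trans[OF abs_ge_self bound] C \<alpha>]
  have bounded: "\<nu> B \<le> C * measure M (space M) powr \<alpha>" if "B \<in> sets M" for B
    by (rule mono[OF _ sets.sets_into_space[OF that] sets.top that])
  define P where "P = positive_variation M \<nu>"
  define Q where "Q A = P A - \<nu> A" for A
  have P_ge: "\<nu> B \<le> P A" if "B \<in> sets M" "B \<subseteq> A" for A B
    unfolding P_def by (rule le_positive_variation[where \<nu> = \<nu>, OF bounded that])
  have P_le: "P A \<le> C * measure M A powr \<alpha>" if "A \<in> sets M" for A
    unfolding P_def by (rule positive_variation_le[OF mono[OF _ _ that]])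
  have P_additive: "P (A \<union> B) = P A + P B" if "A \<in> sets M" "B \<in> sets M" "A \<inter> B = {}" for A B
    unfolding P_def by (rule positive_variation_additive[where \<nu> = \<nu>, OF additive bounded that])
  have P_nonneg: "0 \<le> P A" for A using P_ge[of "{}" A] bound[of "{}"] \<alpha> by simp
  obtain g where g: "g \<in> borel_measurable M" "integrable M g"
    "\<And>A. A \<in> sets M \<Longrightarrow> P A = (LINT x|M. indicator A x * g x)"
    using density_of_set_function[of P C \<alpha>, OF P_nonneg P_additive P_le \<alpha>] by blast
  have Q_le: "Q A \<le> (2 * C) * measure M A powr \<alpha>" if "A \<in> sets M" for A
    using P_le[OF that] bound[OF that] by (simp add: Q_def)
  have Q_additive: "Q (A \<union> B) = Q A + Q B" if "A \<in> sets M" "B \<in> sets M" "A \<inter> B = {}" for A B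
    using P_additive[OF that] additive[OF that] by (simp add: Q_def)
  have Q_nonneg: "0 \<le> Q A" if "A \<in> sets M" for A using P_ge[OF that, of A] by (simp add: Q_def)
  obtain h where h: "h \<in> borel_measurable M" "integrable M h"
    "\<And>A. A \<in> sets M \<Longrightarrow> Q A = (LINT x|M. indicator A x * h x)"
    using density_of_set_function[of Q "2 * C" \<alpha>, OF Q_nonneg Q_additive Q_le \<alpha>] by blast
  have density: "\<nu> A = (LINT x|M. indicator A x * (g x - h x))" if A: "A \<in> sets M" for A
    using g(3)[OF A] h(3)[OF A] integrable_mult_indicator[OF A g(2)] integrable_mult_indicator[OF A h(2)]
    by (simp add: Q_def right_diff_distrib)
  show thesis
    by (rule that[of "\<lambda>x. g x - h x", OF _ _ density]) (use g(1,2) h(1,2) in simp_all)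
qed

lemma indicator_Lp: "A \<in> sets M01 \<Longrightarrow> 0 \<le> p \<Longrightarrow> (\<lambda>x. indicator A x) \<in> Lp p"
  by (rule Lp_bounded[where K = 1]) (auto simp: indicator_def)

lemma lpnorm_indicator:
  assumes "A \<in> sets M01" "0 < p"
  shows "lpnorm p (\<lambda>x. indicator A x) = measure M01 A powr (1 / p)"
proof -
  have "(LINT x|M01. \<bar>indicator A x\<bar> powr p) = (LINT x|M01. indicator A x)"
    by (intro Bochner_Integration.integral_cong) (auto simp: indicator_def)
  then show ?thesis using assms by (simp add: lpnorm_def) (metis Int_absorb2 sets.sets_into_space space_M01)
qed

lemma dual_Lp_lin:
  "dual_Lp p \<phi> \<Longrightarrow> f \<in> Lp p \<Longrightarrow> g \<in> Lp p \<Longrightarrow> \<phi> (\<lambda>y. a * f y + b * g y) = a * \<phi> f + b * \<phi> g"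
  by (auto simp: dual_Lp_def)

lemma dual_Lp_diff:
  "dual_Lp p \<phi> \<Longrightarrow> f \<in> Lp p \<Longrightarrow> g \<in> Lp p \<Longrightarrow> \<phi> (\<lambda>y. f y - g y) = \<phi> f - \<phi> g"
  using dual_Lp_lin[of p \<phi> f g 1 "-1"] by simp

lemma dual_Lp_bound:
  assumes "dual_Lp p \<phi>"
  obtains C where "0 \<le> C" "\<And>f. f \<in> Lp p \<Longrightarrow> \<bar>\<phi> f\<bar> \<le> C * lpnorm p f"
proof -
  obtain C where "\<forall>f\<in>Lp p. \<bar>\<phi> f\<bar> \<le> C * lpnorm p f" using assms by (auto simp: dual_Lp_def)
  then have "\<forall>f\<in>Lp p. \<bar>\<phi> f\<bar> \<le> \<bar>C\<bar> * lpnorm p f"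
    by (meson abs_ge_self lpnorm_nonneg mult_right_mono order_trans)
  then show thesis by (intro that[of "\<bar>C\<bar>"]) auto
qed

lemma dual_Lp_cong_AE:
  assumes \<phi>: "dual_Lp p \<phi>" and p: "1 \<le> p" and f: "f \<in> Lp p" and g: "g \<in> Lp p"
    and eq: "AE x in M01. f x = g x"
  shows "\<phi> f = \<phi> g"
proof -
  obtain C where bound: "\<And>f. f \<in> Lp p \<Longrightarrow> \<bar>\<phi> f\<bar> \<le> C * lpnorm p f" using dual_Lp_bound[OF \<phi>] by blast
  have diff: "(\<lambda>x. f x - g x) \<in> Lp p" using f g p by (intro Lp_diff) auto
  have "lpnorm p (\<lambda>x. f x - g x) = 0"
    using eq p by (subst lpnorm_eq_0_iff[OF diff]) auto
  then show ?thesis using bound[OF diff] dual_Lp_diff[OF \<phi> f g] by simp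
qed

lemma dual_Lp_sum:
  assumes \<phi>: "dual_Lp p \<phi>" and p: "0 \<le> p" and u: "\<And>i. i \<in> s \<Longrightarrow> u i \<in> Lp p"
  shows "\<phi> (\<lambda>x. \<Sum>i\<in>s. c i * u i x) = (\<Sum>i\<in>s. c i * \<phi> (u i))"
proof -
  have zero: "\<phi> (\<lambda>x. 0) = 0" using dual_Lp_diff[OF \<phi>, of "\<lambda>x. 0" "\<lambda>x. 0"] p by simp
  show ?thesis using u
  proof (induction s rule: infinite_finite_induct)
    case (insert i s)
    have "\<phi> (\<lambda>x. c i * u i x + 1 * (\<Sum>i\<in>s. c i * u i x)) = c i * \<phi> (u i) + 1 * \<phi> (\<lambda>x. \<Sum>i\<in>s. c i * u i x)"
      using insert p by (intro dual_Lp_lin[OF \<phi>] Lp_sum Lp_scale) auto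
    then show ?case using insert by simp
  qed (auto simp: zero)
qed

lemma dual_Lp_tendsto:
  assumes \<phi>: "dual_Lp p \<phi>" and p: "1 \<le> p" and f: "f \<in> Lp p" and s: "\<And>i. s i \<in> Lp p"
    and lim: "(\<lambda>i. lpnorm p (\<lambda>x. f x - s i x)) \<longlonglongrightarrow> 0"
  shows "(\<lambda>i. \<phi> (s i)) \<longlonglongrightarrow> \<phi> f"
proof -
  obtain C where bound: "\<And>f. f \<in> Lp p \<Longrightarrow> \<bar>\<phi> f\<bar> \<le> C * lpnorm p f" using dual_Lp_bound[OF \<phi>] by blast
  have le: "norm (\<phi> f - \<phi> (s i)) \<le> C * lpnorm p (\<lambda>x. f x - s i x)" for i
    using bound[OF Lp_diff[OF f s]] dual_Lp_diff[OF \<phi> f s] p by simp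
  have "(\<lambda>i. \<phi> f - \<phi> (s i)) \<longlonglongrightarrow> 0"
    by (rule Lim_null_comparison[OF always_eventually[OF allI[OF le]] tendsto_mult_right_zero[OF lim]])
  from tendsto_diff[OF tendsto_const[of "\<phi> f"] this] show ?thesis by simp
qed

definition dual_density :: "((real \<Rightarrow> real) \<Rightarrow> real) \<Rightarrow> (real \<Rightarrow> real) \<Rightarrow> bool" where
  "dual_density \<phi> g \<longleftrightarrow> g \<in> borel_measurable M01 \<and> integrable M01 g \<and>
     (\<forall>A\<in>sets M01. \<phi> (\<lambda>x. indicator A x) = (LINT x|M01. indicator A x * g x))"

lemma dual_density_exists:
  assumes \<phi>: "dual_Lp p \<phi>" and p: "1 \<le> p"
  obtains g where "dual_density \<phi> g"
proof -
  obtain C where C: "0 \<le> C" "\<And>f. f \<in> Lp p \<Longrightarrow> \<bar>\<phi> f\<bar> \<le> C * lpnorm p f"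
    using dual_Lp_bound[OF \<phi>] by blast
  define \<nu> where "\<nu> A = \<phi> (\<lambda>x. indicator A x)" for A :: "real set"
  have bound: "\<bar>\<nu> A\<bar> \<le> C * measure M01 A powr (1 / p)" if "A \<in> sets M01" for A
    using C(2)[OF indicator_Lp[OF that, of p]] lpnorm_indicator[OF that, of p] p by (simp add: \<nu>_def)
  have additive: "\<nu> (A \<union> B) = \<nu> A + \<nu> B" if "A \<in> sets M01" "B \<in> sets M01" "A \<inter> B = {}" for A B
  proof -
    have "(\<lambda>x. indicator (A \<union> B) x) = (\<lambda>x. 1 * indicator A x + 1 * indicator B x :: real)"
      using that by (auto simp: indicator_def fun_eq_iff)
    then show ?thesis unfolding \<nu>_def using that p by (simp only: dual_Lp_lin[OF \<phi>] indicator_Lp)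
  qed
  have "0 < 1 / p" using p by simp
  then obtain g where g: "g \<in> borel_measurable M01" "integrable M01 g"
    "\<And>A. A \<in> sets M01 \<Longrightarrow> \<nu> A = (LINT x|M01. indicator A x * g x)"
    using M01.density_of_signed_set_function[OF additive bound C(1)] by blast
  show thesis
    by (rule that[of g]) (use g in \<open>simp add: dual_density_def \<nu>_def\<close>)
qed

lemma integral_simple_function_comp:
  fixes k :: "'a \<Rightarrow> real"
  assumes f: "simple_function M f" and k: "integrable M k"
  shows "(LINT x|M. \<theta> (f x) * k x)
    = (\<Sum>v\<in>f ` space M. \<theta> v * (LINT x|M. indicator (f -` {v} \<inter> space M) x * k x))"
proof -
  note finite = simple_functionD(1)[OF f] and E = simple_functionD(2)[OF f]
  have "(LINT x|M. \<theta> (f x) * k x)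
      = (LINT x|M. (\<Sum>v\<in>f ` space M. \<theta> v * (indicator (f -` {v} \<inter> space M) x * k x)))"
  proof (intro Bochner_Integration.integral_cong refl)
    fix x assume x: "x \<in> space M"
    have "(\<Sum>v\<in>f ` space M. \<theta> v * (indicator (f -` {v} \<inter> space M) x * k x))
        = (\<Sum>v\<in>f ` space M. if v = f x then \<theta> v * k x else 0)"
      using x by (intro sum.cong) (auto simp: indicator_def)
    then show "\<theta> (f x) * k x = (\<Sum>v\<in>f ` space M. \<theta> v * (indicator (f -` {v} \<inter> space M) x * k x))"
      using finite x by simp
  qed
  also have "\<dots> = (\<Sum>v\<in>f ` space M. \<theta> v * (LINT x|M. indicator (f -` {v} \<inter> space M) x * k x))"
    using integrable_mult_indicator[OF E k] by (subst Bochner_Integration.integral_sum) auto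
  finally show ?thesis .
qed

lemma dual_density_simple:
  assumes \<phi>: "dual_Lp p \<phi>" and p: "1 \<le> p" and g: "dual_density \<phi> g" and s: "simple_function M01 s"
  shows "\<phi> s = (LINT x|M01. s x * g x)"
proof -
  define V where "V = s ` space M01"
  define E where "E y = s -` {y} \<inter> space M01" for y
  have E: "E y \<in> sets M01" for y unfolding E_def using s by (rule simple_functionD)
  have rep: "s x = (\<Sum>y\<in>V. y * indicator (E y) x)" if "x \<in> space M01" for x
    unfolding V_def E_def
    by (subst simple_function_indicator_representation_banach[OF s that]) (simp add: mult.commute)
  have sum_Lp: "(\<lambda>x. \<Sum>y\<in>V. y * indicator (E y) x) \<in> Lp p"
    using E p by (intro Lp_sum Lp_scale indicator_Lp) auto
  have AE: "AE x in M01. (\<Sum>y\<in>V. y * indicator (E y) x) = s x"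
    by (rule AE_I2) (rule rep[symmetric])
  have "s \<in> Lp p" using Lp_cong_AE[OF sum_Lp borel_measurable_simple_function[OF s] AE] .
  then have "\<phi> s = \<phi> (\<lambda>x. \<Sum>y\<in>V. y * indicator (E y) x)"
    using dual_Lp_cong_AE[OF \<phi> p sum_Lp _ AE] by simp
  also have "\<dots> = (\<Sum>y\<in>V. y * \<phi> (\<lambda>x. indicator (E y) x))"
    using E p by (intro dual_Lp_sum[OF \<phi>] indicator_Lp) auto
  also have "\<dots> = (\<Sum>y\<in>V. y * (LINT x|M01. indicator (E y) x * g x))"
    using E g by (simp add: dual_density_def)
  also have "\<dots> = (LINT x|M01. s x * g x)"
    unfolding V_def E_def
    using g by (intro integral_simple_function_comp[OF s, symmetric]) (simp add: dual_density_def)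
  finally show ?thesis .
qed

lemma dual_density_limit:
  assumes \<phi>: "dual_Lp p \<phi>" and p: "1 \<le> p" and g: "dual_density \<phi> g" and h: "h \<in> Lp p"
    and s [measurable]: "\<And>i. s i \<in> borel_measurable M01"
    and lim: "\<And>x. x \<in> {0..1} \<Longrightarrow> (\<lambda>i. s i x) \<longlonglongrightarrow> h x"
    and le: "\<And>i x. x \<in> {0..1} \<Longrightarrow> \<bar>s i x\<bar> \<le> 2 * \<bar>h x\<bar>"
    and s_eq: "\<And>i. \<phi> (s i) = (LINT x|M01. s i x * g x)"
    and integrable: "integrable M01 (\<lambda>x. h x * g x)"
  shows "\<phi> h = (LINT x|M01. h x * g x)"
proof (rule LIMSEQ_unique)
  note [measurable] = Lp_measurable[OF h]
  have [measurable]: "g \<in> borel_measurable M01" using g by (simp add: dual_density_def)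
  have s_Lp: "s i \<in> Lp p" for i
    using le p by (intro Lp_mono[OF s Lp_scale[OF h, of 2]]) (auto simp: abs_mult)
  have "\<bar>h x - s i x\<bar> \<le> \<bar>3 * h x\<bar>" if "x \<in> {0..1}" for i x
    using le[OF that, of i] by linarith
  then have "(\<lambda>i. lpnorm p (\<lambda>x. h x - s i x)) \<longlonglongrightarrow> 0"
    using lim p by (intro Lp_dominated_convergence[OF Lp_scale[OF h]] s) auto
  then show "(\<lambda>i. \<phi> (s i)) \<longlonglongrightarrow> \<phi> h" by (rule dual_Lp_tendsto[OF \<phi> p h s_Lp])
  show "(\<lambda>i. \<phi> (s i)) \<longlonglongrightarrow> (LINT x|M01. h x * g x)"
    unfolding s_eq
  proof (rule integral_dominated_convergence[where w = "\<lambda>x. 2 * \<bar>h x * g x\<bar>"])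
    show "integrable M01 (\<lambda>x. 2 * \<bar>h x * g x\<bar>)" using integrable by simp
    show "AE x in M01. (\<lambda>i. s i x * g x) \<longlonglongrightarrow> h x * g x"
      using lim by (intro AE_I2 tendsto_intros) auto
    show "AE x in M01. norm (s i x * g x) \<le> 2 * \<bar>h x * g x\<bar>" for i
      using mult_right_mono[OF le abs_ge_zero] by (intro AE_I2) (simp add: abs_mult mult.assoc)
  qed measurable
qed

lemma dual_density_bounded:
  assumes \<phi>: "dual_Lp p \<phi>" and p: "1 \<le> p" and g: "dual_density \<phi> g"
    and h [measurable]: "h \<in> borel_measurable M01" and K: "\<And>x. x \<in> {0..1} \<Longrightarrow> \<bar>h x\<bar> \<le> K"
  shows "\<phi> h = (LINT x|M01. h x * g x)"
proof -
  obtain s where s: "\<And>i. simple_function M01 (s i)"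
    "\<And>x. x \<in> space M01 \<Longrightarrow> (\<lambda>i. s i x) \<longlonglongrightarrow> h x"
    "\<And>i x. x \<in> space M01 \<Longrightarrow> dist (s i x) 0 \<le> 2 * dist (h x) 0"
    using borel_measurable_implies_sequence_metric[OF h, of 0] by metis
  have [measurable]: "g \<in> borel_measurable M01" using g by (simp add: dual_density_def)
  have integrable: "integrable M01 (\<lambda>x. h x * g x)"
  proof (rule Bochner_Integration.integrable_bound)
    show "integrable M01 (\<lambda>x. K * g x)" using g by (simp add: dual_density_def)
    show "AE x in M01. norm (h x * g x) \<le> norm (K * g x)"
      using K by (intro AE_I2) (force simp: abs_mult intro!: mult_right_mono)
  qed measurable
  show ?thesis
  proof (rule dual_density_limit[where s = s, OF \<phi> p g _ _ _ _ _ integrable])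
    show "h \<in> Lp p" using p by (intro Lp_bounded[OF h _ K]) auto
    show "s i \<in> borel_measurable M01" for i using s(1) by (rule borel_measurable_simple_function)
    show "\<phi> (s i) = (LINT x|M01. s i x * g x)" for i by (rule dual_density_simple[OF \<phi> p g s(1)])
  qed (use s(2,3) in \<open>auto simp: dist_real_def\<close>)
qed

definition truncate :: "real \<Rightarrow> (real \<Rightarrow> real) \<Rightarrow> real \<Rightarrow> real" where
  "truncate K f x = (if \<bar>f x\<bar> \<le> K then f x else 0)"

lemma truncate_measurable [measurable]:
  assumes [measurable]: "f \<in> borel_measurable M"
  shows "truncate K f \<in> borel_measurable M"
  unfolding truncate_def[abs_def] by measurable

lemma abs_truncate_le: "0 \<le> K \<Longrightarrow> \<bar>truncate K f x\<bar> \<le> K" "\<bar>truncate K f x\<bar> \<le> \<bar>f x\<bar>"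
  by (auto simp: truncate_def)

lemma truncate_eq: "\<bar>f x\<bar> \<le> K \<Longrightarrow> truncate K f x = f x"
  by (simp add: truncate_def)

lemma tendsto_truncate: "(\<lambda>n. truncate (real n) f x) \<longlonglongrightarrow> f x"
proof (rule tendsto_eventually)
  obtain N :: nat where "\<bar>f x\<bar> \<le> real N" using real_arch_simple by blast
  then show "\<forall>\<^sub>F n in sequentially. truncate (real n) f x = f x"
    by (intro eventually_sequentiallyI[of N]) (auto intro!: truncate_eq)
qed

lemma Lp_if_truncations_bounded:
  assumes f [measurable]: "f \<in> borel_measurable M01" and p: "0 < p" and C: "0 \<le> C"
    and bound: "\<And>n. lpnorm p (truncate (real n) f) \<le> C"
  shows "f \<in> Lp p"
proof (rule LpI[OF f])
  define k where "k n x = \<bar>truncate (real n) f x\<bar> powr p" for n :: nat and x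
  have trunc_Lp: "truncate (real n) f \<in> Lp p" for n
    using abs_truncate_le(1)[of "real n" f] p by (intro Lp_bounded[where K = "real n"]) auto
  have int_k: "integrable M01 (k n)" for n
    unfolding k_def by (rule Lp_integrable_powr[OF trunc_Lp])
  have mono: "k m x \<le> k n x" if "m \<le> n" for m n x
    using that p by (auto simp: k_def truncate_def)
  have "(LINT x|M01. k n x) \<le> C powr p" for n
    unfolding k_def using bound[of n] p C lpnorm_le_iff by blast
  moreover have "incseq (\<lambda>n. LINT x|M01. k n x)"
    using mono int_k by (intro incseq_SucI integral_mono) auto
  ultimately obtain L where L: "(\<lambda>n. LINT x|M01. k n x) \<longlonglongrightarrow> L"
    using incseq_convergent[of _ "C powr p"] by blast
  show "integrable M01 (\<lambda>x. \<bar>f x\<bar> powr p)"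
  proof (rule integrable_monotone_convergence[where f = k and x = L])
    show "AE x in M01. (\<lambda>n. k n x) \<longlonglongrightarrow> \<bar>f x\<bar> powr p"
      unfolding k_def using p by (intro AE_I2 tendsto_powr' tendsto_rabs tendsto_truncate tendsto_const) auto
    show "AE x in M01. mono (\<lambda>n. k n x)" using mono by (auto simp: mono_def)
  qed (use int_k L in auto)
qed

lemma dual_density_Lp:
  assumes pq: "conjugate_exponents p q" and \<phi>: "dual_Lp p \<phi>" and g: "dual_density \<phi> g"
  shows "g \<in> Lp q"
proof -
  note p = conjugate_exponentsD(1)[OF pq] and q = conjugate_exponentsD(2)[OF pq]
  note qp = conjugate_exponents_sym[OF pq]
  have [measurable]: "g \<in> borel_measurable M01" using g by (simp add: dual_density_def)
  obtain C where C: "0 \<le> C" "\<And>f. f \<in> Lp p \<Longrightarrow> \<bar>\<phi> f\<bar> \<le> C * lpnorm p f"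
    using dual_Lp_bound[OF \<phi>] by blast
  have "lpnorm q (truncate (real n) g) \<le> C" for n
  proof (cases "lpnorm q (truncate (real n) g) = 0")
    case False
    define t where "t = truncate (real n) g"
    define h where "h x = duality_map q (t x)" for x
    have t: "t \<in> Lp q"
      unfolding t_def using abs_truncate_le(1)[of "real n" g] q by (intro Lp_bounded[where K = "real n"]) auto
    have [measurable]: "h \<in> borel_measurable M01" unfolding h_def t_def by measurable
    have "\<bar>h x\<bar> \<le> real n powr (q - 1)" for x
      using abs_truncate_le(1)[of "real n" g x] q
      by (auto simp: h_def t_def abs_duality_map intro!: powr_mono2)
    then have "\<phi> h = (LINT x|M01. h x * g x)"
      using p by (intro dual_density_bounded[OF \<phi> _ g]) auto
    also have "\<dots> = (LINT x|M01. t x * h x)"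
      by (intro Bochner_Integration.integral_cong) (auto simp: h_def t_def truncate_def duality_map_def)
    also have "\<dots> = lpnorm q t powr q" unfolding h_def by (rule integral_mult_duality_map[OF qp t])
    also have "\<dots> = lpnorm q t * lpnorm q t powr (q - 1)" by (simp add: powr_mult_base)
    finally have "lpnorm q t * lpnorm q t powr (q - 1) \<le> C * lpnorm q t powr (q - 1)"
      using C(2)[of h] duality_map_Lp[OF qp t] lpnorm_duality_map[OF qp t] by (simp add: h_def[abs_def])
    then show ?thesis using False by (simp add: t_def)
  qed (use C in simp)
  then show ?thesis using C(1) q by (intro Lp_if_truncations_bounded[where C = C]) auto
qed

theorem Lp_Riesz:
  assumes pq: "conjugate_exponents p q" and \<phi>: "dual_Lp p \<phi>"
  obtains g where "g \<in> Lp q" "\<And>f. f \<in> Lp p \<Longrightarrow> \<phi> f = (LINT x|M01. f x * g x)"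
proof -
  have p: "1 \<le> p" using conjugate_exponentsD(1)[OF pq] by simp
  obtain g where density: "dual_density \<phi> g" using dual_density_exists[OF \<phi> p] .
  have g: "g \<in> Lp q" using pq \<phi> density by (rule dual_density_Lp)
  have "\<phi> f = (LINT x|M01. f x * g x)" if f: "f \<in> Lp p" for f
  proof (rule dual_density_limit[OF \<phi> p density f])
    show "truncate (real n) f \<in> borel_measurable M01" for n
      using Lp_measurable[OF f] by measurable
    then show "\<phi> (truncate (real n) f) = (LINT x|M01. truncate (real n) f x * g x)" for n
      using dual_density_bounded[OF \<phi> p density, where K = "real n"] abs_truncate_le(1) by simp
    show "\<bar>truncate (real n) f x\<bar> \<le> 2 * \<bar>f x\<bar>" for n x using abs_truncate_le(2)[of "real n" f x] by simp
  qed (use tendsto_truncate Lp_mult_integrable[OF pq f g] in auto)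
  then show thesis using that g by blast
qed

lemma dual_Lp_pairing:
  assumes pq: "conjugate_exponents p q" and g: "g \<in> Lp q"
  shows "dual_Lp p (\<lambda>f. LINT x|M01. f x * g x)"
  unfolding dual_Lp_def
proof (intro conjI ballI allI exI[of _ "lpnorm q g"])
  fix f h a b assume "f \<in> Lp p" "h \<in> Lp p"
  then show "(LINT x|M01. (a * f x + b * h x) * g x)
    = a * (LINT x|M01. f x * g x) + b * (LINT x|M01. h x * g x)"
    using Lp_mult_integrable[OF pq _ g] by (simp add: distrib_right mult.assoc)
next
  fix f assume "f \<in> Lp p"
  then show "\<bar>LINT x|M01. f x * g x\<bar> \<le> lpnorm q g * lpnorm p f"
    using Holder_inequality[OF pq _ g] by (simp add: mult.commute)
qed

section \<open>Ultrafilters\<close>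

lemma ultrafilter_dichotomy:
  assumes U: "nonprincipal_ultrafilter U"
  shows "(\<forall>\<^sub>F n in U. P n) \<or> (\<forall>\<^sub>F n in U. \<not> P n)"
proof -
  have "(\<forall>\<^sub>F n in U. n \<in> Collect P) \<or> (\<forall>\<^sub>F n in U. n \<notin> Collect P)"
    using U unfolding nonprincipal_ultrafilter_def by blast
  then show ?thesis by simp
qed

lemma nonprincipal_ultrafilter_ne_bot: "nonprincipal_ultrafilter U \<Longrightarrow> U \<noteq> bot"
  by (simp add: nonprincipal_ultrafilter_def)

lemma ultrafilter_convergent_compact:
  fixes x :: "nat \<Rightarrow> 'a::topological_space"
  assumes U: "nonprincipal_ultrafilter U" and K: "compact K" and ev: "\<forall>\<^sub>F n in U. x n \<in> K"
  obtains l where "(x \<longlongrightarrow> l) U"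
proof -
  have "filtermap x U \<noteq> bot"
    using nonprincipal_ultrafilter_ne_bot[OF U] by (simp add: filtermap_bot_iff)
  moreover have "\<forall>\<^sub>F y in filtermap x U. y \<in> K" using ev by (simp add: eventually_filtermap)
  ultimately obtain l where l: "inf (nhds l) (filtermap x U) \<noteq> bot"
    using K unfolding compact_filter by blast
  have "(x \<longlongrightarrow> l) U"
  proof (rule topological_tendstoI, rule ccontr)
    fix S assume S: "open S" "l \<in> S" "\<not> (\<forall>\<^sub>F n in U. x n \<in> S)"
    then have "\<forall>\<^sub>F n in U. x n \<notin> S"
      using ultrafilter_dichotomy[OF U, of "\<lambda>n. x n \<in> S"] by blast
    then have "eventually (\<lambda>y. y \<notin> S) (filtermap x U)" by (simp add: eventually_filtermap)
    moreover have "eventually (\<lambda>y. y \<in> S) (nhds l)" using S by (intro eventually_nhds_in_open)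
    ultimately have "eventually (\<lambda>y. False) (inf (nhds l) (filtermap x U))"
      unfolding eventually_inf by blast
    then show False using l by (simp add: trivial_limit_def)
  qed
  then show thesis by (rule that)
qed

lemma nonprincipal_ultrafilter_eventually_notin_finite:
  assumes U: "nonprincipal_ultrafilter U" and "finite A"
  shows "\<forall>\<^sub>F n in U. n \<notin> A"
proof -
  have "\<forall>\<^sub>F n in U. n \<noteq> k" for k
    using ultrafilter_dichotomy[OF U, of "\<lambda>n. n = k"] U by (auto simp: nonprincipal_ultrafilter_def)
  then have "\<forall>\<^sub>F n in U. \<forall>k\<in>A. n \<noteq> k" using \<open>finite A\<close> by (intro eventually_ball_finite) auto
  then show ?thesis by (rule eventually_mono) blast
qed

lemma nonprincipal_ultrafilter_eventually_gt:
  "nonprincipal_ultrafilter U \<Longrightarrow> \<forall>\<^sub>F n in U. k < n"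
  using nonprincipal_ultrafilter_eventually_notin_finite[of U "{..k}"]
  by (auto elim: eventually_mono)

lemma nonprincipal_ultrafilter_infinite:
  assumes U: "nonprincipal_ultrafilter U" and A: "\<forall>\<^sub>F n in U. n \<in> A"
  shows "infinite A"
proof
  assume "finite A"
  from nonprincipal_ultrafilter_eventually_notin_finite[OF U this] A have "\<forall>\<^sub>F n in U. False"
    by eventually_elim simp
  then show False using nonprincipal_ultrafilter_ne_bot[OF U] by (simp add: trivial_limit_def)
qed

lemma nonprincipal_ultrafilter_le_sequentially:
  assumes "nonprincipal_ultrafilter U"
  shows "U \<le> sequentially"
proof -
  have "filterlim (\<lambda>n. n) sequentially U"
    unfolding filterlim_at_top
    by (intro allI, rule eventually_mono[OF nonprincipal_ultrafilter_eventually_gt[OF assms] less_imp_le])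
  then show ?thesis by (simp add: filterlim_def filtermap_ident)
qed

lemma selective_nonprincipal: "selective_ultrafilter U \<Longrightarrow> nonprincipal_ultrafilter U"
  unfolding selective_ultrafilter_def by (rule conjunct1)

lemma selective_pseudo_intersection:
  fixes B :: "nat \<Rightarrow> nat set"
  assumes "selective_ultrafilter U" "\<And>m. \<forall>\<^sub>F n in U. n \<in> B m"
  obtains A where "\<forall>\<^sub>F n in U. n \<in> A" "\<And>m. finite (A - B m)"
proof -
  have "(\<forall>k. \<forall>\<^sub>F n in U. n \<in> B k) \<longrightarrow> (\<exists>A. (\<forall>\<^sub>F n in U. n \<in> A) \<and> (\<forall>k. finite (A - B k)))"
    using assms(1) unfolding selective_ultrafilter_def by (elim conjE) (rule spec[of _ B])
  then show thesis using assms(2) that by auto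
qed

lemma selective_transversal:
  fixes I :: "nat \<Rightarrow> nat set"
  assumes U: "selective_ultrafilter U" and I: "\<And>k. finite (I k)" "\<And>k. I k \<noteq> {}"
    and disjoint: "\<And>k l. k \<noteq> l \<Longrightarrow> I k \<inter> I l = {}" and cover: "(\<Union>k. I k) = UNIV"
  obtains A where "\<forall>\<^sub>F n in U. n \<in> A" "\<And>k m n. {m, n} \<subseteq> A \<inter> I k \<Longrightarrow> m = n"
proof -
  have "((\<forall>k. finite (I k) \<and> I k \<noteq> {}) \<and> (\<forall>k l. k \<noteq> l \<longrightarrow> I k \<inter> I l = {}) \<and> (\<Union>k. I k) = UNIV)
      \<longrightarrow> (\<exists>A. (\<forall>\<^sub>F n in U. n \<in> A) \<and> (\<forall>k. \<exists>m. A \<inter> I k = {m}))"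
    using U unfolding selective_ultrafilter_def by (elim conjE) (rule spec[of _ I])
  then obtain A where "\<forall>\<^sub>F n in U. n \<in> A" "\<And>k. \<exists>m. A \<inter> I k = {m}"
    using I disjoint cover by blast
  then show thesis using that by (metis insert_subset singletonD)
qed

lemma strict_mono_intervals_cover:
  fixes x :: "nat \<Rightarrow> nat"
  assumes x: "strict_mono x" and "x 0 = 0"
  obtains j where "n \<in> {x j..<x (Suc j)}"
proof -
  have "\<exists>j. n < x (Suc j)" using strict_mono_imp_increasing[OF x, of "Suc n"] by (intro exI[of _ n]) simp
  then have least: "n < x (Suc (LEAST j. n < x (Suc j)))" by (rule LeastI_ex)
  show thesis
  proof (rule that[of "LEAST j. n < x (Suc j)"])
    show "n \<in> {x (LEAST j. n < x (Suc j))..<x (Suc (LEAST j. n < x (Suc j)))}"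
    proof (cases "LEAST j. n < x (Suc j)")
      case (Suc i)
      then have "\<not> n < x (Suc i)" using not_less_Least[of i "\<lambda>j. n < x (Suc j)"] by simp
      then show ?thesis using least Suc by simp
    qed (use least assms(2) in simp)
  qed
qed

lemma strict_mono_intervals_disjoint:
  fixes x :: "nat \<Rightarrow> nat"
  assumes x: "strict_mono x" and m: "m \<in> {x j..<x (Suc j)}" and n: "n \<in> {x l..<x (Suc l)}"
    and "m \<le> n"
  shows "j \<le> l"
proof (rule ccontr)
  assume "\<not> j \<le> l"
  then have "x (Suc l) \<le> x j" using x by (simp add: strict_mono_less_eq)
  then show False using m n \<open>m \<le> n\<close> by simp
qed

text \<open>A transversal of the partition into consecutive intervals, the ends of which grow faster
  than \<^term>\<open>h\<close>, is still in $U$ after every second interval is dropped.\<close>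
lemma selective_sparse:
  assumes U: "selective_ultrafilter U"
  obtains A where "\<forall>\<^sub>F n in U. n \<in> A" "\<And>m n. m \<in> A \<Longrightarrow> n \<in> A \<Longrightarrow> m < n \<Longrightarrow> h m \<le> (n :: nat)"
proof -
  define H where "H k = Suc (k + (\<Sum>i\<le>k. h i))" for k
  define x where "x j = (H ^^ j) 0" for j
  have x_Suc: "x (Suc j) = H (x j)" for j by (simp add: x_def)
  have mono: "strict_mono x" by (rule strict_monoI_Suc) (simp add: x_Suc H_def)
  have h_le: "h m \<le> x (Suc (Suc j))" if "m < x (Suc j)" for m j
    using member_le_sum[of m "{..x (Suc j)}" h] that by (simp add: x_Suc[of "Suc j"] H_def)
  define I where "I j = {x j..<x (Suc j)}" for j
  note ordered = strict_mono_intervals_disjoint[OF mono, folded I_def]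
  have "\<forall>n. \<exists>j. n \<in> I j" using strict_mono_intervals_cover[OF mono] by (metis I_def funpow_0 x_def)
  then obtain index where index: "\<And>n. n \<in> I (index n)" by metis
  have "I k \<inter> I l = {}" if "k \<noteq> l" for k l
    using ordered[OF _ _ order_refl] that by (meson disjoint_iff order_antisym)
  moreover have "I k \<noteq> {}" for k using mono by (simp add: I_def strict_mono_less)
  moreover have "(\<Union>k. I k) = UNIV" using index by blast
  ultimately obtain A where A: "\<forall>\<^sub>F n in U. n \<in> A" "\<And>k m n. {m, n} \<subseteq> A \<inter> I k \<Longrightarrow> m = n"
    using selective_transversal[OF U, of I] by (metis I_def finite_atLeastLessThan)
  obtain Q :: "nat \<Rightarrow> bool" where Q: "\<forall>\<^sub>F n in U. Q (index n)" "\<And>j. Q j \<Longrightarrow> \<not> Q (Suc j)"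
    using ultrafilter_dichotomy[OF selective_nonprincipal[OF U], of "\<lambda>n. even (index n)"]
      that[of even] that[of odd] by auto
  show thesis
  proof
    show "\<forall>\<^sub>F n in U. n \<in> {n \<in> A. Q (index n)}" using A(1) Q(1) by eventually_elim simp
    fix m n assume m: "m \<in> {n \<in> A. Q (index n)}" and n: "n \<in> {n \<in> A. Q (index n)}" and "m < n"
    then have "index m \<noteq> index n" using A(2)[of m n "index m"] index[of m] index[of n] by auto
    moreover have "index m \<le> index n" using ordered[OF index index] \<open>m < n\<close> by simp
    moreover have "index n \<noteq> Suc (index m)" using Q(2) m n by force
    ultimately have "x (Suc (Suc (index m))) \<le> x (index n)" using mono by (simp add: strict_mono_less_eq)
    then show "h m \<le> n" using h_le[of m "index m"] index[of m] index[of n] by (simp add: I_def)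
  qed
qed

theorem selective_diagonal:
  fixes B :: "nat \<Rightarrow> nat set"
  assumes U: "selective_ultrafilter U" and B: "\<And>m. \<forall>\<^sub>F n in U. n \<in> B m"
  obtains A where "\<forall>\<^sub>F n in U. n \<in> A" "\<And>m n. m \<in> A \<Longrightarrow> n \<in> A \<Longrightarrow> m < n \<Longrightarrow> n \<in> B m"
proof -
  obtain A where A: "\<forall>\<^sub>F n in U. n \<in> A" "\<And>m. finite (A - B m)"
    using selective_pseudo_intersection[where B = B, OF U B] by blast
  have "\<forall>m. \<exists>b. A - B m \<subseteq> {..<b}" using A(2) by (simp add: finite_nat_iff_bounded[symmetric])
  then obtain h where "\<And>m. A - B m \<subseteq> {..<h m}" by metis
  then have h: "n \<in> B m" if "n \<in> A" "h m \<le> n" for m n using that by fastforce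
  obtain S where S: "\<forall>\<^sub>F n in U. n \<in> S" "\<And>m n. m \<in> S \<Longrightarrow> n \<in> S \<Longrightarrow> m < n \<Longrightarrow> h m \<le> n"
    using selective_sparse[OF U, of h] by blast
  have "\<forall>\<^sub>F n in U. n \<in> A \<inter> S" using A(1) S(1) by eventually_elim simp
  moreover have "n \<in> B m" if "m \<in> A \<inter> S" "n \<in> A \<inter> S" "m < n" for m n
    using that h S(2) by blast
  ultimately show thesis using that by blast
qed

section \<open>Ultrapowers of $L^p$\<close>

lemma UP_Lp: "F \<in> UP p \<Longrightarrow> F n \<in> Lp p"
  by (simp add: UP_def)

lemma UP_bound: "F \<in> UP p \<Longrightarrow> \<exists>C\<ge>0. \<forall>n. lpnorm p (F n) \<le> C"
  unfolding UP_def by (auto intro: order_trans[OF lpnorm_nonneg])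

lemma UPI: "(\<And>n. F n \<in> Lp p) \<Longrightarrow> (\<And>n. lpnorm p (F n) \<le> C) \<Longrightarrow> F \<in> UP p"
  unfolding UP_def by blast

lemma UP_const: "f \<in> Lp p \<Longrightarrow> (\<lambda>n. f) \<in> UP p"
  by (rule UPI[where C = "lpnorm p f"]) auto

lemma UP_lin:
  assumes F: "F \<in> UP p" and G: "G \<in> UP p" and p: "1 \<le> p"
  shows "(\<lambda>n x. a * F n x + b * G n x) \<in> UP p"
proof -
  obtain C D where C: "\<And>n. lpnorm p (F n) \<le> C" and D: "\<And>n. lpnorm p (G n) \<le> D"
    using UP_bound[OF F] UP_bound[OF G] by blast
  show ?thesis
  proof (rule UPI)
    fix n
    show "(\<lambda>x. a * F n x + b * G n x) \<in> Lp p" using UP_Lp[OF F] UP_Lp[OF G] p by (intro Lp_lin) auto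
    have "lpnorm p (\<lambda>x. a * F n x + b * G n x) \<le> \<bar>a\<bar> * lpnorm p (F n) + \<bar>b\<bar> * lpnorm p (G n)"
      using UP_Lp[OF F] UP_Lp[OF G] p by (intro lpnorm_lin_le)
    also have "\<dots> \<le> \<bar>a\<bar> * C + \<bar>b\<bar> * D" using C D by (intro add_mono mult_left_mono) auto
    finally show "lpnorm p (\<lambda>x. a * F n x + b * G n x) \<le> \<bar>a\<bar> * C + \<bar>b\<bar> * D" .
  qed
qed

lemma UP_add: "F \<in> UP p \<Longrightarrow> G \<in> UP p \<Longrightarrow> 1 \<le> p \<Longrightarrow> (\<lambda>n x. F n x + G n x) \<in> UP p"
  using UP_lin[of F p G 1 1] by simp

lemma UP_diff: "F \<in> UP p \<Longrightarrow> G \<in> UP p \<Longrightarrow> 1 \<le> p \<Longrightarrow> (\<lambda>n x. F n x - G n x) \<in> UP p"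
  using UP_lin[of F p G 1 "-1"] by simp

lemma UP_scale: "F \<in> UP p \<Longrightarrow> 1 \<le> p \<Longrightarrow> (\<lambda>n x. a * F n x) \<in> UP p"
  using UP_lin[of F p F a 0] by simp

lemma UP_zero: "1 \<le> p \<Longrightarrow> (\<lambda>n x. 0) \<in> UP p"
  by (rule UP_const) simp

lemma UP_sum:
  assumes "\<And>i. i \<in> s \<Longrightarrow> F i \<in> UP p" "1 \<le> p"
  shows "(\<lambda>n x. \<Sum>i\<in>s. F i n x) \<in> UP p"
  using assms
proof (induction s rule: infinite_finite_induct)
  case (insert i s)
  have "(\<lambda>n x. F i n x + (\<Sum>i\<in>s. F i n x)) \<in> UP p" using insert by (intro UP_add) auto
  then show ?case using insert by simp
qed (auto simp: UP_zero)

lemma UP_exponent_antimono: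
  assumes F: "F \<in> UP p" and r: "1 < r" "r \<le> p"
  shows "F \<in> UP r"
proof -
  obtain C where C: "\<And>n. lpnorm p (F n) \<le> C" using UP_bound[OF F] by blast
  show ?thesis
  proof (rule UPI)
    fix n
    show "F n \<in> Lp r" by (rule Lp_exponent_antimono[OF UP_Lp[OF F] r])
    show "lpnorm r (F n) \<le> C" by (rule order_trans[OF lpnorm_exponent_mono[OF UP_Lp[OF F] r] C])
  qed
qed

lemma UP_uniformly_bounded:
  assumes "\<And>n. H n \<in> borel_measurable M01" "\<And>n x. x \<in> {0..1} \<Longrightarrow> \<bar>H n x\<bar> \<le> K" "0 < p"
  shows "H \<in> UP p"
proof (rule UPI)
  have K: "0 \<le> K" using assms(2)[of 0 0] by simp
  show "H n \<in> Lp p" for n using assms by (intro Lp_bounded[where K = K]) auto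
  show "lpnorm p (H n) \<le> K" for n using assms K by (intro lpnorm_bounded) auto
qed

definition upair :: "nat filter \<Rightarrow> useq \<Rightarrow> useq \<Rightarrow> real" where
  "upair U F G = Lim U (\<lambda>n. LINT x|M01. F n x * G n x)"

lemma upair_commute: "upair U F G = upair U G F"
  by (simp add: upair_def mult.commute)

definition weak_limit :: "real \<Rightarrow> nat filter \<Rightarrow> useq \<Rightarrow> real \<Rightarrow> real" where
  "weak_limit p U F = (SOME f. f \<in> Lp p \<and>
     (\<forall>g\<in>Lp (p / (p - 1)). (LINT x|M01. f x * g x) = upair U F (\<lambda>n. g)))"

definition annihilator :: "real \<Rightarrow> nat filter \<Rightarrow> useq set \<Rightarrow> useq set" where
  "annihilator p U S = {F \<in> UP p. \<forall>G\<in>S. upair U F G = 0}"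

definition UP_eq :: "real \<Rightarrow> nat filter \<Rightarrow> useq \<Rightarrow> useq \<Rightarrow> bool" where
  "UP_eq p U F G \<longleftrightarrow> F \<in> UP p \<and> G \<in> UP p \<and> unorm p U (\<lambda>n x. F n x - G n x) = 0"

abbreviation weakly_null_part :: "real \<Rightarrow> nat filter \<Rightarrow> useq \<Rightarrow> useq" where
  "weakly_null_part p U F \<equiv> \<lambda>n x. F n x - weak_limit p U F x"

locale ultrapower =
  fixes U :: "nat filter"
  assumes nonprincipal: "nonprincipal_ultrafilter U"
begin

lemmas U_ne_bot = nonprincipal_ultrafilter_ne_bot[OF nonprincipal]
lemmas U_gt = nonprincipal_ultrafilter_eventually_gt[OF nonprincipal]
lemmas U_infinite = nonprincipal_ultrafilter_infinite[OF nonprincipal]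
lemmas U_le_sequentially = nonprincipal_ultrafilter_le_sequentially[OF nonprincipal]

lemma LimI: "(f \<longlongrightarrow> (l::real)) U \<Longrightarrow> Lim U f = l"
  using U_ne_bot by (rule tendsto_Lim)

lemma bounded_tendsto_Lim:
  fixes x :: "nat \<Rightarrow> real"
  assumes "\<And>n. \<bar>x n\<bar> \<le> C"
  shows "(x \<longlongrightarrow> Lim U x) U"
proof -
  have "\<forall>\<^sub>F n in U. x n \<in> {-C..C}"
    using assms by (intro always_eventually) (auto simp: abs_le_iff minus_le_iff)
  then obtain l where "(x \<longlongrightarrow> l) U"
    by (rule ultrafilter_convergent_compact[OF nonprincipal compact_Icc])
  then show ?thesis using LimI by simp
qed

lemma eventually_ex: "\<forall>\<^sub>F n in U. P n \<Longrightarrow> \<exists>n. P n"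
  by (rule eventually_happens'[OF U_ne_bot])

lemma sequentially_tendsto: "x \<longlonglongrightarrow> (l::real) \<Longrightarrow> (x \<longlongrightarrow> l) U"
  using U_le_sequentially by (rule tendsto_mono)

lemma unorm_tendsto:
  assumes "F \<in> UP p"
  shows "((\<lambda>n. lpnorm p (F n)) \<longlongrightarrow> unorm p U F) U"
proof -
  obtain C where "\<And>n. lpnorm p (F n) \<le> C" using UP_bound[OF assms] by blast
  then show ?thesis unfolding unorm_def by (intro bounded_tendsto_Lim[where C = C]) simp
qed

lemma unorm_le:
  assumes "F \<in> UP p" "\<forall>\<^sub>F n in U. lpnorm p (F n) \<le> c"
  shows "unorm p U F \<le> c"
  by (rule tendsto_upperbound[OF unorm_tendsto[OF assms(1)] assms(2) U_ne_bot])

lemma unorm_nonneg: "F \<in> UP p \<Longrightarrow> 0 \<le> unorm p U F"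
  by (rule tendsto_lowerbound[OF unorm_tendsto _ U_ne_bot]) auto

lemma unorm_const: "unorm p U (\<lambda>n. f) = lpnorm p f"
  unfolding unorm_def by (rule LimI) simp

lemma unorm_lin_le:
  assumes F: "F \<in> UP p" and G: "G \<in> UP p" and p: "1 \<le> p"
  shows "unorm p U (\<lambda>n x. a * F n x + b * G n x) \<le> \<bar>a\<bar> * unorm p U F + \<bar>b\<bar> * unorm p U G"
proof (rule tendsto_le[OF U_ne_bot])
  show "((\<lambda>n. \<bar>a\<bar> * lpnorm p (F n) + \<bar>b\<bar> * lpnorm p (G n)) \<longlongrightarrow> \<bar>a\<bar> * unorm p U F + \<bar>b\<bar> * unorm p U G) U"
    by (intro tendsto_intros unorm_tendsto F G)
  show "((\<lambda>n. lpnorm p (\<lambda>x. a * F n x + b * G n x)) \<longlongrightarrow> unorm p U (\<lambda>n x. a * F n x + b * G n x)) U"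
    by (intro unorm_tendsto UP_lin F G p)
  show "\<forall>\<^sub>F n in U. lpnorm p (\<lambda>x. a * F n x + b * G n x) \<le> \<bar>a\<bar> * lpnorm p (F n) + \<bar>b\<bar> * lpnorm p (G n)"
    by (intro always_eventually allI lpnorm_lin_le UP_Lp F G p)
qed

lemma unorm_scale:
  assumes F: "F \<in> UP p" and p: "1 \<le> p"
  shows "unorm p U (\<lambda>n x. a * F n x) = \<bar>a\<bar> * unorm p U F"
proof -
  have "((\<lambda>n. \<bar>a\<bar> * lpnorm p (F n)) \<longlongrightarrow> \<bar>a\<bar> * unorm p U F) U"
    by (intro tendsto_intros unorm_tendsto F)
  then show ?thesis unfolding unorm_def[of p U "\<lambda>n x. a * F n x"]
    using p by (intro LimI) (simp add: lpnorm_scale)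
qed

lemma unorm_triangle:
  assumes "F \<in> UP p" "G \<in> UP p" "1 \<le> p"
  shows "unorm p U (\<lambda>n x. F n x + G n x) \<le> unorm p U F + unorm p U G"
  using unorm_lin_le[OF assms, of 1 1] by simp

lemma unorm_diff_trans:
  assumes "F \<in> UP p" "G \<in> UP p" "H \<in> UP p" "1 \<le> p"
  shows "unorm p U (\<lambda>n x. F n x - H n x) \<le> unorm p U (\<lambda>n x. F n x - G n x) + unorm p U (\<lambda>n x. G n x - H n x)"
  using unorm_triangle[OF UP_diff[OF assms(1,2,4)] UP_diff[OF assms(2,3,4)] assms(4)] by simp

lemma unorm_minus_commute: "unorm p U (\<lambda>n x. F n x - G n x) = unorm p U (\<lambda>n x. G n x - F n x)"
  unfolding unorm_def by (subst lpnorm_minus_commute) (rule refl)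

lemma ueq_iff:
  assumes "F \<in> UP p" "G \<in> UP p" "1 \<le> p"
  shows "ueq p U F G \<longleftrightarrow> unorm p U (\<lambda>n x. F n x - G n x) = 0"
proof -
  have "((\<lambda>n. lpnorm p (\<lambda>x. F n x - G n x)) \<longlongrightarrow> unorm p U (\<lambda>n x. F n x - G n x)) U"
    by (intro unorm_tendsto UP_diff assms)
  then show ?thesis unfolding ueq_def fun_diff_def using tendsto_unique[OF U_ne_bot] by auto
qed

lemma uzero_iff: "1 \<le> p \<Longrightarrow> F \<in> uzero p U \<longleftrightarrow> F \<in> UP p \<and> unorm p U F = 0"
  by (auto simp: uzero_def ueq_iff UP_zero)

lemma UP_eq_refl: "F \<in> UP p \<Longrightarrow> UP_eq p U F F"
  by (simp add: UP_eq_def unorm_const)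

lemma UP_eq_sym: "UP_eq p U F G \<Longrightarrow> UP_eq p U G F"
  unfolding UP_eq_def using unorm_minus_commute[of p F G] by simp

lemma UP_eq_trans:
  assumes "1 \<le> p" "UP_eq p U F G" "UP_eq p U G H"
  shows "UP_eq p U F H"
  using unorm_diff_trans[of F p G H] unorm_nonneg[OF UP_diff[of F p H]] assms by (auto simp: UP_eq_def)

lemma UP_eq_lin:
  assumes p: "1 \<le> p" and "UP_eq p U F F'" "UP_eq p U G G'"
  shows "UP_eq p U (\<lambda>n x. a * F n x + b * G n x) (\<lambda>n x. a * F' n x + b * G' n x)"
proof -
  have U: "F \<in> UP p" "F' \<in> UP p" "G \<in> UP p" "G' \<in> UP p"
    and z: "unorm p U (\<lambda>n x. F n x - F' n x) = 0" "unorm p U (\<lambda>n x. G n x - G' n x) = 0"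
    using assms by (auto simp: UP_eq_def)
  have "unorm p U (\<lambda>n x. a * (F n x - F' n x) + b * (G n x - G' n x)) \<le> 0"
    using unorm_lin_le[OF UP_diff[OF U(1,2) p] UP_diff[OF U(3,4) p] p, of a b] z by simp
  moreover have "(\<lambda>n x. a * (F n x - F' n x) + b * (G n x - G' n x))
    = (\<lambda>n x. (a * F n x + b * G n x) - (a * F' n x + b * G' n x))"
    by (simp add: algebra_simps)
  moreover have "0 \<le> unorm p U (\<lambda>n x. (a * F n x + b * G n x) - (a * F' n x + b * G' n x))"
    using U p by (intro unorm_nonneg UP_diff UP_lin)
  ultimately show ?thesis using U p by (auto simp: UP_eq_def intro!: UP_lin)
qed

lemma UP_eq_add: "1 \<le> p \<Longrightarrow> UP_eq p U F F' \<Longrightarrow> UP_eq p U G G' \<Longrightarrow>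
  UP_eq p U (\<lambda>n x. F n x + G n x) (\<lambda>n x. F' n x + G' n x)"
  using UP_eq_lin[of p F F' G G' 1 1] by simp

lemma UP_eq_ueq: "1 \<le> p \<Longrightarrow> F \<in> UP p \<Longrightarrow> G \<in> UP p \<Longrightarrow> UP_eq p U F G \<longleftrightarrow> ueq p U F G"
  by (simp add: UP_eq_def ueq_iff)

lemma
  assumes "closed_usub p U X"
  shows closed_usub_UP: "X \<subseteq> UP p" and closed_usub_zero: "(\<lambda>n x. 0) \<in> X"
  using assms unfolding closed_usub_def by blast+

lemma closed_usub_lin:
  assumes "closed_usub p U X" "F \<in> X" "G \<in> X"
  shows "(\<lambda>n x. a * F n x + b * G n x) \<in> X"
  using assms unfolding closed_usub_def by blast

lemma closed_usub_sum:
  assumes X: "closed_usub p U X" and "\<And>i. i \<in> s \<Longrightarrow> F i \<in> X"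
  shows "(\<lambda>n x. \<Sum>i\<in>s. c i * F i n x) \<in> X"
  using assms(2)
proof (induction s rule: infinite_finite_induct)
  case (insert i s)
  then have "(\<lambda>n x. c i * F i n x + 1 * (\<Sum>i\<in>s. c i * F i n x)) \<in> X"
    by (intro closed_usub_lin[OF X]) auto
  then show ?case using insert by simp
qed (simp_all add: closed_usub_zero[OF X])

lemma closed_usub_cancel_scale:
  assumes X: "closed_usub p U X" and "c \<noteq> 0" and "(\<lambda>n x. c * F n x) \<in> X"
  shows "F \<in> X"
  using closed_usub_lin[OF X assms(3,3), of "1 / c" 0] \<open>c \<noteq> 0\<close> by simp

lemma closed_usub_UP_eq:
  assumes X: "closed_usub p U X" and p: "1 \<le> p" and F: "F \<in> X" and eq: "UP_eq p U F G"
  shows "G \<in> X"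
proof -
  have "F \<in> UP p" "G \<in> UP p" using eq by (auto simp: UP_eq_def)
  moreover from this have "ueq p U F G" using eq p UP_eq_ueq by blast
  ultimately show ?thesis using X F unfolding closed_usub_def by blast
qed

lemma ueq_refl: "F \<in> UP p \<Longrightarrow> 1 \<le> p \<Longrightarrow> ueq p U F F"
  by (simp add: ueq_iff unorm_const)

lemma UP_eq_unorm:
  assumes p: "1 \<le> p" and eq: "UP_eq p U F G"
  shows "unorm p U F = unorm p U G"
proof -
  have U: "F \<in> UP p" "G \<in> UP p" and zero: "unorm p U (\<lambda>n x. F n x - G n x) = 0"
    using eq by (auto simp: UP_eq_def)
  moreover have "unorm p U (\<lambda>n x. G n x - F n x) = 0" using zero by (subst unorm_minus_commute)
  ultimately show ?thesis
    using unorm_triangle[OF UP_diff[OF U p] U(2) p] unorm_triangle[OF UP_diff[OF U(2,1) p] U(1) p]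
    by simp
qed

lemma uzero_subset_closed:
  assumes X: "closed_usub p U X" and p: "1 \<le> p"
  shows "uzero p U \<subseteq> X"
proof
  fix F assume "F \<in> uzero p U"
  then have "F \<in> UP p" "unorm p U F = 0" using p uzero_iff by auto
  then have "UP_eq p U F (\<lambda>n x. 0)" using p by (simp add: UP_eq_def UP_zero)
  then show "F \<in> X" using closed_usub_UP_eq[OF X p closed_usub_zero[OF X] UP_eq_sym] by blast
qed

lemma pairing_tendsto:
  assumes pq: "conjugate_exponents p q" and F: "F \<in> UP p" and G: "G \<in> UP q"
  shows "((\<lambda>n. LINT x|M01. F n x * G n x) \<longlongrightarrow> upair U F G) U"
proof -
  obtain C D where C: "\<And>n. lpnorm p (F n) \<le> C" "0 \<le> C" and D: "\<And>n. lpnorm q (G n) \<le> D"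
    using UP_bound[OF F] UP_bound[OF G] by blast
  have "\<bar>LINT x|M01. F n x * G n x\<bar> \<le> C * D" for n
    using Holder_inequality[OF pq UP_Lp[OF F] UP_Lp[OF G], of n n]
      mult_mono[OF C(1)[of n] D[of n] C(2) lpnorm_nonneg] by linarith
  then show ?thesis unfolding upair_def by (rule bounded_tendsto_Lim)
qed

lemma upair_lin_left:
  assumes pq: "conjugate_exponents p q" and F: "F \<in> UP p" and F': "F' \<in> UP p" and G: "G \<in> UP q"
  shows "upair U (\<lambda>n x. a * F n x + b * F' n x) G = a * upair U F G + b * upair U F' G"
proof -
  have "((\<lambda>n. a * (LINT x|M01. F n x * G n x) + b * (LINT x|M01. F' n x * G n x))
    \<longlongrightarrow> a * upair U F G + b * upair U F' G) U"
    by (intro tendsto_intros pairing_tendsto[OF pq] F F' G)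
  moreover have "(LINT x|M01. (a * F n x + b * F' n x) * G n x)
    = a * (LINT x|M01. F n x * G n x) + b * (LINT x|M01. F' n x * G n x)" for n
    using Lp_mult_integrable[OF pq UP_Lp[OF F] UP_Lp[OF G], of n n]
      Lp_mult_integrable[OF pq UP_Lp[OF F'] UP_Lp[OF G], of n n]
    by (simp add: distrib_right mult.assoc)
  ultimately show ?thesis unfolding upair_def[of U "\<lambda>n x. a * F n x + b * F' n x"] by (intro LimI) simp
qed

lemma upair_lin_right:
  assumes pq: "conjugate_exponents p q" and "F \<in> UP p" "G \<in> UP q" "G' \<in> UP q"
  shows "upair U F (\<lambda>n x. a * G n x + b * G' n x) = a * upair U F G + b * upair U F G'"
  using upair_lin_left[OF conjugate_exponents_sym[OF pq] assms(3,4,2)] by (simp add: upair_commute[of U F])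

lemma upair_diff_left:
  assumes "conjugate_exponents p q" "F \<in> UP p" "F' \<in> UP p" "G \<in> UP q"
  shows "upair U (\<lambda>n x. F n x - F' n x) G = upair U F G - upair U F' G"
  using upair_lin_left[OF assms, of 1 "-1"] by simp

lemma upair_add_left:
  assumes "conjugate_exponents p q" "F \<in> UP p" "F' \<in> UP p" "G \<in> UP q"
  shows "upair U (\<lambda>n x. F n x + F' n x) G = upair U F G + upair U F' G"
  using upair_lin_left[OF assms, of 1 1] by simp

lemma upair_diff_right:
  assumes "conjugate_exponents p q" "F \<in> UP p" "G \<in> UP q" "G' \<in> UP q"
  shows "upair U F (\<lambda>n x. G n x - G' n x) = upair U F G - upair U F G'"
  using upair_lin_right[OF assms, of 1 "-1"] by simp

lemma upair_zero_left: "upair U (\<lambda>n x. 0) G = 0"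
  unfolding upair_def by (rule LimI) simp

lemma upair_sum_left:
  assumes pq: "conjugate_exponents p q" and F: "\<And>i. i \<in> s \<Longrightarrow> F i \<in> UP p" and G: "G \<in> UP q"
  shows "upair U (\<lambda>n x. \<Sum>i\<in>s. c i * F i n x) G = (\<Sum>i\<in>s. c i * upair U (F i) G)"
  using F
proof (induction s rule: infinite_finite_induct)
  case (insert i s)
  have p: "1 \<le> p" using conjugate_exponentsD(1)[OF pq] by simp
  have "upair U (\<lambda>n x. c i * F i n x + 1 * (\<Sum>i\<in>s. c i * F i n x)) G
    = c i * upair U (F i) G + 1 * upair U (\<lambda>n x. \<Sum>i\<in>s. c i * F i n x) G"
    using insert p by (intro upair_lin_left[OF pq] UP_sum UP_scale G) auto
  then show ?case using insert by simp
qed (auto simp: upair_zero_left)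

lemma upair_bound:
  assumes pq: "conjugate_exponents p q" and F: "F \<in> UP p" and G: "G \<in> UP q"
  shows "\<bar>upair U F G\<bar> \<le> unorm p U F * unorm q U G"
proof (rule tendsto_le[OF U_ne_bot])
  show "((\<lambda>n. lpnorm p (F n) * lpnorm q (G n)) \<longlongrightarrow> unorm p U F * unorm q U G) U"
    by (intro tendsto_intros unorm_tendsto F G)
  show "((\<lambda>n. \<bar>LINT x|M01. F n x * G n x\<bar>) \<longlongrightarrow> \<bar>upair U F G\<bar>) U"
    by (intro tendsto_intros pairing_tendsto[OF pq] F G)
  show "\<forall>\<^sub>F n in U. \<bar>LINT x|M01. F n x * G n x\<bar> \<le> lpnorm p (F n) * lpnorm q (G n)"
    by (intro always_eventually allI Holder_inequality[OF pq] UP_Lp F G)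
qed

lemma upair_null_left:
  assumes "conjugate_exponents p q" "F \<in> UP p" "G \<in> UP q" "unorm p U F = 0"
  shows "upair U F G = 0"
  using upair_bound[OF assms(1-3)] assms(4) by simp

lemma upair_ueq_left:
  assumes pq: "conjugate_exponents p q" and F: "F \<in> UP p" "F' \<in> UP p" and G: "G \<in> UP q" and "ueq p U F F'"
  shows "upair U F G = upair U F' G"
proof -
  have p: "1 \<le> p" using conjugate_exponentsD(1)[OF pq] by simp
  have "upair U (\<lambda>n x. F n x - F' n x) G = 0"
    using \<open>ueq p U F F'\<close> F G p by (intro upair_null_left[OF pq] UP_diff) (auto simp: ueq_iff)
  then show ?thesis using upair_diff_left[OF pq F G] by simp
qed

lemma upair_eq_0_if_approx:
  assumes pq: "conjugate_exponents p q" and F: "F \<in> UP p" and G: "G \<in> UP q"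
    and approx: "\<And>\<epsilon>. 0 < \<epsilon> \<Longrightarrow> \<exists>F'\<in>UP p. upair U F' G = 0 \<and> unorm p U (\<lambda>n x. F n x - F' n x) < \<epsilon>"
  shows "upair U F G = 0"
proof -
  have p: "1 \<le> p" using conjugate_exponentsD(1)[OF pq] by simp
  define c where "c = unorm q U G + 1"
  have c: "0 < c" using unorm_nonneg[OF G] by (simp add: c_def)
  have "\<bar>upair U F G\<bar> \<le> 0 + \<epsilon>" if "0 < \<epsilon>" for \<epsilon>
  proof -
    obtain F' where F': "F' \<in> UP p" "upair U F' G = 0" "unorm p U (\<lambda>n x. F n x - F' n x) < \<epsilon> / c"
      using approx[of "\<epsilon> / c"] \<open>0 < \<epsilon>\<close> c by auto
    note diff = UP_diff[OF F F'(1) p]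
    have "\<bar>upair U F G\<bar> = \<bar>upair U (\<lambda>n x. F n x - F' n x) G\<bar>"
      using upair_diff_left[OF pq F F'(1) G] F'(2) by simp
    also have "\<dots> \<le> unorm p U (\<lambda>n x. F n x - F' n x) * unorm q U G"
      by (rule upair_bound[OF pq diff G])
    also have "\<dots> \<le> \<epsilon> / c * c"
      using F'(3) unorm_nonneg[OF G] unorm_nonneg[OF diff] by (intro mult_mono) (auto simp: c_def)
    finally show ?thesis using c by simp
  qed
  then have "\<bar>upair U F G\<bar> \<le> 0" by (rule field_le_epsilon)
  then show ?thesis by simp
qed

lemma weak_limit_exists:
  assumes pq: "conjugate_exponents p q" and F: "F \<in> UP p"
  shows "\<exists>f. f \<in> Lp p \<and> (\<forall>g\<in>Lp q. (LINT x|M01. f x * g x) = upair U F (\<lambda>n. g))"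
proof -
  note qp = conjugate_exponents_sym[OF pq]
  have "dual_Lp q (\<lambda>g. upair U F (\<lambda>n. g))"
    unfolding dual_Lp_def
  proof (intro conjI ballI allI exI[of _ "unorm p U F"])
    fix f g a b assume fg: "f \<in> Lp q" "g \<in> Lp q"
    show "upair U F (\<lambda>n y. a * f y + b * g y) = a * upair U F (\<lambda>n. f) + b * upair U F (\<lambda>n. g)"
      by (rule upair_lin_right[OF pq F UP_const[OF fg(1)] UP_const[OF fg(2)]])
  next
    fix f assume f: "f \<in> Lp q"
    show "\<bar>upair U F (\<lambda>n. f)\<bar> \<le> unorm p U F * lpnorm q f"
      using upair_bound[OF pq F UP_const[OF f]] by (simp add: unorm_const)
  qed
  then obtain f where "f \<in> Lp p" "\<And>g. g \<in> Lp q \<Longrightarrow> upair U F (\<lambda>n. g) = (LINT x|M01. g x * f x)"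
    using Lp_Riesz[OF qp] by blast
  then show ?thesis by (intro exI[of _ f]) (auto simp: mult.commute)
qed

lemma conjugate_exponents_eq: "conjugate_exponents p q \<Longrightarrow> p / (p - 1) = q"
  unfolding conjugate_exponents_def by (auto simp: field_simps)

lemma
  assumes pq: "conjugate_exponents p q" and F: "F \<in> UP p"
  shows weak_limit_Lp: "weak_limit p U F \<in> Lp p"
    and integral_weak_limit: "\<And>g. g \<in> Lp q \<Longrightarrow> (LINT x|M01. weak_limit p U F x * g x) = upair U F (\<lambda>n. g)"
  using someI_ex[OF weak_limit_exists[OF pq F]]
  unfolding weak_limit_def conjugate_exponents_eq[OF pq] by auto

lemma upair_const: "upair U (\<lambda>n. f) (\<lambda>n. g) = (LINT x|M01. f x * g x)"
  unfolding upair_def by (rule LimI) simp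

lemma upair_weak_limit:
  assumes pq: "conjugate_exponents p q" and F: "F \<in> UP p" and g: "g \<in> Lp q"
  shows "upair U (\<lambda>n. weak_limit p U F) (\<lambda>n. g) = upair U F (\<lambda>n. g)"
  using integral_weak_limit[OF assms] by (simp add: upair_const)

lemma lpnorm_weak_limit_le:
  assumes pq: "conjugate_exponents p q" and F: "F \<in> UP p"
  shows "lpnorm p (weak_limit p U F) \<le> unorm p U F"
proof (rule lpnorm_le_dual[OF pq weak_limit_Lp[OF pq F] _ unorm_nonneg[OF F]])
  fix g assume g: "g \<in> Lp q"
  show "(LINT x|M01. weak_limit p U F x * g x) \<le> unorm p U F * lpnorm q g"
    using integral_weak_limit[OF pq F g] upair_bound[OF pq F UP_const[OF g]] by (simp add: unorm_const)
qed

lemma lpnorm_weak_limit_unique: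
  assumes pq: "conjugate_exponents p q" and F: "F \<in> UP p" and f: "f \<in> Lp p"
    and e: "\<And>g. g \<in> Lp q \<Longrightarrow> upair U F (\<lambda>n. g) = (LINT x|M01. f x * g x)"
  shows "lpnorm p (\<lambda>x. weak_limit p U F x - f x) = 0"
proof (rule lpnorm_eq_0_dual[OF pq])
  have p: "0 \<le> p" using conjugate_exponentsD(1)[OF pq] by simp
  show "(\<lambda>x. weak_limit p U F x - f x) \<in> Lp p" by (rule Lp_diff[OF weak_limit_Lp[OF pq F] f p])
  fix g assume g: "g \<in> Lp q"
  show "(LINT x|M01. (weak_limit p U F x - f x) * g x) = 0"
    using Lp_mult_integrable[OF pq weak_limit_Lp[OF pq F] g] Lp_mult_integrable[OF pq f g]
      integral_weak_limit[OF pq F g] e[OF g]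
    by (simp add: left_diff_distrib)
qed

lemma Lhat_iff:
  assumes pq: "conjugate_exponents p q"
  shows "F \<in> Lhat p U \<longleftrightarrow> F \<in> UP p \<and> (\<forall>g\<in>Lp q. upair U F (\<lambda>n. g) = 0)"
proof (intro iffI conjI ballI)
  assume F: "F \<in> Lhat p U"
  then show "F \<in> UP p" by (simp add: Lhat_def)
  fix g assume "g \<in> Lp q"
  then have "((\<lambda>n. LINT x|M01. F n x * g x) \<longlongrightarrow> 0) U"
    using F dual_Lp_pairing[OF pq, of g] unfolding Lhat_def by blast
  then show "upair U F (\<lambda>n. g) = 0" unfolding upair_def by (rule LimI)
next
  assume F: "F \<in> UP p \<and> (\<forall>g\<in>Lp q. upair U F (\<lambda>n. g) = 0)"
  show "F \<in> Lhat p U" unfolding Lhat_def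
  proof (intro CollectI conjI allI impI)
    fix \<phi> assume "dual_Lp p \<phi>"
    then obtain g where g: "g \<in> Lp q" "\<And>f. f \<in> Lp p \<Longrightarrow> \<phi> f = (LINT x|M01. f x * g x)"
      using Lp_Riesz[OF pq] by blast
    have "((\<lambda>n. LINT x|M01. F n x * g x) \<longlongrightarrow> upair U F (\<lambda>n. g)) U"
      using pairing_tendsto[OF pq conjunct1[OF F] UP_const[OF g(1)]] .
    then show "((\<lambda>n. \<phi> (F n)) \<longlongrightarrow> 0) U" using F g UP_Lp[of F p] by simp
  qed (use F in simp)
qed

lemma Lhat_UP: "F \<in> Lhat p U \<Longrightarrow> F \<in> UP p"
  by (simp add: Lhat_def)

lemma
  assumes pq: "conjugate_exponents p q" and F: "F \<in> Lhat p U" and g: "g \<in> Lp q"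
  shows upair_Lhat_const: "upair U F (\<lambda>n. g) = 0"
    and upair_const_Lhat: "upair U (\<lambda>n. g) F = 0"
    and Lhat_tendsto: "((\<lambda>n. LINT x|M01. F n x * g x) \<longlongrightarrow> 0) U"
proof -
  show "upair U F (\<lambda>n. g) = 0" using F g Lhat_iff[OF pq] by blast
  then show "upair U (\<lambda>n. g) F = 0" "((\<lambda>n. LINT x|M01. F n x * g x) \<longlongrightarrow> 0) U"
    using pairing_tendsto[OF pq Lhat_UP[OF F] UP_const[OF g]] by (simp_all add: upair_commute)
qed

lemma Lhat_lin:
  assumes pq: "conjugate_exponents p q" and F: "F \<in> Lhat p U" "G \<in> Lhat p U"
  shows "(\<lambda>n x. a * F n x + b * G n x) \<in> Lhat p U"
proof -
  have p: "1 \<le> p" using conjugate_exponentsD(1)[OF pq] by simp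
  show ?thesis
    using F p unfolding Lhat_iff[OF pq] by (auto simp: upair_lin_left[OF pq] UP_const intro!: UP_lin)
qed

lemma weakly_null_part_Lhat:
  assumes pq: "conjugate_exponents p q" and F: "F \<in> UP p"
  shows "weakly_null_part p U F \<in> Lhat p U"
proof -
  have p: "1 \<le> p" using conjugate_exponentsD(1)[OF pq] by simp
  note W = UP_const[OF weak_limit_Lp[OF pq F]]
  show ?thesis unfolding Lhat_iff[OF pq]
    using upair_diff_left[OF pq F W] upair_weak_limit[OF pq F] UP_diff[OF F W p] by (auto simp: UP_const)
qed

lemma
  assumes pq: "conjugate_exponents p q" and F: "F \<in> UP p"
  shows duality_map_UP: "(\<lambda>n x. duality_map p (F n x)) \<in> UP q"
    and upair_duality_map: "upair U F (\<lambda>n x. duality_map p (F n x)) = unorm p U F powr p"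
proof -
  have p: "1 < p" using conjugate_exponentsD(1)[OF pq] by simp
  obtain C where C: "\<And>n. lpnorm p (F n) \<le> C" using UP_bound[OF F] by blast
  show "(\<lambda>n x. duality_map p (F n x)) \<in> UP q"
  proof (rule UPI)
    fix n
    show "(\<lambda>x. duality_map p (F n x)) \<in> Lp q" by (rule duality_map_Lp[OF pq UP_Lp[OF F]])
    have "lpnorm p (F n) powr (p - 1) \<le> C powr (p - 1)" using C p by (intro powr_mono2) auto
    then show "lpnorm q (\<lambda>x. duality_map p (F n x)) \<le> C powr (p - 1)"
      using lpnorm_duality_map[OF pq UP_Lp[OF F]] by simp
  qed
  have "((\<lambda>n. lpnorm p (F n) powr p) \<longlongrightarrow> unorm p U F powr p) U"
    using p by (intro tendsto_powr' unorm_tendsto F tendsto_const) auto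
  then show "upair U F (\<lambda>n x. duality_map p (F n x)) = unorm p U F powr p"
    unfolding upair_def using integral_mult_duality_map[OF pq UP_Lp[OF F]] by (intro LimI) simp
qed

lemma Lhat_separation:
  assumes pq: "conjugate_exponents p q" and F: "F \<in> Lhat p U" and "unorm p U F \<noteq> 0"
  obtains G where "G \<in> Lhat q U" "upair U F G \<noteq> 0"
proof -
  note F_UP = Lhat_UP[OF F] and qp = conjugate_exponents_sym[OF pq]
  let ?J = "\<lambda>n x. duality_map p (F n x)"
  note J = duality_map_UP[OF pq F_UP]
  note W = weak_limit_Lp[OF qp J]
  have "upair U F (weakly_null_part q U ?J) = unorm p U F powr p"
    using upair_diff_right[OF pq F_UP J UP_const[OF W]] upair_duality_map[OF pq F_UP]
      upair_Lhat_const[OF pq F W]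
    by simp
  then show thesis using that[OF weakly_null_part_Lhat[OF qp J]] \<open>unorm p U F \<noteq> 0\<close> by simp
qed

lemma annihilatorD: "F \<in> annihilator p U S \<Longrightarrow> G \<in> S \<Longrightarrow> upair U F G = 0"
  by (simp add: annihilator_def)

lemma closed_usub_annihilator:
  assumes pq: "conjugate_exponents p q" and S: "S \<subseteq> UP q"
  shows "closed_usub p U (annihilator p U S)"
  unfolding closed_usub_def
proof (intro conjI ballI allI impI)
  have p: "1 \<le> p" using conjugate_exponentsD(1)[OF pq] by simp
  have S_UP: "G \<in> UP q" if "G \<in> S" for G using S that by blast
  show "annihilator p U S \<subseteq> UP p" by (auto simp: annihilator_def)
  show "(\<lambda>n x. 0) \<in> annihilator p U S" using p by (simp add: annihilator_def UP_zero upair_zero_left)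
  show "G \<in> annihilator p U S" if "F \<in> annihilator p U S" "G \<in> UP p" "ueq p U F G" for F G
    using that upair_ueq_left[OF pq _ _ S_UP, of F G] by (simp add: annihilator_def)
  show "(\<lambda>n x. a * F n x + b * G n x) \<in> annihilator p U S"
    if "F \<in> annihilator p U S" "G \<in> annihilator p U S" for F G a b
    using that p by (auto simp: annihilator_def upair_lin_left[OF pq _ _ S_UP] intro!: UP_lin)
  fix G assume G: "G \<in> UP p" "\<forall>\<epsilon>>0. \<exists>F\<in>annihilator p U S. unorm p U (uminus_seq G F) < \<epsilon>"
  have "upair U G H = 0" if "H \<in> S" for H
  proof (rule upair_eq_0_if_approx[OF pq G(1) S_UP[OF that]])
    fix \<epsilon> :: real assume "0 < \<epsilon>"
    then obtain F where "F \<in> annihilator p U S" "unorm p U (uminus_seq G F) < \<epsilon>" using G(2) by blast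
    then show "\<exists>F\<in>UP p. upair U F H = 0 \<and> unorm p U (\<lambda>n x. G n x - F n x) < \<epsilon>"
      using that by (auto simp: annihilator_def uminus_seq_def)
  qed
  then show "G \<in> annihilator p U S" using G(1) by (simp add: annihilator_def)
qed

lemma Lhat_eq_annihilator:
  assumes "conjugate_exponents p q"
  shows "Lhat p U = annihilator p U ((\<lambda>g n. g) ` Lp q)"
  unfolding annihilator_def using Lhat_iff[OF assms] by auto

lemma closed_usub_Lhat:
  assumes "conjugate_exponents p q"
  shows "closed_usub p U (Lhat p U)"
  unfolding Lhat_eq_annihilator[OF assms]
  by (rule closed_usub_annihilator[OF assms]) (auto intro: UP_const)

lemma upair_weakly_null_part:
  assumes pq: "conjugate_exponents p q" and F: "F \<in> UP p" and G: "G \<in> Lhat q U"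
  shows "upair U (weakly_null_part p U F) G = upair U F G"
  using upair_diff_left[OF pq F UP_const[OF weak_limit_Lp[OF pq F]] Lhat_UP[OF G]]
    upair_const_Lhat[OF conjugate_exponents_sym[OF pq] G weak_limit_Lp[OF pq F]] by simp

lemma unorm_weakly_null_part_eq_0:
  assumes pq: "conjugate_exponents p q" and F: "F \<in> UP p"
    and "\<And>G. G \<in> Lhat q U \<Longrightarrow> upair U F G = 0"
  shows "unorm p U (weakly_null_part p U F) = 0"
  using Lhat_separation[OF pq weakly_null_part_Lhat[OF pq F]] assms(3) upair_weakly_null_part[OF pq F]
  by metis

lemma LpC_eq_annihilator:
  assumes pq: "conjugate_exponents p q"
  shows "LpC p U = annihilator p U (Lhat q U)"
proof (intro equalityI subsetI)
  fix F assume "F \<in> LpC p U"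
  then obtain f where F: "F \<in> UP p" and f: "f \<in> Lp p" "ueq p U F (\<lambda>n. f)" by (auto simp: LpC_def)
  have "upair U F G = 0" if G: "G \<in> Lhat q U" for G
    using upair_ueq_left[OF pq F UP_const[OF f(1)] Lhat_UP[OF G] f(2)]
      upair_const_Lhat[OF conjugate_exponents_sym[OF pq] G f(1)] by simp
  then show "F \<in> annihilator p U (Lhat q U)" using F by (simp add: annihilator_def)
next
  fix F assume "F \<in> annihilator p U (Lhat q U)"
  then have F: "F \<in> UP p" and zero: "\<And>G. G \<in> Lhat q U \<Longrightarrow> upair U F G = 0"
    by (simp_all add: annihilator_def)
  have "ueq p U F (\<lambda>n. weak_limit p U F)"
    using unorm_weakly_null_part_eq_0[OF pq F zero] F UP_const[OF weak_limit_Lp[OF pq F]]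
      conjugate_exponentsD(1)[OF pq] by (simp add: ueq_iff)
  then show "F \<in> LpC p U" using F weak_limit_Lp[OF pq F] by (auto simp: LpC_def)
qed

lemma closed_usub_LpC:
  assumes "conjugate_exponents p q"
  shows "closed_usub p U (LpC p U)"
  unfolding LpC_eq_annihilator[OF assms]
  by (rule closed_usub_annihilator[OF assms]) (auto intro: Lhat_UP)

end

section \<open>Sequences tending to zero in $L^1$\<close>

definition L1null :: "real \<Rightarrow> nat filter \<Rightarrow> useq set" where
  "L1null p U = {F \<in> UP p. ((\<lambda>n. LINT x|M01. \<bar>F n x\<bar>) \<longlongrightarrow> 0) U}"

definition bounded_seqs :: "useq set" where
  "bounded_seqs = {H. (\<forall>n. H n \<in> borel_measurable M01) \<and> (\<exists>K. \<forall>n. \<forall>x\<in>{0..1}. \<bar>H n x\<bar> \<le> K)}"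

definition equiintegrable :: "real \<Rightarrow> nat filter \<Rightarrow> useq set" where
  "equiintegrable p U = {F \<in> UP p. \<forall>\<epsilon>>0. \<exists>H\<in>bounded_seqs. unorm p U (\<lambda>n x. F n x - H n x) < \<epsilon>}"

lemma bounded_seqsI:
  assumes "\<And>n. H n \<in> borel_measurable M01" "\<And>n x. x \<in> {0..1} \<Longrightarrow> \<bar>H n x\<bar> \<le> K"
  shows "H \<in> bounded_seqs"
  using assms unfolding bounded_seqs_def by blast

lemma bounded_seqs_UP:
  assumes "H \<in> bounded_seqs" "0 < p"
  shows "H \<in> UP p"
proof -
  obtain K where "\<And>n. H n \<in> borel_measurable M01" "\<And>n x. x \<in> {0..1} \<Longrightarrow> \<bar>H n x\<bar> \<le> K"
    using assms(1) unfolding bounded_seqs_def by blast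
  then show ?thesis using assms(2) by (rule UP_uniformly_bounded)
qed

lemma simple_function_bounded:
  fixes s :: "real \<Rightarrow> real"
  assumes "simple_function M01 s"
  obtains K where "0 \<le> K" "\<And>x. x \<in> {0..1} \<Longrightarrow> \<bar>s x\<bar> \<le> K"
proof
  have "finite (s ` {0..1})" using simple_functionD(1)[OF assms] by simp
  then have finite: "finite (insert 0 (abs ` s ` {0..1}))" by simp
  show "0 \<le> Max (insert 0 (abs ` s ` {0..1}))" by (rule Max_ge[OF finite]) simp
  show "\<bar>s x\<bar> \<le> Max (insert 0 (abs ` s ` {0..1}))" if "x \<in> {0..1}" for x
    by (rule Max_ge[OF finite]) (use that in simp)
qed

lemma const_simple_bounded_seqs:
  assumes s: "simple_function M01 s"
  shows "(\<lambda>n. s) \<in> bounded_seqs"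
proof -
  obtain K where "\<And>x. x \<in> {0..1} \<Longrightarrow> \<bar>s x\<bar> \<le> K" using simple_function_bounded[OF s] by blast
  then show ?thesis by (intro bounded_seqsI[where K = K] borel_measurable_simple_function[OF s])
qed

lemma powr_le_linear_plus_powr:
  fixes s p \<epsilon> :: real
  assumes s: "0 < s" "s < p" and \<epsilon>: "0 < \<epsilon>"
  obtains K where "0 \<le> K" "\<And>y. \<bar>y\<bar> powr s \<le> K * \<bar>y\<bar> + \<epsilon> * (1 + \<bar>y\<bar> powr p)"
proof -
  define a where "a = \<epsilon> powr (1 / s)"
  define b where "b = \<epsilon> powr (1 / (s - p))"
  have a: "0 < a" "a powr s = \<epsilon>" and b: "0 < b" "b powr (s - p) = \<epsilon>"
    using \<epsilon> s by (simp_all add: a_def b_def powr_powr)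
  have "\<bar>y\<bar> powr s \<le> (b powr s / a) * \<bar>y\<bar> + \<epsilon> * (1 + \<bar>y\<bar> powr p)" for y
  proof -
    consider "\<bar>y\<bar> \<le> a" | "a < \<bar>y\<bar>" "\<bar>y\<bar> \<le> b" | "b < \<bar>y\<bar>" by linarith
    then have "\<bar>y\<bar> powr s \<le> \<epsilon> \<or> \<bar>y\<bar> powr s \<le> (b powr s / a) * \<bar>y\<bar> \<or> \<bar>y\<bar> powr s \<le> \<epsilon> * \<bar>y\<bar> powr p"
    proof cases
      assume "\<bar>y\<bar> \<le> a"
      then show ?thesis using powr_mono2[of s "\<bar>y\<bar>" a] s a by simp
    next
      assume y: "a < \<bar>y\<bar>" "\<bar>y\<bar> \<le> b"
      have "\<bar>y\<bar> powr s \<le> b powr s * 1" using powr_mono2[of s "\<bar>y\<bar>" b] s y by simp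
      also have "\<dots> \<le> b powr s * (\<bar>y\<bar> / a)" using y a by (intro mult_left_mono) auto
      finally show ?thesis by simp
    next
      assume y: "b < \<bar>y\<bar>"
      have "\<bar>y\<bar> powr s = \<bar>y\<bar> powr (s - p) * \<bar>y\<bar> powr p" using y b by (simp add: powr_add[symmetric])
      also have "\<dots> \<le> b powr (s - p) * \<bar>y\<bar> powr p" using y b s by (intro mult_right_mono powr_mono2') auto
      finally show ?thesis using b by simp
    qed
    moreover have "0 \<le> (b powr s / a) * \<bar>y\<bar>" "0 \<le> \<epsilon> * \<bar>y\<bar> powr p" using a \<epsilon> by auto
    ultimately show ?thesis using \<epsilon> unfolding distrib_left by linarith
  qed
  then show thesis using that[of "b powr s / a"] a by simp
qed

context ultrapower
begin

lemma L1null_UP: "F \<in> L1null p U \<Longrightarrow> F \<in> UP p"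
  by (simp add: L1null_def)

lemma L1nullD: "F \<in> L1null p U \<Longrightarrow> ((\<lambda>n. LINT x|M01. \<bar>F n x\<bar>) \<longlongrightarrow> 0) U"
  by (simp add: L1null_def)

lemma L1null_upair_bounded:
  assumes p: "1 < p" and F: "F \<in> L1null p U" and H: "H \<in> bounded_seqs"
  shows "upair U F H = 0"
proof -
  obtain K where H: "\<And>n. H n \<in> borel_measurable M01" "\<And>n x. x \<in> {0..1} \<Longrightarrow> \<bar>H n x\<bar> \<le> K"
    using H unfolding bounded_seqs_def by blast
  have le: "norm (LINT x|M01. F n x * H n x) \<le> K * (LINT x|M01. \<bar>F n x\<bar>)" for n
  proof -
    note int_F = Lp_integrable[OF UP_Lp[OF L1null_UP[OF F]] p, of n]
    note [measurable] = H(1)[of n] borel_measurable_integrable[OF int_F]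
    have pointwise: "norm (F n x * H n x) \<le> K * \<bar>F n x\<bar>" if "x \<in> space M01" for x
      using mult_left_mono[OF H(2)[of x n], of "\<bar>F n x\<bar>"] that by (simp add: abs_mult mult.commute)
    have "integrable M01 (\<lambda>x. F n x * H n x)"
    proof (rule Bochner_Integration.integrable_bound)
      show "integrable M01 (\<lambda>x. K * \<bar>F n x\<bar>)" using int_F by simp
      show "AE x in M01. norm (F n x * H n x) \<le> norm (K * \<bar>F n x\<bar>)"
        using order_trans[OF pointwise abs_ge_self] by (intro AE_I2) simp
    qed measurable
    then have "norm (LINT x|M01. F n x * H n x) \<le> (LINT x|M01. K * \<bar>F n x\<bar>)"
      using int_F pointwise by (intro order_trans[OF integral_norm_bound] integral_mono) auto
    then show ?thesis by simp
  qed
  show ?thesis unfolding upair_def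
    by (rule LimI[OF Lim_null_comparison[OF always_eventually[OF allI[OF le]]
          tendsto_mult_right_zero[OF L1nullD[OF F]]]])
qed

lemma L1null_eq_annihilator:
  assumes pq: "conjugate_exponents p q"
  shows "L1null p U = annihilator p U bounded_seqs"
proof (intro equalityI subsetI)
  fix F assume "F \<in> L1null p U"
  then show "F \<in> annihilator p U bounded_seqs"
    using L1null_upair_bounded[OF conjugate_exponentsD(1)[OF pq]] by (simp add: annihilator_def L1null_UP)
next
  fix F assume F: "F \<in> annihilator p U bounded_seqs"
  then have F_UP: "F \<in> UP p" by (simp add: annihilator_def)
  let ?sgn = "\<lambda>n x. sgn (F n x)"
  have sgn: "?sgn \<in> bounded_seqs"
    using Lp_measurable[OF UP_Lp[OF F_UP]] by (intro bounded_seqsI[where K = 1]) (auto simp: abs_sgn_eq)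
  have "upair U F ?sgn = 0" by (rule annihilatorD[OF F sgn])
  moreover have "F n x * ?sgn n x = \<bar>F n x\<bar>" for n x by (simp add: sgn_if)
  moreover have "?sgn \<in> UP q" using conjugate_exponentsD(2)[OF pq] by (intro bounded_seqs_UP[OF sgn]) simp
  ultimately have "((\<lambda>n. LINT x|M01. \<bar>F n x\<bar>) \<longlongrightarrow> 0) U" using pairing_tendsto[OF pq F_UP] by fastforce
  then show "F \<in> L1null p U" using F_UP by (simp add: L1null_def)
qed

lemma closed_usub_L1null:
  assumes pq: "conjugate_exponents p q"
  shows "closed_usub p U (L1null p U)"
  unfolding L1null_eq_annihilator[OF pq] using conjugate_exponentsD(2)[OF pq]
  by (intro closed_usub_annihilator[OF pq]) (auto intro: bounded_seqs_UP)

lemma L1null_Lhat: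
  assumes pq: "conjugate_exponents p q" and F: "F \<in> L1null p U"
  shows "F \<in> Lhat p U"
  unfolding Lhat_iff[OF pq]
proof (intro conjI ballI)
  note p = conjugate_exponentsD(1)[OF pq] and q = conjugate_exponentsD(2)[OF pq]
  show F_UP: "F \<in> UP p" using F by (rule L1null_UP)
  fix g assume g: "g \<in> Lp q"
  have "upair U (\<lambda>n. g) F = 0"
  proof (rule upair_eq_0_if_approx[OF conjugate_exponents_sym[OF pq] UP_const[OF g] F_UP])
    fix \<epsilon> :: real assume "0 < \<epsilon>"
    then obtain s where s: "simple_function M01 s" "s \<in> Lp q" "lpnorm q (\<lambda>x. g x - s x) < \<epsilon>"
      using Lp_simple_dense[OF g] q by (metis less_imp_le)
    then show "\<exists>G\<in>UP q. upair U G F = 0 \<and> unorm q U (\<lambda>n x. g x - G n x) < \<epsilon>"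
      using L1null_upair_bounded[OF p F const_simple_bounded_seqs[OF s(1)]]
      by (intro bexI[of _ "\<lambda>n. s"]) (auto simp: upair_commute[of U _ F] unorm_const UP_const)
  qed
  then show "upair U F (\<lambda>n. g) = 0" by (simp add: upair_commute)
qed

lemma L1null_powr:
  assumes p: "1 < p" and F: "F \<in> L1null p U" and s: "0 < s" "s < p"
  shows "((\<lambda>n. LINT x|M01. \<bar>F n x\<bar> powr s) \<longlongrightarrow> 0) U"
proof (rule tendstoI)
  note F_UP = L1null_UP[OF F]
  fix d :: real assume d: "0 < d"
  obtain C where C: "\<And>n. lpnorm p (F n) \<le> C" "0 \<le> C" using UP_bound[OF F_UP] by blast
  have moment: "(LINT x|M01. \<bar>F n x\<bar> powr p) \<le> C powr p" for n
    using C p lpnorm_le_iff by simp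
  define M where "M = 1 + C powr p"
  have "0 < M" by (simp add: M_def add_pos_nonneg)
  define \<epsilon> where "\<epsilon> = d / (2 * M)"
  have \<epsilon>: "0 < \<epsilon>" "\<epsilon> * M = d / 2" using d \<open>0 < M\<close> by (simp_all add: \<epsilon>_def)
  obtain K where K: "0 \<le> K" "\<And>y. \<bar>y\<bar> powr s \<le> K * \<bar>y\<bar> + \<epsilon> * (1 + \<bar>y\<bar> powr p)"
    using powr_le_linear_plus_powr[OF s \<epsilon>(1)] by blast
  have "\<forall>\<^sub>F n in U. K * (LINT x|M01. \<bar>F n x\<bar>) < d / 2"
    using d tendsto_mult_right_zero[OF L1nullD[OF F]] by (intro order_tendstoD) auto
  then show "\<forall>\<^sub>F n in U. dist (LINT x|M01. \<bar>F n x\<bar> powr s) 0 < d"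
  proof eventually_elim
    case (elim n)
    note int_F = Lp_integrable[OF UP_Lp[OF F_UP] p, of n] Lp_integrable_powr[OF UP_Lp[OF F_UP], of n]
    note [measurable] = Lp_measurable[OF UP_Lp[OF F_UP], of n]
    have dominating: "integrable M01 (\<lambda>x. K * \<bar>F n x\<bar> + \<epsilon> * (1 + \<bar>F n x\<bar> powr p))" using int_F by simp
    have "integrable M01 (\<lambda>x. \<bar>F n x\<bar> powr s)"
      using order_trans[OF K(2) abs_ge_self]
      by (intro Bochner_Integration.integrable_bound[OF dominating] AE_I2) auto
    then have "(LINT x|M01. \<bar>F n x\<bar> powr s) \<le> (LINT x|M01. K * \<bar>F n x\<bar> + \<epsilon> * (1 + \<bar>F n x\<bar> powr p))"
      using dominating K(2) by (intro integral_mono)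
    also have "\<dots> = K * (LINT x|M01. \<bar>F n x\<bar>) + \<epsilon> * (1 + (LINT x|M01. \<bar>F n x\<bar> powr p))"
      using int_F by simp
    also have "\<dots> < d / 2 + \<epsilon> * M"
      unfolding M_def using elim moment \<epsilon>(1) by (intro add_less_le_mono mult_left_mono) auto
    finally show ?case using \<epsilon>(2) by (simp add: dist_real_def)
  qed
qed

lemma L1null_duality_map:
  assumes pq: "conjugate_exponents p q" and F: "F \<in> L1null p U"
  shows "(\<lambda>n x. duality_map p (F n x)) \<in> L1null q U"
proof -
  have "1 < p" using conjugate_exponentsD(1)[OF pq] .
  then have "((\<lambda>n. LINT x|M01. \<bar>F n x\<bar> powr (p - 1)) \<longlongrightarrow> 0) U"
    using F by (intro L1null_powr) auto
  then show ?thesis using duality_map_UP[OF pq L1null_UP[OF F]] by (simp add: L1null_def abs_duality_map)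
qed

lemma unorm_L1null_eq_0:
  assumes pq: "conjugate_exponents p q" and F: "F \<in> L1null p U"
    and zero: "\<And>G. G \<in> L1null q U \<Longrightarrow> upair U F G = 0"
  shows "unorm p U F = 0"
  using upair_duality_map[OF pq L1null_UP[OF F]] zero[OF L1null_duality_map[OF pq F]] by simp

lemma eventually_diagonal:
  assumes "\<And>K. \<forall>\<^sub>F n in U. P K n"
  obtains k :: "nat \<Rightarrow> nat" where "\<And>K. \<forall>\<^sub>F n in U. K \<le> k n" "\<forall>\<^sub>F n in U. P (k n) n"
proof
  define A where "A n = {K. K \<le> n \<and> P K n}" for n
  define k where "k n = Max (A n)" for n
  have finite: "finite (A n)" for n by (rule finite_subset[of _ "{..n}"]) (auto simp: A_def)
  have mem: "\<forall>\<^sub>F n in U. K \<in> A n" for K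
    using assms[of K] U_gt[of K] by eventually_elim (simp add: A_def)
  show "\<forall>\<^sub>F n in U. K \<le> k n" for K
    using mem[of K] by eventually_elim (simp add: k_def finite)
  show "\<forall>\<^sub>F n in U. P (k n) n"
    using mem[of 0]
  proof eventually_elim
    case (elim n)
    then have "k n \<in> A n" unfolding k_def using finite by (intro Max_in) auto
    then show ?case by (simp add: A_def)
  qed
qed

lemma truncate_Lp: "f \<in> Lp p \<Longrightarrow> 0 \<le> p \<Longrightarrow> truncate K f \<in> Lp p"
  using Lp_measurable abs_truncate_le(2) by (intro Lp_mono[of "truncate K f" f]) auto

lemma truncate_UP:
  assumes F: "F \<in> UP p" and p: "0 < p"
  shows "(\<lambda>n. truncate (k n) (F n)) \<in> UP p"
proof -
  obtain C where "\<And>n. lpnorm p (F n) \<le> C" using UP_bound[OF F] by blast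
  moreover have "lpnorm p (truncate (k n) (F n)) \<le> lpnorm p (F n)" for n
    using Lp_measurable[OF UP_Lp[OF F]] abs_truncate_le(2) p by (intro lpnorm_mono UP_Lp[OF F]) auto
  ultimately show ?thesis
    using truncate_Lp[OF UP_Lp[OF F]] p by (intro UPI[where C = C]) (auto intro: order_trans)
qed

lemma lpnorm_truncate_diff:
  assumes f: "f \<in> Lp p" and p: "0 < p" and "K \<le> L"
  shows "lpnorm p (\<lambda>x. truncate L f x - truncate K f x) powr p
    = (LINT x|M01. \<bar>truncate L f x\<bar> powr p) - (LINT x|M01. \<bar>truncate K f x\<bar> powr p)"
proof -
  have "\<bar>truncate L f x - truncate K f x\<bar> powr p = \<bar>truncate L f x\<bar> powr p - \<bar>truncate K f x\<bar> powr p" for x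
    using \<open>K \<le> L\<close> by (auto simp: truncate_def)
  then show ?thesis using f p Lp_integrable_powr[OF truncate_Lp[OF f]] by (simp add: lpnorm_powr)
qed

definition truncated_moment :: "real \<Rightarrow> useq \<Rightarrow> nat \<Rightarrow> nat \<Rightarrow> real" where
  "truncated_moment p F K n = (LINT x|M01. \<bar>truncate (real K) (F n) x\<bar> powr p)"

lemma truncated_moment_mono:
  assumes F: "F \<in> UP p" and p: "0 < p" and "K \<le> L"
  shows "truncated_moment p F K n \<le> truncated_moment p F L n"
proof -
  have "\<bar>truncate (real K) (F n) x\<bar> powr p \<le> \<bar>truncate (real L) (F n) x\<bar> powr p" for x
    using \<open>K \<le> L\<close> by (simp add: truncate_def)
  then show ?thesis
    unfolding truncated_moment_def using p truncate_Lp[OF UP_Lp[OF F]]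
    by (intro integral_mono Lp_integrable_powr) auto
qed

lemma truncated_moment_bounded:
  assumes F: "F \<in> UP p" and p: "0 < p"
  obtains C where "\<And>K n. \<bar>truncated_moment p F K n\<bar> \<le> C"
proof -
  obtain C where C: "\<And>n. lpnorm p (F n) \<le> C" "0 \<le> C" using UP_bound[OF F] by blast
  have "truncated_moment p F K n \<le> C powr p" for K n
  proof -
    have "truncated_moment p F K n \<le> (LINT x|M01. \<bar>F n x\<bar> powr p)"
      unfolding truncated_moment_def using p truncate_Lp[OF UP_Lp[OF F]] UP_Lp[OF F] abs_truncate_le(2)
      by (intro integral_mono Lp_integrable_powr) (auto intro!: powr_mono2)
    also have "\<dots> \<le> C powr p" using C p lpnorm_le_iff by simp
    finally show ?thesis .
  qed
  then show thesis by (intro that[of "C powr p"]) (simp add: truncated_moment_def)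
qed

text \<open>The truncation levels $k_n$ tend to infinity along $U$ so slowly that the $p$-th moments of
  the truncations converge to the supremum over all fixed levels.\<close>
lemma truncation_levels:
  assumes p: "0 < p" and F: "F \<in> UP p"
  obtains k :: "nat \<Rightarrow> nat" where "\<And>K. \<forall>\<^sub>F n in U. K \<le> k n"
    "\<And>\<eta>. 0 < \<eta> \<Longrightarrow> \<exists>K. \<forall>\<^sub>F n in U. truncated_moment p F (k n) n - truncated_moment p F K n < \<eta>"
proof -
  let ?m = "truncated_moment p F"
  obtain C where C: "\<And>K n. \<bar>?m K n\<bar> \<le> C" using truncated_moment_bounded[OF F p] by blast
  define b where "b K = Lim U (?m K)" for K
  have b: "(?m K \<longlongrightarrow> b K) U" for K
    unfolding b_def using C by (rule bounded_tendsto_Lim)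
  have "incseq b"
    by (rule incseq_SucI, rule tendsto_le[OF U_ne_bot b b]) (simp add: truncated_moment_mono[OF F p])
  moreover have "b K \<le> C" for K
    using C by (intro tendsto_upperbound[OF b _ U_ne_bot]) (simp add: abs_le_iff)
  ultimately obtain B where B: "b \<longlonglongrightarrow> B" "\<And>K. b K \<le> B" using incseq_convergent by blast
  have close: "\<forall>\<^sub>F n in U. ?m K n < b K + 1 / (real K + 1)" for K
    using b[of K] by (rule order_tendstoD) simp
  obtain k where k: "\<And>K. \<forall>\<^sub>F n in U. K \<le> k n" "\<forall>\<^sub>F n in U. ?m (k n) n < b (k n) + 1 / (real (k n) + 1)"
    using eventually_diagonal[where P = "\<lambda>K n. ?m K n < b K + 1 / (real K + 1)", OF close] by blast
  have "\<exists>K. \<forall>\<^sub>F n in U. ?m (k n) n - ?m K n < \<eta>" if \<eta>: "0 < \<eta>" for \<eta>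
  proof -
    have "\<forall>\<^sub>F K in sequentially. B - \<eta> / 3 < b K" using B(1) \<eta> by (intro order_tendstoD) auto
    then obtain K where K: "B - \<eta> / 3 < b K" by (auto simp: eventually_sequentially)
    obtain L :: nat where "3 / \<eta> < real L" using reals_Archimedean2 by blast
    then have "3 / \<eta> < real l + 1" if "L \<le> l" for l using that by linarith
    then have L: "1 / (real l + 1) < \<eta> / 3" if "L \<le> l" for l using that \<eta> by (simp add: field_simps)
    have "\<forall>\<^sub>F n in U. b K - \<eta> / 3 < ?m K n" using b[of K] \<eta> by (intro order_tendstoD) auto
    with k(1)[of L] k(2) have "\<forall>\<^sub>F n in U. ?m (k n) n - ?m K n < \<eta>"
    proof eventually_elim
      case (elim n)
      then show ?case using L[of "k n"] B(2)[of "k n"] K by linarith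
    qed
    then show ?thesis by blast
  qed
  then show thesis using that k(1) by blast
qed

lemma abs_minus_truncate_le:
  assumes p: "1 \<le> p" and K: "0 < K" "K \<le> L"
  shows "\<bar>f x - truncate L f x\<bar> \<le> K powr (1 - p) * \<bar>f x\<bar> powr p"
proof (cases "\<bar>f x\<bar> \<le> L")
  case False
  then have fx: "K \<le> \<bar>f x\<bar>" "0 < \<bar>f x\<bar>" using K by auto
  have "\<bar>f x - truncate L f x\<bar> = \<bar>f x\<bar> powr (1 - p) * \<bar>f x\<bar> powr p"
    using False fx by (simp add: truncate_def powr_add[symmetric])
  also have "\<dots> \<le> K powr (1 - p) * \<bar>f x\<bar> powr p"
    using fx p K by (intro mult_right_mono powr_mono2') auto
  finally show ?thesis .
qed (simp add: truncate_def)

lemma L1null_truncation_tail: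
  assumes p: "1 < p" and F: "F \<in> UP p" and k: "\<And>K. \<forall>\<^sub>F n in U. K \<le> k n"
  shows "(\<lambda>n x. F n x - truncate (real (k n)) (F n) x) \<in> L1null p U" (is "?d \<in> _")
proof -
  obtain C where C: "\<And>n. lpnorm p (F n) \<le> C" "0 \<le> C" using UP_bound[OF F] by blast
  have d_UP: "?d \<in> UP p" using p by (intro UP_diff F truncate_UP) auto
  have "((\<lambda>n. LINT x|M01. \<bar>?d n x\<bar>) \<longlongrightarrow> 0) U"
  proof (rule tendstoI)
    fix \<delta> :: real assume "0 < \<delta>"
    have "(\<lambda>K. C powr p * real K powr (1 - p)) \<longlonglongrightarrow> 0"
      using p by (intro tendsto_mult_right_zero tendsto_neg_powr filterlim_real_sequentially) auto
    from order_tendstoD(2)[OF this \<open>0 < \<delta>\<close>] eventually_gt_at_top[of 0]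
    obtain K where K: "C powr p * real K powr (1 - p) < \<delta>" "0 < K"
      by (metis (mono_tags, lifting) eventually_conj eventually_happens' sequentially_bot)
    show "\<forall>\<^sub>F n in U. dist (LINT x|M01. \<bar>?d n x\<bar>) 0 < \<delta>"
      using k[of K]
    proof eventually_elim
      case (elim n)
      have "(LINT x|M01. \<bar>?d n x\<bar>) \<le> (LINT x|M01. real K powr (1 - p) * \<bar>F n x\<bar> powr p)"
        using abs_minus_truncate_le[of p "real K" "real (k n)" "F n"] elim K(2) p
          Lp_integrable[OF UP_Lp[OF d_UP] p] Lp_integrable_powr[OF UP_Lp[OF F]]
        by (intro integral_mono) auto
      also have "\<dots> \<le> real K powr (1 - p) * C powr p"
        using C p by (simp add: lpnorm_le_iff[symmetric] mult_left_mono)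
      finally show ?case using K(1) by (simp add: dist_real_def mult.commute)
    qed
  qed
  then show ?thesis using d_UP by (simp add: L1null_def)
qed

theorem subsequence_splitting:
  assumes p: "1 < p" and F: "F \<in> UP p"
  obtains d e where "d \<in> L1null p U" "e \<in> equiintegrable p U" "F = (\<lambda>n x. d n x + e n x)"
proof -
  have p_pos: "0 < p" using p by simp
  obtain k :: "nat \<Rightarrow> nat" where k: "\<And>K. \<forall>\<^sub>F n in U. K \<le> k n"
    and moments: "\<And>\<eta>. 0 < \<eta> \<Longrightarrow> \<exists>K. \<forall>\<^sub>F n in U. truncated_moment p F (k n) n - truncated_moment p F K n < \<eta>"
    using truncation_levels[OF p_pos F] by blast
  define e where "e n = truncate (real (k n)) (F n)" for n
  have e_UP: "e \<in> UP p" unfolding e_def using p by (intro truncate_UP F) simp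
  have "\<exists>H\<in>bounded_seqs. unorm p U (\<lambda>n x. e n x - H n x) < \<epsilon>" if \<epsilon>: "0 < \<epsilon>" for \<epsilon>
  proof -
    obtain K where K: "\<forall>\<^sub>F n in U. truncated_moment p F (k n) n - truncated_moment p F K n < (\<epsilon> / 2) powr p"
      using moments[of "(\<epsilon> / 2) powr p"] \<epsilon> by auto
    define H where "H n = truncate (real K) (F n)" for n
    have H: "H \<in> bounded_seqs"
      unfolding H_def using Lp_measurable[OF UP_Lp[OF F]] abs_truncate_le(1)
      by (intro bounded_seqsI[where K = "real K"]) auto
    have "\<forall>\<^sub>F n in U. lpnorm p (\<lambda>x. e n x - H n x) \<le> \<epsilon> / 2"
      using K k[of K]
    proof eventually_elim
      case (elim n)
      then have "lpnorm p (\<lambda>x. e n x - H n x) powr p \<le> (\<epsilon> / 2) powr p"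
        using lpnorm_truncate_diff[OF UP_Lp[OF F]] p by (simp add: e_def H_def truncated_moment_def)
      then show ?case using p \<epsilon> lpnorm_le_iff[of p "\<epsilon> / 2"] by (simp add: lpnorm_powr)
    qed
    then have "unorm p U (\<lambda>n x. e n x - H n x) \<le> \<epsilon> / 2"
      using p by (intro unorm_le UP_diff e_UP bounded_seqs_UP[OF H]) auto
    then show ?thesis using H \<epsilon> by (intro bexI[of _ H]) auto
  qed
  then have "e \<in> equiintegrable p U" using e_UP by (simp add: equiintegrable_def)
  with L1null_truncation_tail[OF p F k] show thesis by (rule that) (simp add: e_def)
qed

lemma equiintegrable_annihilates_L1null:
  assumes pq: "conjugate_exponents p q" and e: "e \<in> equiintegrable p U" and G: "G \<in> L1null q U"
  shows "upair U e G = 0"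
proof (rule upair_eq_0_if_approx[OF pq _ L1null_UP[OF G]])
  note p = conjugate_exponentsD(1)[OF pq] and q = conjugate_exponentsD(2)[OF pq]
  show "e \<in> UP p" using e by (simp add: equiintegrable_def)
  fix \<epsilon> :: real assume "0 < \<epsilon>"
  then obtain H where H: "H \<in> bounded_seqs" "unorm p U (\<lambda>n x. e n x - H n x) < \<epsilon>"
    using e by (auto simp: equiintegrable_def)
  then show "\<exists>H\<in>UP p. upair U H G = 0 \<and> unorm p U (\<lambda>n x. e n x - H n x) < \<epsilon>"
    using L1null_upair_bounded[OF q G H(1)] p bounded_seqs_UP[OF H(1)]
    by (intro bexI[of _ H]) (auto simp: upair_commute[of U H])
qed

theorem annihilator_L1null:
  assumes pq: "conjugate_exponents p q"
  shows "annihilator p U (L1null q U) = equiintegrable p U"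
proof (intro equalityI subsetI)
  have p: "1 < p" "1 \<le> p" using conjugate_exponentsD(1)[OF pq] by auto
  fix F assume F: "F \<in> annihilator p U (L1null q U)"
  then have F_UP: "F \<in> UP p" by (simp add: annihilator_def)
  obtain d e where d: "d \<in> L1null p U" and e: "e \<in> equiintegrable p U" and split: "F = (\<lambda>n x. d n x + e n x)"
    using subsequence_splitting[OF p(1) F_UP] .
  have e_UP: "e \<in> UP p" using e by (simp add: equiintegrable_def)
  have "upair U d G = 0" if G: "G \<in> L1null q U" for G
    using upair_add_left[OF pq L1null_UP[OF d] e_UP L1null_UP[OF G]] annihilatorD[OF F G]
      equiintegrable_annihilates_L1null[OF pq e G] split by simp
  then have null: "unorm p U (\<lambda>n x. F n x - e n x) = 0"
    using unorm_L1null_eq_0[OF pq d] split by simp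
  have "\<exists>H\<in>bounded_seqs. unorm p U (\<lambda>n x. F n x - H n x) < \<epsilon>" if "0 < \<epsilon>" for \<epsilon>
  proof -
    obtain H where H: "H \<in> bounded_seqs" "unorm p U (\<lambda>n x. e n x - H n x) < \<epsilon>"
      using e \<open>0 < \<epsilon>\<close> by (auto simp: equiintegrable_def)
    have "H \<in> UP p" using p by (intro bounded_seqs_UP[OF H(1)]) simp
    then have "unorm p U (\<lambda>n x. F n x - H n x) < \<epsilon>"
      using unorm_diff_trans[OF F_UP e_UP _ p(2), of H] null H(2) by simp
    then show ?thesis using H(1) by blast
  qed
  then show "F \<in> equiintegrable p U" using F_UP by (simp add: equiintegrable_def)
next
  fix e assume "e \<in> equiintegrable p U"
  then show "e \<in> annihilator p U (L1null q U)"
    using equiintegrable_annihilates_L1null[OF pq] by (simp add: annihilator_def equiintegrable_def)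
qed

end

section \<open>Operators\<close>

lemma bop_Lp_Lp: "bop_Lp p T \<Longrightarrow> f \<in> Lp p \<Longrightarrow> T f \<in> Lp p"
  unfolding bop_Lp_def by blast

lemma bop_Lp_lin_AE:
  "bop_Lp p T \<Longrightarrow> f \<in> Lp p \<Longrightarrow> g \<in> Lp p \<Longrightarrow> AE x in M01. T (\<lambda>y. a * f y + b * g y) x = a * T f x + b * T g x"
  unfolding bop_Lp_def by blast

lemma bop_Lp_cong_AE:
  "bop_Lp p T \<Longrightarrow> f \<in> Lp p \<Longrightarrow> g \<in> Lp p \<Longrightarrow> AE x in M01. f x = g x \<Longrightarrow> AE x in M01. T f x = T g x"
  unfolding bop_Lp_def by blast

lemma bop_Lp_bound:
  assumes T: "bop_Lp p T"
  obtains C where "0 \<le> C" "\<And>f. f \<in> Lp p \<Longrightarrow> lpnorm p (T f) \<le> C * lpnorm p f"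
proof -
  obtain C where C: "\<forall>f\<in>Lp p. lpnorm p (T f) \<le> C * lpnorm p f" using T unfolding bop_Lp_def by blast
  have "lpnorm p (T f) \<le> \<bar>C\<bar> * lpnorm p f" if "f \<in> Lp p" for f
    using C that mult_right_mono[OF abs_ge_self lpnorm_nonneg, of C p f] by fastforce
  then show thesis by (intro that[of "\<bar>C\<bar>"]) auto
qed

lemma bop_Lp_sum_AE:
  assumes T: "bop_Lp p T" and p: "0 \<le> p" and s: "finite s" and f: "\<And>i. i \<in> s \<Longrightarrow> f i \<in> Lp p"
  shows "AE x in M01. T (\<lambda>y. \<Sum>i\<in>s. f i y) x = (\<Sum>i\<in>s. T (f i) x)"
  using s f
proof (induction s rule: finite_induct)
  case empty
  have zero: "(\<lambda>y. 0) \<in> Lp p" using p by simp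
  have "AE x in M01. T (\<lambda>y. 0 * 0 + 0 * 0) x = 0 * T (\<lambda>y. 0) x + 0 * T (\<lambda>y. 0) x"
    by (rule bop_Lp_lin_AE[OF T zero zero])
  then show ?case by simp
next
  case (insert i s)
  have "AE x in M01. T (\<lambda>y. 1 * f i y + 1 * (\<Sum>i\<in>s. f i y)) x = 1 * T (f i) x + 1 * T (\<lambda>y. \<Sum>i\<in>s. f i y) x"
    using insert p by (intro bop_Lp_lin_AE[OF T] Lp_sum) auto
  moreover have "AE x in M01. T (\<lambda>y. \<Sum>i\<in>s. f i y) x = (\<Sum>i\<in>s. T (f i) x)" using insert by auto
  ultimately show ?case by eventually_elim (simp add: insert(1,2))
qed

lemma bop_Lp_add:
  assumes S: "bop_Lp p S" and T: "bop_Lp p T" and p: "1 \<le> p"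
  shows "bop_Lp p (\<lambda>f x. S f x + T f x)"
  unfolding bop_Lp_def
proof (intro conjI ballI allI impI)
  show "(\<lambda>x. S f x + T f x) \<in> Lp p" if "f \<in> Lp p" for f
    using that p by (intro Lp_add bop_Lp_Lp[OF S] bop_Lp_Lp[OF T]) auto
  show "AE x in M01. S (\<lambda>y. a * f y + b * g y) x + T (\<lambda>y. a * f y + b * g y) x
      = a * (S f x + T f x) + b * (S g x + T g x)" if "f \<in> Lp p" "g \<in> Lp p" for f g a b
    using bop_Lp_lin_AE[OF S that, of a b] bop_Lp_lin_AE[OF T that, of a b]
    by eventually_elim (simp add: distrib_left)
  show "AE x in M01. S f x + T f x = S g x + T g x" if "f \<in> Lp p" "g \<in> Lp p" "AE x in M01. f x = g x" for f g
    using bop_Lp_cong_AE[OF S that] bop_Lp_cong_AE[OF T that] by eventually_elim simp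
  obtain C where C: "\<And>f. f \<in> Lp p \<Longrightarrow> lpnorm p (S f) \<le> C * lpnorm p f" using bop_Lp_bound[OF S] by blast
  obtain D where D: "\<And>f. f \<in> Lp p \<Longrightarrow> lpnorm p (T f) \<le> D * lpnorm p f" using bop_Lp_bound[OF T] by blast
  have "lpnorm p (\<lambda>x. S f x + T f x) \<le> (C + D) * lpnorm p f" if f: "f \<in> Lp p" for f
    using lpnorm_triangle[OF bop_Lp_Lp[OF S f] bop_Lp_Lp[OF T f] p] C[OF f] D[OF f]
    by (simp add: distrib_right)
  then show "\<exists>C. \<forall>f\<in>Lp p. lpnorm p (\<lambda>x. S f x + T f x) \<le> C * lpnorm p f" by blast
qed

lemma bop_Lp_zero: "1 \<le> p \<Longrightarrow> bop_Lp p (\<lambda>f x. 0)"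
  unfolding bop_Lp_def by (auto intro!: exI[of _ 0])

lemma dual_Lp_comp:
  assumes \<phi>: "dual_Lp p \<phi>" and T: "bop_Lp p T" and p: "1 \<le> p"
  shows "dual_Lp p (\<lambda>f. \<phi> (T f))"
  unfolding dual_Lp_def
proof (intro conjI ballI allI)
  fix f g a b assume fg: "f \<in> Lp p" "g \<in> Lp p"
  have "\<phi> (T (\<lambda>y. a * f y + b * g y)) = \<phi> (\<lambda>y. a * T f y + b * T g y)"
    using fg p by (intro dual_Lp_cong_AE[OF \<phi>] bop_Lp_Lp[OF T] Lp_lin bop_Lp_lin_AE[OF T]) auto
  also have "\<dots> = a * \<phi> (T f) + b * \<phi> (T g)" using fg by (intro dual_Lp_lin[OF \<phi>] bop_Lp_Lp[OF T])
  finally show "\<phi> (T (\<lambda>y. a * f y + b * g y)) = a * \<phi> (T f) + b * \<phi> (T g)" .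
next
  obtain C where C: "0 \<le> C" "\<And>f. f \<in> Lp p \<Longrightarrow> lpnorm p (T f) \<le> C * lpnorm p f" using bop_Lp_bound[OF T] by blast
  obtain D where D: "0 \<le> D" "\<And>f. f \<in> Lp p \<Longrightarrow> \<bar>\<phi> f\<bar> \<le> D * lpnorm p f" using dual_Lp_bound[OF \<phi>] by blast
  have "\<bar>\<phi> (T f)\<bar> \<le> (D * C) * lpnorm p f" if f: "f \<in> Lp p" for f
    using D(2)[OF bop_Lp_Lp[OF T f]] mult_left_mono[OF C(2)[OF f] D(1)] by (simp add: mult.assoc)
  then show "\<exists>C. \<forall>f\<in>Lp p. \<bar>\<phi> (T f)\<bar> \<le> C * lpnorm p f" by blast
qed

lemma bop_Lp_rank_one:
  assumes pq: "conjugate_exponents p q" and g: "g \<in> Lp q" and h: "h \<in> Lp p"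
  shows "bop_Lp p (\<lambda>f x. (LINT y|M01. f y * g y) * h x)"
  unfolding bop_Lp_def
proof (intro conjI ballI allI impI)
  have p: "0 < p" using conjugate_exponentsD(1)[OF pq] by simp
  show "(\<lambda>x. (LINT y|M01. f y * g y) * h x) \<in> Lp p" for f using h by (rule Lp_scale)
  show "AE x in M01. (LINT y|M01. (a * f y + b * k y) * g y) * h x
    = a * ((LINT y|M01. f y * g y) * h x) + b * ((LINT y|M01. k y * g y) * h x)"
    if "f \<in> Lp p" "k \<in> Lp p" for f k a b
    using Lp_mult_integrable[OF pq that(1) g] Lp_mult_integrable[OF pq that(2) g]
    by (simp add: distrib_right mult.assoc)
  show "AE x in M01. (LINT y|M01. f y * g y) * h x = (LINT y|M01. k y * g y) * h x"
    if "f \<in> Lp p" "k \<in> Lp p" "AE x in M01. f x = k x" for f k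
  proof -
    note [measurable] = Lp_measurable[OF that(1)] Lp_measurable[OF that(2)] Lp_measurable[OF g]
    have "(LINT y|M01. f y * g y) = (LINT y|M01. k y * g y)"
      using that(3) by (intro integral_cong_AE) auto
    then show ?thesis by simp
  qed
  have "lpnorm p (\<lambda>x. (LINT y|M01. f y * g y) * h x) \<le> (lpnorm q g * lpnorm p h) * lpnorm p f"
    if f: "f \<in> Lp p" for f
    using mult_right_mono[OF Holder_inequality[OF pq f g] lpnorm_nonneg[of p h]] unfolding lpnorm_scale[OF p]
    by (simp add: mult_ac)
  then show "\<exists>C. \<forall>f\<in>Lp p. lpnorm p (\<lambda>x. (LINT y|M01. f y * g y) * h x) \<le> C * lpnorm p f" by blast
qed

context ultrapower
begin

lemma ultra_op_UP:
  assumes T: "bop_Lp p T" and F: "F \<in> UP p"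
  shows "ultra_op T F \<in> UP p"
proof -
  obtain C where C: "0 \<le> C" "\<And>f. f \<in> Lp p \<Longrightarrow> lpnorm p (T f) \<le> C * lpnorm p f" using bop_Lp_bound[OF T] by blast
  obtain D where D: "\<And>n. lpnorm p (F n) \<le> D" using UP_bound[OF F] by blast
  show ?thesis unfolding ultra_op_def
  proof (rule UPI)
    show "T (F n) \<in> Lp p" for n by (intro bop_Lp_Lp[OF T] UP_Lp F)
    show "lpnorm p (T (F n)) \<le> C * D" for n
      using C(2)[OF UP_Lp[OF F]] mult_left_mono[OF D C(1)] by (rule order_trans)
  qed
qed

lemma unorm_ultra_op_le:
  assumes T: "bop_Lp p T"
  obtains C where "0 \<le> C" "\<And>F. F \<in> UP p \<Longrightarrow> unorm p U (ultra_op T F) \<le> C * unorm p U F"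
proof -
  obtain C where C: "0 \<le> C" "\<And>f. f \<in> Lp p \<Longrightarrow> lpnorm p (T f) \<le> C * lpnorm p f" using bop_Lp_bound[OF T] by blast
  have "unorm p U (ultra_op T F) \<le> C * unorm p U F" if F: "F \<in> UP p" for F
  proof (rule tendsto_le[OF U_ne_bot])
    show "((\<lambda>n. C * lpnorm p (F n)) \<longlongrightarrow> C * unorm p U F) U" by (intro tendsto_intros unorm_tendsto F)
    show "((\<lambda>n. lpnorm p (ultra_op T F n)) \<longlongrightarrow> unorm p U (ultra_op T F)) U"
      by (intro unorm_tendsto ultra_op_UP T F)
    show "\<forall>\<^sub>F n in U. lpnorm p (ultra_op T F n) \<le> C * lpnorm p (F n)"
      using C(2)[OF UP_Lp[OF F]] by (simp add: ultra_op_def)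
  qed
  then show thesis using that C(1) by blast
qed

lemma ultra_op_lin:
  assumes T: "bop_Lp p T" and F: "F \<in> UP p" and G: "G \<in> UP p" and p: "1 \<le> p"
  shows "UP_eq p U (ultra_op T (\<lambda>n x. a * F n x + b * G n x))
    (\<lambda>n x. a * ultra_op T F n x + b * ultra_op T G n x)"
    (is "UP_eq p U ?L ?R")
proof -
  have U: "?L \<in> UP p" "?R \<in> UP p" using T F G p by (auto intro!: ultra_op_UP UP_lin)
  have "lpnorm p (\<lambda>x. ?L n x - ?R n x) = 0" for n
    using bop_Lp_lin_AE[OF T UP_Lp[OF F, of n] UP_Lp[OF G, of n], of a b]
      Lp_diff[OF UP_Lp[OF U(1), of n] UP_Lp[OF U(2), of n]] p
    by (subst lpnorm_eq_0_iff) (auto simp: ultra_op_def)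
  then show ?thesis using U unfolding UP_eq_def unorm_def by (simp add: LimI)
qed

lemma unorm_ultra_op_diff:
  assumes T: "bop_Lp p T" and F: "F \<in> UP p" and G: "G \<in> UP p" and p: "1 \<le> p"
  shows "unorm p U (\<lambda>n x. ultra_op T F n x - ultra_op T G n x) = unorm p U (ultra_op T (\<lambda>n x. F n x - G n x))"
  using UP_eq_unorm[OF p ultra_op_lin[OF T F G p, of 1 "-1"]] by simp

lemma bop_U_ultra_op:
  assumes T: "bop_Lp p T" and p: "1 \<le> p"
  shows "bop_U p U (ultra_op T)"
  unfolding bop_U_def
proof (intro conjI ballI allI impI)
  obtain C where C: "0 \<le> C" "\<And>F. F \<in> UP p \<Longrightarrow> unorm p U (ultra_op T F) \<le> C * unorm p U F"
    using unorm_ultra_op_le[OF T] by blast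
  then show "\<exists>C. \<forall>F\<in>UP p. unorm p U (ultra_op T F) \<le> C * unorm p U F" by blast
  show "ultra_op T F \<in> UP p" if "F \<in> UP p" for F by (intro ultra_op_UP T that)
  show "ueq p U (ultra_op T F) (ultra_op T G)" if FG: "F \<in> UP p" "G \<in> UP p" "ueq p U F G" for F G
  proof -
    note diff = UP_diff[OF FG(1,2) p]
    have "unorm p U (\<lambda>n x. F n x - G n x) = 0" using FG p by (simp add: ueq_iff)
    then have "unorm p U (ultra_op T (\<lambda>n x. F n x - G n x)) \<le> 0" using C(2)[OF diff] by simp
    then show ?thesis
      using unorm_ultra_op_diff[OF T FG(1,2) p] unorm_nonneg[OF ultra_op_UP[OF T diff]] FG p T
      by (simp add: ueq_iff ultra_op_UP)
  qed
  show "ueq p U (ultra_op T (\<lambda>n x. a * F n x + b * G n x)) (\<lambda>n x. a * ultra_op T F n x + b * ultra_op T G n x)"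
    if FG: "F \<in> UP p" "G \<in> UP p" for F G a b
    using ultra_op_lin[OF T FG p] ultra_op_UP[OF T] FG p by (subst UP_eq_ueq[symmetric]) (auto intro!: UP_lin)
qed

lemma bop_U_UP: "bop_U p U S \<Longrightarrow> F \<in> UP p \<Longrightarrow> S F \<in> UP p"
  unfolding bop_U_def by blast

lemma bop_U_cong:
  assumes S: "bop_U p U S" and p: "1 \<le> p" and eq: "UP_eq p U F G"
  shows "UP_eq p U (S F) (S G)"
proof -
  have FG: "F \<in> UP p" "G \<in> UP p" using eq by (auto simp: UP_eq_def)
  then have "ueq p U F G" using eq p UP_eq_ueq by blast
  then have "ueq p U (S F) (S G)" using S FG unfolding bop_U_def by blast
  then show ?thesis using bop_U_UP[OF S] FG p UP_eq_ueq by blast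
qed

lemma bop_U_lin:
  assumes S: "bop_U p U S" and p: "1 \<le> p" and FG: "F \<in> UP p" "G \<in> UP p"
  shows "UP_eq p U (S (\<lambda>n x. a * F n x + b * G n x)) (\<lambda>n x. a * S F n x + b * S G n x)"
proof -
  have "ueq p U (S (\<lambda>n x. a * F n x + b * G n x)) (\<lambda>n x. a * S F n x + b * S G n x)"
    using S FG unfolding bop_U_def by blast
  then show ?thesis using FG p bop_U_UP[OF S] by (subst UP_eq_ueq) (auto intro!: UP_lin)
qed

lemma bop_U_sum:
  assumes S: "bop_U p U S" and p: "1 \<le> p" and F: "\<And>i. i \<in> s \<Longrightarrow> F i \<in> UP p" and s: "finite s"
  shows "UP_eq p U (S (\<lambda>n x. \<Sum>i\<in>s. c i * F i n x)) (\<lambda>n x. \<Sum>i\<in>s. c i * S (F i) n x)"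
  using s F
proof (induction s rule: finite_induct)
  case empty
  have "UP_eq p U (S (\<lambda>n x. 0 * 0 + 0 * 0)) (\<lambda>n x. 0 * S (\<lambda>n x. 0) n x + 0 * S (\<lambda>n x. 0) n x)"
    using p by (intro bop_U_lin[OF S p] UP_zero)
  then show ?case by simp
next
  case (insert i s)
  have "UP_eq p U (S (\<lambda>n x. c i * F i n x + 1 * (\<Sum>i\<in>s. c i * F i n x)))
    (\<lambda>n x. c i * S (F i) n x + 1 * S (\<lambda>n x. \<Sum>i\<in>s. c i * F i n x) n x)"
    using insert p by (intro bop_U_lin[OF S p] UP_sum UP_scale) auto
  moreover have "UP_eq p U (\<lambda>n x. c i * S (F i) n x + 1 * S (\<lambda>n x. \<Sum>i\<in>s. c i * F i n x) n x)
    (\<lambda>n x. c i * S (F i) n x + 1 * (\<Sum>i\<in>s. c i * S (F i) n x))"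
    using insert by (intro UP_eq_lin p UP_eq_refl bop_U_UP[OF S]) auto
  ultimately have "UP_eq p U (S (\<lambda>n x. c i * F i n x + 1 * (\<Sum>i\<in>s. c i * F i n x)))
    (\<lambda>n x. c i * S (F i) n x + 1 * (\<Sum>i\<in>s. c i * S (F i) n x))"
    by (rule UP_eq_trans[OF p])
  then show ?case using insert by simp
qed

lemma ultra_op_Lhat:
  assumes T: "bop_Lp p T" and p: "1 \<le> p" and F: "F \<in> Lhat p U"
  shows "ultra_op T F \<in> Lhat p U"
  using dual_Lp_comp[OF _ T p] ultra_op_UP[OF T Lhat_UP[OF F]] F
  unfolding Lhat_def ultra_op_def by blast

lemma ultra_op_LpC:
  assumes T: "bop_Lp p T" and p: "1 \<le> p" and F: "F \<in> LpC p U"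
  shows "ultra_op T F \<in> LpC p U"
proof -
  obtain f where f: "f \<in> Lp p" "ueq p U F (\<lambda>n. f)" "F \<in> UP p" using F by (auto simp: LpC_def)
  have "ueq p U (ultra_op T F) (ultra_op T (\<lambda>n. f))"
    using bop_U_ultra_op[OF T p] f UP_const[OF f(1)] unfolding bop_U_def by blast
  then show ?thesis
    unfolding LpC_def using ultra_op_UP[OF T f(3)] bop_Lp_Lp[OF T f(1)] by (auto simp: ultra_op_def)
qed

end

section \<open>Upper estimates for weakly null sequences\<close>

lemma powr_le_two_powr:
  fixes x a q :: real
  assumes x: "1 / 2 \<le> x" "x \<le> 2" and a: "\<bar>a\<bar> \<le> q"
  shows "x powr a \<le> 2 powr q"
proof (cases "0 \<le> a")
  case True
  then have "x powr a \<le> 2 powr a" using x by (intro powr_mono2) auto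
  also have "\<dots> \<le> 2 powr q" using a by (intro powr_mono) auto
  finally show ?thesis .
next
  case False
  then have "x powr a \<le> (1 / 2) powr a" using x by (intro powr_mono2') auto
  also have "\<dots> = 2 powr (- a)" by (simp add: powr_divide powr_minus_divide)
  also have "\<dots> \<le> 2 powr q" using a by (intro powr_mono) auto
  finally show ?thesis .
qed

lemma powr_second_order_le:
  fixes t q :: real
  assumes q: "1 < q" and t: "\<bar>t\<bar> \<le> 1 / 2"
  shows "(1 + t) powr q \<le> 1 + q * t + q * q * 2 powr q * t\<^sup>2"
proof (cases "t = 0")
  case False
  define diff where "diff m x = (if m = 0 then x powr q
    else if m = 1 then q * x powr (q - 1) else q * (q - 1) * x powr (q - 2))" for m :: nat and x :: real
  have diff: "diff 0 = (\<lambda>x. x powr q)" "diff (Suc 0) = (\<lambda>x. q * x powr (q - 1))"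
    "diff 2 = (\<lambda>x. q * (q - 1) * x powr (q - 2))"
    by (auto simp: diff_def)
  have "\<exists>\<xi>. (if 1 + t < 1 then 1 + t < \<xi> \<and> \<xi> < 1 else 1 < \<xi> \<and> \<xi> < 1 + t) \<and>
      (1 + t) powr q = (\<Sum>m<2. (diff m 1 / fact m) * (1 + t - 1) ^ m) + (diff 2 \<xi> / fact 2) * (1 + t - 1) ^ 2"
  proof (rule Taylor[where a = "1 / 2" and b = "3 / 2"])
    show "\<forall>m x. m < 2 \<and> 1 / 2 \<le> x \<and> x \<le> 3 / 2 \<longrightarrow> DERIV (diff m) x :> diff (Suc m) x"
      by (auto simp: less_2_cases_iff diff numeral_2_eq_2[symmetric] intro!: derivative_eq_intros)
  qed (use t False in \<open>auto simp: diff_def\<close>)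
  then obtain \<xi> where between: "if 1 + t < 1 then 1 + t < \<xi> \<and> \<xi> < 1 else 1 < \<xi> \<and> \<xi> < 1 + t"
    and Taylor: "(1 + t) powr q
        = (\<Sum>m<2. (diff m 1 / fact m) * (1 + t - 1) ^ m) + (diff 2 \<xi> / fact 2) * (1 + t - 1) ^ 2"
    by blast
  have expansion: "(1 + t) powr q = 1 + q * t + q * (q - 1) * \<xi> powr (q - 2) / 2 * t\<^sup>2"
    unfolding Taylor by (simp add: diff_def numeral_2_eq_2)
  have "1 / 2 \<le> \<xi>" "\<xi> \<le> 2" using between t by (auto split: if_splits)
  then have "\<xi> powr (q - 2) \<le> 2 powr q" using q by (intro powr_le_two_powr) auto
  then have "q * (q - 1) / 2 * \<xi> powr (q - 2) \<le> q * q * 2 powr q"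
    using q by (intro mult_mono) auto
  then have "q * (q - 1) * \<xi> powr (q - 2) / 2 * t\<^sup>2 \<le> q * q * 2 powr q * t\<^sup>2"
    by (intro mult_right_mono) auto
  then show ?thesis unfolding expansion by linarith
qed simp

lemma abs_one_add_powr_le:
  fixes q r :: real
  assumes q: "1 < q" and r: "0 < r" "r \<le> 2"
  obtains C where "1 \<le> C" "\<And>t. \<bar>1 + t\<bar> powr q \<le> 1 + q * t + C * (\<bar>t\<bar> powr r + \<bar>t\<bar> powr q)"
proof
  define C where "C = q * q * 2 powr q + (3 powr q + q * 2 powr q)"
  have summands: "0 \<le> q * q * 2 powr q" "0 \<le> q * 2 powr q" using q by auto
  moreover have "1 \<le> (3 :: real) powr q" using q by (intro ge_one_powr_ge_zero) auto
  ultimately show "1 \<le> C" unfolding C_def by linarith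
  fix t :: real
  show "\<bar>1 + t\<bar> powr q \<le> 1 + q * t + C * (\<bar>t\<bar> powr r + \<bar>t\<bar> powr q)"
  proof (cases "\<bar>t\<bar> \<le> 1 / 2")
    case True
    have "t\<^sup>2 = \<bar>t\<bar> powr 2" by simp
    also have "\<dots> \<le> \<bar>t\<bar> powr r" using True r by (intro powr_mono') auto
    finally have "q * q * 2 powr q * t\<^sup>2 \<le> C * (\<bar>t\<bar> powr r + \<bar>t\<bar> powr q)"
      using summands by (intro mult_mono) (auto simp: C_def intro: add_increasing2)
    then show ?thesis using powr_second_order_le[OF q True] True by simp
  next
    case False
    then have t: "0 < \<bar>t\<bar>" by simp
    have "\<bar>1 + t\<bar> powr q \<le> (3 * \<bar>t\<bar>) powr q" using False q by (intro powr_mono2) auto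
    then have growth: "\<bar>1 + t\<bar> powr q \<le> 3 powr q * \<bar>t\<bar> powr q" by (simp add: powr_mult)
    have "\<bar>t\<bar> = \<bar>t\<bar> powr (1 - q) * \<bar>t\<bar> powr q" using t by (simp add: powr_add[symmetric])
    also have "\<dots> \<le> (1 / 2) powr (1 - q) * \<bar>t\<bar> powr q"
      using False q by (intro mult_right_mono powr_mono2') auto
    also have "(1 / 2) powr (1 - q) = 2 powr (q - 1)" by (simp add: powr_divide powr_minus_divide[symmetric])
    also have "\<dots> * \<bar>t\<bar> powr q \<le> 2 powr q * \<bar>t\<bar> powr q" by (intro mult_right_mono powr_mono) auto
    finally have "q * \<bar>t\<bar> \<le> q * 2 powr q * \<bar>t\<bar> powr q" using q by (simp add: mult_left_mono mult.assoc)
    moreover have "- (q * t) \<le> q * \<bar>t\<bar>" using mult_left_mono[of "- t" "\<bar>t\<bar>" q] q by simp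
    ultimately have "\<bar>1 + t\<bar> powr q \<le> 1 + q * t + (3 powr q + q * 2 powr q) * \<bar>t\<bar> powr q"
      using growth by (simp add: distrib_right)
    also have "\<dots> \<le> 1 + q * t + C * (\<bar>t\<bar> powr r + \<bar>t\<bar> powr q)"
      using summands by (intro add_left_mono mult_mono) (auto simp: C_def)
    finally show ?thesis .
  qed
qed

lemma abs_add_powr_le_duality_map:
  fixes q r :: real
  assumes q: "1 < q" and r: "0 < r" "r \<le> 2"
  obtains C where "0 \<le> C"
    "\<And>x y. \<bar>x + y\<bar> powr q
      \<le> \<bar>x\<bar> powr q + q * (duality_map q x * y) + C * (\<bar>x\<bar> powr (q - r) * \<bar>y\<bar> powr r + \<bar>y\<bar> powr q)"
proof -
  obtain C where C: "1 \<le> C" "\<And>t. \<bar>1 + t\<bar> powr q \<le> 1 + q * t + C * (\<bar>t\<bar> powr r + \<bar>t\<bar> powr q)"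
    using abs_one_add_powr_le[OF assms] by blast
  have "\<bar>x + y\<bar> powr q
    \<le> \<bar>x\<bar> powr q + q * (duality_map q x * y) + C * (\<bar>x\<bar> powr (q - r) * \<bar>y\<bar> powr r + \<bar>y\<bar> powr q)" for x y
  proof (cases "x = 0")
    case True
    then show ?thesis using C(1) mult_right_mono[of 1 C "\<bar>y\<bar> powr q"] by (simp add: duality_map_def)
  next
    case False
    define t where "t = y / x"
    have y: "y = x * t" using False by (simp add: t_def)
    have "\<bar>x + y\<bar> powr q = \<bar>x\<bar> powr q * \<bar>1 + t\<bar> powr q"
      by (simp add: y powr_mult[symmetric] abs_mult[symmetric] distrib_left)
    also have "\<dots> \<le> \<bar>x\<bar> powr q * (1 + q * t + C * (\<bar>t\<bar> powr r + \<bar>t\<bar> powr q))"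
      using C(2) by (intro mult_left_mono) auto
    also have "\<dots> = \<bar>x\<bar> powr q + q * (\<bar>x\<bar> powr q * t) + C * (\<bar>x\<bar> powr q * \<bar>t\<bar> powr r + \<bar>x\<bar> powr q * \<bar>t\<bar> powr q)"
      by (simp add: algebra_simps)
    also have "\<bar>x\<bar> powr q * t = duality_map q x * y" by (simp add: y mult_duality_map[symmetric] mult_ac)
    also have "\<bar>x\<bar> powr q * \<bar>t\<bar> powr r = \<bar>x\<bar> powr (q - r) * \<bar>y\<bar> powr r"
      using False by (simp add: y abs_mult powr_mult powr_diff)
    also have "\<bar>x\<bar> powr q * \<bar>t\<bar> powr q = \<bar>y\<bar> powr q" by (simp add: y abs_mult powr_mult)
    finally show ?thesis .
  qed
  then show thesis using that[of C] C(1) by simp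
qed

lemma powr_superadditive:
  fixes x y t :: real
  assumes "0 \<le> x" "0 \<le> y" "1 \<le> t"
  shows "x powr t + y powr t \<le> (x + y) powr t"
proof -
  have "x powr t = x * x powr (t - 1)" "y powr t = y * y powr (t - 1)"
    "(x + y) powr t = (x + y) * (x + y) powr (t - 1)"
    using powr_mult_base[of x "t - 1"] powr_mult_base[of y "t - 1"] powr_mult_base[of "x + y" "t - 1"] assms
    by auto
  moreover have "x * x powr (t - 1) \<le> x * (x + y) powr (t - 1)"
    "y * y powr (t - 1) \<le> y * (x + y) powr (t - 1)"
    using assms by (auto intro!: mult_left_mono powr_mono2)
  ultimately show ?thesis by (simp add: distrib_right)
qed

lemma powr_add_ge:
  fixes x y t :: real
  assumes "0 \<le> x" "0 \<le> y" "1 \<le> t"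
  shows "x powr t + y * x powr (t - 1) \<le> (x + y) powr t"
proof -
  have "x powr t = x * x powr (t - 1)" "(x + y) powr t = (x + y) * (x + y) powr (t - 1)"
    using powr_mult_base[of x "t - 1"] powr_mult_base[of "x + y" "t - 1"] assms by auto
  moreover have "(x + y) * x powr (t - 1) \<le> (x + y) * (x + y) powr (t - 1)"
    using assms by (auto intro!: mult_left_mono powr_mono2)
  ultimately show ?thesis by (simp add: distrib_right)
qed

lemma powr_sum_increment_le:
  fixes X b z t C K :: real
  assumes t: "1 \<le> t" and nonneg: "0 \<le> X" "0 \<le> b" "0 \<le> z" and K: "2 \<le> K" "2 * C \<le> K"
  shows "X powr t + z powr t + C * (X powr (t - 1) * b + b powr t) \<le> (X + K * b + z) powr t"
proof -
  define h where "h = K / 2"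
  have h: "1 \<le> h" "C \<le> h" "K * b = h * b + h * b" using K by (auto simp: h_def)
  have hb: "0 \<le> h * b" "0 \<le> X + h * b" "0 \<le> X + h * b + h * b" using h nonneg by auto
  have h_powr: "h \<le> h powr t" using h(1) t powr_mono[of 1 t h] by simp
  have "C * (X powr (t - 1) * b) \<le> h * b * X powr (t - 1)"
    using mult_right_mono[OF h(2), of "X powr (t - 1) * b"] nonneg by (simp add: mult_ac)
  moreover have "C * b powr t \<le> (h * b) powr t"
    using h h_powr nonneg mult_right_mono[of C "h powr t" "b powr t"] by (simp add: powr_mult)
  ultimately have "X powr t + z powr t + C * (X powr (t - 1) * b + b powr t)
      \<le> (X powr t + h * b * X powr (t - 1)) + (h * b) powr t + z powr t"
    by (simp add: distrib_left)
  also have "\<dots> \<le> (X + h * b) powr t + (h * b) powr t + z powr t"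
    using powr_add_ge[OF nonneg(1) hb(1) t] by simp
  also have "\<dots> \<le> (X + h * b + h * b) powr t + z powr t"
    using powr_superadditive[OF hb(2,1) t] by simp
  also have "\<dots> \<le> (X + h * b + h * b + z) powr t"
    by (rule powr_superadditive[OF hb(3) nonneg(3) t])
  also have "X + h * b + h * b + z = X + K * b + z" using h(3) by linarith
  finally show ?thesis .
qed

definition upper_estimate :: "real \<Rightarrow> real \<Rightarrow> nat filter \<Rightarrow> useq \<Rightarrow> bool" where
  "upper_estimate q r U H \<longleftrightarrow> (\<exists>A C. (\<forall>\<^sub>F n in U. n \<in> A) \<and> 0 \<le> C \<and>
     (\<forall>s a. finite s \<longrightarrow> s \<subseteq> A \<longrightarrow>
        lpnorm q (\<lambda>x. \<Sum>n\<in>s. a n * H n x) \<le> C * (\<Sum>n\<in>s. \<bar>a n\<bar> powr r) powr (1 / r)))"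

lemma upper_estimateE:
  assumes "upper_estimate q r U H"
  obtains A C where "\<forall>\<^sub>F n in U. n \<in> A" "0 \<le> C"
    "\<And>s a. finite s \<Longrightarrow> s \<subseteq> A \<Longrightarrow> lpnorm q (\<lambda>x. \<Sum>n\<in>s. a n * H n x) \<le> C * (\<Sum>n\<in>s. \<bar>a n\<bar> powr r) powr (1 / r)"
  using assms unfolding upper_estimate_def by blast

lemma upper_estimateI:
  assumes "\<forall>\<^sub>F n in U. n \<in> A" "0 \<le> C"
    "\<And>s a. finite s \<Longrightarrow> s \<subseteq> A \<Longrightarrow> lpnorm q (\<lambda>x. \<Sum>n\<in>s. a n * H n x) \<le> C * (\<Sum>n\<in>s. \<bar>a n\<bar> powr r) powr (1 / r)"
  shows "upper_estimate q r U H"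
  using assms unfolding upper_estimate_def by blast

lemma abs_le_powr_sum:
  fixes a :: "'i \<Rightarrow> real"
  assumes "finite s" "n \<in> s" "0 < r"
  shows "\<bar>a n\<bar> \<le> (\<Sum>n\<in>s. \<bar>a n\<bar> powr r) powr (1 / r)"
proof -
  have "\<bar>a n\<bar> = (\<bar>a n\<bar> powr r) powr (1 / r)" using assms by (simp add: powr_powr)
  also have "\<dots> \<le> (\<Sum>n\<in>s. \<bar>a n\<bar> powr r) powr (1 / r)"
    using assms by (intro powr_mono2 member_le_sum) auto
  finally show ?thesis .
qed

lemma sum_half_powers_le: "finite s \<Longrightarrow> (\<Sum>n\<in>s. (1 / 2 :: real) ^ n) \<le> 2"
  using sum_le_suminf[of "\<lambda>n. (1 / 2 :: real) ^ n" s] suminf_geometric[of "1 / 2 :: real"] by simp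

lemma lpnorm_sum_small_perturbation:
  assumes q: "1 \<le> q" and r: "0 < r" and s: "finite s" and D: "\<And>n. D n \<in> Lp q"
    and small: "\<And>n. lpnorm q (D n) \<le> (1 / 2) ^ n"
  shows "lpnorm q (\<lambda>x. \<Sum>n\<in>s. a n * D n x) \<le> 2 * (\<Sum>n\<in>s. \<bar>a n\<bar> powr r) powr (1 / r)" (is "_ \<le> 2 * ?R")
proof -
  have "lpnorm q (\<lambda>x. \<Sum>n\<in>s. a n * D n x) \<le> (\<Sum>n\<in>s. \<bar>a n\<bar> * lpnorm q (D n))"
    using q D by (intro lpnorm_sum_le)
  also have "\<dots> \<le> (\<Sum>n\<in>s. ?R * (1 / 2) ^ n)"
    using abs_le_powr_sum[OF s _ r] small by (intro sum_mono mult_mono) auto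
  also have "\<dots> = ?R * (\<Sum>n\<in>s. (1 / 2) ^ n)" by (simp add: sum_distrib_left)
  also have "\<dots> \<le> ?R * 2" using sum_half_powers_le[OF s] by (intro mult_left_mono) auto
  finally show ?thesis by simp
qed

lemma upper_estimate_perturb:
  assumes q: "1 \<le> q" and r: "0 < r" and H': "upper_estimate q r U H'"
    and L: "\<And>n. H n \<in> Lp q" "\<And>n. H' n \<in> Lp q"
    and small: "\<And>n. lpnorm q (\<lambda>x. H n x - H' n x) \<le> (1 / 2) ^ n"
  shows "upper_estimate q r U H"
proof -
  obtain A C where A: "\<forall>\<^sub>F n in U. n \<in> A" "0 \<le> C"
    and C: "\<And>s a. finite s \<Longrightarrow> s \<subseteq> A \<Longrightarrow> lpnorm q (\<lambda>x. \<Sum>n\<in>s. a n * H' n x)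
        \<le> C * (\<Sum>n\<in>s. \<bar>a n\<bar> powr r) powr (1 / r)"
    using upper_estimateE[OF H'] by blast
  show ?thesis
  proof (rule upper_estimateI[OF A(1), of "C + 2"])
    fix s a assume s: "finite s" "s \<subseteq> A"
    let ?R = "(\<Sum>n\<in>s. \<bar>a n\<bar> powr r) powr (1 / r)"
    have D: "(\<lambda>x. H n x - H' n x) \<in> Lp q" for n using L q by (intro Lp_diff) auto
    have "(\<lambda>x. \<Sum>n\<in>s. a n * H n x) = (\<lambda>x. (\<Sum>n\<in>s. a n * H' n x) + (\<Sum>n\<in>s. a n * (H n x - H' n x)))"
      by (simp add: sum.distrib[symmetric] algebra_simps)
    then have "lpnorm q (\<lambda>x. \<Sum>n\<in>s. a n * H n x)
        \<le> lpnorm q (\<lambda>x. \<Sum>n\<in>s. a n * H' n x) + lpnorm q (\<lambda>x. \<Sum>n\<in>s. a n * (H n x - H' n x))"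
      using L q D by (auto intro!: lpnorm_triangle Lp_sum Lp_scale)
    also have "\<dots> \<le> C * ?R + 2 * ?R"
      using C[OF s] lpnorm_sum_small_perturbation[OF q r s(1) D small] by (rule add_mono)
    finally show "lpnorm q (\<lambda>x. \<Sum>n\<in>s. a n * H n x) \<le> (C + 2) * ?R" by (simp add: distrib_right)
  qed (use A(2) in simp)
qed

lemma upper_estimate_exponent_antimono:
  assumes H: "upper_estimate p r U H" and L: "\<And>n. H n \<in> Lp p" and q: "1 < q" "q \<le> p"
  shows "upper_estimate q r U H"
proof -
  obtain A C where A: "\<forall>\<^sub>F n in U. n \<in> A" "0 \<le> C"
    and C: "\<And>s a. finite s \<Longrightarrow> s \<subseteq> A \<Longrightarrow> lpnorm p (\<lambda>x. \<Sum>n\<in>s. a n * H n x) \<le> C * (\<Sum>n\<in>s. \<bar>a n\<bar> powr r) powr (1 / r)"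
    using upper_estimateE[OF H] by blast
  have "lpnorm q (\<lambda>x. \<Sum>n\<in>s. a n * H n x) \<le> lpnorm p (\<lambda>x. \<Sum>n\<in>s. a n * H n x)" for s a
    using L q by (intro lpnorm_exponent_mono[OF _ q] Lp_sum Lp_scale) auto
  then show ?thesis using C by (intro upper_estimateI[OF A]) (rule order_trans)
qed

lemma upper_estimate_of_normalized:
  assumes q: "0 < q" and r: "0 < r" and A: "\<forall>\<^sub>F n in U. n \<in> A" and C: "0 \<le> C"
    and normalized: "\<And>s a. finite s \<Longrightarrow> s \<subseteq> A \<Longrightarrow> \<forall>i. \<bar>a i\<bar> \<le> 1 \<Longrightarrow> (\<Sum>i\<in>s. \<bar>a i\<bar> powr r) = 1
      \<Longrightarrow> lpnorm q (\<lambda>x. \<Sum>i\<in>s. a i * H i x) \<le> C"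
  shows "upper_estimate q r U H"
proof (rule upper_estimateI[OF A C])
  fix s :: "nat set" and a assume s: "finite s" "s \<subseteq> A"
  define R where "R = (\<Sum>i\<in>s. \<bar>a i\<bar> powr r) powr (1 / r)"
  show "lpnorm q (\<lambda>x. \<Sum>i\<in>s. a i * H i x) \<le> C * R"
  proof (cases "(\<Sum>i\<in>s. \<bar>a i\<bar> powr r) = 0")
    case True
    then have "\<forall>i\<in>s. a i = 0" using s by (subst (asm) sum_nonneg_eq_0_iff) auto
    then have "(\<lambda>x. \<Sum>i\<in>s. a i * H i x) = (\<lambda>x. 0)" by simp
    then show ?thesis using C by (simp add: R_def)
  next
    case False
    then have R: "0 < R" by (simp add: R_def)
    have R_powr: "R powr r = (\<Sum>i\<in>s. \<bar>a i\<bar> powr r)" using r by (simp add: R_def powr_powr sum_nonneg)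
    define b where "b i = (if i \<in> s then a i / R else 0)" for i
    have "\<forall>i. \<bar>b i\<bar> \<le> 1"
      using abs_le_powr_sum[OF s(1) _ r, of _ a] R by (auto simp: b_def R_def[symmetric] divide_le_eq)
    moreover have "(\<Sum>i\<in>s. \<bar>b i\<bar> powr r) = (\<Sum>i\<in>s. \<bar>a i\<bar> powr r) / R powr r"
      using R by (simp add: b_def powr_divide sum_divide_distrib)
    then have "(\<Sum>i\<in>s. \<bar>b i\<bar> powr r) = 1" using R_powr False by simp
    ultimately have "R * lpnorm q (\<lambda>x. \<Sum>i\<in>s. b i * H i x) \<le> R * C"
      using normalized s R by (intro mult_left_mono) auto
    moreover have "(\<lambda>x. \<Sum>i\<in>s. a i * H i x) = (\<lambda>x. R * (\<Sum>i\<in>s. b i * H i x))"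
      using R by (simp add: sum_distrib_left b_def)
    ultimately show ?thesis using q R by (simp add: lpnorm_scale mult.commute)
  qed
qed

definition upper_step :: "real \<Rightarrow> real \<Rightarrow> real \<Rightarrow> real \<Rightarrow> useq \<Rightarrow> nat set \<Rightarrow> nat \<Rightarrow> bool" where
  "upper_step q r C \<epsilon> H s n \<longleftrightarrow> (\<forall>a. (\<forall>i. \<bar>a i\<bar> \<le> 1) \<longrightarrow>
     lpnorm q (\<lambda>x. (\<Sum>i\<in>s. a i * H i x) + a n * H n x) powr q
       \<le> lpnorm q (\<lambda>x. \<Sum>i\<in>s. a i * H i x) powr q + \<epsilon>
          + C * (lpnorm q (\<lambda>x. \<Sum>i\<in>s. a i * H i x) powr (q - r) * \<bar>a n\<bar> powr r + \<bar>a n\<bar> powr q))"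

lemma upper_step_partial_sums:
  assumes r: "0 < r" "r \<le> q" and K: "2 \<le> K" "2 * C \<le> K" and C: "0 \<le> C" and a: "\<forall>i. \<bar>a i\<bar> \<le> 1"
    and step: "\<And>s n. finite s \<Longrightarrow> s \<subseteq> A \<Longrightarrow> n \<in> A \<Longrightarrow> \<forall>m\<in>s. m < n
      \<Longrightarrow> upper_step q r C ((K * (1 / 2) ^ card s) powr (q / r)) H s n"
    and s: "finite s" "s \<subseteq> A"
  shows "lpnorm q (\<lambda>x. \<Sum>i\<in>s. a i * H i x) powr q
    \<le> (K * ((\<Sum>i\<in>s. \<bar>a i\<bar> powr r) + (\<Sum>k<card s. (1 / 2) ^ k))) powr (q / r)"
  using s
proof (induction s rule: finite_linorder_max_induct)
  case (insert n s)
  define t where "t = q / r"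
  have t: "1 \<le> t" "0 < q" "t * ((q - r) / q) = t - 1" using r by (simp_all add: t_def field_simps)
  let ?S = "\<lambda>x. \<Sum>i\<in>s. a i * H i x"
  define X where "X = K * ((\<Sum>i\<in>s. \<bar>a i\<bar> powr r) + (\<Sum>k<card s. (1 / 2) ^ k))"
  define b where "b = \<bar>a n\<bar> powr r"
  define z where "z = K * (1 / 2) ^ card s"
  have nonneg: "0 \<le> X" "0 \<le> b" "0 \<le> z"
    using K by (auto simp: X_def b_def z_def intro!: mult_nonneg_nonneg add_nonneg_nonneg sum_nonneg)
  have b_powr: "b powr t = \<bar>a n\<bar> powr q" using r by (simp add: b_def t_def powr_powr)
  have IH: "lpnorm q ?S powr q \<le> X powr t" using insert by (simp add: X_def t_def)
  have "lpnorm q ?S powr (q - r) = (lpnorm q ?S powr q) powr ((q - r) / q)"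
    using t by (simp add: powr_powr)
  also have "\<dots> \<le> (X powr t) powr ((q - r) / q)" using IH t r by (intro powr_mono2) auto
  finally have S: "lpnorm q ?S powr (q - r) \<le> X powr (t - 1)" using t by (simp add: powr_powr)
  have "upper_step q r C (z powr t) H s n" unfolding z_def t_def using insert by (intro step) auto
  then have "lpnorm q (\<lambda>x. ?S x + a n * H n x) powr q \<le> lpnorm q ?S powr q + z powr t
        + C * (lpnorm q ?S powr (q - r) * \<bar>a n\<bar> powr r + \<bar>a n\<bar> powr q)"
    using a unfolding upper_step_def by blast
  also have "\<dots> \<le> X powr t + z powr t + C * (X powr (t - 1) * b + b powr t)"
    unfolding b_powr b_def[symmetric]
    using IH S C nonneg by (intro add_mono mult_left_mono mult_right_mono) auto
  also have "\<dots> \<le> (X + K * b + z) powr t" using t(1) nonneg K by (rule powr_sum_increment_le)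
  also have "X + K * b + z = K * ((\<Sum>i\<in>insert n s. \<bar>a i\<bar> powr r) + (\<Sum>k<card (insert n s). (1 / 2) ^ k))"
    using insert by (auto simp: X_def b_def z_def algebra_simps)
  also have "(\<lambda>x. ?S x + a n * H n x) = (\<lambda>x. \<Sum>i\<in>insert n s. a i * H i x)"
    using insert by (auto simp: fun_eq_iff)
  finally show ?case by (simp add: t_def)
qed simp

locale selective_ultrapower = ultrapower +
  assumes selective: "selective_ultrafilter U"
begin

lemma selective_finite_diagonal:
  assumes P: "\<And>s. finite s \<Longrightarrow> \<forall>\<^sub>F n in U. P s n"
  obtains A where "\<forall>\<^sub>F n in U. n \<in> A"
    "\<And>s n. finite s \<Longrightarrow> s \<subseteq> A \<Longrightarrow> n \<in> A \<Longrightarrow> \<forall>m\<in>s. m < n \<Longrightarrow> P s n"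
proof -
  define B where "B m = {n. \<forall>s\<in>Pow {..m}. P s n}" for m
  have "\<forall>\<^sub>F n in U. n \<in> B m" for m
  proof -
    have "\<forall>\<^sub>F n in U. \<forall>s\<in>Pow {..m}. P s n"
      using P finite_subset[of _ "{..m}"] by (intro eventually_ball_finite) auto
    then show ?thesis by (simp add: B_def)
  qed
  then obtain A where A: "\<forall>\<^sub>F n in U. n \<in> A" "\<And>m n. m \<in> A \<Longrightarrow> n \<in> A \<Longrightarrow> m < n \<Longrightarrow> n \<in> B m"
    using selective_diagonal[where B = B, OF selective] by blast
  show thesis
  proof
    show "\<forall>\<^sub>F n in U. n \<in> {n \<in> A. P {} n}" using A(1) P[of "{}"] by (simp add: eventually_conj)
    fix s n assume s: "finite s" "s \<subseteq> {n \<in> A. P {} n}" "\<forall>m\<in>s. m < n" and n: "n \<in> {n \<in> A. P {} n}"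
    show "P s n"
    proof (cases "s = {}")
      case False
      then have "Max s \<in> s" using s(1) by (intro Max_in)
      then have "n \<in> B (Max s)" using s n by (intro A(2)) auto
      moreover have "s \<in> Pow {..Max s}" using s(1) by auto
      ultimately show ?thesis unfolding B_def by blast
    qed (use n in simp)
  qed
qed

text \<open>With $t = q/r$ the partial sums satisfy
  $\|S\|_q^q \le (K (\sum |a_i|^r + \sum_{k<|s|} 2^{-k}))^t$, by induction on the largest index.\<close>
theorem upper_estimate_of_step:
  assumes r: "0 < r" "r \<le> q" and C: "0 \<le> C"
    and step: "\<And>s \<epsilon>. finite s \<Longrightarrow> 0 < \<epsilon> \<Longrightarrow> \<forall>\<^sub>F n in U. upper_step q r C \<epsilon> H s n"
  shows "upper_estimate q r U H"
proof -
  have q: "0 < q" using r by simp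
  define K where "K = 2 * max 1 C"
  have K: "2 \<le> K" "2 * C \<le> K" by (auto simp: K_def)
  have ev: "\<forall>\<^sub>F n in U. upper_step q r C ((K * (1 / 2) ^ card s) powr (q / r)) H s n" if "finite s" for s
    using K by (intro step that) auto
  obtain A where A: "\<forall>\<^sub>F n in U. n \<in> A" and steps: "\<And>s n. finite s \<Longrightarrow> s \<subseteq> A \<Longrightarrow> n \<in> A \<Longrightarrow> \<forall>m\<in>s. m < n
      \<Longrightarrow> upper_step q r C ((K * (1 / 2) ^ card s) powr (q / r)) H s n"
    using selective_finite_diagonal[where P = "\<lambda>s n. upper_step q r C ((K * (1 / 2) ^ card s) powr (q / r)) H s n", OF ev]
    by blast
  show ?thesis
  proof (rule upper_estimate_of_normalized[OF q r(1) A])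
    fix s and a :: "nat \<Rightarrow> real"
    assume s: "finite s" "s \<subseteq> A" and a: "\<forall>i. \<bar>a i\<bar> \<le> 1" "(\<Sum>i\<in>s. \<bar>a i\<bar> powr r) = 1"
    have "lpnorm q (\<lambda>x. \<Sum>i\<in>s. a i * H i x) powr q \<le> (K * (1 + (\<Sum>k<card s. (1 / 2) ^ k))) powr (q / r)"
      using upper_step_partial_sums[OF r K C a(1) steps s] unfolding a(2) .
    also have "\<dots> \<le> (K * 3) powr (q / r)"
      using K r sum_half_powers_le[of "{..<card s}"]
      by (intro powr_mono2 mult_left_mono) (auto intro!: mult_nonneg_nonneg add_nonneg_nonneg sum_nonneg)
    finally have "(lpnorm q (\<lambda>x. \<Sum>i\<in>s. a i * H i x) powr q) powr (1 / q)
      \<le> ((K * 3) powr (q / r)) powr (1 / q)"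
      using q by (intro powr_mono2) auto
    then show "lpnorm q (\<lambda>x. \<Sum>i\<in>s. a i * H i x) \<le> (K * 3) powr (1 / r)" using q by (simp add: powr_powr)
  qed simp
qed

end

lemma simple_function_restrict:
  assumes "finite s" "\<And>i. i \<in> s \<Longrightarrow> simple_function M (u i)"
  shows "simple_function M (\<lambda>x. \<lambda>i\<in>s. u i x)"
  using assms
proof (induction s rule: finite_induct)
  case (insert j s)
  have "simple_function M (\<lambda>x. \<lambda>i\<in>s. u i x)" "simple_function M (u j)" using insert by blast+
  then have "simple_function M (\<lambda>x. (\<lambda>i\<in>s. u i x)(j := u j x))"
    by (rule simple_function_compose2[where h = "\<lambda>v y. v(j := y)"])
  moreover have "(\<lambda>x. \<lambda>i\<in>insert j s. u i x) = (\<lambda>x. (\<lambda>i\<in>s. u i x)(j := u j x))"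
    by (auto simp: fun_eq_iff)
  ultimately show ?case by metis
qed (simp add: restrict_def)

lemma eventually_integral_simple_comp_small:
  fixes k :: "'n \<Rightarrow> 'a \<Rightarrow> real"
  assumes f: "simple_function M f" and k: "\<And>n. integrable M (k n)"
    and lim: "\<And>E. E \<in> sets M \<Longrightarrow> ((\<lambda>n. LINT x|M. indicator E x * k n x) \<longlongrightarrow> 0) F"
    and \<epsilon>: "0 < \<epsilon>"
  shows "\<forall>\<^sub>F n in F. \<forall>\<theta>. (\<forall>x\<in>space M. \<bar>\<theta> (f x)\<bar> \<le> R) \<longrightarrow> \<bar>LINT x|M. \<theta> (f x) * k n x\<bar> \<le> \<epsilon>"
proof -
  define I where "I n v = (LINT x|M. indicator (f -` {v} \<inter> space M) x * k n x)" for n v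
  have "((\<lambda>n. R * (\<Sum>v\<in>f ` space M. \<bar>I n v\<bar>)) \<longlongrightarrow> R * (\<Sum>v\<in>f ` space M. \<bar>0\<bar>)) F"
    unfolding I_def using lim simple_functionD(2)[OF f] by (intro tendsto_intros) auto
  then have "\<forall>\<^sub>F n in F. R * (\<Sum>v\<in>f ` space M. \<bar>I n v\<bar>) < \<epsilon>" using \<epsilon> by (intro order_tendstoD) auto
  then show ?thesis
  proof eventually_elim
    case (elim n)
    show ?case
    proof (intro allI impI)
      fix \<theta> assume \<theta>: "\<forall>x\<in>space M. \<bar>\<theta> (f x)\<bar> \<le> R"
      have "\<bar>LINT x|M. \<theta> (f x) * k n x\<bar> = \<bar>\<Sum>v\<in>f ` space M. \<theta> v * I n v\<bar>"
        unfolding I_def integral_simple_function_comp[OF f k] ..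
      also have "\<dots> \<le> (\<Sum>v\<in>f ` space M. \<bar>\<theta> v * I n v\<bar>)" by (rule sum_abs)
      also have "\<dots> \<le> (\<Sum>v\<in>f ` space M. R * \<bar>I n v\<bar>)"
        using \<theta> by (intro sum_mono) (auto simp: abs_mult intro!: mult_right_mono)
      finally show "\<bar>LINT x|M. \<theta> (f x) * k n x\<bar> \<le> \<epsilon>" using elim by (simp add: sum_distrib_left)
    qed
  qed
qed

lemma sum_simple_functions_bounded:
  fixes u :: "'i \<Rightarrow> real \<Rightarrow> real"
  assumes u: "\<And>i. simple_function M01 (u i)"
  shows "\<exists>m. \<forall>a x. (\<forall>i. \<bar>a i\<bar> \<le> 1) \<longrightarrow> x \<in> {0..1} \<longrightarrow> \<bar>\<Sum>i\<in>s. a i * u i x\<bar> \<le> m"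
proof -
  have "\<exists>K. \<forall>x\<in>{0..1}. \<bar>u i x\<bar> \<le> K" for i
    using simple_function_bounded[OF u[of i]] by metis
  then obtain K where K: "\<And>i x. x \<in> {0..1} \<Longrightarrow> \<bar>u i x\<bar> \<le> K i" by metis
  have "\<bar>\<Sum>i\<in>s. a i * u i x\<bar> \<le> (\<Sum>i\<in>s. K i)" if a: "\<forall>i. \<bar>a i\<bar> \<le> 1" and x: "x \<in> {0..1}" for a x
  proof -
    have "\<bar>\<Sum>i\<in>s. a i * u i x\<bar> \<le> (\<Sum>i\<in>s. \<bar>a i\<bar> * \<bar>u i x\<bar>)" unfolding abs_mult[symmetric] by (rule sum_abs)
    also have "\<dots> \<le> (\<Sum>i\<in>s. 1 * K i)" using a K[OF x] by (intro sum_mono mult_mono) auto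
    finally show ?thesis by simp
  qed
  then show ?thesis by blast
qed

text \<open>Finitely many simple functions generate a finite algebra of sets, which makes the convergence
  uniform in the coefficients.\<close>
lemma eventually_integral_comp_sum_small:
  fixes u :: "'i \<Rightarrow> real \<Rightarrow> real" and \<phi> :: "real \<Rightarrow> real"
  assumes s: "finite s" and u: "\<And>i. simple_function M01 (u i)" and k: "\<And>n. integrable M01 (k n)"
    and lim: "\<And>E. E \<in> sets M01 \<Longrightarrow> ((\<lambda>n. LINT x|M01. indicator E x * k n x) \<longlongrightarrow> 0) F"
    and \<phi>: "\<And>y. \<bar>\<phi> y\<bar> \<le> \<bar>y\<bar> powr t" "0 \<le> t" and \<epsilon>: "0 < \<epsilon>"
  shows "\<forall>\<^sub>F n in F. \<forall>a. (\<forall>i. \<bar>a i\<bar> \<le> 1) \<longrightarrow> \<bar>LINT x|M01. \<phi> (\<Sum>i\<in>s. a i * u i x) * k n x\<bar> \<le> \<epsilon>"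
proof -
  obtain m where m: "\<forall>a x. (\<forall>i. \<bar>a i\<bar> \<le> 1) \<longrightarrow> x \<in> {0..1} \<longrightarrow> \<bar>\<Sum>i\<in>s. a i * u i x\<bar> \<le> m"
    using sum_simple_functions_bounded[OF u] ..
  have "\<forall>\<^sub>F n in F. \<forall>\<theta>. (\<forall>x\<in>space M01. \<bar>\<theta> (\<lambda>i\<in>s. u i x)\<bar> \<le> m powr t) \<longrightarrow>
      \<bar>LINT x|M01. \<theta> (\<lambda>i\<in>s. u i x) * k n x\<bar> \<le> \<epsilon>"
    by (rule eventually_integral_simple_comp_small[OF simple_function_restrict[OF s u] k lim \<epsilon>])
  then show ?thesis
  proof eventually_elim
    case (elim n)
    show ?case
    proof (intro allI impI)
      fix a :: "'i \<Rightarrow> real" assume a: "\<forall>i. \<bar>a i\<bar> \<le> 1"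
      define \<theta> where "\<theta> v = \<phi> (\<Sum>i\<in>s. a i * v i)" for v
      have \<theta>: "\<theta> (\<lambda>i\<in>s. u i x) = \<phi> (\<Sum>i\<in>s. a i * u i x)" for x by (simp add: \<theta>_def)
      have "\<bar>\<theta> (\<lambda>i\<in>s. u i x)\<bar> \<le> m powr t" if "x \<in> space M01" for x
      proof -
        have "\<bar>\<phi> (\<Sum>i\<in>s. a i * u i x)\<bar> \<le> \<bar>\<Sum>i\<in>s. a i * u i x\<bar> powr t" by (rule \<phi>(1))
        also have "\<dots> \<le> m powr t" using m a that \<phi>(2) by (intro powr_mono2) auto
        finally show ?thesis by (simp add: \<theta>)
      qed
      then have "\<bar>LINT x|M01. \<theta> (\<lambda>i\<in>s. u i x) * k n x\<bar> \<le> \<epsilon>" using elim by blast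
      then show "\<bar>LINT x|M01. \<phi> (\<Sum>i\<in>s. a i * u i x) * k n x\<bar> \<le> \<epsilon>" by (simp add: \<theta>)
    qed
  qed
qed

definition simple_approximant :: "real \<Rightarrow> useq \<Rightarrow> useq \<Rightarrow> bool" where
  "simple_approximant q H H' \<longleftrightarrow> (\<forall>n. simple_function M01 (H' n) \<and> H' n \<in> Lp q \<and>
     lpnorm q (\<lambda>x. H n x - H' n x) \<le> (1 / 2) ^ n)"

lemma
  assumes "simple_approximant q H H'"
  shows simple_approximant_simple: "simple_function M01 (H' n)"
    and simple_approximant_Lp: "H' n \<in> Lp q"
    and simple_approximant_dist: "lpnorm q (\<lambda>x. H n x - H' n x) \<le> (1 / 2) ^ n"
  using assms by (simp_all add: simple_approximant_def)

lemma simple_approximant_exists: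
  assumes H: "H \<in> UP q" and q: "1 \<le> q"
  obtains H' where "simple_approximant q H H'"
proof -
  have "\<exists>h. simple_function M01 h \<and> h \<in> Lp q \<and> lpnorm q (\<lambda>x. H n x - h x) < (1 / 2) ^ n" for n
    using Lp_simple_dense[OF UP_Lp[OF H, of n] q, of "(1 / 2) ^ n"]
    by (metis half_gt_zero zero_less_one zero_less_power)
  then show thesis using that unfolding simple_approximant_def by (metis less_imp_le)
qed

lemma simple_approximant_UP:
  assumes H: "H \<in> UP q" and q: "1 \<le> q" and H': "simple_approximant q H H'"
  shows "H' \<in> UP q"
proof -
  note H'_Lp = simple_approximant_Lp[OF H']
  obtain B where B: "\<And>n. lpnorm q (H n) \<le> B" using UP_bound[OF H] by blast
  have "lpnorm q (H' n) \<le> B + 1" for n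
  proof -
    have "lpnorm q (H' n) \<le> lpnorm q (H n) + lpnorm q (\<lambda>x. H n x - H' n x)"
      using lpnorm_reverse_triangle[OF UP_Lp[OF H, of n] H'_Lp[of n] q] by linarith
    moreover have "(1 / 2 :: real) ^ n \<le> 1" by (simp add: power_le_one)
    ultimately show ?thesis using B[of n] simple_approximant_dist[OF H', of n] by linarith
  qed
  then show ?thesis using H'_Lp by (intro UPI)
qed

lemma (in ultrapower) simple_approximant_UP_eq:
  assumes H: "H \<in> UP q" and q: "1 \<le> q" and H': "simple_approximant q H H'"
  shows "UP_eq q U H H'"
proof -
  have "(\<lambda>n. (1 / 2 :: real) ^ n) \<longlonglongrightarrow> 0" by (rule LIMSEQ_realpow_zero) auto
  then have "(\<lambda>n. lpnorm q (\<lambda>x. H n x - H' n x)) \<longlonglongrightarrow> 0"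
    by (rule Lim_null_comparison[rotated]) (use simple_approximant_dist[OF H'] in auto)
  then have "unorm q U (\<lambda>n x. H n x - H' n x) = 0"
    unfolding unorm_def by (intro LimI sequentially_tendsto)
  then show ?thesis using H simple_approximant_UP[OF assms] by (simp add: UP_eq_def)
qed

lemma
  assumes r: "0 < r" "r < q" and f: "f \<in> Lp q" and g: "g \<in> Lp q"
  shows integrable_powr_mult_powr_less: "integrable M01 (\<lambda>x. \<bar>f x\<bar> powr (q - r) * \<bar>g x\<bar> powr r)"
    and integral_powr_mult_powr_less:
      "(LINT x|M01. \<bar>f x\<bar> powr (q - r) * \<bar>g x\<bar> powr r) \<le> lpnorm q f powr (q - r) * lpnorm q g powr r"
proof -
  note [measurable] = Lp_measurable[OF f] Lp_measurable[OF g]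
  have qr: "conjugate_exponents (q / (q - r)) (q / r)"
    using r by (auto simp: conjugate_exponents_def field_simps)
  have f': "(\<lambda>x. \<bar>f x\<bar> powr (q - r)) \<in> Lp (q / (q - r))" and g': "(\<lambda>x. \<bar>g x\<bar> powr r) \<in> Lp (q / r)"
    using Lp_integrable_powr[OF f] Lp_integrable_powr[OF g] r by (auto intro!: LpI simp: powr_powr)
  show "integrable M01 (\<lambda>x. \<bar>f x\<bar> powr (q - r) * \<bar>g x\<bar> powr r)" by (rule Lp_mult_integrable[OF qr f' g'])
  have "lpnorm (q / (q - r)) (\<lambda>x. \<bar>f x\<bar> powr (q - r)) = lpnorm q f powr (q - r)"
    "lpnorm (q / r) (\<lambda>x. \<bar>g x\<bar> powr r) = lpnorm q g powr r"
    using r by (simp_all add: lpnorm_def powr_powr)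
  then show "(LINT x|M01. \<bar>f x\<bar> powr (q - r) * \<bar>g x\<bar> powr r) \<le> lpnorm q f powr (q - r) * lpnorm q g powr r"
    using order_trans[OF abs_ge_self Holder_inequality[OF qr f' g']] by simp
qed

text \<open>For $r = q$ the first factor is \<^term>\<open>0 powr 0 = 0\<close> where $f$ vanishes and $1$ elsewhere.\<close>
lemma
  assumes r: "0 < r" "r \<le> q" and f: "f \<in> Lp q" and g: "g \<in> Lp q"
  shows integrable_powr_mult_powr: "integrable M01 (\<lambda>x. \<bar>f x\<bar> powr (q - r) * \<bar>g x\<bar> powr r)"
    and integral_powr_mult_powr:
      "(LINT x|M01. \<bar>f x\<bar> powr (q - r) * \<bar>g x\<bar> powr r) \<le> lpnorm q f powr (q - r) * lpnorm q g powr r"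
proof -
  note [measurable] = Lp_measurable[OF f] Lp_measurable[OF g]
  have q: "0 < q" using r by simp
  have le: "\<bar>f x\<bar> powr (q - q) * \<bar>g x\<bar> powr q \<le> \<bar>g x\<bar> powr q" for x by simp
  have int: "integrable M01 (\<lambda>x. \<bar>f x\<bar> powr (q - q) * \<bar>g x\<bar> powr q)"
    using le by (intro Bochner_Integration.integrable_bound[OF Lp_integrable_powr[OF g]] AE_I2) auto
  have "(LINT x|M01. \<bar>f x\<bar> powr (q - q) * \<bar>g x\<bar> powr q) \<le> lpnorm q f powr (q - q) * lpnorm q g powr q"
  proof (cases "lpnorm q f = 0")
    case True
    then have "AE x in M01. f x = 0" using f q by (simp add: lpnorm_eq_0_iff)
    then have "(LINT x|M01. \<bar>f x\<bar> powr (q - q) * \<bar>g x\<bar> powr q) = (LINT x|M01. 0)"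
      by (intro integral_cong_AE) auto
    then show ?thesis by simp
  next
    case False
    have "(LINT x|M01. \<bar>f x\<bar> powr (q - q) * \<bar>g x\<bar> powr q) \<le> (LINT x|M01. \<bar>g x\<bar> powr q)"
      using le int Lp_integrable_powr[OF g] by (intro integral_mono) auto
    then show ?thesis using False q by (simp add: lpnorm_powr)
  qed
  then show "integrable M01 (\<lambda>x. \<bar>f x\<bar> powr (q - r) * \<bar>g x\<bar> powr r)"
    "(LINT x|M01. \<bar>f x\<bar> powr (q - r) * \<bar>g x\<bar> powr r) \<le> lpnorm q f powr (q - r) * lpnorm q g powr r"
    using int integrable_powr_mult_powr_less[OF r(1) _ f g] integral_powr_mult_powr_less[OF r(1) _ f g] r(2)
    by (cases "r = q"; simp)+
qed

lemma lpnorm_add_powr_le: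
  assumes q: "1 \<le> q" and r: "0 < r" "r \<le> q" and C: "0 \<le> C" and f: "f \<in> Lp q" and g: "g \<in> Lp q"
    and pointwise: "\<And>x y. \<bar>x + y\<bar> powr q
        \<le> \<bar>x\<bar> powr q + e x y + C * (\<bar>x\<bar> powr (q - r) * \<bar>y\<bar> powr r + \<bar>y\<bar> powr q)"
    and int_e: "integrable M01 (\<lambda>x. e (f x) (g x))"
  shows "lpnorm q (\<lambda>x. f x + g x) powr q \<le> lpnorm q f powr q + (LINT x|M01. e (f x) (g x))
    + C * (lpnorm q f powr (q - r) * lpnorm q g powr r + lpnorm q g powr q)"
proof -
  have q_pos: "0 < q" using q by simp
  note int = Lp_integrable_powr[OF f] Lp_integrable_powr[OF g] int_e integrable_powr_mult_powr[OF r f g]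
  have "lpnorm q (\<lambda>x. f x + g x) powr q = (LINT x|M01. \<bar>f x + g x\<bar> powr q)"
    using q_pos by (simp add: lpnorm_powr)
  also have "\<dots> \<le> (LINT x|M01. \<bar>f x\<bar> powr q + e (f x) (g x)
      + C * (\<bar>f x\<bar> powr (q - r) * \<bar>g x\<bar> powr r + \<bar>g x\<bar> powr q))"
    using int pointwise q by (intro integral_mono Lp_integrable_powr[OF Lp_add[OF f g]]) auto
  also have "\<dots> = lpnorm q f powr q + (LINT x|M01. e (f x) (g x))
      + C * ((LINT x|M01. \<bar>f x\<bar> powr (q - r) * \<bar>g x\<bar> powr r) + lpnorm q g powr q)"
    using int q_pos by (simp add: lpnorm_powr)
  also have "\<dots> \<le> lpnorm q f powr q + (LINT x|M01. e (f x) (g x))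
      + C * (lpnorm q f powr (q - r) * lpnorm q g powr r + lpnorm q g powr q)"
    using integral_powr_mult_powr[OF r f g] C by (intro add_mono mult_left_mono) auto
  finally show ?thesis .
qed

lemma upper_step_if_error_small:
  assumes q: "1 \<le> q" and r: "0 < r" "r \<le> q" and C: "0 \<le> C"
    and pointwise: "\<And>x y. \<bar>x + y\<bar> powr q
        \<le> \<bar>x\<bar> powr q + e x y + C * (\<bar>x\<bar> powr (q - r) * \<bar>y\<bar> powr r + \<bar>y\<bar> powr q)"
    and H: "\<And>i. H i \<in> Lp q" "lpnorm q (H n) \<le> B" and B: "1 \<le> B"
    and error: "\<forall>a. (\<forall>i. \<bar>a i\<bar> \<le> 1) \<longrightarrow> integrable M01 (\<lambda>x. e (\<Sum>i\<in>s. a i * H i x) (a n * H n x))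
      \<and> (LINT x|M01. e (\<Sum>i\<in>s. a i * H i x) (a n * H n x)) \<le> \<epsilon>"
  shows "upper_step q r (C * B powr q) \<epsilon> H s n"
  unfolding upper_step_def
proof (intro allI impI)
  fix a :: "nat \<Rightarrow> real" assume "\<forall>i. \<bar>a i\<bar> \<le> 1"
  then have int_e: "integrable M01 (\<lambda>x. e (\<Sum>i\<in>s. a i * H i x) (a n * H n x))"
    and e_le: "(LINT x|M01. e (\<Sum>i\<in>s. a i * H i x) (a n * H n x)) \<le> \<epsilon>"
    using error by blast+
  define f where "f x = (\<Sum>i\<in>s. a i * H i x)" for x
  define g where "g x = a n * H n x" for x
  have f: "f \<in> Lp q" and g: "g \<in> Lp q"
    unfolding f_def g_def using H q by (auto intro!: Lp_sum Lp_scale)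
  have "lpnorm q g \<le> \<bar>a n\<bar> * B"
    unfolding g_def using H(2) q by (simp add: lpnorm_scale mult_left_mono)
  then have powr_le: "lpnorm q g powr t \<le> \<bar>a n\<bar> powr t * B powr q" if "0 \<le> t" "t \<le> q" for t
  proof -
    have "lpnorm q g powr t \<le> (\<bar>a n\<bar> * B) powr t" using \<open>lpnorm q g \<le> _\<close> that by (intro powr_mono2) auto
    also have "\<dots> \<le> \<bar>a n\<bar> powr t * B powr q"
      unfolding powr_mult using that B by (intro mult_left_mono powr_mono) auto
    finally show ?thesis .
  qed
  have "lpnorm q (\<lambda>x. f x + g x) powr q \<le> lpnorm q f powr q + (LINT x|M01. e (f x) (g x))
      + C * (lpnorm q f powr (q - r) * lpnorm q g powr r + lpnorm q g powr q)"
    using int_e unfolding f_def g_def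
    by (intro lpnorm_add_powr_le[OF q r C _ _ pointwise])
      (use f g in \<open>simp_all add: f_def[abs_def] g_def[abs_def]\<close>)
  also have "\<dots> \<le> lpnorm q f powr q + \<epsilon>
      + C * (lpnorm q f powr (q - r) * (\<bar>a n\<bar> powr r * B powr q) + \<bar>a n\<bar> powr q * B powr q)"
    using e_le r C powr_le by (intro add_mono mult_left_mono) (auto simp: f_def g_def)
  finally show "lpnorm q (\<lambda>x. (\<Sum>i\<in>s. a i * H i x) + a n * H n x) powr q
      \<le> lpnorm q (\<lambda>x. \<Sum>i\<in>s. a i * H i x) powr q + \<epsilon>
        + C * B powr q * (lpnorm q (\<lambda>x. \<Sum>i\<in>s. a i * H i x) powr (q - r) * \<bar>a n\<bar> powr r + \<bar>a n\<bar> powr q)"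
    by (simp add: f_def[abs_def] g_def[abs_def] algebra_simps)
qed

context selective_ultrapower
begin

lemma upper_estimate_of_error:
  assumes q: "1 \<le> q" and r: "0 < r" "r \<le> q" and C: "0 \<le> C" and H: "H \<in> UP q"
    and pointwise: "\<And>x y. \<bar>x + y\<bar> powr q
        \<le> \<bar>x\<bar> powr q + e x y + C * (\<bar>x\<bar> powr (q - r) * \<bar>y\<bar> powr r + \<bar>y\<bar> powr q)"
    and error: "\<And>H' s \<epsilon>. simple_approximant q H H' \<Longrightarrow> finite s \<Longrightarrow> 0 < \<epsilon> \<Longrightarrow>
      \<forall>\<^sub>F n in U. \<forall>a. (\<forall>i. \<bar>a i\<bar> \<le> 1) \<longrightarrow> integrable M01 (\<lambda>x. e (\<Sum>i\<in>s. a i * H' i x) (a n * H' n x))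
        \<and> (LINT x|M01. e (\<Sum>i\<in>s. a i * H' i x) (a n * H' n x)) \<le> \<epsilon>"
  shows "upper_estimate q r U H"
proof -
  obtain H' where H': "simple_approximant q H H'" using simple_approximant_exists[OF H q] .
  note H'_Lp = simple_approximant_Lp[OF H']
  obtain B where B: "\<And>n. lpnorm q (H' n) \<le> B" using UP_bound[OF simple_approximant_UP[OF H q H']] by blast
  have "upper_estimate q r U H'"
  proof (rule upper_estimate_of_step[OF r, of "C * max 1 B powr q"])
    fix s :: "nat set" and \<epsilon> :: real assume "finite s" "0 < \<epsilon>"
    from error[OF H' this] show "\<forall>\<^sub>F n in U. upper_step q r (C * max 1 B powr q) \<epsilon> H' s n"
    proof eventually_elim
      case (elim n)
      show ?case
        by (rule upper_step_if_error_small[OF q r C pointwise H'_Lp _ _ elim])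
          (use B in \<open>auto simp: le_max_iff_disj\<close>)
    qed
  qed (use C in simp)
  then show ?thesis
    by (rule upper_estimate_perturb[OF q r(1) _ UP_Lp[OF H] H'_Lp simple_approximant_dist[OF H']])
qed

lemma eventually_error_small:
  assumes q: "1 < q" and H': "simple_approximant q H H'" and k: "\<And>n. k n \<in> Lp q"
    and lim: "\<And>E. E \<in> sets M01 \<Longrightarrow> ((\<lambda>n. LINT x|M01. indicator E x * k n x) \<longlongrightarrow> 0) F"
    and \<phi>: "\<And>y. \<bar>\<phi> y\<bar> = \<bar>y\<bar> powr (q - 1)" "\<phi> \<in> borel_measurable borel"
    and b: "\<And>y. \<bar>b y\<bar> \<le> \<bar>y :: real\<bar>" and D: "0 < D" and s: "finite s" and \<epsilon>: "0 < \<epsilon>"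
  shows "\<forall>\<^sub>F n in F. \<forall>a. (\<forall>i. \<bar>a i\<bar> \<le> 1) \<longrightarrow>
    integrable M01 (\<lambda>x. D * (\<phi> (\<Sum>i\<in>s. a i * H' i x) * (b (a n) * k n x)))
    \<and> (LINT x|M01. D * (\<phi> (\<Sum>i\<in>s. a i * H' i x) * (b (a n) * k n x))) \<le> \<epsilon>"
proof -
  note qp = conjugate_exponentsI[OF q]
  have "\<forall>\<^sub>F n in F. \<forall>a. (\<forall>i. \<bar>a i\<bar> \<le> 1) \<longrightarrow> \<bar>LINT x|M01. \<phi> (\<Sum>i\<in>s. a i * H' i x) * k n x\<bar> \<le> \<epsilon> / D"
    using lim \<phi>(1) q \<epsilon> D
    by (intro eventually_integral_comp_sum_small[where t = "q - 1", OF s simple_approximant_simple[OF H']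
          Lp_integrable[OF k q]]) auto
  then show ?thesis
  proof eventually_elim
    case (elim n)
    show ?case
    proof (intro allI impI conjI)
      fix a :: "nat \<Rightarrow> real" assume a: "\<forall>i. \<bar>a i\<bar> \<le> 1"
      define S where "S x = (\<Sum>i\<in>s. a i * H' i x)" for x
      have S: "S \<in> Lp q" unfolding S_def using simple_approximant_Lp[OF H'] q by (intro Lp_sum Lp_scale) auto
      have "(\<lambda>x. \<phi> (S x)) \<in> Lp (q / (q - 1))"
        using Lp_measurable[OF S] Lp_integrable_powr[OF S] q \<phi>
        by (intro LpI measurable_compose[OF _ \<phi>(2)]) (auto simp: powr_powr)
      then show "integrable M01 (\<lambda>x. D * (\<phi> (\<Sum>i\<in>s. a i * H' i x) * (b (a n) * k n x)))"
        using Lp_mult_integrable[OF conjugate_exponents_sym[OF qp] _ Lp_scale[OF k]] by (simp add: S_def)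
      have "b (a n) * (LINT x|M01. \<phi> (S x) * k n x) \<le> \<bar>b (a n)\<bar> * \<bar>LINT x|M01. \<phi> (S x) * k n x\<bar>"
        unfolding abs_mult[symmetric] by (rule abs_ge_self)
      also have "\<dots> \<le> 1 * (\<epsilon> / D)"
        using a elim order_trans[OF b[of "a n"]] by (intro mult_mono) (auto simp: S_def)
      finally have "D * (b (a n) * (LINT x|M01. \<phi> (S x) * k n x)) \<le> \<epsilon>"
        using D by (simp add: pos_le_divide_eq mult.commute)
      then show "(LINT x|M01. D * (\<phi> (\<Sum>i\<in>s. a i * H' i x) * (b (a n) * k n x))) \<le> \<epsilon>"
        by (simp add: S_def mult.left_commute[of _ "b (a n)"])
    qed
  qed
qed

theorem upper_estimate_Lhat:
  assumes q: "1 < q" and H: "H \<in> Lhat q U"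
  shows "upper_estimate q (min q 2) U H"
proof -
  note qp = conjugate_exponentsI[OF q]
  have q_bounds: "1 \<le> q" and r: "0 < min q 2" "min q 2 \<le> 2" "min q 2 \<le> q" using q by auto
  obtain C where C: "0 \<le> C" "\<And>x y. \<bar>x + y\<bar> powr q \<le> \<bar>x\<bar> powr q + q * (duality_map q x * y)
      + C * (\<bar>x\<bar> powr (q - min q 2) * \<bar>y\<bar> powr min q 2 + \<bar>y\<bar> powr q)"
    using abs_add_powr_le_duality_map[OF q r(1,2)] by blast
  show ?thesis
  proof (rule upper_estimate_of_error[OF q_bounds r(1,3) C(1) Lhat_UP[OF H] C(2)])
    fix H' and s :: "nat set" and \<epsilon> :: real assume H': "simple_approximant q H H'" and s: "finite s"
      and \<epsilon>: "0 < \<epsilon>"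
    have "H' \<in> Lhat q U"
      by (rule closed_usub_UP_eq[OF closed_usub_Lhat[OF qp]
        q_bounds H simple_approximant_UP_eq[OF Lhat_UP[OF H] q_bounds H']])
    then have "((\<lambda>n. LINT x|M01. indicator E x * H' n x) \<longlongrightarrow> 0) U" if "E \<in> sets M01" for E
      using Lhat_tendsto[OF qp _ indicator_Lp[OF that]] q by (simp add: mult.commute)
    then show "\<forall>\<^sub>F n in U. \<forall>a. (\<forall>i. \<bar>a i\<bar> \<le> 1) \<longrightarrow>
        integrable M01 (\<lambda>x. q * (duality_map q (\<Sum>i\<in>s. a i * H' i x) * (a n * H' n x)))
        \<and> (LINT x|M01. q * (duality_map q (\<Sum>i\<in>s. a i * H' i x) * (a n * H' n x))) \<le> \<epsilon>"
      using q \<epsilon> s by (intro eventually_error_small[where b = "\<lambda>y. y", OF q H' simple_approximant_Lp[OF H']])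
        (auto simp: abs_duality_map)
  qed
qed

lemma L1null_abs:
  assumes "F \<in> L1null p U"
  shows "(\<lambda>n x. \<bar>F n x\<bar>) \<in> L1null p U"
proof -
  have "lpnorm p (\<lambda>x. \<bar>F n x\<bar>) = lpnorm p (F n)" for n by (simp add: lpnorm_def)
  then show ?thesis using assms by (auto simp: L1null_def UP_def Lp_def intro!: borel_measurable_abs)
qed

theorem upper_estimate_L1null:
  assumes q: "1 < q" and H: "H \<in> L1null q U"
  shows "upper_estimate q q U H"
proof -
  note qp = conjugate_exponentsI[OF q] and H_UP = L1null_UP[OF H]
  have q_bounds: "1 \<le> q" "0 < q" using q by auto
  obtain C where C: "0 \<le> C" "\<And>x y. \<bar>x + y\<bar> powr q \<le> \<bar>x\<bar> powr q + q * (duality_map q x * y)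
      + C * (\<bar>x\<bar> powr (q - 1) * \<bar>y\<bar> powr 1 + \<bar>y\<bar> powr q)"
    using abs_add_powr_le_duality_map[OF q, of 1] by auto
  have pointwise: "\<bar>x + y\<bar> powr q \<le> \<bar>x\<bar> powr q + (q + C) * (\<bar>duality_map q x\<bar> * \<bar>y\<bar>)
      + C * (\<bar>x\<bar> powr (q - q) * \<bar>y\<bar> powr q + \<bar>y\<bar> powr q)" for x y
  proof -
    have "q * (duality_map q x * y) \<le> q * (\<bar>duality_map q x\<bar> * \<bar>y\<bar>)"
      using q by (intro mult_left_mono) (auto simp: abs_mult[symmetric])
    moreover have "0 \<le> C * (\<bar>x\<bar> powr (q - q) * \<bar>y\<bar> powr q)" using C(1) by simp
    ultimately show ?thesis using C(2)[of x y] by (simp add: abs_duality_map algebra_simps)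
  qed
  show ?thesis
  proof (rule upper_estimate_of_error[OF q_bounds order_refl C(1) H_UP pointwise])
    fix H' and s :: "nat set" and \<epsilon> :: real assume H': "simple_approximant q H H'" and s: "finite s"
      and \<epsilon>: "0 < \<epsilon>"
    have "H' \<in> L1null q U"
      by (rule closed_usub_UP_eq[OF closed_usub_L1null[OF qp] q_bounds(1)
        H simple_approximant_UP_eq[OF H_UP q_bounds(1) H']])
    then have "((\<lambda>n. LINT x|M01. indicator E x * \<bar>H' n x\<bar>) \<longlongrightarrow> 0) U" if "E \<in> sets M01" for E
      using Lhat_tendsto[OF qp L1null_Lhat[OF qp L1null_abs] indicator_Lp[OF that]] q
      by (simp add: mult.commute)
    then show "\<forall>\<^sub>F n in U. \<forall>a. (\<forall>i. \<bar>a i\<bar> \<le> 1) \<longrightarrow>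
        integrable M01 (\<lambda>x. (q + C) * (\<bar>duality_map q (\<Sum>i\<in>s. a i * H' i x)\<bar> * \<bar>a n * H' n x\<bar>))
        \<and> (LINT x|M01. (q + C) * (\<bar>duality_map q (\<Sum>i\<in>s. a i * H' i x)\<bar> * \<bar>a n * H' n x\<bar>)) \<le> \<epsilon>"
      unfolding abs_mult[of "_ :: real" "H' _ _"]
      using q C(1) \<epsilon> s UP_Lp[OF L1null_UP[OF L1null_abs[OF \<open>H' \<in> L1null q U\<close>]]]
      by (intro eventually_error_small[where b = abs and \<phi> = "\<lambda>y. \<bar>duality_map q y\<bar>", OF q H'])
        (auto simp: abs_duality_map)
  qed
qed

end

section \<open>Diagonal operators\<close>

lemma sum_le_twice_if_geometric_ranks:
  fixes f :: "nat \<Rightarrow> real"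
  assumes "finite s" "0 \<le> c" "\<And>j. j \<in> s \<Longrightarrow> f j \<le> c * (1 / 2) ^ card {i \<in> s. i < j}"
  shows "sum f s \<le> 2 * c"
proof -
  have "sum f s \<le> c * (\<Sum>j\<in>s. (1 / 2) ^ card {i \<in> s. i < j})"
    unfolding sum_distrib_left using assms(3) by (rule sum_mono)
  also have "(\<Sum>j\<in>s. (1 / 2 :: real) ^ card {i \<in> s. i < j}) = (\<Sum>k<card s. (1 / 2) ^ k)"
    using assms(1)
  proof (induction s rule: finite_linorder_max_induct)
    case (insert b s)
    have "{i \<in> insert b s. i < b} = s" "\<And>j. j \<in> s \<Longrightarrow> {i \<in> insert b s. i < j} = {i \<in> s. i < j}"
      using insert(2) by force+
    moreover have "b \<notin> s" using insert(2) by blast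
    ultimately show ?case using insert by simp
  qed simp
  also have "c * \<dots> \<le> c * 2" using sum_half_powers_le[of "{..<card s}"] assms(2) by (intro mult_left_mono) auto
  finally show ?thesis by simp
qed

definition offdiagonal_sums_le :: "(nat \<Rightarrow> nat \<Rightarrow> real) \<Rightarrow> nat set \<Rightarrow> real \<Rightarrow> bool" where
  "offdiagonal_sums_le y A c \<longleftrightarrow> (\<forall>n\<in>A. \<forall>s. finite s \<longrightarrow> s \<subseteq> A - {n} \<longrightarrow> (\<Sum>m\<in>s. \<bar>y n m\<bar>) \<le> c)"

lemma offdiagonal_sums_leD:
  "offdiagonal_sums_le y A c \<Longrightarrow> n \<in> A \<Longrightarrow> finite s \<Longrightarrow> s \<subseteq> A - {n} \<Longrightarrow> (\<Sum>m\<in>s. \<bar>y n m\<bar>) \<le> c"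
  unfolding offdiagonal_sums_le_def by blast

lemma offdiagonal_sums_le_subset: "offdiagonal_sums_le y A c \<Longrightarrow> B \<subseteq> A \<Longrightarrow> offdiagonal_sums_le y B c"
  unfolding offdiagonal_sums_le_def by blast

lemma abs_double_sum_ge:
  fixes y :: "nat \<Rightarrow> nat \<Rightarrow> real"
  assumes s: "finite s" and diagonal: "\<And>n. n \<in> s \<Longrightarrow> \<bar>y n n - c\<bar> \<le> \<bar>c\<bar> / 4"
    and offdiagonal: "offdiagonal_sums_le y s (\<bar>c\<bar> / 4)"
  shows "card s * (\<bar>c\<bar> / 2) \<le> \<bar>\<Sum>n\<in>s. \<Sum>m\<in>s. y n m\<bar>"
proof -
  have "\<bar>(\<Sum>m\<in>s. y n m) - c\<bar> \<le> \<bar>c\<bar> / 2" if n: "n \<in> s" for n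
  proof -
    have "(\<Sum>m\<in>s. y n m) - c = (y n n - c) + (\<Sum>m\<in>s - {n}. y n m)" using n s by (simp add: sum.remove)
    moreover have "\<bar>\<Sum>m\<in>s - {n}. y n m\<bar> \<le> \<bar>c\<bar> / 4"
      using s by (intro order_trans[OF sum_abs offdiagonal_sums_leD[OF offdiagonal n]]) auto
    ultimately show ?thesis using diagonal[OF n] by linarith
  qed
  then have "\<bar>\<Sum>n\<in>s. (\<Sum>m\<in>s. y n m) - c\<bar> \<le> card s * (\<bar>c\<bar> / 2)"
    using order_trans[OF sum_abs sum_bounded_above[of s "\<lambda>n. \<bar>(\<Sum>m\<in>s. y n m) - c\<bar>" "\<bar>c\<bar> / 2"]] by simp
  then have "\<bar>(\<Sum>n\<in>s. \<Sum>m\<in>s. y n m) - card s * c\<bar> \<le> card s * (\<bar>c\<bar> / 2)" by (simp add: sum_subtractf)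
  moreover have "\<bar>card s * c\<bar> = card s * (\<bar>c\<bar> / 2) + card s * (\<bar>c\<bar> / 2)" by (simp add: abs_mult)
  ultimately show ?thesis by linarith
qed

lemma nonpos_if_linear_le_powr:
  fixes c :: real
  assumes "\<beta> < 1" and le: "\<And>N :: nat. real N * c \<le> K * real N powr \<beta>"
  shows "c \<le> 0"
proof (rule tendsto_lowerbound)
  have "(\<lambda>N. K * real N powr (\<beta> - 1)) \<longlonglongrightarrow> K * 0"
    using assms(1) by (intro tendsto_intros tendsto_neg_powr filterlim_real_sequentially) simp
  then show "(\<lambda>N. K * real N powr (\<beta> - 1)) \<longlonglongrightarrow> 0" by simp
  show "\<forall>\<^sub>F N in sequentially. c \<le> K * real N powr (\<beta> - 1)"
    using eventually_gt_at_top[of 0]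
  proof eventually_elim
    case (elim N)
    then show ?case using le[of N] by (simp add: powr_diff pos_le_divide_eq mult.commute)
  qed
qed simp

lemma powr_sum_le_dual:
  fixes x :: "'i \<Rightarrow> real"
  assumes rr: "conjugate_exponents r r'" and K: "0 \<le> K"
    and dual: "\<And>a. (\<Sum>n\<in>s. a n * x n) \<le> K * (\<Sum>n\<in>s. \<bar>a n\<bar> powr r') powr (1 / r')"
  shows "(\<Sum>n\<in>s. \<bar>x n\<bar> powr r) powr (1 / r) \<le> K"
proof (cases "(\<Sum>n\<in>s. \<bar>x n\<bar> powr r) = 0")
  case False
  define Q where "Q = (\<Sum>n\<in>s. \<bar>x n\<bar> powr r)"
  have Q: "0 < Q" unfolding Q_def using False sum_nonneg[of s "\<lambda>n. \<bar>x n\<bar> powr r"] by fastforce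
  have "(\<Sum>n\<in>s. \<bar>duality_map r (x n)\<bar> powr r') = Q"
    unfolding Q_def by (simp add: abs_duality_map powr_powr conjugate_exponentsD(4)[OF rr])
  moreover have "(\<Sum>n\<in>s. duality_map r (x n) * x n) = Q"
    unfolding Q_def using mult_duality_map[of _ r] by (simp add: mult.commute)
  ultimately have "Q \<le> K * Q powr (1 / r')" using dual[of "\<lambda>n. duality_map r (x n)"] by simp
  moreover have "Q = Q powr (1 / r) * Q powr (1 / r')"
    using Q rr by (simp add: powr_add[symmetric] conjugate_exponents_def)
  ultimately have "Q powr (1 / r) * Q powr (1 / r') \<le> K * Q powr (1 / r')" by simp
  then show ?thesis using Q by (simp add: Q_def)
qed (use K in simp)

lemma powr_sum_integrals_le:
  assumes pq: "conjugate_exponents p q" and rr: "conjugate_exponents r r'"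
    and G: "\<And>n. G n \<in> Lp q" and f: "f \<in> Lp p" and C: "0 \<le> C"
    and est: "\<And>a. lpnorm q (\<lambda>x. \<Sum>n\<in>s. a n * G n x) \<le> C * (\<Sum>n\<in>s. \<bar>a n\<bar> powr r') powr (1 / r')"
  shows "(\<Sum>n\<in>s. \<bar>LINT x|M01. f x * G n x\<bar> powr r) powr (1 / r) \<le> C * lpnorm p f"
proof (rule powr_sum_le_dual[OF rr])
  show "0 \<le> C * lpnorm p f" using C by simp
  fix a
  have sum_Lp: "(\<lambda>x. \<Sum>n\<in>s. a n * G n x) \<in> Lp q"
    using G conjugate_exponentsD(2)[OF pq] by (intro Lp_sum Lp_scale) auto
  have "(\<Sum>n\<in>s. a n * (LINT x|M01. f x * G n x)) = (LINT x|M01. (\<Sum>n\<in>s. a n * (f x * G n x)))"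
    using Lp_mult_integrable[OF pq f G] by (subst Bochner_Integration.integral_sum) auto
  also have "\<dots> = (LINT x|M01. f x * (\<Sum>n\<in>s. a n * G n x))" by (simp add: sum_distrib_left mult_ac)
  also have "\<dots> \<le> lpnorm p f * lpnorm q (\<lambda>x. \<Sum>n\<in>s. a n * G n x)"
    by (rule order_trans[OF abs_ge_self Holder_inequality[OF pq f sum_Lp]])
  also have "\<dots> \<le> lpnorm p f * (C * (\<Sum>n\<in>s. \<bar>a n\<bar> powr r') powr (1 / r'))"
    using est by (intro mult_left_mono) auto
  finally show "(\<Sum>n\<in>s. a n * (LINT x|M01. f x * G n x))
    \<le> C * lpnorm p f * (\<Sum>n\<in>s. \<bar>a n\<bar> powr r') powr (1 / r')"
    by (simp add: mult_ac)
qed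

lemma (in ultrapower) lpnorm_weak_limit_diff_le:
  assumes pq: "conjugate_exponents p q" and F: "F \<in> UP p" and h: "h \<in> Lp p"
    and le: "\<forall>\<^sub>F n in U. lpnorm p (\<lambda>x. F n x - h x) \<le> c"
  shows "lpnorm p (\<lambda>x. weak_limit p U F x - h x) \<le> c"
proof -
  have p: "1 \<le> p" "0 \<le> p" using conjugate_exponentsD(1)[OF pq] by auto
  note W = weak_limit_Lp[OF pq F]
  have diff_UP: "(\<lambda>n x. F n x - h x) \<in> UP p" by (rule UP_diff[OF F UP_const[OF h] p(1)])
  have "lpnorm p (\<lambda>x. weak_limit p U F x - h x) \<le> unorm p U (\<lambda>n x. F n x - h x)"
  proof (rule lpnorm_le_dual[OF pq Lp_diff[OF W h p(2)] _ unorm_nonneg[OF diff_UP]])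
    fix g assume g: "g \<in> Lp q"
    have "(LINT x|M01. (weak_limit p U F x - h x) * g x)
      = (LINT x|M01. weak_limit p U F x * g x) - (LINT x|M01. h x * g x)"
      using Lp_mult_integrable[OF pq W g] Lp_mult_integrable[OF pq h g] by (simp add: left_diff_distrib)
    also have "\<dots> = upair U (\<lambda>n x. F n x - h x) (\<lambda>n. g)"
      using integral_weak_limit[OF pq F g] upair_diff_left[OF pq F UP_const[OF h] UP_const[OF g]]
      by (simp add: upair_const)
    also have "\<dots> \<le> unorm p U (\<lambda>n x. F n x - h x) * lpnorm q g"
      using upair_bound[OF pq diff_UP UP_const[OF g]] by (simp add: unorm_const)
    finally show "(LINT x|M01. (weak_limit p U F x - h x) * g x)
      \<le> unorm p U (\<lambda>n x. F n x - h x) * lpnorm q g" .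
  qed
  also have "\<dots> \<le> c" by (rule unorm_le[OF diff_UP le])
  finally show ?thesis .
qed

definition diagonal_sum :: "nat set \<Rightarrow> useq \<Rightarrow> useq \<Rightarrow> (real \<Rightarrow> real) \<Rightarrow> useq" where
  "diagonal_sum A G H f N = (\<lambda>x. \<Sum>m\<in>A \<inter> {..<N}. (LINT y|M01. f y * G m y) * H m x)"

definition diagonal_op :: "real \<Rightarrow> nat filter \<Rightarrow> nat set \<Rightarrow> useq \<Rightarrow> useq \<Rightarrow> (real \<Rightarrow> real) \<Rightarrow> real \<Rightarrow> real" where
  "diagonal_op p U A G H f = weak_limit p U (diagonal_sum A G H f)"

lemma diagonal_sum_lin:
  assumes "conjugate_exponents p q" "\<And>m. G m \<in> Lp q" "f \<in> Lp p" "g \<in> Lp p"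
  shows "diagonal_sum A G H (\<lambda>y. a * f y + b * g y)
    = (\<lambda>N x. a * diagonal_sum A G H f N x + b * diagonal_sum A G H g N x)"
proof -
  have "(LINT y|M01. (a * f y + b * g y) * G m y)
    = a * (LINT y|M01. f y * G m y) + b * (LINT y|M01. g y * G m y)" for m
    using Lp_mult_integrable[OF assms(1,3,2), of m] Lp_mult_integrable[OF assms(1,4,2), of m]
    by (simp add: distrib_right mult.assoc)
  then show ?thesis
    by (simp add: diagonal_sum_def sum_distrib_left sum.distrib[symmetric] fun_eq_iff algebra_simps)
qed

locale diagonal_operator = ultrapower +
  fixes p q :: real and A :: "nat set" and G H :: useq and K :: real
  assumes pq: "conjugate_exponents p q" and G_Lp: "\<And>m. G m \<in> Lp q" and H_Lp: "\<And>m. H m \<in> Lp p"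
    and lpnorm_diagonal_sum_le: "\<And>f N. f \<in> Lp p \<Longrightarrow> lpnorm p (diagonal_sum A G H f N) \<le> K * lpnorm p f"
begin

lemma diagonal_sum_UP: "f \<in> Lp p \<Longrightarrow> diagonal_sum A G H f \<in> UP p"
  using conjugate_exponentsD(1)[OF pq] H_Lp lpnorm_diagonal_sum_le
  by (intro UPI[where C = "K * lpnorm p f"]) (auto simp: diagonal_sum_def intro!: Lp_sum Lp_scale)

lemma diagonal_op_Lp: "f \<in> Lp p \<Longrightarrow> diagonal_op p U A G H f \<in> Lp p"
  unfolding diagonal_op_def by (rule weak_limit_Lp[OF pq diagonal_sum_UP])

lemma diagonal_op_lin_AE:
  assumes f: "f \<in> Lp p" and g: "g \<in> Lp p"
  shows "AE x in M01. diagonal_op p U A G H (\<lambda>y. a * f y + b * g y) x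
    = a * diagonal_op p U A G H f x + b * diagonal_op p U A G H g x"
proof -
  have p: "0 < p" "0 \<le> p" using conjugate_exponentsD(1)[OF pq] by auto
  have fg: "(\<lambda>y. a * f y + b * g y) \<in> Lp p" using f g p by (intro Lp_lin) auto
  have Tfg: "(\<lambda>x. a * diagonal_op p U A G H f x + b * diagonal_op p U A G H g x) \<in> Lp p"
    using p by (intro Lp_lin diagonal_op_Lp f g) auto
  have "lpnorm p (\<lambda>x. diagonal_op p U A G H (\<lambda>y. a * f y + b * g y) x
      - (a * diagonal_op p U A G H f x + b * diagonal_op p U A G H g x)) = 0"
    unfolding diagonal_op_def[of p U A G H "\<lambda>y. a * f y + b * g y"]
  proof (rule lpnorm_weak_limit_unique[OF pq diagonal_sum_UP[OF fg] Tfg])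
    fix h assume h: "h \<in> Lp q"
    have "upair U (diagonal_sum A G H (\<lambda>y. a * f y + b * g y)) (\<lambda>n. h)
        = a * upair U (diagonal_sum A G H f) (\<lambda>n. h) + b * upair U (diagonal_sum A G H g) (\<lambda>n. h)"
      unfolding diagonal_sum_lin[OF pq G_Lp f g]
      by (rule upair_lin_left[OF pq diagonal_sum_UP[OF f] diagonal_sum_UP[OF g] UP_const[OF h]])
    also have "\<dots> = a * (LINT x|M01. diagonal_op p U A G H f x * h x) + b * (LINT x|M01. diagonal_op p U A G H g x * h x)"
      unfolding diagonal_op_def
      using integral_weak_limit[OF pq diagonal_sum_UP[OF f] h]
        integral_weak_limit[OF pq diagonal_sum_UP[OF g] h] by simp
    also have "\<dots> = (LINT x|M01. (a * diagonal_op p U A G H f x + b * diagonal_op p U A G H g x) * h x)"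
      using Lp_mult_integrable[OF pq diagonal_op_Lp[OF f] h] Lp_mult_integrable[OF pq diagonal_op_Lp[OF g] h]
      by (simp add: distrib_right mult.assoc)
    finally show "upair U (diagonal_sum A G H (\<lambda>y. a * f y + b * g y)) (\<lambda>n. h)
      = (LINT x|M01. (a * diagonal_op p U A G H f x + b * diagonal_op p U A G H g x) * h x)" .
  qed
  then show ?thesis using lpnorm_eq_0_iff[OF Lp_diff[OF diagonal_op_Lp[OF fg] Tfg p(2)] p(1)] by simp
qed

lemma diagonal_op_cong_AE:
  assumes f: "f \<in> Lp p" and g: "g \<in> Lp p" and eq: "AE x in M01. f x = g x"
  shows "diagonal_op p U A G H f = diagonal_op p U A G H g"
proof -
  have "(LINT y|M01. f y * G m y) = (LINT y|M01. g y * G m y)" for m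
  proof -
    note [measurable] = Lp_measurable[OF f] Lp_measurable[OF g] Lp_measurable[OF G_Lp]
    show ?thesis using eq by (intro integral_cong_AE) auto
  qed
  then have "diagonal_sum A G H f = diagonal_sum A G H g" by (simp add: diagonal_sum_def fun_eq_iff)
  then show ?thesis by (simp add: diagonal_op_def)
qed

lemma lpnorm_diagonal_op_le:
  assumes f: "f \<in> Lp p"
  shows "lpnorm p (diagonal_op p U A G H f) \<le> K * lpnorm p f"
  unfolding diagonal_op_def
  using lpnorm_weak_limit_le[OF pq diagonal_sum_UP[OF f]]
    unorm_le[OF diagonal_sum_UP[OF f] always_eventually[OF allI[OF lpnorm_diagonal_sum_le[OF f]]]]
  by (rule order_trans)

lemma bop_Lp_diagonal_op: "bop_Lp p (diagonal_op p U A G H)"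
  unfolding bop_Lp_def
proof (intro conjI ballI allI impI exI[of _ K])
  show "AE x in M01. diagonal_op p U A G H f x = diagonal_op p U A G H g x"
    if "f \<in> Lp p" "g \<in> Lp p" "AE x in M01. f x = g x" for f g
    using diagonal_op_cong_AE[OF that] by simp
qed (rule diagonal_op_Lp diagonal_op_lin_AE lpnorm_diagonal_op_le; assumption)+

lemma lpnorm_diagonal_op_diff_le:
  assumes f: "f \<in> Lp p" and n: "n \<in> A" and B: "0 \<le> B" "\<And>m. lpnorm p (H m) \<le> B"
    and offdiagonal: "\<And>s. finite s \<Longrightarrow> s \<subseteq> A - {n} \<Longrightarrow> (\<Sum>m\<in>s. \<bar>LINT x|M01. f x * G m x\<bar>) \<le> \<eta>"
  shows "lpnorm p (\<lambda>x. diagonal_op p U A G H f x - (LINT y|M01. f y * G n y) * H n x) \<le> \<eta> * B"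
  unfolding diagonal_op_def
proof (rule lpnorm_weak_limit_diff_le[OF pq diagonal_sum_UP[OF f] Lp_scale[OF H_Lp]])
  let ?c = "\<lambda>m. LINT y|M01. f y * G m y"
  show "\<forall>\<^sub>F N in U. lpnorm p (\<lambda>x. diagonal_sum A G H f N x - ?c n * H n x) \<le> \<eta> * B"
    using U_gt[of n]
  proof eventually_elim
    case (elim N)
    let ?s = "A \<inter> {..<N} - {n}"
    have "diagonal_sum A G H f N x - ?c n * H n x = (\<Sum>m\<in>?s. ?c m * H m x)" for x
      unfolding diagonal_sum_def using n elim by (subst sum.remove[of _ n]) auto
    then have "lpnorm p (\<lambda>x. diagonal_sum A G H f N x - ?c n * H n x) = lpnorm p (\<lambda>x. \<Sum>m\<in>?s. ?c m * H m x)"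
      by simp
    also have "\<dots> \<le> (\<Sum>m\<in>?s. \<bar>?c m\<bar> * lpnorm p (H m))"
      using conjugate_exponentsD(1)[OF pq] H_Lp by (intro lpnorm_sum_le) auto
    also have "\<dots> \<le> (\<Sum>m\<in>?s. \<bar>?c m\<bar>) * B"
      unfolding sum_distrib_right using B by (intro sum_mono mult_left_mono) auto
    also have "\<dots> \<le> \<eta> * B" using B(1) by (intro mult_right_mono offdiagonal) auto
    finally show ?case .
  qed
qed

lemma unorm_ultra_op_diagonal_op_le:
  assumes F: "F \<in> UP p" and GH: "G \<in> UP q" "H \<in> UP p" and A: "\<forall>\<^sub>F n in U. n \<in> A"
    and B: "0 \<le> B" "\<And>m. lpnorm p (H m) \<le> B" and \<eta>: "0 < \<eta>"
    and offdiagonal: "offdiagonal_sums_le (\<lambda>n m. LINT x|M01. F n x * G m x) A \<eta>"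
  shows "unorm p U (\<lambda>n x. ultra_op (diagonal_op p U A G H) F n x - upair U F G * H n x) \<le> 2 * (\<eta> * B)"
proof (rule unorm_le)
  have p: "1 \<le> p" "0 < p" using conjugate_exponentsD(1)[OF pq] by auto
  let ?T = "diagonal_op p U A G H" and ?c = "\<lambda>n. LINT x|M01. F n x * G n x"
  show "(\<lambda>n x. ultra_op ?T F n x - upair U F G * H n x) \<in> UP p"
    using p F GH bop_Lp_diagonal_op by (intro UP_diff ultra_op_UP UP_scale)
  have "\<forall>\<^sub>F n in U. dist (?c n) (upair U F G) < \<eta>"
    using pairing_tendsto[OF pq F GH(1)] \<eta> by (rule tendstoD)
  with A show "\<forall>\<^sub>F n in U. lpnorm p (\<lambda>x. ultra_op ?T F n x - upair U F G * H n x) \<le> 2 * (\<eta> * B)"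
  proof eventually_elim
    case (elim n)
    have "lpnorm p (\<lambda>x. ?T (F n) x - ?c n * H n x) \<le> \<eta> * B"
      using elim(1) offdiagonal_sums_leD[OF offdiagonal]
      by (intro lpnorm_diagonal_op_diff_le UP_Lp[OF F] B) auto
    moreover have "lpnorm p (\<lambda>x. ?c n * H n x - upair U F G * H n x) \<le> \<eta> * B"
      unfolding left_diff_distrib[symmetric] lpnorm_scale[OF p(2)]
      using elim(2) B \<eta> by (intro mult_mono) (auto simp: dist_real_def)
    ultimately show ?case
      using lpnorm_diff_trans[OF diagonal_op_Lp[OF UP_Lp[OF F]] Lp_scale[OF H_Lp] Lp_scale[OF H_Lp] p(1),
        of n "upair U F G" n "?c n" n]
      by (simp add: ultra_op_def)
  qed
qed

end

lemma (in ultrapower) diagonal_operatorI: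
  assumes pq: "conjugate_exponents p q" and rr: "conjugate_exponents r r'"
    and G: "\<And>m. G m \<in> Lp q" and H: "\<And>m. H m \<in> Lp p" and C: "0 \<le> C" "0 \<le> D"
    and upper_G: "\<And>s a. finite s \<Longrightarrow> s \<subseteq> A \<Longrightarrow> lpnorm q (\<lambda>x. \<Sum>n\<in>s. a n * G n x)
        \<le> C * (\<Sum>n\<in>s. \<bar>a n\<bar> powr r') powr (1 / r')"
    and upper_H: "\<And>s a. finite s \<Longrightarrow> s \<subseteq> A \<Longrightarrow> lpnorm p (\<lambda>x. \<Sum>n\<in>s. a n * H n x)
        \<le> D * (\<Sum>n\<in>s. \<bar>a n\<bar> powr r) powr (1 / r)"
  shows "diagonal_operator U p q A G H (D * C)"
proof
  fix f N assume f: "f \<in> Lp p"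
  let ?s = "A \<inter> {..<N}"
  have "lpnorm p (diagonal_sum A G H f N) \<le> D * (\<Sum>m\<in>?s. \<bar>LINT y|M01. f y * G m y\<bar> powr r) powr (1 / r)"
    unfolding diagonal_sum_def by (rule upper_H) auto
  also have "\<dots> \<le> D * (C * lpnorm p f)"
    using C by (intro mult_left_mono powr_sum_integrals_le[OF pq rr G f] upper_G) auto
  finally show "lpnorm p (diagonal_sum A G H f N) \<le> D * C * lpnorm p f" by simp
qed (rule pq G H)+

definition negligible_after :: "(nat \<Rightarrow> nat \<Rightarrow> real) \<Rightarrow> (nat \<Rightarrow> real) \<Rightarrow> real \<Rightarrow> nat set \<Rightarrow> nat \<Rightarrow> bool" where
  "negligible_after y w \<epsilon> s k \<longleftrightarrow> \<bar>w k\<bar> < \<epsilon> * (1 / 2) ^ card s \<and> (\<forall>m\<in>s. \<bar>y m k\<bar> < \<epsilon> * (1 / 2) ^ card s)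
    \<and> (\<forall>m\<in>s. \<bar>y k m - w m\<bar> < \<epsilon> * (1 / 2) ^ m)"

text \<open>Both above and below the diagonal, $|y_{n,m}|$ is bounded by a geometric sequence in the rank
  of $m$.\<close>
lemma offdiagonal_sums_le_if_negligible:
  assumes negligible: "\<And>s n. finite s \<Longrightarrow> s \<subseteq> A \<Longrightarrow> n \<in> A \<Longrightarrow> \<forall>m\<in>s. m < n \<Longrightarrow> negligible_after y w \<epsilon> s n"
    and \<epsilon>: "0 < \<epsilon>"
  shows "offdiagonal_sums_le y A (4 * \<epsilon>)"
  unfolding offdiagonal_sums_le_def
proof (intro ballI allI impI)
  fix n s assume n: "n \<in> A" and s: "finite s" "s \<subseteq> A - {n}"
  have "\<bar>y n j\<bar> \<le> 2 * \<epsilon> * (1 / 2) ^ card {i \<in> s. i < j}" if j: "j \<in> s" for j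
  proof (cases "n < j")
    case True
    let ?s = "insert n {i \<in> s. i < j}"
    have "negligible_after y w \<epsilon> ?s j" using n s j True by (intro negligible) auto
    then have "\<bar>y n j\<bar> \<le> \<epsilon> * (1 / 2) ^ card ?s" unfolding negligible_after_def by (blast intro: less_imp_le)
    also have "\<dots> \<le> 2 * \<epsilon> * (1 / 2) ^ card {i \<in> s. i < j}"
      using \<epsilon> s(1) by (intro mult_mono power_decreasing card_mono) auto
    finally show ?thesis .
  next
    case False
    let ?s = "{i \<in> s. i < j}"
    have "j < n" using False j s by (metis DiffD2 insertI1 linorder_neqE_nat subsetD)
    then have "negligible_after y w \<epsilon> {j} n" using n j s by (intro negligible) auto
    then have "\<bar>y n j - w j\<bar> < \<epsilon> * (1 / 2) ^ j" unfolding negligible_after_def by blast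
    moreover have "negligible_after y w \<epsilon> ?s j" using s j by (intro negligible) auto
    then have "\<bar>w j\<bar> \<le> \<epsilon> * (1 / 2) ^ card ?s" unfolding negligible_after_def by (blast intro: less_imp_le)
    moreover have "card ?s \<le> card {..<j}" by (intro card_mono) auto
    then have "\<epsilon> * (1 / 2) ^ j \<le> \<epsilon> * (1 / 2) ^ card ?s"
      using \<epsilon> by (intro mult_left_mono power_decreasing) auto
    ultimately show ?thesis by linarith
  qed
  from sum_le_twice_if_geometric_ranks[OF s(1) _ this] show "(\<Sum>m\<in>s. \<bar>y n m\<bar>) \<le> 4 * \<epsilon>" using \<epsilon> by simp
qed

context selective_ultrapower
begin

lemma offdiagonal_sums_small:
  fixes y :: "nat \<Rightarrow> nat \<Rightarrow> real"
  assumes rows: "\<And>n. ((\<lambda>m. y n m) \<longlongrightarrow> 0) U" and columns: "\<And>m. ((\<lambda>n. y n m) \<longlongrightarrow> w m) U"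
    and w: "(w \<longlongrightarrow> 0) U" and \<epsilon>: "0 < \<epsilon>"
  obtains A where "\<forall>\<^sub>F n in U. n \<in> A" "offdiagonal_sums_le y A \<epsilon>"
proof -
  have eventually_small: "\<forall>\<^sub>F k in U. \<bar>v k - l\<bar> < \<epsilon> / 4 * (1 / 2) ^ i" if "(v \<longlongrightarrow> l) U" for v l i
    using tendstoD[OF that, of "\<epsilon> / 4 * (1 / 2) ^ i"] \<epsilon> by (simp add: dist_real_def)
  have "\<forall>\<^sub>F k in U. negligible_after y w (\<epsilon> / 4) s k" if "finite s" for s
    unfolding negligible_after_def
    using eventually_small[OF w] eventually_small[OF rows] eventually_small[OF columns] that
    by (intro eventually_conj eventually_ball_finite) auto
  then obtain A where A: "\<forall>\<^sub>F n in U. n \<in> A"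
    and negligible: "\<And>s n. finite s \<Longrightarrow> s \<subseteq> A \<Longrightarrow> n \<in> A \<Longrightarrow> \<forall>m\<in>s. m < n \<Longrightarrow> negligible_after y w (\<epsilon> / 4) s n"
    using selective_finite_diagonal[where P = "negligible_after y w (\<epsilon> / 4)"] by blast
  have "offdiagonal_sums_le y A (4 * (\<epsilon> / 4))"
    by (rule offdiagonal_sums_le_if_negligible[where w = w, OF negligible]) (use \<epsilon> in auto)
  then have "offdiagonal_sums_le y A \<epsilon>" by simp
  with A show thesis by (rule that)
qed

lemma offdiagonal_pairings_small:
  assumes pq: "conjugate_exponents p q" and F: "F \<in> UP p" and G: "G \<in> Lhat q U" and \<epsilon>: "0 < \<epsilon>"
  shows "\<exists>A. (\<forall>\<^sub>F n in U. n \<in> A) \<and> offdiagonal_sums_le (\<lambda>n m. LINT x|M01. F n x * G m x) A \<epsilon>"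
proof (rule offdiagonal_sums_small[OF _ _ _ \<epsilon>])
  let ?w = "weak_limit p U F"
  note G_Lp = UP_Lp[OF Lhat_UP[OF G]]
  have null: "((\<lambda>m. LINT x|M01. f x * G m x) \<longlongrightarrow> 0) U" if "f \<in> Lp p" for f
    using Lhat_tendsto[OF conjugate_exponents_sym[OF pq] G that] by (simp add: mult.commute)
  show "((\<lambda>m. LINT x|M01. F n x * G m x) \<longlongrightarrow> 0) U" for n by (rule null[OF UP_Lp[OF F]])
  show "((\<lambda>m. LINT x|M01. ?w x * G m x) \<longlongrightarrow> 0) U" by (rule null[OF weak_limit_Lp[OF pq F]])
  show "((\<lambda>n. LINT x|M01. F n x * G m x) \<longlongrightarrow> (LINT x|M01. ?w x * G m x)) U" for m
    using pairing_tendsto[OF pq F UP_const[OF G_Lp]] integral_weak_limit[OF pq F G_Lp] by simp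
qed blast

lemma offdiagonal_pairings_small_finite:
  assumes pq: "conjugate_exponents p q" and fin: "finite \<F>" "\<F> \<subseteq> UP p" and G: "G \<in> Lhat q U" and \<epsilon>: "0 < \<epsilon>"
  shows "\<exists>A. (\<forall>\<^sub>F n in U. n \<in> A) \<and> (\<forall>F\<in>\<F>. offdiagonal_sums_le (\<lambda>n m. LINT x|M01. F n x * G m x) A \<epsilon>)"
proof -
  have "\<forall>F\<in>\<F>. \<exists>A. (\<forall>\<^sub>F n in U. n \<in> A) \<and> offdiagonal_sums_le (\<lambda>n m. LINT x|M01. F n x * G m x) A \<epsilon>"
  proof
    fix F assume "F \<in> \<F>"
    then have "F \<in> UP p" using fin(2) by blast
    then show "\<exists>A. (\<forall>\<^sub>F n in U. n \<in> A) \<and> offdiagonal_sums_le (\<lambda>n m. LINT x|M01. F n x * G m x) A \<epsilon>"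
      by (rule offdiagonal_pairings_small[OF pq _ G \<epsilon>])
  qed
  from bchoice[OF this] obtain A where A: "\<forall>F\<in>\<F>. (\<forall>\<^sub>F n in U. n \<in> A F)
      \<and> offdiagonal_sums_le (\<lambda>n m. LINT x|M01. F n x * G m x) (A F) \<epsilon>" ..
  have "\<forall>\<^sub>F n in U. n \<in> (\<Inter>F\<in>\<F>. A F)" using A fin(1) by (simp add: eventually_ball_finite)
  moreover have "offdiagonal_sums_le (\<lambda>n m. LINT x|M01. F n x * G m x) (\<Inter>F\<in>\<F>. A F) \<epsilon>" if "F \<in> \<F>" for F
    by (rule offdiagonal_sums_le_subset[OF conjunct2[OF bspec[OF A that]]]) (use that in blast)
  ultimately show ?thesis by blast
qed

text \<open>The operator is $f \mapsto \sum_{m\in A} \langle f, G_m\rangle H_m$, bounded because it factors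
  through $\ell^r$.\<close>
theorem rank_one_approximation:
  assumes pq: "conjugate_exponents p q" and rr: "conjugate_exponents r r'"
    and G: "G \<in> Lhat q U" "upper_estimate q r' U G" and H: "H \<in> UP p" "upper_estimate p r U H"
    and fin: "finite \<F>" "\<F> \<subseteq> UP p" and \<epsilon>: "0 < \<epsilon>"
  shows "\<exists>T. bop_Lp p T \<and> (\<forall>F\<in>\<F>. unorm p U (\<lambda>n x. ultra_op T F n x - upair U F G * H n x) < \<epsilon>)"
proof -
  note G_UP = Lhat_UP[OF G(1)]
  note G_Lp = UP_Lp[OF G_UP] and H_Lp = UP_Lp[OF H(1)]
  obtain AG C where AG: "\<forall>\<^sub>F n in U. n \<in> AG" "0 \<le> C"
    "\<And>s a. finite s \<Longrightarrow> s \<subseteq> AG \<Longrightarrow> lpnorm q (\<lambda>x. \<Sum>n\<in>s. a n * G n x) \<le> C * (\<Sum>n\<in>s. \<bar>a n\<bar> powr r') powr (1 / r')"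
    using upper_estimateE[OF G(2)] by blast
  obtain AH D where AH: "\<forall>\<^sub>F n in U. n \<in> AH" "0 \<le> D"
    "\<And>s a. finite s \<Longrightarrow> s \<subseteq> AH \<Longrightarrow> lpnorm p (\<lambda>x. \<Sum>n\<in>s. a n * H n x) \<le> D * (\<Sum>n\<in>s. \<bar>a n\<bar> powr r) powr (1 / r)"
    using upper_estimateE[OF H(2)] by blast
  obtain B where B: "0 \<le> B" "\<And>n. lpnorm p (H n) \<le> B" using UP_bound[OF H(1)] by blast
  define \<eta> where "\<eta> = \<epsilon> / (4 * (B + 1))"
  have \<eta>: "0 < \<eta>" using \<epsilon> B(1) by (simp add: \<eta>_def)
  have "\<eta> * B \<le> \<eta> * (B + 1)" using \<eta> by simp
  also have "\<dots> = \<epsilon> / 4" using B(1) by (simp add: \<eta>_def field_simps)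
  finally have small: "2 * (\<eta> * B) < \<epsilon>" using \<epsilon> by simp
  obtain A' where A': "\<forall>\<^sub>F n in U. n \<in> A'"
    "\<forall>F\<in>\<F>. offdiagonal_sums_le (\<lambda>n m. LINT x|M01. F n x * G m x) A' \<eta>"
    using offdiagonal_pairings_small_finite[OF pq fin G(1) \<eta>(1)] by blast
  define A where "A = AG \<inter> AH \<inter> A'"
  have A: "\<forall>\<^sub>F n in U. n \<in> A" unfolding A_def using AG(1) AH(1) A'(1) by (simp add: eventually_conj)
  interpret diagonal_operator U p q A G H "D * C"
    by (rule diagonal_operatorI[OF pq rr G_Lp H_Lp AG(2) AH(2)]; rule AG(3) AH(3); auto simp: A_def)
  have "unorm p U (\<lambda>n x. ultra_op (diagonal_op p U A G H) F n x - upair U F G * H n x) < \<epsilon>"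
    if F: "F \<in> \<F>" for F
  proof -
    have "offdiagonal_sums_le (\<lambda>n m. LINT x|M01. F n x * G m x) A \<eta>"
      by (rule offdiagonal_sums_le_subset[OF bspec[OF A'(2) F]]) (simp add: A_def)
    from unorm_ultra_op_diagonal_op_le[OF subsetD[OF fin(2) F] G_UP H(1) A B \<eta> this] small show ?thesis
      by linarith
  qed
  then show ?thesis using bop_Lp_diagonal_op by blast
qed

lemma abs_sum_pairings_le:
  assumes pq: "conjugate_exponents p q"
    and T: "bop_Lp p T" "\<And>f. f \<in> Lp p \<Longrightarrow> lpnorm p (T f) \<le> K * lpnorm p f" "0 \<le> K"
    and F: "\<And>n. F n \<in> Lp p" "lpnorm p (\<lambda>x. \<Sum>n\<in>s. F n x) \<le> B"
    and G: "\<And>n. G n \<in> Lp q" "lpnorm q (\<lambda>x. \<Sum>n\<in>s. G n x) \<le> C" and s: "finite s"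
  shows "\<bar>\<Sum>n\<in>s. \<Sum>m\<in>s. LINT x|M01. T (F n) x * G m x\<bar> \<le> (K * B) * C"
proof -
  have p: "0 \<le> p" and q: "0 \<le> q" using conjugate_exponentsD(1,2)[OF pq] by auto
  let ?F = "\<lambda>x. \<Sum>n\<in>s. F n x" and ?TF = "\<lambda>x. \<Sum>n\<in>s. T (F n) x" and ?G = "\<lambda>x. \<Sum>n\<in>s. G n x"
  note TF_Lp = bop_Lp_Lp[OF T(1) F(1)]
  have sums: "?F \<in> Lp p" "?TF \<in> Lp p" "?G \<in> Lp q" using F(1) TF_Lp G(1) p q by (auto intro!: Lp_sum)
  have "lpnorm p ?TF = lpnorm p (T ?F)"
    by (intro lpnorm_cong_AE[symmetric] bop_Lp_sum_AE[OF T(1) p s F(1)] Lp_measurable[OF sums(2)]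
        Lp_measurable[OF bop_Lp_Lp[OF T(1) sums(1)]])
  also have "\<dots> \<le> K * B" using T(2)[OF sums(1)] mult_left_mono[OF F(2) T(3)] by linarith
  finally have TF: "lpnorm p ?TF \<le> K * B" .
  have "(\<Sum>n\<in>s. \<Sum>m\<in>s. LINT x|M01. T (F n) x * G m x) = (LINT x|M01. ?TF x * ?G x)"
    unfolding sum_product using Lp_mult_integrable[OF pq TF_Lp G(1)]
    by (subst Bochner_Integration.integral_sum)
      (auto intro!: Bochner_Integration.integrable_sum simp: Bochner_Integration.integral_sum)
  also have "\<bar>\<dots>\<bar> \<le> lpnorm p ?TF * lpnorm q ?G" by (rule Holder_inequality[OF pq sums(2,3)])
  also have "\<dots> \<le> (K * B) * C" using TF G(2) by (intro mult_mono order_trans[OF lpnorm_nonneg TF]) auto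
  finally show ?thesis .
qed

text \<open>Averaging over $N$ indices: off-diagonal pairings are negligible, so the double sum is of
  order $N$, while the upper estimates bound it by a multiple of $N^{1/r + 1/r'}$.\<close>
theorem upair_ultra_op_eq_0:
  assumes pq: "conjugate_exponents p q" and T: "bop_Lp p T"
    and F: "F \<in> UP p" "upper_estimate p r U F" and G: "G \<in> Lhat q U" "upper_estimate q r' U G"
    and r: "1 / r + 1 / r' < 1"
  shows "upair U (ultra_op T F) G = 0"
proof (rule ccontr)
  define c where "c = upair U (ultra_op T F) G"
  define y where "y n m = (LINT x|M01. T (F n) x * G m x)" for n m
  note TF = ultra_op_UP[OF T F(1)]
  assume "upair U (ultra_op T F) G \<noteq> 0"
  then have c: "0 < \<bar>c\<bar> / 4" by (simp add: c_def)
  obtain A where A: "\<forall>\<^sub>F n in U. n \<in> A" "offdiagonal_sums_le y A (\<bar>c\<bar> / 4)"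
    using offdiagonal_pairings_small[OF pq TF G(1) c] unfolding y_def ultra_op_def by blast
  obtain AF C where AF: "\<forall>\<^sub>F n in U. n \<in> AF" "0 \<le> C"
    "\<And>s a. finite s \<Longrightarrow> s \<subseteq> AF \<Longrightarrow> lpnorm p (\<lambda>x. \<Sum>n\<in>s. a n * F n x) \<le> C * (\<Sum>n\<in>s. \<bar>a n\<bar> powr r) powr (1 / r)"
    using upper_estimateE[OF F(2)] by blast
  obtain AG D where AG: "\<forall>\<^sub>F n in U. n \<in> AG" "0 \<le> D"
    "\<And>s a. finite s \<Longrightarrow> s \<subseteq> AG \<Longrightarrow> lpnorm q (\<lambda>x. \<Sum>n\<in>s. a n * G n x) \<le> D * (\<Sum>n\<in>s. \<bar>a n\<bar> powr r') powr (1 / r')"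
    using upper_estimateE[OF G(2)] by blast
  obtain K where K: "0 \<le> K" "\<And>f. f \<in> Lp p \<Longrightarrow> lpnorm p (T f) \<le> K * lpnorm p f" using bop_Lp_bound[OF T] by blast
  have "\<forall>\<^sub>F n in U. dist (y n n) c < \<bar>c\<bar> / 4"
    using pairing_tendsto[OF pq TF Lhat_UP[OF G(1)]] c unfolding y_def c_def ultra_op_def by (rule tendstoD)
  with A(1) AF(1) AG(1) have "\<forall>\<^sub>F n in U. n \<in> {n \<in> A \<inter> AF \<inter> AG. \<bar>y n n - c\<bar> < \<bar>c\<bar> / 4}"
    by eventually_elim (simp add: dist_real_def)
  then have inf: "infinite {n \<in> A \<inter> AF \<inter> AG. \<bar>y n n - c\<bar> < \<bar>c\<bar> / 4}" by (rule U_infinite)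
  have "real N * (\<bar>c\<bar> / 2) \<le> K * C * D * real N powr (1 / r + 1 / r')" for N
  proof -
    obtain s where s: "finite s" "card s = N" "s \<subseteq> {n \<in> A \<inter> AF \<inter> AG. \<bar>y n n - c\<bar> < \<bar>c\<bar> / 4}"
      using infinite_arbitrarily_large[OF inf, of N] by blast
    have "card s * (\<bar>c\<bar> / 2) \<le> \<bar>\<Sum>n\<in>s. \<Sum>m\<in>s. y n m\<bar>"
      using s by (intro abs_double_sum_ge offdiagonal_sums_le_subset[OF A(2)]) (auto intro: less_imp_le)
    also have "\<dots> \<le> (K * (C * real N powr (1 / r))) * (D * real N powr (1 / r'))"
      unfolding y_def using AF(3)[of s "\<lambda>n. 1"] AG(3)[of s "\<lambda>n. 1"] s
      by (intro abs_sum_pairings_le[OF pq T K(2,1) UP_Lp[OF F(1)] _ UP_Lp[OF Lhat_UP[OF G(1)]]]) auto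
    finally show ?thesis using s(2) by (simp add: powr_add mult_ac)
  qed
  from nonpos_if_linear_le_powr[OF r this] c show False by simp
qed

end
section \<open>Invariant subspaces and the weak operator closure\<close>

lemma sum_mem_linear_set:
  fixes W :: "('i \<Rightarrow> real) set"
  assumes zero: "(\<lambda>i. 0) \<in> W" and lin: "\<And>w w' a b. w \<in> W \<Longrightarrow> w' \<in> W \<Longrightarrow> (\<lambda>i. a * w i + b * w' i) \<in> W"
    and \<omega>: "\<And>j. j \<in> J \<Longrightarrow> \<omega> j \<in> W"
  shows "(\<lambda>i. \<Sum>j\<in>J. c j * \<omega> j i) \<in> W"
  using \<omega>
proof (induction J rule: infinite_finite_induct)
  case (insert j J)
  then have "(\<lambda>i. c j * \<omega> j i + 1 * (\<Sum>j\<in>J. c j * \<omega> j i)) \<in> W" by (intro lin) auto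
  then show ?case using insert by simp
qed (simp_all add: zero)

lemma interpolating_functions_insert:
  fixes W :: "('i \<Rightarrow> real) set"
  assumes zero: "(\<lambda>i. 0) \<in> W" and lin: "\<And>w w' a b. w \<in> W \<Longrightarrow> w' \<in> W \<Longrightarrow> (\<lambda>i. a * w i + b * w' i) \<in> W"
    and \<nu>: "\<nu> \<in> W" "\<nu> v = 1" and J: "finite J" "v \<notin> J"
    and \<omega>: "\<forall>j\<in>J. \<omega> j \<in> {w \<in> W. w v = 0}"
    and interpolates: "\<forall>w\<in>{w \<in> W. w v = 0}. \<forall>i\<in>I. w i = (\<Sum>j\<in>J. \<omega> j i * w j)"
  defines "\<omega>' \<equiv> (\<lambda>j. if j = v then (\<lambda>i. 1 * \<nu> i + (- 1) * (\<Sum>j\<in>J. \<nu> j * \<omega> j i)) else \<omega> j)"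
  shows "(\<forall>j\<in>insert v J. \<omega>' j \<in> W) \<and> (\<forall>w\<in>W. \<forall>i\<in>insert v I. w i = (\<Sum>j\<in>insert v J. \<omega>' j i * w j))"
proof (intro conjI ballI)
  have "(\<lambda>i. \<Sum>j\<in>J. \<nu> j * \<omega> j i) \<in> W" using \<omega> by (intro sum_mem_linear_set[OF zero lin]) auto
  then have "(\<lambda>i. 1 * \<nu> i + (- 1) * (\<Sum>j\<in>J. \<nu> j * \<omega> j i)) \<in> W" by (rule lin[OF \<nu>(1)])
  then show "\<omega>' j \<in> W" if "j \<in> insert v J" for j using that \<omega> by (auto simp: \<omega>'_def)
next
  fix w i assume w: "w \<in> W" and i: "i \<in> insert v I"
  have "(\<Sum>j\<in>insert v J. \<omega>' j i * w j) = w v * (\<nu> i - (\<Sum>j\<in>J. \<nu> j * \<omega> j i)) + (\<Sum>j\<in>J. \<omega> j i * w j)"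
    using J by (simp add: \<omega>'_def) (rule sum.cong, auto)
  also have "\<dots> = w i"
  proof (cases "i = v")
    case True
    have "(\<Sum>j\<in>J. \<nu> j * \<omega> j v) = 0" "(\<Sum>j\<in>J. \<omega> j v * w j) = 0" using \<omega> by (auto intro!: sum.neutral)
    then show ?thesis using True \<nu>(2) by simp
  next
    case False
    have "(\<lambda>i. 1 * w i + (- w v) * \<nu> i) \<in> {w \<in> W. w v = 0}" using lin[OF w \<nu>(1), of 1 "- w v"] \<nu>(2) by simp
    moreover have "i \<in> I" using i False by simp
    ultimately have "1 * w i + (- w v) * \<nu> i = (\<Sum>j\<in>J. \<omega> j i * (1 * w j + (- w v) * \<nu> j))"
      by (rule bspec[OF bspec[OF interpolates]])
    then show ?thesis by (simp add: algebra_simps sum.distrib sum_subtractf sum_distrib_left)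
  qed
  finally show "w i = (\<Sum>j\<in>insert v J. \<omega>' j i * w j)" ..
qed

lemma interpolating_functions:
  fixes W :: "('i \<Rightarrow> real) set"
  assumes "finite I" "(\<lambda>i. 0) \<in> W" "\<And>w w' a b. w \<in> W \<Longrightarrow> w' \<in> W \<Longrightarrow> (\<lambda>i. a * w i + b * w' i) \<in> W"
  shows "\<exists>J\<subseteq>I. \<exists>\<omega>. (\<forall>j\<in>J. \<omega> j \<in> W) \<and> (\<forall>w\<in>W. \<forall>i\<in>I. w i = (\<Sum>j\<in>J. \<omega> j i * w j))"
  using assms
proof (induction I arbitrary: W rule: finite_induct)
  case empty
  show ?case by (rule exI[of _ "{}"]) simp
next
  case (insert v I W)
  note zero = insert.prems(1) and lin = insert.prems(2)
  show ?case
  proof (cases "\<forall>w\<in>W. w v = 0")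
    case True
    obtain J \<omega> where J: "J \<subseteq> I" and \<omega>: "\<forall>j\<in>J. \<omega> j \<in> W" "\<forall>w\<in>W. \<forall>i\<in>I. w i = (\<Sum>j\<in>J. \<omega> j i * w j)"
      using insert.IH[OF zero lin] by blast
    have "w v = (\<Sum>j\<in>J. \<omega> j v * w j)" if "w \<in> W" for w
      using bspec[OF True that] bspec[OF True bspec[OF \<omega>(1)]] by simp
    with \<omega>(2) have "\<forall>w\<in>W. \<forall>i\<in>insert v I. w i = (\<Sum>j\<in>J. \<omega> j i * w j)" by blast
    with J \<omega>(1) show ?thesis by blast
  next
    case False
    then obtain w where w: "w \<in> W" "w v \<noteq> 0" by blast
    define \<nu> where "\<nu> = (\<lambda>i. (1 / w v) * w i + 0 * w i)"
    have \<nu>: "\<nu> \<in> W" "\<nu> v = 1" using lin[OF w(1) w(1), of "1 / w v" 0] w(2) by (auto simp: \<nu>_def)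
    let ?W = "{w \<in> W. w v = 0}"
    have zero_lin: "(\<lambda>i. 0) \<in> ?W" "\<And>w w' a b. w \<in> ?W \<Longrightarrow> w' \<in> ?W \<Longrightarrow> (\<lambda>i. a * w i + b * w' i) \<in> ?W"
      using zero lin by auto
    obtain J \<omega> where J: "J \<subseteq> I" and \<omega>: "\<forall>j\<in>J. \<omega> j \<in> ?W" "\<forall>w\<in>?W. \<forall>i\<in>I. w i = (\<Sum>j\<in>J. \<omega> j i * w j)"
      using insert.IH[OF zero_lin] by blast
    have "finite J" "v \<notin> J" using finite_subset[OF J insert.hyps(1)] J insert.hyps(2) by blast+
    note interpolates = interpolating_functions_insert[OF zero lin \<nu> this \<omega>]
    have "insert v J \<subseteq> insert v I" using J by blast
    then show ?thesis by (intro exI[of _ "insert v J"] conjI) (assumption, rule exI, rule interpolates)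
  qed
qed

definition approximable :: "real \<Rightarrow> nat filter \<Rightarrow> (useq \<Rightarrow> useq) \<Rightarrow> bool" where
  "approximable p U S \<longleftrightarrow> (\<forall>\<F> \<epsilon>. finite \<F> \<longrightarrow> \<F> \<subseteq> UP p \<longrightarrow> 0 < \<epsilon> \<longrightarrow>
     (\<exists>T. bop_Lp p T \<and> (\<forall>F\<in>\<F>. unorm p U (\<lambda>n x. ultra_op T F n x - S F n x) < \<epsilon>)))"

definition rank_one :: "nat filter \<Rightarrow> useq \<Rightarrow> useq \<Rightarrow> useq \<Rightarrow> useq" where
  "rank_one U G H F = (\<lambda>n x. upair U F G * H n x)"

definition finite_rank :: "nat filter \<Rightarrow> useq set \<Rightarrow> (useq \<Rightarrow> useq) \<Rightarrow> (useq \<Rightarrow> useq) \<Rightarrow> useq \<Rightarrow> useq" where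
  "finite_rank U J G H F = (\<lambda>n x. \<Sum>j\<in>J. rank_one U (G j) (H j) F n x)"

text \<open>Approximating $S$ amounts to finding residuals that vanish on prescribed vectors.\<close>
definition residual :: "real \<Rightarrow> nat filter \<Rightarrow> (useq \<Rightarrow> useq) \<Rightarrow> (useq \<Rightarrow> useq) \<Rightarrow> bool" where
  "residual p U S R \<longleftrightarrow> bop_U p U R \<and> approximable p U (\<lambda>F n x. S F n x - R F n x)"

definition invariant_usub :: "real \<Rightarrow> nat filter \<Rightarrow> useq set \<Rightarrow> bool" where
  "invariant_usub p U X \<longleftrightarrow> closed_usub p U X \<and> (\<forall>T. bop_Lp p T \<longrightarrow> invariant_under (ultra_op T) X)"

definition hat_annihilator :: "real \<Rightarrow> nat filter \<Rightarrow> useq set \<Rightarrow> useq set" where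
  "hat_annihilator p U \<G> = {F \<in> Lhat p U. \<forall>G\<in>\<G>. upair U F G = 0}"

lemma subspace_sumI:
  assumes "F \<in> UP p" "G \<in> X" "H \<in> Y" "ueq p U F (\<lambda>n x. G n x + H n x)"
  shows "F \<in> subspace_sum p U X Y"
  unfolding subspace_sum_def
  by (intro CollectI conjI assms(1) bexI[where x = G] bexI[where x = H] assms(2-4))

lemma subspace_sum_commute: "subspace_sum p U X Y = subspace_sum p U Y X"
proof -
  have "F \<in> subspace_sum p U Y X" if F: "F \<in> subspace_sum p U X Y" for F X Y
  proof -
    obtain G H where GH: "F \<in> UP p" "G \<in> X" "H \<in> Y" "ueq p U F (\<lambda>n x. G n x + H n x)"
      using F unfolding subspace_sum_def by blast
    have "ueq p U F (\<lambda>n x. H n x + G n x)" using GH(4) by (simp add: add.commute)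
    then show ?thesis by (rule subspace_sumI[OF GH(1,3,2)])
  qed
  then show ?thesis by blast
qed

context ultrapower
begin

lemma bop_UI:
  assumes p: "1 \<le> p" and UP: "\<And>F. F \<in> UP p \<Longrightarrow> S F \<in> UP p"
    and cong: "\<And>F G. UP_eq p U F G \<Longrightarrow> UP_eq p U (S F) (S G)"
    and lin: "\<And>F G a b. F \<in> UP p \<Longrightarrow> G \<in> UP p \<Longrightarrow>
      UP_eq p U (S (\<lambda>n x. a * F n x + b * G n x)) (\<lambda>n x. a * S F n x + b * S G n x)"
    and bound: "\<And>F. F \<in> UP p \<Longrightarrow> unorm p U (S F) \<le> C * unorm p U F"
  shows "bop_U p U S"
  unfolding bop_U_def
proof (intro conjI ballI allI impI exI[of _ C] UP bound)
  show "ueq p U (S F) (S G)" if "F \<in> UP p" "G \<in> UP p" "ueq p U F G" for F G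
    using cong[of F G] that by (simp add: UP_eq_ueq[OF p] UP)
  show "ueq p U (S (\<lambda>n x. a * F n x + b * G n x)) (\<lambda>n x. a * S F n x + b * S G n x)"
    if "F \<in> UP p" "G \<in> UP p" for F G a b
    using lin[OF that] that by (simp add: UP_eq_ueq[OF p] UP UP_lin[OF _ _ p])
qed

lemma bop_U_bound:
  assumes "bop_U p U S"
  shows "\<exists>C\<ge>0. \<forall>F\<in>UP p. unorm p U (S F) \<le> C * unorm p U F"
proof -
  obtain C where C: "\<forall>F\<in>UP p. unorm p U (S F) \<le> C * unorm p U F" using assms unfolding bop_U_def by blast
  have "unorm p U (S F) \<le> \<bar>C\<bar> * unorm p U F" if "F \<in> UP p" for F
    using order_trans[OF bspec[OF C that] mult_right_mono[OF abs_ge_self unorm_nonneg[OF that]]] .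
  then show ?thesis by (intro exI[of _ "\<bar>C\<bar>"]) auto
qed

lemma bop_U_combination:
  assumes p: "1 \<le> p" and S: "bop_U p U S" and T: "bop_U p U T"
  shows "bop_U p U (\<lambda>F n x. a * S F n x + b * T F n x)"
proof -
  note UP = bop_U_UP[OF S] bop_U_UP[OF T]
  obtain C D where C: "0 \<le> C" "\<forall>F\<in>UP p. unorm p U (S F) \<le> C * unorm p U F"
    and D: "0 \<le> D" "\<forall>F\<in>UP p. unorm p U (T F) \<le> D * unorm p U F"
    using bop_U_bound[OF S] bop_U_bound[OF T] by auto
  show ?thesis
  proof (rule bop_UI[OF p])
    show "(\<lambda>n x. a * S F n x + b * T F n x) \<in> UP p" if "F \<in> UP p" for F using that p by (intro UP_lin UP)
    show "UP_eq p U (\<lambda>n x. a * S F n x + b * T F n x) (\<lambda>n x. a * S G n x + b * T G n x)"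
      if "UP_eq p U F G" for F G
      using that p by (intro UP_eq_lin bop_U_cong[OF S] bop_U_cong[OF T])
    show "UP_eq p U (\<lambda>n x. a * S (\<lambda>n x. c * F n x + d * G n x) n x + b * T (\<lambda>n x. c * F n x + d * G n x) n x)
        (\<lambda>n x. c * (a * S F n x + b * T F n x) + d * (a * S G n x + b * T G n x))"
      if "F \<in> UP p" "G \<in> UP p" for F G c d
      using UP_eq_lin[OF p bop_U_lin[OF S p that, of c d] bop_U_lin[OF T p that, of c d], of a b]
      by (simp add: algebra_simps)
    show "unorm p U (\<lambda>n x. a * S F n x + b * T F n x) \<le> (\<bar>a\<bar> * C + \<bar>b\<bar> * D) * unorm p U F"
      if F: "F \<in> UP p" for F
    proof -
      have "unorm p U (\<lambda>n x. a * S F n x + b * T F n x) \<le> \<bar>a\<bar> * unorm p U (S F) + \<bar>b\<bar> * unorm p U (T F)"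
        using F p by (intro unorm_lin_le UP)
      also have "\<dots> \<le> \<bar>a\<bar> * (C * unorm p U F) + \<bar>b\<bar> * (D * unorm p U F)"
        using C(2) D(2) F by (intro add_mono mult_left_mono) auto
      finally show ?thesis by (simp add: algebra_simps)
    qed
  qed
qed

lemma rank_one_UP: "1 \<le> p \<Longrightarrow> H \<in> UP p \<Longrightarrow> rank_one U G H F \<in> UP p"
  unfolding rank_one_def by (rule UP_scale)

lemma bop_U_rank_one:
  assumes pq: "conjugate_exponents p q" and G: "G \<in> UP q" and H: "H \<in> UP p"
  shows "bop_U p U (rank_one U G H)"
proof (rule bop_UI)
  show p: "1 \<le> p" using conjugate_exponentsD(1)[OF pq] by simp
  show UP: "rank_one U G H F \<in> UP p" for F by (rule rank_one_UP[OF p H])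
  show "UP_eq p U (rank_one U G H F) (rank_one U G H F')" if "UP_eq p U F F'" for F F'
  proof -
    have "upair U F G = upair U F' G"
      using that p by (intro upair_ueq_left[OF pq _ _ G]) (auto simp: UP_eq_def ueq_iff)
    then show ?thesis using UP_eq_refl[OF UP, of F'] by (simp add: rank_one_def)
  qed
  show "UP_eq p U (rank_one U G H (\<lambda>n x. a * F n x + b * F' n x))
    (\<lambda>n x. a * rank_one U G H F n x + b * rank_one U G H F' n x)"
    if "F \<in> UP p" "F' \<in> UP p" for F F' a b
  proof -
    have "rank_one U G H (\<lambda>n x. a * F n x + b * F' n x)
      = (\<lambda>n x. a * rank_one U G H F n x + b * rank_one U G H F' n x)"
      by (simp add: rank_one_def upair_lin_left[OF pq that G] algebra_simps)
    then show ?thesis using UP_eq_refl[OF UP, of "\<lambda>n x. a * F n x + b * F' n x"] by simp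
  qed
  show "unorm p U (rank_one U G H F) \<le> (unorm q U G * unorm p U H) * unorm p U F" if "F \<in> UP p" for F
    unfolding rank_one_def unorm_scale[OF H p]
    using mult_right_mono[OF upair_bound[OF pq that G] unorm_nonneg[OF H]] by (simp add: mult_ac)
qed

lemma finite_rank_UP:
  "1 \<le> p \<Longrightarrow> (\<And>j. j \<in> J \<Longrightarrow> H j \<in> UP p) \<Longrightarrow> finite_rank U J G H F \<in> UP p"
  unfolding finite_rank_def by (intro UP_sum rank_one_UP) auto

lemma bop_U_finite_rank:
  assumes pq: "conjugate_exponents p q" and J: "finite J"
    and GH: "\<And>j. j \<in> J \<Longrightarrow> G j \<in> UP q" "\<And>j. j \<in> J \<Longrightarrow> H j \<in> UP p"
  shows "bop_U p U (finite_rank U J G H)"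
  using J GH
proof (induction J rule: finite_induct)
  case empty
  have p: "1 \<le> p" using conjugate_exponentsD(1)[OF pq] by simp
  show ?case
    using bop_U_ultra_op[OF bop_Lp_zero[OF p] p] by (simp add: finite_rank_def[abs_def] ultra_op_def[abs_def])
next
  case (insert j J)
  have p: "1 \<le> p" using conjugate_exponentsD(1)[OF pq] by simp
  have "bop_U p U (\<lambda>F n x. 1 * rank_one U (G j) (H j) F n x + 1 * finite_rank U J G H F n x)"
    using insert by (intro bop_U_combination[OF p] bop_U_rank_one[OF pq]) auto
  then show ?case using insert(1,2) by (simp add: finite_rank_def[abs_def])
qed

lemma approximable_zero:
  assumes p: "1 \<le> p"
  shows "approximable p U (\<lambda>F n x. 0)"
  unfolding approximable_def
proof (intro allI impI)
  fix \<F> :: "useq set" and \<epsilon> :: real assume "0 < \<epsilon>"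
  then show "\<exists>T. bop_Lp p T \<and> (\<forall>F\<in>\<F>. unorm p U (\<lambda>n x. ultra_op T F n x - 0) < \<epsilon>)"
    using bop_Lp_zero[OF p] by (intro exI[of _ "\<lambda>f x. 0"]) (simp add: ultra_op_def unorm_const)
qed

lemma approximable_add:
  assumes p: "1 \<le> p" and A: "approximable p U A" and B: "approximable p U B"
    and A_UP: "\<And>F. F \<in> UP p \<Longrightarrow> A F \<in> UP p" and B_UP: "\<And>F. F \<in> UP p \<Longrightarrow> B F \<in> UP p"
  shows "approximable p U (\<lambda>F n x. A F n x + B F n x)"
  unfolding approximable_def
proof (intro allI impI)
  fix \<F> :: "useq set" and \<epsilon> :: real assume f: "finite \<F>" "\<F> \<subseteq> UP p" "0 < \<epsilon>"
  then have e: "0 < \<epsilon> / 2" by simp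
  obtain S where S: "bop_Lp p S" "\<forall>F\<in>\<F>. unorm p U (\<lambda>n x. ultra_op S F n x - A F n x) < \<epsilon> / 2"
    using A f e unfolding approximable_def by blast
  obtain T where T: "bop_Lp p T" "\<forall>F\<in>\<F>. unorm p U (\<lambda>n x. ultra_op T F n x - B F n x) < \<epsilon> / 2"
    using B f e unfolding approximable_def by blast
  have "unorm p U (\<lambda>n x. ultra_op (\<lambda>f x. S f x + T f x) F n x - (A F n x + B F n x)) < \<epsilon>" if F: "F \<in> \<F>" for F
  proof -
    have F_UP: "F \<in> UP p" using F f by blast
    have "(\<lambda>n x. ultra_op (\<lambda>f x. S f x + T f x) F n x - (A F n x + B F n x))
      = (\<lambda>n x. (ultra_op S F n x - A F n x) + (ultra_op T F n x - B F n x))"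
      by (simp add: ultra_op_def algebra_simps)
    moreover have "unorm p U (\<lambda>n x. (ultra_op S F n x - A F n x) + (ultra_op T F n x - B F n x)) \<le>
      unorm p U (\<lambda>n x. ultra_op S F n x - A F n x) + unorm p U (\<lambda>n x. ultra_op T F n x - B F n x)"
      using F_UP by (intro unorm_triangle UP_diff ultra_op_UP S T A_UP B_UP p)
    ultimately show ?thesis using S(2) T(2) F by fastforce
  qed
  then show "\<exists>T. bop_Lp p T \<and> (\<forall>F\<in>\<F>. unorm p U (\<lambda>n x. ultra_op T F n x - (A F n x + B F n x)) < \<epsilon>)"
    using bop_Lp_add[OF S(1) T(1) p] by blast
qed

lemma approximable_finite_rank:
  assumes p: "1 \<le> p" and J: "finite J" and H: "\<And>j. j \<in> J \<Longrightarrow> H j \<in> UP p"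
    and GH: "\<And>j. j \<in> J \<Longrightarrow> approximable p U (rank_one U (G j) (H j))"
  shows "approximable p U (finite_rank U J G H)"
  using J H GH
proof (induction J rule: finite_induct)
  case empty
  then show ?case using approximable_zero[OF p] by (simp add: finite_rank_def[abs_def])
next
  case (insert j J)
  have "approximable p U (\<lambda>F n x. rank_one U (G j) (H j) F n x + finite_rank U J G H F n x)"
    using insert by (intro approximable_add[OF p] rank_one_UP finite_rank_UP p) auto
  then show ?case using insert(1,2) by (simp add: finite_rank_def[abs_def])
qed

lemma approximable_rank_one_const:
  assumes pq: "conjugate_exponents p q" and g: "g \<in> Lp q" and h: "h \<in> Lp p"
  shows "approximable p U (rank_one U (\<lambda>n. g) (\<lambda>n. h))"
  unfolding approximable_def
proof (intro allI impI)
  fix \<F> :: "useq set" and \<epsilon> :: real assume f: "finite \<F>" "\<F> \<subseteq> UP p" "0 < \<epsilon>"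
  have p: "0 < p" using conjugate_exponentsD(1)[OF pq] by simp
  let ?T = "\<lambda>f x. (LINT y|M01. f y * g y) * h x"
  have "unorm p U (\<lambda>n x. ultra_op ?T F n x - rank_one U (\<lambda>n. g) (\<lambda>n. h) F n x) = 0" if F: "F \<in> UP p" for F
  proof -
    have "((\<lambda>n. LINT y|M01. F n y * g y) \<longlongrightarrow> upair U F (\<lambda>n. g)) U"
      by (rule pairing_tendsto[OF pq F UP_const[OF g]])
    then have "((\<lambda>n. \<bar>(LINT y|M01. F n y * g y) - upair U F (\<lambda>n. g)\<bar> * lpnorm p h)
      \<longlongrightarrow> \<bar>upair U F (\<lambda>n. g) - upair U F (\<lambda>n. g)\<bar> * lpnorm p h) U"
      by (intro tendsto_intros)
    moreover have "lpnorm p (\<lambda>x. ultra_op ?T F n x - rank_one U (\<lambda>n. g) (\<lambda>n. h) F n x)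
      = \<bar>(LINT y|M01. F n y * g y) - upair U F (\<lambda>n. g)\<bar> * lpnorm p h" for n
      using lpnorm_scale[OF p, of "(LINT y|M01. F n y * g y) - upair U F (\<lambda>n. g)" h]
      by (simp add: ultra_op_def rank_one_def left_diff_distrib)
    ultimately show ?thesis unfolding unorm_def by (intro LimI) simp
  qed
  then show "\<exists>T. bop_Lp p T
    \<and> (\<forall>F\<in>\<F>. unorm p U (\<lambda>n x. ultra_op T F n x - rank_one U (\<lambda>n. g) (\<lambda>n. h) F n x) < \<epsilon>)"
    using bop_Lp_rank_one[OF pq g h] f by (intro exI[of _ ?T]) auto
qed

lemma approximable_rank_one_closed:
  assumes pq: "conjugate_exponents p q" and G: "G \<in> UP q" and H: "H \<in> UP p"
    and cl: "\<And>\<delta>. 0 < \<delta> \<Longrightarrow> \<exists>H'\<in>UP p. approximable p U (rank_one U G H') \<and> unorm p U (\<lambda>n x. H n x - H' n x) < \<delta>"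
  shows "approximable p U (rank_one U G H)"
  unfolding approximable_def
proof (intro allI impI)
  fix \<F> :: "useq set" and \<epsilon> :: real assume f: "finite \<F>" "\<F> \<subseteq> UP p" "0 < \<epsilon>"
  have p: "1 \<le> p" using conjugate_exponentsD(1)[OF pq] by simp
  define K where "K = (\<Sum>F\<in>\<F>. \<bar>upair U F G\<bar>) + 1"
  have K: "0 < K" unfolding K_def by (intro add_nonneg_pos sum_nonneg) auto
  have KF: "\<bar>upair U F G\<bar> \<le> K" if "F \<in> \<F>" for F
    using member_le_sum[OF that, of "\<lambda>F. \<bar>upair U F G\<bar>"] f by (simp add: K_def)
  have e: "0 < \<epsilon> / 2" "0 < \<epsilon> / (2 * K)" using f K by auto
  obtain H'
    where H': "H' \<in> UP p" "approximable p U (rank_one U G H')"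
      "unorm p U (\<lambda>n x. H n x - H' n x) < \<epsilon> / (2 * K)"
    using cl[OF e(2)] by blast
  obtain T where T: "bop_Lp p T" "\<forall>F\<in>\<F>. unorm p U (\<lambda>n x. ultra_op T F n x - rank_one U G H' F n x) < \<epsilon> / 2"
    using H'(2) f e unfolding approximable_def by blast
  have "unorm p U (\<lambda>n x. ultra_op T F n x - rank_one U G H F n x) < \<epsilon>" if F: "F \<in> \<F>" for F
  proof -
    have F_UP: "F \<in> UP p" using F f by blast
    have "(\<lambda>n x. rank_one U G H' F n x - rank_one U G H F n x) = (\<lambda>n x. upair U F G * (H' n x - H n x))"
      by (simp add: rank_one_def right_diff_distrib)
    then have "unorm p U (\<lambda>n x. rank_one U G H' F n x - rank_one U G H F n x)
      = \<bar>upair U F G\<bar> * unorm p U (\<lambda>n x. H n x - H' n x)"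
      using unorm_scale[OF UP_diff[OF H'(1) H p] p] by (simp add: unorm_minus_commute[of p H])
    also have "\<dots> \<le> K * (\<epsilon> / (2 * K))"
      using KF[OF F] H'(3) unorm_nonneg[OF UP_diff[OF H H'(1) p]] K by (intro mult_mono) auto
    finally have "unorm p U (\<lambda>n x. rank_one U G H' F n x - rank_one U G H F n x) \<le> \<epsilon> / 2" using K by simp
    then show ?thesis
      using unorm_diff_trans[OF ultra_op_UP[OF T(1) F_UP] rank_one_UP[OF p H'(1)] rank_one_UP[OF p H]
        p, of G F G F] T(2) F by fastforce
  qed
  then show "\<exists>T. bop_Lp p T \<and> (\<forall>F\<in>\<F>. unorm p U (\<lambda>n x. ultra_op T F n x - rank_one U G H F n x) < \<epsilon>)"
    using T(1) by blast
qed

lemma const_LpC: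
  assumes f: "f \<in> Lp p" and p: "1 \<le> p"
  shows "(\<lambda>n. f) \<in> LpC p U"
  unfolding LpC_def
proof (intro CollectI conjI)
  show "(\<lambda>n. f) \<in> UP p" by (rule UP_const[OF f])
  show "\<exists>g\<in>Lp p. ueq p U (\<lambda>n. f) (\<lambda>n. g)" by (intro bexI[where x = f] ueq_refl UP_const f p)
qed

lemma unorm_eq_0_if_Lhat_LpC:
  assumes pq: "conjugate_exponents p q" and F: "F \<in> Lhat p U" "F \<in> LpC p U"
  shows "unorm p U F = 0"
proof (rule ccontr)
  assume "unorm p U F \<noteq> 0"
  then obtain G where "G \<in> Lhat q U" "upair U F G \<noteq> 0" using Lhat_separation[OF pq F(1)] by blast
  then show False using F(2) unfolding LpC_eq_annihilator[OF pq] by (simp add: annihilator_def)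
qed

lemma hat_annihilator_eq_Int: "hat_annihilator p U \<G> = Lhat p U \<inter> annihilator p U \<G>"
  by (auto simp: hat_annihilator_def annihilator_def intro: Lhat_UP)

lemma hat_annihilator_eq_annihilator:
  assumes "conjugate_exponents p q"
  shows "hat_annihilator p U \<G> = annihilator p U (\<G> \<union> (\<lambda>g n. g) ` Lp q)"
  unfolding hat_annihilator_eq_Int Lhat_eq_annihilator[OF assms] annihilator_def by auto

lemma closed_usub_hat_annihilator:
  assumes pq: "conjugate_exponents p q" and "\<G> \<subseteq> UP q"
  shows "closed_usub p U (hat_annihilator p U \<G>)"
  unfolding hat_annihilator_eq_annihilator[OF pq]
  using assms(2) UP_const by (intro closed_usub_annihilator[OF pq]) auto

lemma Lhat_if_annihilates_LpC:
  assumes pq: "conjugate_exponents p q" and F: "F \<in> annihilator p U (LpC q U)"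
  shows "F \<in> Lhat p U"
  using F const_LpC[of _ q] conjugate_exponentsD(2)[OF pq] unfolding Lhat_iff[OF pq] annihilator_def by auto

lemma approximable_rank_one_LpC:
  assumes pq: "conjugate_exponents p q" and G: "G \<in> LpC q U" and H: "H \<in> LpC p U"
  shows "approximable p U (rank_one U G H)"
proof -
  note qp = conjugate_exponents_sym[OF pq]
  obtain g h where g: "G \<in> UP q" "g \<in> Lp q" "ueq q U G (\<lambda>n. g)"
    and h: "H \<in> UP p" "h \<in> Lp p" "ueq p U H (\<lambda>n. h)"
    using G H unfolding LpC_def by blast
  have "unorm p U (\<lambda>n x. H n x - h x) = 0"
    using h UP_const conjugate_exponentsD(1)[OF pq] by (simp add: ueq_iff)
  then have "approximable p U (rank_one U (\<lambda>n. g) H)"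
    using approximable_rank_one_const[OF pq g(2) h(2)] UP_const[OF h(2)]
    by (intro approximable_rank_one_closed[OF pq UP_const[OF g(2)] h(1)] bexI[of _ "\<lambda>n. h"]) auto
  moreover have "rank_one U (\<lambda>n. g) H F = rank_one U G H F" if "F \<in> UP p" for F
    using upair_ueq_left[OF qp g(1) UP_const[OF g(2)] that g(3)]
    by (simp add: rank_one_def upair_commute[of U F])
  ultimately show ?thesis unfolding approximable_def by (simp add: subset_iff)
qed

lemma finite_interpolation:
  assumes pq: "conjugate_exponents p q" and Z: "finite Z" "Z \<subseteq> UP p" and D_UP: "D \<subseteq> UP q"
    and D_zero: "(\<lambda>n x. 0) \<in> D"
    and D_lin: "\<And>G G' a b. G \<in> D \<Longrightarrow> G' \<in> D \<Longrightarrow> (\<lambda>n x. a * G n x + b * G' n x) \<in> D"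
  shows "\<exists>J\<subseteq>Z. \<exists>K. (\<forall>j\<in>J. K j \<in> D) \<and>
    (\<forall>F\<in>Z. (\<lambda>n x. F n x - finite_rank U J K (\<lambda>j. j) F n x) \<in> annihilator p U D)"
proof -
  define pairings where "pairings G F = (if F \<in> Z then upair U F G else 0)" for G F
  have zero: "(\<lambda>F. 0) \<in> pairings ` D"
    using D_zero
    by (intro image_eqI[of _ _ "\<lambda>n x. 0"])
      (auto simp: pairings_def upair_commute[of U _ "\<lambda>n x. 0"] upair_zero_left)
  have lin: "(\<lambda>F. a * w F + b * w' F) \<in> pairings ` D" if w: "w \<in> pairings ` D"
    "w' \<in> pairings ` D" for w w' a b
  proof -
    obtain G G' where G: "G \<in> D" "w = pairings G" "G' \<in> D" "w' = pairings G'" using w by blast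
    have "(\<lambda>F. a * w F + b * w' F) = pairings (\<lambda>n x. a * G n x + b * G' n x)"
      using upair_lin_right[OF pq _ subsetD[OF D_UP G(1)] subsetD[OF D_UP G(3)]] Z(2)
      by (auto simp: G pairings_def fun_eq_iff)
    then show ?thesis using D_lin[OF G(1,3)] by blast
  qed
  obtain J \<omega> where J: "J \<subseteq> Z" "\<forall>j\<in>J. \<omega> j \<in> pairings ` D"
    and \<omega>: "\<forall>w\<in>pairings ` D. \<forall>F\<in>Z. w F = (\<Sum>j\<in>J. \<omega> j F * w j)"
    using interpolating_functions[OF Z(1) zero lin] by blast
  have "\<forall>j\<in>J. \<exists>G. G \<in> D \<and> \<omega> j = pairings G" using J(2) by blast
  from bchoice[OF this] obtain K where K: "\<forall>j\<in>J. K j \<in> D \<and> \<omega> j = pairings (K j)" ..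
  have "(\<lambda>n x. F n x - finite_rank U J K (\<lambda>j. j) F n x) \<in> annihilator p U D" if F: "F \<in> Z" for F
    unfolding annihilator_def
  proof (intro CollectI conjI ballI)
    have p: "1 \<le> p" using conjugate_exponentsD(1)[OF pq] by simp
    have J_UP: "j \<in> UP p" if "j \<in> J" for j using that J(1) Z(2) by blast
    have F_UP: "F \<in> UP p" using F Z(2) by blast
    have R_UP: "finite_rank U J K (\<lambda>j. j) F \<in> UP p" using J_UP by (intro finite_rank_UP p)
    show "(\<lambda>n x. F n x - finite_rank U J K (\<lambda>j. j) F n x) \<in> UP p" by (rule UP_diff[OF F_UP R_UP p])
    fix G assume G: "G \<in> D"
    have "upair U (finite_rank U J K (\<lambda>j. j) F) G = (\<Sum>j\<in>J. upair U F (K j) * upair U j G)"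
      unfolding finite_rank_def rank_one_def using J_UP by (intro upair_sum_left[OF pq _ subsetD[OF D_UP G]])
    also have "\<dots> = (\<Sum>j\<in>J. \<omega> j F * pairings G j)"
      using K F J(1) by (intro sum.cong) (auto simp: pairings_def)
    also have "\<dots> = upair U F G" using \<omega> F G by (auto simp: pairings_def)
    finally show "upair U (\<lambda>n x. F n x - finite_rank U J K (\<lambda>j. j) F n x) G = 0"
      using upair_diff_left[OF pq F_UP R_UP subsetD[OF D_UP G]] by simp
  qed
  then show ?thesis using J(1) K by blast
qed

lemma residual_self:
  assumes "1 \<le> p" "bop_U p U S"
  shows "residual p U S S"
  using assms approximable_zero by (simp add: residual_def)

lemma residual_UP: "residual p U S R \<Longrightarrow> F \<in> UP p \<Longrightarrow> R F \<in> UP p"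
  unfolding residual_def using bop_U_UP by blast

lemma residual_diff_finite_rank:
  assumes pq: "conjugate_exponents p q" and S: "bop_U p U S" and R: "residual p U S R" and J: "finite J"
    and K: "\<And>j. j \<in> J \<Longrightarrow> K j \<in> UP q" and H: "\<And>j. j \<in> J \<Longrightarrow> H j \<in> UP p"
    and approx: "\<And>j. j \<in> J \<Longrightarrow> approximable p U (rank_one U (K j) (H j))"
  shows "residual p U S (\<lambda>F n x. R F n x - finite_rank U J K H F n x)"
proof -
  have p: "1 \<le> p" using conjugate_exponentsD(1)[OF pq] by simp
  have bop: "bop_U p U R" and SR: "approximable p U (\<lambda>F n x. S F n x - R F n x)"
    using R by (auto simp: residual_def)
  have "bop_U p U (\<lambda>F n x. 1 * R F n x + (- 1) * finite_rank U J K H F n x)"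
    by (rule bop_U_combination[OF p bop bop_U_finite_rank[OF pq J K H]])
  then have "bop_U p U (\<lambda>F n x. R F n x - finite_rank U J K H F n x)" by simp
  moreover have "approximable p U (\<lambda>F n x. (S F n x - R F n x) + finite_rank U J K H F n x)"
    by (rule approximable_add[OF p SR approximable_finite_rank[OF p J H approx]
          UP_diff[OF bop_U_UP[OF S] bop_U_UP[OF bop] p] finite_rank_UP[OF p H]])
  then have "approximable p U (\<lambda>F n x. S F n x - (R F n x - finite_rank U J K H F n x))"
    by (simp add: diff_diff_eq2 diff_add_eq)
  ultimately show ?thesis by (simp add: residual_def)
qed

lemma residual_diff_finite_rank_null:
  assumes p: "1 \<le> p" and R: "bop_U p U R" and J: "finite J" "J \<subseteq> UP p"
    and E: "E \<in> UP p" "UP_eq p U (R E) (\<lambda>n x. 0)"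
    and F: "UP_eq p U F (\<lambda>n x. E n x + finite_rank U J K (\<lambda>j. j) F n x)"
  shows "UP_eq p U (\<lambda>n x. R F n x - finite_rank U J K R F n x) (\<lambda>n x. 0)"
proof -
  have J_UP: "j \<in> UP p" if "j \<in> J" for j using J(2) that by blast
  have sum_UP: "finite_rank U J K (\<lambda>j. j) F \<in> UP p" by (rule finite_rank_UP[OF p J_UP])
  have R_sum_UP: "finite_rank U J K R F \<in> UP p" by (rule finite_rank_UP[OF p bop_U_UP[OF R J_UP]])
  have "UP_eq p U (R (finite_rank U J K (\<lambda>j. j) F)) (finite_rank U J K R F)"
    unfolding finite_rank_def rank_one_def by (rule bop_U_sum[OF R p J_UP J(1)])
  from UP_eq_add[OF p E(2) this]
  have "UP_eq p U (\<lambda>n x. R E n x + R (finite_rank U J K (\<lambda>j. j) F) n x) (finite_rank U J K R F)" by simp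
  moreover have "UP_eq p U (R (\<lambda>n x. E n x + finite_rank U J K (\<lambda>j. j) F n x))
      (\<lambda>n x. R E n x + R (finite_rank U J K (\<lambda>j. j) F) n x)"
    using bop_U_lin[OF R p E(1) sum_UP, of 1 1] by simp
  ultimately have "UP_eq p U (R F) (finite_rank U J K R F)"
    by (rule UP_eq_trans[OF p UP_eq_trans[OF p bop_U_cong[OF R p F]], rotated])
  then show ?thesis using UP_diff[OF _ R_sum_UP p] UP_zero p by (simp add: UP_eq_def)
qed

lemma invariant_under_diff_finite_rank:
  assumes X: "closed_usub p U X" and R: "invariant_under R X"
    and KH: "\<And>F j. F \<in> X \<Longrightarrow> j \<in> J \<Longrightarrow> H j \<in> X \<or> upair U F (K j) = 0"
  shows "invariant_under (\<lambda>F n x. R F n x - finite_rank U J K H F n x) X"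
  unfolding invariant_under_def
proof
  fix F assume F: "F \<in> X"
  have "rank_one U (K j) (H j) F \<in> X" if "j \<in> J" for j
    using KH[OF F that] closed_usub_zero[OF X] closed_usub_lin[OF X, of "H j" "H j" "upair U F (K j)" 0]
    by (auto simp: rank_one_def)
  then have "finite_rank U J K H F \<in> X"
    using closed_usub_sum[OF X, of J "\<lambda>j. rank_one U (K j) (H j) F" "\<lambda>j. 1"] by (simp add: finite_rank_def)
  then show "(\<lambda>n x. R F n x - finite_rank U J K H F n x) \<in> X"
    using closed_usub_lin[OF X, of "R F" _ 1 "- 1"] R F unfolding invariant_under_def by simp
qed

lemma approximable_if_residual_null:
  assumes p: "1 \<le> p" and S: "bop_U p U S"
    and residual: "\<And>Z. finite Z \<Longrightarrow> Z \<subseteq> UP p \<Longrightarrow> \<exists>R. residual p U S R \<and> (\<forall>F\<in>Z. UP_eq p U (R F) (\<lambda>n x. 0))"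
  shows "approximable p U S"
  unfolding approximable_def
proof (intro allI impI)
  fix Z and \<epsilon> :: real assume Z: "finite Z" "Z \<subseteq> UP p" and \<epsilon>: "0 < \<epsilon>"
  obtain R where R: "residual p U S R" "\<forall>F\<in>Z. UP_eq p U (R F) (\<lambda>n x. 0)" using residual[OF Z] by blast
  obtain T where T: "bop_Lp p T" "\<forall>F\<in>Z. unorm p U (\<lambda>n x. ultra_op T F n x - (S F n x - R F n x)) < \<epsilon>"
    using R(1) Z \<epsilon> unfolding residual_def approximable_def by blast
  have "unorm p U (\<lambda>n x. ultra_op T F n x - S F n x) < \<epsilon>" if F: "F \<in> Z" for F
  proof -
    have F_UP: "F \<in> UP p" using F Z(2) by blast
    have "unorm p U (\<lambda>n x. (S F n x - R F n x) - S F n x) = 0"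
      using R(2) F unorm_minus_commute[of p "\<lambda>n x. 0" "R F"] by (simp add: UP_eq_def)
    then show ?thesis
      using unorm_diff_trans[OF ultra_op_UP[OF T(1) F_UP]
        UP_diff[OF bop_U_UP[OF S F_UP] residual_UP[OF R(1) F_UP] p]
          bop_U_UP[OF S F_UP] p] T(2) F by force
  qed
  then show "\<exists>T. bop_Lp p T \<and> (\<forall>F\<in>Z. unorm p U (\<lambda>n x. ultra_op T F n x - S F n x) < \<epsilon>)" using T(1) by blast
qed

lemma closed_usub_approximable:
  assumes X: "invariant_usub p U X"
    and p: "1 \<le> p" and A: "approximable p U A" and F: "F \<in> X" and AF: "A F \<in> UP p"
  shows "A F \<in> X"
proof -
  note closed = X[unfolded invariant_usub_def, THEN conjunct1]
  have F_UP: "F \<in> UP p" using closed_usub_UP[OF closed] F by blast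
  have "\<exists>H\<in>X. unorm p U (uminus_seq (A F) H) < \<epsilon>" if \<epsilon>: "0 < \<epsilon>" for \<epsilon>
  proof -
    have "finite {F}" "{F} \<subseteq> UP p" using F_UP by auto
    then obtain T where T: "bop_Lp p T" "unorm p U (\<lambda>n x. ultra_op T F n x - A F n x) < \<epsilon>"
      using A \<epsilon> unfolding approximable_def by blast
    have "ultra_op T F \<in> X" using X T(1) F unfolding invariant_usub_def invariant_under_def by blast
    moreover have "unorm p U (uminus_seq (A F) (ultra_op T F)) < \<epsilon>"
      using T(2) by (simp add: uminus_seq_def unorm_minus_commute[of p "A F"])
    ultimately show ?thesis by blast
  qed
  then show ?thesis using closed AF unfolding closed_usub_def by blast
qed

lemma mem_if_rank_one_approximable:
  assumes X: "invariant_usub p U X" and p: "1 \<le> p" and F: "F \<in> X"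
    and approx: "approximable p U (rank_one U G H)" and H: "H \<in> UP p" and nonzero: "upair U F G \<noteq> 0"
  shows "H \<in> X"
proof -
  have "rank_one U G H F \<in> X"
    by (rule closed_usub_approximable[where A = "rank_one U G H"
      and F = F, OF X p approx F rank_one_UP[OF p H]])
  then show ?thesis
    unfolding rank_one_def
    by (rule closed_usub_cancel_scale[OF conjunct1[OF X[unfolded invariant_usub_def]] nonzero])
qed

lemma dual_U_upair:
  assumes pq: "conjugate_exponents p q" and G: "G \<in> UP q"
  shows "dual_U p U (\<lambda>F. upair U F G)"
  unfolding dual_U_def
proof (intro conjI ballI allI impI exI[of _ "unorm q U G"])
  show "upair U F G = upair U F' G" if "F \<in> UP p" "F' \<in> UP p" "ueq p U F F'" for F F'
    by (rule upair_ueq_left[OF pq that(1,2) G that(3)])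
  show "upair U (\<lambda>n x. a * F n x + b * F' n x) G = a * upair U F G + b * upair U F' G" if "F \<in> UP p"
    "F' \<in> UP p" for F F' a b
    by (rule upair_lin_left[OF pq that G])
  show "\<bar>upair U F G\<bar> \<le> unorm q U G * unorm p U F" if "F \<in> UP p" for F
    using upair_bound[OF pq that G] by (simp add: mult.commute)
qed

lemma in_wot_closure_approx:
  assumes p: "1 \<le> p" and A: "approximable p U S" and S_UP: "\<And>F. F \<in> UP p \<Longrightarrow> S F \<in> UP p"
  shows "in_wot_closure p U S"
  unfolding in_wot_closure_def
proof (intro allI impI)
  fix P :: "(useq \<times> (useq \<Rightarrow> real)) set" and \<epsilon> :: real
  assume P: "finite P" "\<forall>(F, \<Phi>)\<in>P. F \<in> UP p \<and> dual_U p U \<Phi>" and \<epsilon>: "0 < \<epsilon>"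
  have "\<forall>pr\<in>P. \<exists>C. \<forall>F\<in>UP p. \<bar>snd pr F\<bar> \<le> C * unorm p U F"
  proof
    fix pr assume "pr \<in> P"
    then have "dual_U p U (snd pr)" using P(2) by (cases pr) auto
    then show "\<exists>C. \<forall>F\<in>UP p. \<bar>snd pr F\<bar> \<le> C * unorm p U F" unfolding dual_U_def by (elim conjE)
  qed
  then obtain C where C: "\<forall>pr\<in>P. \<forall>F\<in>UP p. \<bar>snd pr F\<bar> \<le> C pr * unorm p U F" by (rule bchoice[THEN exE])
  define K where "K = (\<Sum>pr\<in>P. \<bar>C pr\<bar>) + 1"
  have K: "0 < K" unfolding K_def by (intro add_nonneg_pos sum_nonneg) auto
  have CK: "C pr \<le> K" if "pr \<in> P" for pr
    using member_le_sum[OF that, of "\<lambda>pr. \<bar>C pr\<bar>"] P(1) by (simp add: K_def)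
  have f: "finite (fst ` P)" "fst ` P \<subseteq> UP p" "0 < \<epsilon> / K" using P \<epsilon> K by auto
  then obtain T where T: "bop_Lp p T" "\<forall>F\<in>fst ` P. unorm p U (\<lambda>n x. ultra_op T F n x - S F n x) < \<epsilon> / K"
    using A unfolding approximable_def by blast
  have "\<bar>\<Phi> (S F) - \<Phi> (ultra_op T F)\<bar> < \<epsilon>" if pr: "(F, \<Phi>) \<in> P" for F \<Phi>
  proof -
    have F_UP: "F \<in> UP p" and \<Phi>: "dual_U p U \<Phi>" using P(2) pr by auto
    note U = S_UP[OF F_UP] ultra_op_UP[OF T(1) F_UP]
    have "\<Phi> (\<lambda>n x. 1 * S F n x + (-1) * ultra_op T F n x) = 1 * \<Phi> (S F) + (-1) * \<Phi> (ultra_op T F)"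
      using \<Phi> U unfolding dual_U_def by blast
    then have "\<bar>\<Phi> (S F) - \<Phi> (ultra_op T F)\<bar> = \<bar>\<Phi> (\<lambda>n x. S F n x - ultra_op T F n x)\<bar>" by simp
    also have "\<dots> \<le> C (F, \<Phi>) * unorm p U (\<lambda>n x. S F n x - ultra_op T F n x)"
      using C pr UP_diff[OF U p] by fastforce
    also have "\<dots> \<le> K * unorm p U (\<lambda>n x. S F n x - ultra_op T F n x)"
      using CK[OF pr] unorm_nonneg[OF UP_diff[OF U p]] by (rule mult_right_mono)
    also have "\<dots> < K * (\<epsilon> / K)"
      using T(2) pr K by (intro mult_strict_left_mono) (force simp: unorm_minus_commute[of p "S F"])+
    finally show ?thesis using K by simp
  qed
  then show "\<exists>T. bop_Lp p T \<and> (\<forall>(F, \<Phi>)\<in>P. \<bar>\<Phi> (S F) - \<Phi> (ultra_op T F)\<bar> < \<epsilon>)" using T(1) by blast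
qed

lemma wot_closure_annihilator_invariant:
  assumes pq: "conjugate_exponents p q" and S: "in_wot_closure p U S" and S_UP: "\<And>F. F \<in> UP p \<Longrightarrow> S F \<in> UP p"
    and V: "V \<subseteq> UP q" and inv: "\<And>T F. bop_Lp p T \<Longrightarrow> F \<in> annihilator p U V \<Longrightarrow> ultra_op T F \<in> annihilator p U V"
  shows "invariant_under S (annihilator p U V)"
  unfolding invariant_under_def
proof
  fix F assume F: "F \<in> annihilator p U V"
  then have F_UP: "F \<in> UP p" by (simp add: annihilator_def)
  have "upair U (S F) G = 0" if G: "G \<in> V" for G
  proof (rule ccontr)
    assume nz: "upair U (S F) G \<noteq> 0"
    have G_UP: "G \<in> UP q" using G V by blast
    let ?P = "{(F, \<lambda>F. upair U F G)}"
    have fP: "finite ?P" and dP: "\<forall>(F, \<Phi>)\<in>?P. F \<in> UP p \<and> dual_U p U \<Phi>"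
      using F_UP dual_U_upair[OF pq G_UP] by auto
    from S have "finite ?P \<longrightarrow> (\<forall>(F, \<Phi>)\<in>?P. F \<in> UP p \<and> dual_U p U \<Phi>) \<longrightarrow>
        (\<forall>\<epsilon>>0. \<exists>T. bop_Lp p T \<and> (\<forall>(F, \<Phi>)\<in>?P. \<bar>\<Phi> (S F) - \<Phi> (ultra_op T F)\<bar> < \<epsilon>))"
      unfolding in_wot_closure_def by (rule spec)
    from this[THEN mp, OF fP, THEN mp, OF dP]
    have "\<exists>T. bop_Lp p T \<and> (\<forall>(F, \<Phi>)\<in>?P. \<bar>\<Phi> (S F) - \<Phi> (ultra_op T F)\<bar> < \<bar>upair U (S F) G\<bar>)"
      using nz by simp
    then obtain T where T: "bop_Lp p T" "\<bar>upair U (S F) G - upair U (ultra_op T F) G\<bar> < \<bar>upair U (S F) G\<bar>"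
      by auto
    then show False using annihilatorD[OF inv[OF T(1) F] G] by simp
  qed
  then show "S F \<in> annihilator p U V" using S_UP[OF F_UP] by (simp add: annihilator_def)
qed

end

locale distinguished_subspace = ultrapower +
  fixes p q :: real and \<G> :: "useq set"
  assumes pq: "conjugate_exponents p q"
    and \<G>_Lhat: "\<G> \<subseteq> Lhat q U" and \<G>_zero: "(\<lambda>n x. 0) \<in> \<G>"
    and \<G>_lin: "\<And>G G' a b. G \<in> \<G> \<Longrightarrow> G' \<in> \<G> \<Longrightarrow> (\<lambda>n x. a * G n x + b * G' n x) \<in> \<G>"
    and rank_one_\<G>: "\<And>G H. G \<in> \<G> \<Longrightarrow> H \<in> Lhat p U \<Longrightarrow> approximable p U (rank_one U G H)"
    and rank_one_M: "\<And>G H. G \<in> Lhat q U \<Longrightarrow> H \<in> hat_annihilator p U \<G> \<Longrightarrow> approximable p U (rank_one U G H)"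
    and M_invariant: "\<And>T F. bop_Lp p T \<Longrightarrow> F \<in> hat_annihilator p U \<G> \<Longrightarrow> ultra_op T F \<in> hat_annihilator p U \<G>"
    and M_complemented: "\<exists>N. closed_usub p U N \<and> N \<subseteq> Lhat p U \<and> hat_annihilator p U \<G> \<inter> N = uzero p U \<and>
          subspace_sum p U (hat_annihilator p U \<G>) N = Lhat p U"
    and M_nonzero: "\<exists>F\<in>hat_annihilator p U \<G>. unorm p U F \<noteq> 0"
    and M_proper: "\<exists>F\<in>Lhat p U. F \<notin> hat_annihilator p U \<G>"
begin

abbreviation "M \<equiv> hat_annihilator p U \<G>"
abbreviation "hat \<equiv> weakly_null_part p U"

lemma p_ge_1: "1 \<le> p"
  using conjugate_exponentsD(1)[OF pq] by simp

lemmas qp = conjugate_exponents_sym[OF pq]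
lemmas closed_Lhat = closed_usub_Lhat[OF pq]
lemmas closed_LpC = closed_usub_LpC[OF pq]

lemma \<G>_UP: "G \<in> \<G> \<Longrightarrow> G \<in> UP q"
  using \<G>_Lhat Lhat_UP by blast

lemma M_Lhat: "M \<subseteq> Lhat p U"
  by (simp add: hat_annihilator_eq_Int)

lemma M_UP: "F \<in> M \<Longrightarrow> F \<in> UP p"
  using M_Lhat Lhat_UP by blast

lemma closed_M: "closed_usub p U M"
  using \<G>_UP by (intro closed_usub_hat_annihilator[OF pq]) auto

lemma closed_annihilator_\<G>: "closed_usub p U (annihilator p U \<G>)"
  by (rule closed_usub_annihilator[OF pq]) (auto intro: \<G>_UP)

lemma upair_LpC_Lhat: "F \<in> LpC p U \<Longrightarrow> G \<in> Lhat q U \<Longrightarrow> upair U F G = 0"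
  unfolding LpC_eq_annihilator[OF pq] by (rule annihilatorD)

lemma LpC_subset_annihilator: "LpC p U \<subseteq> annihilator p U \<G>"
  using upair_LpC_Lhat \<G>_Lhat closed_usub_UP[OF closed_LpC] unfolding annihilator_def by blast

lemma const_weak_limit_LpC: "F \<in> UP p \<Longrightarrow> (\<lambda>n. weak_limit p U F) \<in> LpC p U"
  by (intro const_LpC weak_limit_Lp[OF pq] p_ge_1)

lemma hat_M: "F \<in> annihilator p U \<G> \<Longrightarrow> hat F \<in> M"
  using upair_weakly_null_part[OF pq] weakly_null_part_Lhat[OF pq] \<G>_Lhat
  by (auto simp: hat_annihilator_def annihilator_def)

lemma mem_if_hat_mem:
  assumes X: "closed_usub p U X" and F: "F \<in> UP p" "LpC p U \<subseteq> X" "hat F \<in> X"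
  shows "F \<in> X"
proof -
  have "(\<lambda>n. weak_limit p U F) \<in> X" using const_weak_limit_LpC[OF F(1)] F(2) by blast
  from closed_usub_lin[OF X this F(3), of 1 1] show ?thesis by simp
qed

lemma LpC_plus_M: "subspace_sum p U (LpC p U) M = annihilator p U \<G>"
proof (intro equalityI subsetI)
  fix F assume "F \<in> subspace_sum p U (LpC p U) M"
  then obtain G H where GH: "G \<in> LpC p U" "H \<in> M" "F \<in> UP p" "ueq p U F (\<lambda>n x. G n x + H n x)"
    by (auto simp: subspace_sum_def)
  have U: "G \<in> UP p" "H \<in> UP p" using GH(1,2) closed_usub_UP[OF closed_LpC] M_UP by auto
  have "upair U F K = 0" if K: "K \<in> \<G>" for K
  proof -
    have "upair U F K = upair U (\<lambda>n x. G n x + H n x) K"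
      by (rule upair_ueq_left[OF pq GH(3) UP_add[OF U p_ge_1] \<G>_UP[OF K] GH(4)])
    also have "\<dots> = upair U G K + upair U H K" by (rule upair_add_left[OF pq U \<G>_UP[OF K]])
    also have "upair U G K = 0" using GH(1) K \<G>_Lhat upair_LpC_Lhat by blast
    also have "upair U H K = 0" using GH(2) K by (simp add: hat_annihilator_def)
    finally show ?thesis by simp
  qed
  then show "F \<in> annihilator p U \<G>" using GH(3) by (simp add: annihilator_def)
next
  fix F assume F: "F \<in> annihilator p U \<G>"
  then have F_UP: "F \<in> UP p" by (simp add: annihilator_def)
  have "ueq p U F (\<lambda>n x. weak_limit p U F x + (F n x - weak_limit p U F x))"
    using ueq_refl[OF F_UP p_ge_1] by simp
  then show "F \<in> subspace_sum p U (LpC p U) M"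
    by (rule subspace_sumI[OF F_UP const_weak_limit_LpC[OF F_UP] hat_M[OF F]])
qed

text \<open>An operator leaving the three subspaces invariant is corrected on the coordinates of finitely
  many vectors in the order $M$, $\widehat{L^p}$, $L^p$; each correction vanishes on the subspaces
  that are still to be treated.\<close>
lemma residual_null_on_M:
  assumes S: "bop_U p U S"
    and inv: "invariant_under S (LpC p U)" "invariant_under S (Lhat p U)" "invariant_under S M"
    and Z: "finite Z" "Z \<subseteq> M"
  shows "\<exists>R. residual p U S R \<and> (\<forall>F\<in>Z. UP_eq p U (R F) (\<lambda>n x. 0))
    \<and> invariant_under R (LpC p U) \<and> invariant_under R (Lhat p U)"
proof -
  have Z_UP: "Z \<subseteq> UP p" using Z(2) M_UP by blast
  note Lhat = closed_usub_Lhat[OF qp]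
  obtain J K where J: "J \<subseteq> Z" and K: "\<forall>j\<in>J. K j \<in> Lhat q U"
    and rem: "\<forall>F\<in>Z. (\<lambda>n x. F n x - finite_rank U J K (\<lambda>j. j) F n x) \<in> annihilator p U (Lhat q U)"
    using finite_interpolation[OF pq Z(1) Z_UP closed_usub_UP[OF Lhat] closed_usub_zero[OF Lhat]
      closed_usub_lin[OF Lhat]] by blast
  have J': "finite J" "J \<subseteq> UP p" using J Z(1) Z_UP finite_subset by auto
  have SJ: "S j \<in> M" if "j \<in> J" for j using inv(3) J Z(2) that unfolding invariant_under_def by blast
  let ?R = "\<lambda>F n x. S F n x - finite_rank U J K S F n x"
  have "residual p U S ?R"
    using K SJ by (intro residual_diff_finite_rank[OF pq S residual_self[OF p_ge_1 S] J'(1)] rank_one_M)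
      (auto intro: Lhat_UP M_UP)
  moreover have "UP_eq p U (?R F) (\<lambda>n x. 0)" if F: "F \<in> Z" for F
  proof (rule residual_diff_finite_rank_null[OF p_ge_1 S J'])
    have "finite_rank U J K (\<lambda>j. j) F \<in> Lhat p U"
      unfolding finite_rank_def rank_one_def
      using J Z(2) M_Lhat by (intro closed_usub_sum[OF closed_Lhat]) auto
    then have "(\<lambda>n x. 1 * F n x + (- 1) * finite_rank U J K (\<lambda>j. j) F n x) \<in> Lhat p U"
      using F Z(2) M_Lhat by (intro closed_usub_lin[OF closed_Lhat]) auto
    then have "unorm p U (\<lambda>n x. F n x - finite_rank U J K (\<lambda>j. j) F n x) = 0"
      using rem F by (intro unorm_eq_0_if_Lhat_LpC[OF pq]) (auto simp: LpC_eq_annihilator[OF pq])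
    then show "UP_eq p U F (\<lambda>n x. (\<lambda>n x. 0) n x + finite_rank U J K (\<lambda>j. j) F n x)"
      using F Z_UP J'(2) p_ge_1 by (auto simp: UP_eq_def intro!: finite_rank_UP)
    show "UP_eq p U (S (\<lambda>n x. 0)) (\<lambda>n x. 0)" using bop_U_sum[OF S p_ge_1, of "{}"] by simp
  qed (use p_ge_1 in \<open>simp add: UP_zero\<close>)
  moreover have "invariant_under ?R (LpC p U)"
    using inv(1) upair_LpC_Lhat K by (intro invariant_under_diff_finite_rank[OF closed_LpC]) auto
  moreover have "invariant_under ?R (Lhat p U)"
    using inv(2) SJ M_Lhat by (intro invariant_under_diff_finite_rank[OF closed_Lhat]) auto
  ultimately show ?thesis by blast
qed

lemma residual_null_on_Lhat:
  assumes S: "bop_U p U S"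
    and inv: "invariant_under S (LpC p U)" "invariant_under S (Lhat p U)" "invariant_under S M"
    and Z: "finite Z" "Z \<subseteq> Lhat p U"
  shows "\<exists>R. residual p U S R \<and> (\<forall>F\<in>Z. UP_eq p U (R F) (\<lambda>n x. 0)) \<and> invariant_under R (LpC p U)"
proof -
  have Z_UP: "Z \<subseteq> UP p" using Z(2) Lhat_UP by blast
  obtain J K where J: "J \<subseteq> Z" and K: "\<forall>j\<in>J. K j \<in> \<G>"
    and rem: "\<forall>F\<in>Z. (\<lambda>n x. F n x - finite_rank U J K (\<lambda>j. j) F n x) \<in> annihilator p U \<G>"
    using finite_interpolation[OF pq Z(1) Z_UP _ \<G>_zero \<G>_lin] \<G>_UP by blast
  have J': "finite J" "J \<subseteq> UP p" using J Z(1) Z_UP finite_subset by auto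
  define m where "m F = (\<lambda>n x. F n x - finite_rank U J K (\<lambda>j. j) F n x)" for F
  have m: "m F \<in> M" if F: "F \<in> Z" for F
  proof -
    have "finite_rank U J K (\<lambda>j. j) F \<in> Lhat p U"
      unfolding finite_rank_def rank_one_def using J Z(2) by (intro closed_usub_sum[OF closed_Lhat]) auto
    then have "(\<lambda>n x. 1 * F n x + (- 1) * finite_rank U J K (\<lambda>j. j) F n x) \<in> Lhat p U"
      using F Z(2) by (intro closed_usub_lin[OF closed_Lhat]) auto
    then show ?thesis using rem F by (simp add: hat_annihilator_eq_Int m_def)
  qed
  then obtain R where R: "residual p U S R" "\<forall>F\<in>Z. UP_eq p U (R (m F)) (\<lambda>n x. 0)"
    and R_inv: "invariant_under R (LpC p U)" "invariant_under R (Lhat p U)"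
    using residual_null_on_M[OF S inv, of "m ` Z"] Z(1) by auto
  have RJ: "R j \<in> Lhat p U" if "j \<in> J" for j using R_inv(2) J Z(2) that unfolding invariant_under_def by blast
  have bop: "bop_U p U R" using R(1) by (simp add: residual_def)
  let ?R = "\<lambda>F n x. R F n x - finite_rank U J K R F n x"
  have "residual p U S ?R"
    using K RJ by (intro residual_diff_finite_rank[OF pq S R(1) J'(1)] rank_one_\<G>) (auto intro: Lhat_UP \<G>_UP)
  moreover have "UP_eq p U (?R F) (\<lambda>n x. 0)" if F: "F \<in> Z" for F
    using F R(2) Z_UP M_UP[OF m[OF F]]
    by (intro residual_diff_finite_rank_null[OF p_ge_1 bop J', where E = "m F"]) (auto simp: m_def UP_eq_refl)
  moreover have "invariant_under ?R (LpC p U)"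
    using R_inv(1) upair_LpC_Lhat K \<G>_Lhat by (intro invariant_under_diff_finite_rank[OF closed_LpC]) auto
  ultimately show ?thesis by blast
qed

lemma upair_const_weak_limit:
  assumes F: "F \<in> UP p" and K: "K \<in> LpC q U"
  shows "upair U (\<lambda>n. weak_limit p U F) K = upair U F K"
proof -
  have "K \<in> annihilator q U (Lhat p U)" using K LpC_eq_annihilator[OF qp] by simp
  from annihilatorD[OF this weakly_null_part_Lhat[OF pq F]]
  have "upair U (hat F) K = 0" by (simp only: upair_commute[of U "hat F"])
  moreover have "K \<in> UP q" using K closed_usub_UP[OF closed_usub_LpC[OF qp]] by blast
  ultimately show ?thesis using upair_diff_left[OF pq F UP_const[OF weak_limit_Lp[OF pq F]]] by simp
qed

lemma UP_eq_hat_plus_finite_rank: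
  fixes F :: useq
  defines "c \<equiv> \<lambda>n :: nat. weak_limit p U F"
  assumes F: "F \<in> UP p" and J: "J \<subseteq> LpC p U" and K: "\<And>j. j \<in> J \<Longrightarrow> K j \<in> LpC q U"
    and rem: "(\<lambda>n x. c n x - finite_rank U J K (\<lambda>j. j) c n x) \<in> annihilator p U (LpC q U)"
  shows "UP_eq p U F (\<lambda>n x. hat F n x + finite_rank U J K (\<lambda>j. j) F n x)"
proof -
  have c_eq: "finite_rank U J K (\<lambda>j. j) c = finite_rank U J K (\<lambda>j. j) F"
    using upair_const_weak_limit[OF F K] by (simp add: finite_rank_def rank_one_def c_def)
  have sum: "finite_rank U J K (\<lambda>j. j) F \<in> LpC p U"
    unfolding finite_rank_def rank_one_def using J by (intro closed_usub_sum[OF closed_LpC]) auto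
  have "(\<lambda>n x. 1 * c n x + (- 1) * finite_rank U J K (\<lambda>j. j) F n x) \<in> LpC p U"
    unfolding c_def by (rule closed_usub_lin[OF closed_LpC const_weak_limit_LpC[OF F] sum])
  then have "unorm p U (\<lambda>n x. c n x - finite_rank U J K (\<lambda>j. j) F n x) = 0"
    using Lhat_if_annihilates_LpC[OF pq rem] by (intro unorm_eq_0_if_Lhat_LpC[OF pq]) (auto simp: c_eq)
  moreover have "(\<lambda>n x. F n x - (hat F n x + finite_rank U J K (\<lambda>j. j) F n x))
      = (\<lambda>n x. c n x - finite_rank U J K (\<lambda>j. j) F n x)"
    by (simp add: c_def)
  moreover have "(\<lambda>n x. hat F n x + finite_rank U J K (\<lambda>j. j) F n x) \<in> UP p"
    by (rule UP_add[OF Lhat_UP[OF weakly_null_part_Lhat[OF pq F]]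
      subsetD[OF closed_usub_UP[OF closed_LpC] sum] p_ge_1])
  ultimately show ?thesis using F by (simp add: UP_eq_def)
qed

lemma residual_null_on_UP:
  assumes S: "bop_U p U S"
    and inv: "invariant_under S (LpC p U)" "invariant_under S (Lhat p U)" "invariant_under S M"
    and Z: "finite Z" "Z \<subseteq> UP p"
  shows "\<exists>R. residual p U S R \<and> (\<forall>F\<in>Z. UP_eq p U (R F) (\<lambda>n x. 0))"
proof -
  note LpC = closed_usub_LpC[OF qp]
  define c where "c F = (\<lambda>n :: nat. weak_limit p U F)" for F
  have c: "c F \<in> LpC p U" "c F \<in> UP p" if "F \<in> Z" for F
    using const_weak_limit_LpC[of F] closed_usub_UP[OF closed_LpC] that Z(2) unfolding c_def by blast+
  obtain R where R: "residual p U S R" "\<forall>F\<in>Z. UP_eq p U (R (hat F)) (\<lambda>n x. 0)"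
    and R_inv: "invariant_under R (LpC p U)"
    using residual_null_on_Lhat[OF S inv, of "hat ` Z"] Z weakly_null_part_Lhat[OF pq] by auto
  have c_UP: "c ` Z \<subseteq> UP p" using c(2) by blast
  obtain J K where J: "J \<subseteq> c ` Z" and K: "\<forall>j\<in>J. K j \<in> LpC q U"
    and rem: "\<forall>F\<in>c ` Z. (\<lambda>n x. F n x - finite_rank U J K (\<lambda>j. j) F n x) \<in> annihilator p U (LpC q U)"
    using finite_interpolation[OF pq finite_imageI[OF Z(1)] c_UP closed_usub_UP[OF LpC]
      closed_usub_zero[OF LpC] closed_usub_lin[OF LpC]]
    by blast
  have J': "finite J" "J \<subseteq> UP p" "J \<subseteq> LpC p U" using finite_subset[OF J] J Z(1) c by auto
  have RJ: "R j \<in> LpC p U" if "j \<in> J" for j using R_inv J'(3) that unfolding invariant_under_def by blast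
  have K_UP: "K j \<in> UP q" if "j \<in> J" for j using K that closed_usub_UP[OF closed_usub_LpC[OF qp]] by blast
  have bop: "bop_U p U R" using R(1) by (simp add: residual_def)
  let ?R = "\<lambda>F n x. R F n x - finite_rank U J K R F n x"
  have "residual p U S ?R"
    using K RJ closed_usub_UP[OF closed_LpC]
    by (intro residual_diff_finite_rank[OF pq S R(1) J'(1) K_UP] approximable_rank_one_LpC[OF pq]) auto
  moreover have "UP_eq p U (?R F) (\<lambda>n x. 0)" if F: "F \<in> Z" for F
  proof (rule residual_diff_finite_rank_null[OF p_ge_1 bop J'(1,2)])
    have F_UP: "F \<in> UP p" using F Z(2) by blast
    have "(\<lambda>n x. c F n x - finite_rank U J K (\<lambda>j. j) (c F) n x) \<in> annihilator p U (LpC q U)"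
      using rem F by blast
    then show "UP_eq p U F (\<lambda>n x. hat F n x + finite_rank U J K (\<lambda>j. j) F n x)"
      using K unfolding c_def by (intro UP_eq_hat_plus_finite_rank[OF F_UP J'(3)]) auto
    show "hat F \<in> UP p" by (rule Lhat_UP[OF weakly_null_part_Lhat[OF pq F_UP]])
    show "UP_eq p U (R (hat F)) (\<lambda>n x. 0)" using R(2) F by blast
  qed
  ultimately show ?thesis by blast
qed

theorem approximable_if_invariant:
  assumes "bop_U p U S" "invariant_under S (LpC p U)" "invariant_under S (Lhat p U)" "invariant_under S M"
  shows "approximable p U S"
  by (rule approximable_if_residual_null[OF p_ge_1 assms(1) residual_null_on_UP[OF assms]])

theorem M_char_M: "M_char p U M"
  unfolding M_char_def
proof (intro conjI allI impI closed_M M_Lhat M_complemented iffI)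
  fix S assume S: "bop_U p U S"
  note S_UP = bop_U_UP[OF S]
  show "in_wot_closure p U S"
    if "invariant_under S (LpC p U) \<and> invariant_under S (Lhat p U) \<and> invariant_under S M"
    using approximable_if_invariant[OF S] that by (intro in_wot_closure_approx[OF p_ge_1 _ S_UP]) auto
  assume W: "in_wot_closure p U S"
  note wot_invariant = wot_closure_annihilator_invariant[OF pq W S_UP]
  show "invariant_under S (LpC p U)" unfolding LpC_eq_annihilator[OF pq]
    using ultra_op_LpC[OF _ p_ge_1] Lhat_UP by (intro wot_invariant) (auto simp: LpC_eq_annihilator[OF pq])
  show "invariant_under S (Lhat p U)" unfolding Lhat_eq_annihilator[OF pq]
    using ultra_op_Lhat[OF _ p_ge_1] UP_const by (intro wot_invariant) (auto simp: Lhat_eq_annihilator[OF pq])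
  show "invariant_under S M" unfolding hat_annihilator_eq_annihilator[OF pq]
    using M_invariant \<G>_UP UP_const unfolding hat_annihilator_eq_annihilator[OF pq] by (intro wot_invariant) auto
qed

lemma
  assumes X: "invariant_usub p U X"
  shows LpC_subset_if_not_subset_Lhat: "\<not> X \<subseteq> Lhat p U \<Longrightarrow> LpC p U \<subseteq> X"
    and Lhat_subset_if_not_subset_annihilator: "\<not> X \<subseteq> annihilator p U \<G> \<Longrightarrow> Lhat p U \<subseteq> X"
    and M_subset_if_not_subset_LpC: "\<not> X \<subseteq> LpC p U \<Longrightarrow> M \<subseteq> X"
proof -
  have X_UP: "X \<subseteq> UP p" using X closed_usub_UP unfolding invariant_usub_def by blast
  note mem = mem_if_rank_one_approximable[OF X p_ge_1]
  show "LpC p U \<subseteq> X" if not_below: "\<not> X \<subseteq> Lhat p U"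
  proof
    fix H assume H: "H \<in> LpC p U"
    obtain F where F: "F \<in> X" "F \<notin> Lhat p U" using not_below by blast
    then obtain g where g: "g \<in> Lp q" "upair U F (\<lambda>n. g) \<noteq> 0" using X_UP Lhat_iff[OF pq, of F] by blast
    have "(\<lambda>n. g) \<in> LpC q U" using const_LpC[OF g(1)] conjugate_exponentsD(2)[OF pq] by simp
    then show "H \<in> X"
      using H closed_usub_UP[OF closed_LpC]
      by (intro mem[OF F(1) _ _ g(2)] approximable_rank_one_LpC[OF pq]) auto
  qed
  show "Lhat p U \<subseteq> X" if not_below: "\<not> X \<subseteq> annihilator p U \<G>"
  proof
    fix H assume H: "H \<in> Lhat p U"
    obtain F G where F: "F \<in> X" and G: "G \<in> \<G>" "upair U F G \<noteq> 0"
      using not_below X_UP unfolding annihilator_def by blast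
    show "H \<in> X" by (rule mem[OF F rank_one_\<G>[OF G(1) H] Lhat_UP[OF H] G(2)])
  qed
  show "M \<subseteq> X" if not_below: "\<not> X \<subseteq> LpC p U"
  proof
    fix H assume H: "H \<in> M"
    obtain F G where F: "F \<in> X" and G: "G \<in> Lhat q U" "upair U F G \<noteq> 0"
      using not_below X_UP unfolding LpC_eq_annihilator[OF pq] annihilator_def by blast
    show "H \<in> X" by (rule mem[OF F rank_one_M[OF G(1) H] M_UP[OF H] G(2)])
  qed
qed

lemma Lhat_Int_LpC: "Lhat p U \<inter> LpC p U = uzero p U"
proof
  show "Lhat p U \<inter> LpC p U \<subseteq> uzero p U" using unorm_eq_0_if_Lhat_LpC[OF pq] Lhat_UP p_ge_1 by (auto simp: uzero_iff)
  show "uzero p U \<subseteq> Lhat p U \<inter> LpC p U"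
    using uzero_subset_closed[OF closed_Lhat p_ge_1] uzero_subset_closed[OF closed_LpC p_ge_1] by blast
qed

theorem invariant_usub_cases:
  assumes X: "invariant_usub p U X"
  shows "X \<in> {uzero p U, LpC p U, Lhat p U, M, annihilator p U \<G>, UP p}"
proof -
  have closed: "closed_usub p U X" using X by (simp add: invariant_usub_def)
  note LpC = LpC_subset_if_not_subset_Lhat[OF X] and Lhat = Lhat_subset_if_not_subset_annihilator[OF X]
    and M = M_subset_if_not_subset_LpC[OF X] and zero = uzero_subset_closed[OF closed p_ge_1]
  show ?thesis
  proof (cases "X \<subseteq> Lhat p U")
    case below_Lhat: True
    consider "\<not> X \<subseteq> annihilator p U \<G>" | "X \<subseteq> M" "\<not> X \<subseteq> LpC p U" | "X \<subseteq> Lhat p U \<inter> LpC p U"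
      using below_Lhat hat_annihilator_eq_Int by blast
    then show ?thesis
      by cases (use below_Lhat Lhat M zero Lhat_Int_LpC in blast)+
  next
    case False
    note above_LpC = LpC[OF False]
    have "F \<in> X" if "F \<in> UP p" "hat F \<in> X" for F by (rule mem_if_hat_mem[OF closed that(1) above_LpC that(2)])
    then have "annihilator p U \<G> \<subseteq> X" if "M \<subseteq> X"
      using hat_M that unfolding annihilator_def by blast
    moreover have "UP p \<subseteq> X" if "Lhat p U \<subseteq> X"
      using \<open>\<And>F. F \<in> UP p \<Longrightarrow> hat F \<in> X \<Longrightarrow> F \<in> X\<close> weakly_null_part_Lhat[OF pq] that by blast
    ultimately show ?thesis using above_LpC Lhat M closed_usub_UP[OF closed] by blast
  qed
qed

lemma invariant_usub_LpC: "invariant_usub p U (LpC p U)"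
  and invariant_usub_Lhat: "invariant_usub p U (Lhat p U)"
  and invariant_usub_M: "invariant_usub p U M"
  using closed_LpC closed_Lhat closed_M ultra_op_LpC[OF _ p_ge_1] ultra_op_Lhat[OF _ p_ge_1] M_invariant
  by (auto simp: invariant_usub_def invariant_under_def)

lemma invariant_usub_annihilator: "invariant_usub p U (annihilator p U \<G>)"
  unfolding invariant_usub_def invariant_under_def
proof (intro conjI allI impI ballI closed_annihilator_\<G>)
  fix T F assume T: "bop_Lp p T" and F: "F \<in> annihilator p U \<G>"
  then have F_UP: "F \<in> UP p" by (simp add: annihilator_def)
  note c = const_weak_limit_LpC[OF F_UP] and h = hat_M[OF F]
  have "UP_eq p U (ultra_op T (\<lambda>n x. 1 * weak_limit p U F x + 1 * hat F n x))
      (\<lambda>n x. 1 * ultra_op T (\<lambda>n. weak_limit p U F) n x + 1 * ultra_op T (hat F) n x)"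
    by (rule ultra_op_lin[OF T UP_const[OF weak_limit_Lp[OF pq F_UP]] M_UP[OF h] p_ge_1])
  then have "ueq p U (ultra_op T F) (\<lambda>n x. ultra_op T (\<lambda>n. weak_limit p U F) n x + ultra_op T (hat F) n x)"
    using p_ge_1 by (auto simp: UP_eq_def ueq_iff)
  then show "ultra_op T F \<in> annihilator p U \<G>"
    unfolding LpC_plus_M[symmetric]
    by (rule subspace_sumI[OF ultra_op_UP[OF T F_UP] ultra_op_LpC[OF T p_ge_1 c] M_invariant[OF T h]])
qed

lemma one_LpC: "(\<lambda>n x. 1) \<in> LpC p U" and one_not_Lhat: "(\<lambda>n x. 1) \<notin> Lhat p U"
proof -
  have one: "(\<lambda>x. 1) \<in> Lp p" "(\<lambda>x. 1) \<in> Lp q" using conjugate_exponentsD(1,2)[OF pq] by auto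
  show "(\<lambda>n x. 1) \<in> LpC p U" by (rule const_LpC[OF one(1) p_ge_1])
  have "upair U (\<lambda>n x. 1) (\<lambda>n x. 1) \<noteq> 0" using upair_const[of "\<lambda>x. 1" "\<lambda>x. 1"] by simp
  then show "(\<lambda>n x. 1) \<notin> Lhat p U" using upair_Lhat_const[OF pq _ one(2), of "\<lambda>n x. 1"] by blast
qed

lemma distinct_invariant_subspaces:
  "distinct ([uzero p U, UP p] @ [LpC p U, Lhat p U, M, annihilator p U \<G>])"
proof -
  obtain u where u: "u \<in> M" "u \<notin> uzero p U" using M_nonzero uzero_iff[OF p_ge_1] by blast
  obtain v where v: "v \<in> Lhat p U" "v \<notin> M" using M_proper by blast
  have u': "u \<in> Lhat p U" "u \<notin> LpC p U" using u M_Lhat Lhat_Int_LpC by auto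
  have v': "v \<notin> annihilator p U \<G>" using v hat_annihilator_eq_Int by blast
  have below: "uzero p U \<subseteq> M" "M \<subseteq> annihilator p U \<G>" "LpC p U \<subseteq> annihilator p U \<G>" "annihilator p U \<G> \<subseteq> UP p"
    "Lhat p U \<subseteq> UP p"
    using uzero_subset_closed[OF closed_M p_ge_1] hat_annihilator_eq_Int LpC_subset_annihilator Lhat_UP
    by (auto simp: annihilator_def)
  show ?thesis
    unfolding append.simps distinct.simps list.set
    using one_LpC one_not_Lhat u u' v v' below M_Lhat by (intro conjI; blast)
qed

theorem inv_subspaces_eq:
  "inv_subspaces p U = {LpC p U, Lhat p U, M, subspace_sum p U (LpC p U) M}"
  unfolding LpC_plus_M
proof (intro equalityI subsetI)
  fix X assume "X \<in> inv_subspaces p U"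
  then have "invariant_usub p U X" and "X \<notin> {uzero p U, UP p}"
    by (auto simp: inv_subspaces_def invariant_usub_def)
  from invariant_usub_cases[OF this(1)] this(2) show "X \<in> {LpC p U, Lhat p U, M, annihilator p U \<G>}"
    by (metis insert_iff)
next
  fix X assume X: "X \<in> {LpC p U, Lhat p U, M, annihilator p U \<G>}"
  then have "invariant_usub p U X"
    using invariant_usub_LpC invariant_usub_Lhat invariant_usub_M invariant_usub_annihilator
    by (elim insertE emptyE) simp_all
  moreover have "{uzero p U, UP p} \<inter> {LpC p U, Lhat p U, M, annihilator p U \<G>} = {}"
    using distinct_invariant_subspaces by (simp only: distinct_append list.set)
  then have "X \<notin> {uzero p U, UP p}" using X by (meson disjoint_iff)
  ultimately show "X \<in> inv_subspaces p U" by (simp add: inv_subspaces_def invariant_usub_def)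
qed

theorem card_inv_subspaces: "card (inv_subspaces p U) = 4"
proof -
  have "distinct [LpC p U, Lhat p U, M, annihilator p U \<G>]"
    using distinct_invariant_subspaces by (simp only: distinct_append)
  from distinct_card[OF this] show ?thesis unfolding inv_subspaces_eq LpC_plus_M by simp
qed

lemma rank_one_not_in_wot_closure:
  "\<exists>S. bop_U p U S \<and> (\<forall>F\<in>LpC p U. S F = (\<lambda>n x. 0)) \<and> (\<forall>F\<in>UP p. S F \<in> Lhat p U) \<and> \<not> in_wot_closure p U S"
proof -
  obtain u where u: "u \<in> M" "unorm p U u \<noteq> 0" using M_nonzero by blast
  obtain v where v: "v \<in> Lhat p U" "v \<notin> M" using M_proper by blast
  obtain G where G: "G \<in> Lhat q U" "upair U u G \<noteq> 0"
    using Lhat_separation[OF pq subsetD[OF M_Lhat u(1)] u(2)] by blast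
  let ?S = "rank_one U G v"
  have S: "bop_U p U ?S" by (rule bop_U_rank_one[OF pq Lhat_UP[OF G(1)] Lhat_UP[OF v(1)]])
  have "?S u \<notin> M"
    using closed_usub_cancel_scale[OF closed_M G(2)] v(2) unfolding rank_one_def by blast
  then have "\<not> invariant_under ?S M" using u(1) unfolding invariant_under_def by blast
  then have "\<not> in_wot_closure p U ?S" using M_char_M S unfolding M_char_def by blast
  moreover have "?S F = (\<lambda>n x. 0)" if "F \<in> LpC p U" for F
    using upair_LpC_Lhat[OF that G(1)] by (simp add: rank_one_def)
  moreover have "?S F \<in> Lhat p U" for F
    using closed_usub_lin[OF closed_Lhat v(1,1), of "upair U F G" 0] by (simp add: rank_one_def)
  ultimately show ?thesis using S by blast
qed

theorem M_char_unique:
  assumes M': "M_char p U M'"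
  shows "M' = M"
proof (rule ccontr)
  assume "M' \<noteq> M"
  have closed: "closed_usub p U M'" and below: "M' \<subseteq> Lhat p U"
    and wot: "\<And>S. bop_U p U S \<Longrightarrow> in_wot_closure p U S \<longleftrightarrow>
      invariant_under S (LpC p U) \<and> invariant_under S (Lhat p U) \<and> invariant_under S M'"
    using M' unfolding M_char_def by blast+
  have "in_wot_closure p U (ultra_op T)" if "bop_Lp p T" for T
    unfolding in_wot_closure_def using that by fastforce
  then have "invariant_usub p U M'"
    unfolding invariant_usub_def using closed wot bop_U_ultra_op[OF _ p_ge_1] by blast
  moreover have "\<not> LpC p U \<subseteq> M'"
    using one_LpC one_not_Lhat below by blast
  moreover have "LpC p U \<subseteq> annihilator p U \<G>" "LpC p U \<subseteq> UP p"
    using LpC_subset_annihilator closed_usub_UP[OF closed_LpC] by auto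
  ultimately have cases: "M' = Lhat p U \<or> M' = uzero p U"
    using invariant_usub_cases[of M'] \<open>M' \<noteq> M\<close> by blast
  obtain S where S: "bop_U p U S" "\<forall>F\<in>LpC p U. S F = (\<lambda>n x. 0)" "\<forall>F\<in>UP p. S F \<in> Lhat p U"
    and not_wot: "\<not> in_wot_closure p U S"
    using rank_one_not_in_wot_closure by blast
  have "invariant_under S (LpC p U)" "invariant_under S (Lhat p U)" "invariant_under S (uzero p U)"
    using S(2,3) closed_usub_zero[OF closed_LpC] closed_usub_zero[OF closed_Lhat] Lhat_UP
    unfolding invariant_under_def Lhat_Int_LpC[symmetric] by auto
  then show False using cases wot[OF S(1)] not_wot by blast
qed

end
section \<open>The distinguished subspace\<close>

lemma conjugate_exponents_2_2: "conjugate_exponents 2 2"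
  by (simp add: conjugate_exponents_def)

lemma conjugate_exponents_less_2_iff:
  assumes "conjugate_exponents p q"
  shows "q < 2 \<longleftrightarrow> 2 < p"
proof -
  have "0 < p" "0 < q" and sum: "1 / p + 1 / q = 1" using assms by (auto simp: conjugate_exponents_def)
  then have "q < 2 \<longleftrightarrow> 1 / 2 < 1 / q" "2 < p \<longleftrightarrow> 1 / p < 1 / 2" by (auto simp: field_simps)
  then show ?thesis using sum by linarith
qed

lemma integral_M01_cos:
  assumes "0 < (k :: nat)"
  shows "(LINT x|M01. cos (real k * pi * x)) = 0"
proof -
  have "(LINT x|M01. cos (real k * pi * x)) = (LINT x|lborel. cos (real k * pi * x) * indicator {0..1} x)"
    unfolding M01_def by (subst integral_restrict_space) (auto simp: mult.commute)
  also have "\<dots> = sin (real k * pi * 1) / (real k * pi) - sin (real k * pi * 0) / (real k * pi)"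
    by (rule integral_FTC_Icc_real)
      (use assms in \<open>auto intro!: derivative_eq_intros continuous_intros simp: field_simps\<close>)
  also have "\<dots> = 0" using sin_npi[of k] by simp
  finally show ?thesis .
qed

lemma cos_diff_squared:
  fixes a b :: real
  shows "(cos a - cos b)\<^sup>2 = 1 + cos (2 * a) / 2 + cos (2 * b) / 2 - cos (b - a) - cos (b + a)"
proof -
  have "(cos a - cos b)\<^sup>2 = (cos a)\<^sup>2 + (cos b)\<^sup>2 - 2 * (cos a * cos b)"
    by (simp add: power2_eq_square algebra_simps)
  moreover have "cos (2 * a) = 2 * (cos a)\<^sup>2 - 1" "cos (2 * b) = 2 * (cos b)\<^sup>2 - 1" by (rule cos_double_cos)+
  moreover have "cos (b - a) + cos (b + a) = 2 * (cos a * cos b)" by (simp add: cos_add cos_diff)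
  ultimately show ?thesis by linarith
qed

lemma integral_cos_diff_squared:
  fixes n m :: nat
  assumes nm: "0 < n" "n < m"
  shows "(LINT x|M01. (cos (real n * pi * x) - cos (real m * pi * x))\<^sup>2) = 1"
proof -
  have int: "integrable M01 (\<lambda>x. cos (real k * pi * x))" for k
    by (rule M01.integrable_const_bound[where B = 1]) (auto intro!: borel_measurable_M01)
  have "2 * (real n * pi * x) = real (2 * n) * pi * x" "2 * (real m * pi * x) = real (2 * m) * pi * x"
    "real m * pi * x - real n * pi * x = real (m - n) * pi * x"
      "real m * pi * x + real n * pi * x = real (m + n) * pi * x" for x
    using nm by (auto simp: of_nat_diff algebra_simps)
  then have "(LINT x|M01. (cos (real n * pi * x) - cos (real m * pi * x))\<^sup>2) =
      (LINT x|M01. 1 + cos (real (2 * n) * pi * x) / 2 + cos (real (2 * m) * pi * x) / 2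
        - cos (real (m - n) * pi * x) - cos (real (m + n) * pi * x))"
    by (simp only: cos_diff_squared)
  also have "\<dots> = 1 + (LINT x|M01. cos (real (2 * n) * pi * x)) / 2 + (LINT x|M01. cos (real (2 * m) * pi * x)) / 2
      - (LINT x|M01. cos (real (m - n) * pi * x)) - (LINT x|M01. cos (real (m + n) * pi * x))"
    using int[of "2 * n"] int[of "2 * m"] int[of "m - n"] int[of "m + n"] by simp
  also have "\<dots> = 1"
    using integral_M01_cos[of "2 * n"] integral_M01_cos[of "2 * m"] integral_M01_cos[of "m - n"]
      integral_M01_cos[of "m + n"] nm
    by simp
  finally show ?thesis .
qed

lemma integral_power2_le_lpnorm:
  assumes f: "f \<in> Lp p" and p: "1 < p" and b: "\<And>x. \<bar>f x\<bar> \<le> b"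
  shows "(LINT x|M01. (f x)\<^sup>2) \<le> b * lpnorm p f"
proof -
  have le: "(f x)\<^sup>2 \<le> b * \<bar>f x\<bar>" for x
    using mult_right_mono[OF b abs_ge_zero, of x "f x"] by (simp add: power2_eq_square abs_mult[symmetric])
  have int: "integrable M01 (\<lambda>x. b * \<bar>f x\<bar>)" using Lp_integrable[OF f p] by simp
  have "(LINT x|M01. (f x)\<^sup>2) \<le> (LINT x|M01. b * \<bar>f x\<bar>)"
    using le Lp_measurable[OF f]
    by (intro integral_mono Bochner_Integration.integrable_bound[OF int] int)
      (auto intro: order_trans[OF le abs_ge_self])
  also have "\<dots> \<le> b * lpnorm p f"
    using integral_abs_le_lpnorm[OF f p] order_trans[OF abs_ge_zero b] by (simp add: mult_left_mono)
  finally show ?thesis .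
qed

definition concentrating_indicators :: "real \<Rightarrow> useq" where
  "concentrating_indicators p n x = real (Suc n) powr (1 / p) * indicator {0..1 / real (Suc n)} x"

lemma concentrating_indicators_Lp: "0 \<le> r \<Longrightarrow> concentrating_indicators p n \<in> Lp r"
  and lpnorm_concentrating_indicators:
    "0 < r \<Longrightarrow> lpnorm r (concentrating_indicators p n) = real (Suc n) powr (1 / p - 1 / r)"
proof -
  have E_subset: "{0..1 / real (Suc n)} \<subseteq> {0..1}" by (auto simp: field_simps)
  have E: "{0..1 / real (Suc n)} \<in> sets M01"
    unfolding M01_def using E_subset by (subst sets_restrict_space_iff) auto
  have measure: "measure M01 {0..1 / real (Suc n)} = 1 / real (Suc n)"
    unfolding M01_def using E_subset by (subst measure_restrict_space) auto
  show "concentrating_indicators p n \<in> Lp r" if "0 \<le> r"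
    unfolding concentrating_indicators_def[abs_def] using that by (intro Lp_scale indicator_Lp E)
  show "lpnorm r (concentrating_indicators p n) = real (Suc n) powr (1 / p - 1 / r)" if "0 < r"
    unfolding concentrating_indicators_def[abs_def] lpnorm_scale[OF that]
    using that E measure by (simp add: lpnorm_indicator powr_divide powr_diff)
qed

context ultrapower
begin

lemma L1null_subset_UP: "L1null p U \<subseteq> UP p"
  using L1null_UP by blast

lemma L1null_inter_hat_annihilator:
  assumes pq: "conjugate_exponents p q"
  shows "L1null p U \<inter> hat_annihilator p U (L1null q U) = uzero p U"
proof
  have p: "1 \<le> p" using conjugate_exponentsD(1)[OF pq] by simp
  show "L1null p U \<inter> hat_annihilator p U (L1null q U) \<subseteq> uzero p U"
    using unorm_L1null_eq_0[OF pq] L1null_UP by (auto simp: hat_annihilator_def uzero_iff[OF p])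
  show "uzero p U \<subseteq> L1null p U \<inter> hat_annihilator p U (L1null q U)"
    using uzero_subset_closed[OF closed_usub_L1null[OF pq] p]
      uzero_subset_closed[OF closed_usub_hat_annihilator[OF pq L1null_subset_UP] p] by blast
qed

lemma L1null_plus_hat_annihilator:
  assumes pq: "conjugate_exponents p q"
  shows "subspace_sum p U (L1null p U) (hat_annihilator p U (L1null q U)) = Lhat p U"
proof (intro equalityI subsetI)
  have p: "1 \<le> p" using conjugate_exponentsD(1)[OF pq] by simp
  note closed = closed_usub_Lhat[OF pq]
  fix F assume "F \<in> subspace_sum p U (L1null p U) (hat_annihilator p U (L1null q U))"
  then obtain G H where F_UP: "F \<in> UP p" and G: "G \<in> L1null p U" and H: "H \<in> hat_annihilator p U (L1null q U)"
    and eq: "ueq p U F (\<lambda>n x. G n x + H n x)"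
    unfolding subspace_sum_def by blast
  have "H \<in> Lhat p U" using H by (simp add: hat_annihilator_def)
  from closed_usub_lin[OF closed L1null_Lhat[OF pq G] this, of 1 1]
  have sum: "(\<lambda>n x. G n x + H n x) \<in> Lhat p U" by simp
  then have "UP_eq p U (\<lambda>n x. G n x + H n x) F" using eq F_UP p Lhat_UP[OF sum] UP_eq_ueq UP_eq_sym by blast
  then show "F \<in> Lhat p U" by (rule closed_usub_UP_eq[OF closed p sum])
next
  have p: "1 < p" "1 \<le> p" using conjugate_exponentsD(1)[OF pq] by auto
  fix F assume F: "F \<in> Lhat p U"
  note F_UP = Lhat_UP[OF F]
  obtain d e where d: "d \<in> L1null p U" and e: "e \<in> equiintegrable p U" and split: "F = (\<lambda>n x. d n x + e n x)"
    using subsequence_splitting[OF p(1) F_UP] by blast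
  have "(\<lambda>n x. 1 * F n x + (- 1) * d n x) \<in> Lhat p U" by (rule Lhat_lin[OF pq F L1null_Lhat[OF pq d]])
  then have "e \<in> hat_annihilator p U (L1null q U)"
    using e split by (simp add: hat_annihilator_eq_Int annihilator_L1null[OF pq])
  moreover have "ueq p U F (\<lambda>n x. d n x + e n x)" using ueq_refl[OF F_UP p(2)] split by simp
  ultimately show "F \<in> subspace_sum p U (L1null p U) (hat_annihilator p U (L1null q U))"
    using subspace_sumI[OF F_UP d] by blast
qed

lemma L1null_nonzero:
  assumes p: "1 < p"
  shows "\<exists>F\<in>L1null p U. unorm p U F \<noteq> 0"
proof
  let ?F = "concentrating_indicators p"
  have norm: "lpnorm p (?F n) = 1" for n using p by (simp add: lpnorm_concentrating_indicators)
  have F_UP: "?F \<in> UP p" using p norm by (intro UPI[where C = 1] concentrating_indicators_Lp) auto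
  have "(LINT x|M01. \<bar>?F n x\<bar>) = real (Suc n) powr (1 / p - 1)" for n
    using lpnorm_concentrating_indicators[of 1 p n] by (simp add: lpnorm_def)
  moreover have "(\<lambda>n. real (Suc n) powr (1 / p - 1)) \<longlonglongrightarrow> 0"
    using p by (intro tendsto_neg_powr filterlim_compose[OF filterlim_real_sequentially filterlim_Suc]) simp
  ultimately show "?F \<in> L1null p U" using F_UP by (simp add: L1null_def sequentially_tendsto)
  show "unorm p U ?F \<noteq> 0" unfolding unorm_def norm using LimI[of "\<lambda>n. 1" 1] by simp
qed

lemma unorm_weakly_null_part_nonzero_if_separated:
  assumes pq: "conjugate_exponents p q" and H: "H \<in> UP p" and c: "0 < c"
    and separated: "\<And>n m. 0 < n \<Longrightarrow> n < m \<Longrightarrow> c \<le> lpnorm p (\<lambda>x. H n x - H m x)"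
  shows "unorm p U (weakly_null_part p U H) \<noteq> 0"
proof
  let ?w = "weak_limit p U H"
  have p: "1 \<le> p" using conjugate_exponentsD(1)[OF pq] by simp
  assume "unorm p U (weakly_null_part p U H) = 0"
  then have "((\<lambda>n. lpnorm p (\<lambda>x. H n x - ?w x)) \<longlongrightarrow> 0) U"
    using unorm_tendsto[OF Lhat_UP[OF weakly_null_part_Lhat[OF pq H]]] by simp
  then have ev: "\<forall>\<^sub>F n in U. lpnorm p (\<lambda>x. H n x - ?w x) < c / 2" by (rule order_tendstoD) (use c in simp)
  obtain n where n: "lpnorm p (\<lambda>x. H n x - ?w x) < c / 2" "0 < n"
    using eventually_ex[OF eventually_conj[OF ev U_gt[of 0]]] by blast
  obtain m where m: "lpnorm p (\<lambda>x. H m x - ?w x) < c / 2" "n < m"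
    using eventually_ex[OF eventually_conj[OF ev U_gt[of n]]] by blast
  have "lpnorm p (\<lambda>x. H n x - H m x) \<le> lpnorm p (\<lambda>x. H n x - ?w x) + lpnorm p (\<lambda>x. ?w x - H m x)"
    by (rule lpnorm_diff_trans[OF UP_Lp[OF H] weak_limit_Lp[OF pq H] UP_Lp[OF H] p])
  then show False using separated[OF n(2) m(2)] n(1) m(1) by (simp add: lpnorm_minus_commute[of p ?w])
qed

lemma bounded_seqs_weakly_null_part:
  assumes pq: "conjugate_exponents p q" and H: "H \<in> bounded_seqs"
  shows "weakly_null_part p U H \<in> hat_annihilator p U (L1null q U)"
proof -
  note qp = conjugate_exponents_sym[OF pq]
  have H_UP: "H \<in> UP p" using H conjugate_exponentsD(1)[OF pq] by (intro bounded_seqs_UP) auto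
  have "upair U (weakly_null_part p U H) G = 0" if G: "G \<in> L1null q U" for G
    using upair_weakly_null_part[OF pq H_UP L1null_Lhat[OF qp G]]
      L1null_upair_bounded[OF conjugate_exponentsD(2)[OF pq] G H] by (simp add: upair_commute[of U H])
  then show ?thesis using weakly_null_part_Lhat[OF pq H_UP] by (simp add: hat_annihilator_def)
qed

lemma hat_annihilator_L1null_nonzero:
  assumes pq: "conjugate_exponents p q"
  shows "\<exists>F\<in>hat_annihilator p U (L1null q U). unorm p U F \<noteq> 0"
proof
  have p: "1 < p" "0 < p" using conjugate_exponentsD(1)[OF pq] by auto
  define H :: useq where "H n x = cos (real n * pi * x)" for n x
  have H: "H \<in> bounded_seqs"
    unfolding H_def[abs_def] by (intro bounded_seqsI[where K = 1] borel_measurable_M01) (simp_all, measurable)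
  note H_UP = bounded_seqs_UP[OF H p(2)]
  show "weakly_null_part p U H \<in> hat_annihilator p U (L1null q U)"
    by (rule bounded_seqs_weakly_null_part[OF pq H])
  have "1 / 2 \<le> lpnorm p (\<lambda>x. H n x - H m x)" if nm: "0 < n" "n < m" for n m
  proof -
    have "\<bar>H n x - H m x\<bar> \<le> 2" for x
      unfolding H_def
      using abs_cos_le_one[of "real n * pi * x"] abs_cos_le_one[of "real m * pi * x"] by linarith
    moreover have "(\<lambda>x. H n x - H m x) \<in> Lp p" using UP_Lp[OF H_UP] p by (intro Lp_diff) auto
    ultimately show ?thesis
      using integral_power2_le_lpnorm[of "\<lambda>x. H n x - H m x" p 2] integral_cos_diff_squared[OF nm] p(1)
      by (simp add: H_def)
  qed
  then show "unorm p U (weakly_null_part p U H) \<noteq> 0"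
    by (intro unorm_weakly_null_part_nonzero_if_separated[OF pq H_UP, of "1 / 2"]) auto
qed

lemma Lhat_exponent_antimono:
  assumes pq: "conjugate_exponents p q" and rs: "conjugate_exponents r s" and r: "r \<le> p"
  shows "Lhat p U \<subseteq> Lhat r U"
proof
  fix G assume G: "G \<in> Lhat p U"
  have r_gt_1: "1 < r" and q: "1 < q"
    using conjugate_exponentsD(1)[OF rs] conjugate_exponentsD(2)[OF pq] by auto
  have "1 / s \<le> 1 / q"
    using pq rs r r_gt_1 divide_left_mono[of r p 1] unfolding conjugate_exponents_def by fastforce
  then have s: "q \<le> s" using q conjugate_exponentsD(2)[OF rs] by (simp add: field_simps)
  show "G \<in> Lhat r U"
    unfolding Lhat_iff[OF rs]
  proof (intro conjI ballI)
    show "G \<in> UP r" by (rule UP_exponent_antimono[OF Lhat_UP[OF G] r_gt_1 r])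
    show "upair U G (\<lambda>n. f) = 0" if "f \<in> Lp s" for f
      by (rule upair_Lhat_const[OF pq G Lp_exponent_antimono[OF that q s]])
  qed
qed

lemma L1null_iff_lpnorm_2:
  assumes p: "2 < p" and F: "F \<in> UP p"
  shows "F \<in> L1null p U \<longleftrightarrow> ((\<lambda>n. lpnorm 2 (F n)) \<longlongrightarrow> 0) U"
proof
  assume "F \<in> L1null p U"
  then have "((\<lambda>n. LINT x|M01. \<bar>F n x\<bar> powr 2) \<longlongrightarrow> 0) U" using p by (intro L1null_powr[of p]) auto
  then have "((\<lambda>n. (LINT x|M01. \<bar>F n x\<bar> powr 2) powr (1 / 2)) \<longlongrightarrow> 0) U"
    by (intro tendsto_zero_powrI[where b = "1/2"]) auto
  then show "((\<lambda>n. lpnorm 2 (F n)) \<longlongrightarrow> 0) U" by (simp add: lpnorm_def)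
next
  assume lim: "((\<lambda>n. lpnorm 2 (F n)) \<longlongrightarrow> 0) U"
  have L2: "F n \<in> Lp 2" for n using p by (intro Lp_exponent_antimono[OF UP_Lp[OF F]]) auto
  have b: "norm (LINT x|M01. \<bar>F n x\<bar>) \<le> lpnorm 2 (F n)" for n using integral_abs_le_lpnorm[OF L2] by simp
  show "F \<in> L1null p U" unfolding L1null_def
    using F Lim_null_comparison[OF always_eventually[OF allI[OF b]] lim] by simp
qed

lemma L1null_eq_lpnorm_2:
  assumes "2 < p"
  shows "L1null p U = {F \<in> UP p. ((\<lambda>n. lpnorm 2 (F n)) \<longlongrightarrow> 0) U}"
  using L1null_iff_lpnorm_2[OF assms] L1null_UP by blast

lemma hat_annihilator_Lhat_2:
  assumes pq: "conjugate_exponents p q" and p: "2 < p"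
  shows "hat_annihilator p U (Lhat 2 U) = L1null p U"
proof (intro equalityI subsetI)
  have q: "1 < q" "q \<le> 2" using conjugate_exponentsD(2)[OF pq] conjugate_exponents_less_2_iff[OF pq] p by auto
  fix F assume F: "F \<in> hat_annihilator p U (Lhat 2 U)"
  then have F_Lhat: "F \<in> Lhat p U" by (simp add: hat_annihilator_def)
  note F_UP = Lhat_UP[OF F_Lhat]
  have "upair U F H = 0" if H: "H \<in> bounded_seqs" for H
  proof -
    have H_UP_2: "H \<in> UP 2" and H_UP_q: "H \<in> UP q" using bounded_seqs_UP[OF H] q by auto
    have w_Lp_q: "weak_limit 2 U H \<in> Lp q"
      by (rule Lp_exponent_antimono[OF weak_limit_Lp[OF conjugate_exponents_2_2 H_UP_2] q])
    have "upair U F (weakly_null_part 2 U H) = 0"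
      using F weakly_null_part_Lhat[OF conjugate_exponents_2_2 H_UP_2] by (simp add: hat_annihilator_def)
    then show ?thesis
      using upair_diff_right[OF pq F_UP H_UP_q UP_const[OF w_Lp_q]] upair_Lhat_const[OF pq F_Lhat w_Lp_q]
      by simp
  qed
  then show "F \<in> L1null p U" using F_UP by (simp add: L1null_eq_annihilator[OF pq] annihilator_def)
next
  fix F assume F: "F \<in> L1null p U"
  note F_UP = L1null_UP[OF F]
  have F_UP_2: "F \<in> UP 2" using p by (intro UP_exponent_antimono[OF F_UP]) auto
  have "unorm 2 U F = 0" unfolding unorm_def by (rule LimI) (use F L1null_iff_lpnorm_2[OF p F_UP] in blast)
  then have "upair U F G = 0" if "G \<in> Lhat 2 U" for G
    using upair_null_left[OF conjugate_exponents_2_2 F_UP_2 Lhat_UP[OF that]] by simp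
  then show "F \<in> hat_annihilator p U (Lhat 2 U)" using L1null_Lhat[OF pq F] by (simp add: hat_annihilator_def)
qed

lemma hat_annihilator_L1null_approx:
  assumes pq: "conjugate_exponents p q" and p: "p \<le> 2" and H: "H \<in> hat_annihilator p U (L1null q U)"
    and \<epsilon>: "0 < \<epsilon>"
  shows "\<exists>H'\<in>Lhat 2 U. H' \<in> UP p \<and> unorm p U (\<lambda>n x. H n x - H' n x) < \<epsilon>"
proof -
  have p_bounds: "1 < p" "1 \<le> p" "0 < p" using conjugate_exponentsD(1)[OF pq] by auto
  have H_Lhat: "H \<in> Lhat p U" and "H \<in> equiintegrable p U"
    using H by (auto simp: hat_annihilator_eq_Int annihilator_L1null[OF pq])
  then obtain B where B: "B \<in> bounded_seqs" and near: "unorm p U (\<lambda>n x. H n x - B n x) < \<epsilon> / 2"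
    using \<epsilon> unfolding equiintegrable_def by (auto dest: spec[of _ "\<epsilon> / 2"])
  note H_UP = Lhat_UP[OF H_Lhat] and B_UP_2 = bounded_seqs_UP[OF B, of 2]
    and B_UP = bounded_seqs_UP[OF B p_bounds(3)]
  let ?w = "weak_limit 2 U B"
  have w_Lp_2: "?w \<in> Lp 2" by (rule weak_limit_Lp[OF conjugate_exponents_2_2 B_UP_2]) simp
  have w: "?w \<in> Lp p" by (rule Lp_exponent_antimono[OF w_Lp_2 p_bounds(1) p])
  have B'_UP: "weakly_null_part 2 U B \<in> UP p" by (rule UP_diff[OF B_UP UP_const[OF w] p_bounds(2)])
  note diff_UP = UP_diff[OF H_UP B_UP p_bounds(2)]
  have "lpnorm p ?w \<le> unorm p U (\<lambda>n x. H n x - B n x)"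
  proof (rule lpnorm_le_dual[OF pq w _ unorm_nonneg[OF diff_UP]])
    fix g assume g: "g \<in> Lp q"
    have "2 \<le> q" using conjugate_exponents_less_2_iff[OF pq] p by auto
    then have "(LINT x|M01. ?w x * g x) = upair U B (\<lambda>n. g)"
      by (intro integral_weak_limit[OF conjugate_exponents_2_2 B_UP_2] Lp_exponent_antimono[OF g]) auto
    also have "\<dots> = - upair U (\<lambda>n x. H n x - B n x) (\<lambda>n. g)"
      using upair_diff_left[OF pq H_UP B_UP UP_const[OF g]] upair_Lhat_const[OF pq H_Lhat g] by simp
    also have "\<dots> \<le> unorm p U (\<lambda>n x. H n x - B n x) * lpnorm q g"
      using upair_bound[OF pq diff_UP UP_const[OF g]] by (simp add: unorm_const)
    finally show "(LINT x|M01. ?w x * g x) \<le> unorm p U (\<lambda>n x. H n x - B n x) * lpnorm q g" .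
  qed
  moreover have "unorm p U (\<lambda>n x. H n x - weakly_null_part 2 U B n x)
    \<le> unorm p U (\<lambda>n x. H n x - B n x) + lpnorm p ?w"
    using unorm_triangle[OF diff_UP UP_const[OF w] p_bounds(2)]
    by (simp add: unorm_const diff_diff_eq2 diff_add_eq)
  ultimately have "unorm p U (\<lambda>n x. H n x - weakly_null_part 2 U B n x) < \<epsilon>" using near by simp
  then show ?thesis using B'_UP weakly_null_part_Lhat[OF conjugate_exponents_2_2 B_UP_2] by (intro bexI) auto
qed

end

context selective_ultrapower
begin

lemma approximable_rank_one:
  assumes "conjugate_exponents p q" "conjugate_exponents r r'" "G \<in> Lhat q U" "upper_estimate q r' U G"
    "H \<in> UP p" "upper_estimate p r U H"
  shows "approximable p U (rank_one U G H)"
  unfolding approximable_def rank_one_def using rank_one_approximation[OF assms] by blast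

lemma upper_estimate_Lhat_2:
  assumes "1 < q" "q \<le> 2" "G \<in> Lhat 2 U"
  shows "upper_estimate q 2 U G"
  using upper_estimate_Lhat[of 2 G] assms UP_Lp[OF Lhat_UP[OF assms(3)]]
  by (intro upper_estimate_exponent_antimono[of 2 2 U G q]) auto

lemma ultra_op_L1null:
  assumes pq: "conjugate_exponents p q" and p: "2 < p" and T: "bop_Lp p T" and F: "F \<in> L1null p U"
  shows "ultra_op T F \<in> L1null p U"
proof -
  have p_bounds: "1 < p" "1 \<le> p" using p by auto
  have q: "1 < q" "q \<le> 2" using conjugate_exponentsD(2)[OF pq] conjugate_exponents_less_2_iff[OF pq] p by auto
  have "upair U (ultra_op T F) G = 0" if G: "G \<in> Lhat 2 U" for G
  proof (rule upair_ultra_op_eq_0[OF pq T L1null_UP[OF F] upper_estimate_L1null[OF p_bounds(1) F]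
    _ upper_estimate_Lhat_2[OF q G]])
    show "G \<in> Lhat q U"
      using Lhat_exponent_antimono[OF conjugate_exponents_2_2 conjugate_exponents_sym[OF pq] q(2)] G by blast
    show "1 / p + 1 / 2 < 1" using p by (simp add: field_simps)
  qed
  moreover have "ultra_op T F \<in> Lhat p U" by (rule ultra_op_Lhat[OF T p_bounds(2) L1null_Lhat[OF pq F]])
  ultimately show ?thesis
    unfolding hat_annihilator_Lhat_2[OF pq p, symmetric] by (simp add: hat_annihilator_def)
qed

theorem distinguished_subspace_gt_2:
  assumes pq: "conjugate_exponents p q" and p: "2 < p"
  shows "distinguished_subspace U p q (Lhat 2 U)"
proof (unfold_locales, unfold hat_annihilator_Lhat_2[OF pq p])
  have p_bounds: "1 < p" "1 \<le> p" "min p 2 = 2" using p by auto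
  have q: "1 < q" "q \<le> 2" "min q 2 = q"
    using conjugate_exponentsD(2)[OF pq] conjugate_exponents_less_2_iff[OF pq] p by auto
  show sub: "Lhat 2 U \<subseteq> Lhat q U"
    by (rule Lhat_exponent_antimono[OF conjugate_exponents_2_2 conjugate_exponents_sym[OF pq] q(2)])
  show "conjugate_exponents p q" by (rule pq)
  show "(\<lambda>n x. 0) \<in> Lhat 2 U" by (rule closed_usub_zero[OF closed_usub_Lhat[OF conjugate_exponents_2_2]])
  show "(\<lambda>n x. a * G n x + b * G' n x) \<in> Lhat 2 U" if "G \<in> Lhat 2 U" "G' \<in> Lhat 2 U" for G G' a b
    by (rule Lhat_lin[OF conjugate_exponents_2_2 that])
  show "approximable p U (rank_one U G H)" if G: "G \<in> Lhat 2 U" and H: "H \<in> Lhat p U" for G H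
    using upper_estimate_Lhat[OF p_bounds(1) H] p_bounds(3) subsetD[OF sub G]
    by (intro approximable_rank_one[OF pq conjugate_exponents_2_2] upper_estimate_Lhat_2[OF q(1,2) G]
      Lhat_UP[OF H]) auto
  show "approximable p U (rank_one U G H)" if G: "G \<in> Lhat q U" and H: "H \<in> L1null p U" for G H
    using upper_estimate_Lhat[OF q(1) G] q(3)
    by (intro approximable_rank_one[OF pq pq G] upper_estimate_L1null[OF p_bounds(1) H] L1null_UP[OF H]) auto
  show "ultra_op T F \<in> L1null p U" if "bop_Lp p T" "F \<in> L1null p U" for T F
    by (rule ultra_op_L1null[OF pq p that])
  show "\<exists>N. closed_usub p U N \<and> N \<subseteq> Lhat p U \<and> L1null p U \<inter> N = uzero p U \<and> subspace_sum p U (L1null p U) N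
    = Lhat p U"
    using closed_usub_hat_annihilator[OF pq L1null_subset_UP] L1null_inter_hat_annihilator[OF pq]
      L1null_plus_hat_annihilator[OF pq]
    by (intro exI[of _ "hat_annihilator p U (L1null q U)"]) (auto simp: hat_annihilator_def)
  show "\<exists>F\<in>L1null p U. unorm p U F \<noteq> 0" by (rule L1null_nonzero[OF p_bounds(1)])
  obtain v where v: "v \<in> hat_annihilator p U (L1null q U)" "unorm p U v \<noteq> 0"
    using hat_annihilator_L1null_nonzero[OF pq] by blast
  have "v \<notin> L1null p U" using L1null_inter_hat_annihilator[OF pq] v uzero_iff[OF p_bounds(2), of v] by blast
  then show "\<exists>F\<in>Lhat p U. F \<notin> L1null p U" using v(1) by (auto simp: hat_annihilator_def)
qed

lemma ultra_op_hat_annihilator_L1null: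
  assumes pq: "conjugate_exponents p q" and p: "p < 2" and T: "bop_Lp p T"
    and F: "F \<in> hat_annihilator p U (L1null q U)"
  shows "ultra_op T F \<in> hat_annihilator p U (L1null q U)"
proof -
  note qp = conjugate_exponents_sym[OF pq]
  have p_bounds: "1 < p" "1 \<le> p" using conjugate_exponentsD(1)[OF pq] by auto
  have q: "2 < q" "1 < q" using conjugate_exponents_less_2_iff[OF qp] p by auto
  have F_Lhat: "F \<in> Lhat p U" using F by (simp add: hat_annihilator_def)
  note F_UP = Lhat_UP[OF F_Lhat]
  obtain C where C: "0 \<le> C" "\<And>F. F \<in> UP p \<Longrightarrow> unorm p U (ultra_op T F) \<le> C * unorm p U F"
    using unorm_ultra_op_le[OF T] by blast
  have "upair U (ultra_op T F) G = 0" if G: "G \<in> L1null q U" for G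
  proof (rule upair_eq_0_if_approx[OF pq ultra_op_UP[OF T F_UP] L1null_UP[OF G]])
    fix \<epsilon> :: real assume \<epsilon>: "0 < \<epsilon>"
    obtain F' where F': "F' \<in> Lhat 2 U" "F' \<in> UP p" and near: "unorm p U (\<lambda>n x. F n x - F' n x) < \<epsilon> / (C + 1)"
      using hat_annihilator_L1null_approx[OF pq _ F, of "\<epsilon> / (C + 1)"] p C(1) \<epsilon> by auto
    note diff = UP_diff[OF F_UP F'(2) p_bounds(2)]
    have "upair U (ultra_op T F') G = 0"
      using p q
      by (intro upair_ultra_op_eq_0[OF pq T F'(2) upper_estimate_Lhat_2[OF p_bounds(1) _ F'(1)]
        L1null_Lhat[OF qp G]
            upper_estimate_L1null[OF q(2) G]]) (auto simp: field_simps)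
    moreover have "unorm p U (\<lambda>n x. ultra_op T F n x - ultra_op T F' n x)
      \<le> C * unorm p U (\<lambda>n x. F n x - F' n x)"
      unfolding unorm_ultra_op_diff[OF T F_UP F'(2) p_bounds(2)] by (rule C(2)[OF diff])
    then have "unorm p U (\<lambda>n x. ultra_op T F n x - ultra_op T F' n x)
      \<le> (C + 1) * unorm p U (\<lambda>n x. F n x - F' n x)"
      using unorm_nonneg[OF diff] by (simp add: distrib_right)
    then have "unorm p U (\<lambda>n x. ultra_op T F n x - ultra_op T F' n x) < \<epsilon>"
      using near C(1) by (simp add: pos_less_divide_eq mult.commute)
    ultimately show "\<exists>F''\<in>UP p. upair U F'' G = 0 \<and> unorm p U (\<lambda>n x. ultra_op T F n x - F'' n x) < \<epsilon>"
      using ultra_op_UP[OF T F'(2)] by blast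
  qed
  then show ?thesis using ultra_op_Lhat[OF T p_bounds(2) F_Lhat] by (simp add: hat_annihilator_def)
qed

theorem distinguished_subspace_lt_2:
  assumes pq: "conjugate_exponents p q" and p: "p < 2"
  shows "distinguished_subspace U p q (L1null q U)"
proof
  note qp = conjugate_exponents_sym[OF pq]
  have p_bounds: "1 < p" "1 \<le> p" "min p 2 = p" "p \<le> 2" using conjugate_exponentsD(1)[OF pq] p by auto
  have q: "1 < q" "min q 2 = 2" using conjugate_exponents_less_2_iff[OF qp] p by auto
  note closed = closed_usub_L1null[OF qp]
  show "conjugate_exponents p q" by (rule pq)
  show "L1null q U \<subseteq> Lhat q U" using L1null_Lhat[OF qp] by blast
  show "(\<lambda>n x. 0) \<in> L1null q U" by (rule closed_usub_zero[OF closed])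
  show "(\<lambda>n x. a * G n x + b * G' n x) \<in> L1null q U" if "G \<in> L1null q U" "G' \<in> L1null q U" for G G' a b
    by (rule closed_usub_lin[OF closed that])
  show "approximable p U (rank_one U G H)" if G: "G \<in> L1null q U" and H: "H \<in> Lhat p U" for G H
    using upper_estimate_Lhat[OF p_bounds(1) H] p_bounds(3)
    by (intro approximable_rank_one[OF pq pq L1null_Lhat[OF qp G] upper_estimate_L1null[OF q(1) G]
      Lhat_UP[OF H]]) auto
  show "approximable p U (rank_one U G H)" if G: "G \<in> Lhat q U"
    and H: "H \<in> hat_annihilator p U (L1null q U)" for G H
  proof (rule approximable_rank_one_closed[OF pq Lhat_UP[OF G]])
    show "H \<in> UP p" using H by (auto simp: hat_annihilator_def intro: Lhat_UP)
    fix \<delta> :: real assume "0 < \<delta>"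
    then obtain H' where H': "H' \<in> Lhat 2 U" "H' \<in> UP p" "unorm p U (\<lambda>n x. H n x - H' n x) < \<delta>"
      using hat_annihilator_L1null_approx[OF pq p_bounds(4) H] by blast
    have "approximable p U (rank_one U G H')"
      using upper_estimate_Lhat[OF q(1) G] q(2)
      by (intro approximable_rank_one[OF pq conjugate_exponents_2_2 G _ H'(2)
        upper_estimate_Lhat_2[OF p_bounds(1,4) H'(1)]]) auto
    then show "\<exists>H'\<in>UP p. approximable p U (rank_one U G H') \<and> unorm p U (\<lambda>n x. H n x - H' n x) < \<delta>"
      using H' by blast
  qed
  show "ultra_op T F \<in> hat_annihilator p U (L1null q U)" if "bop_Lp p T"
    "F \<in> hat_annihilator p U (L1null q U)" for T F
    by (rule ultra_op_hat_annihilator_L1null[OF pq p that])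
  show "\<exists>N. closed_usub p U N \<and> N \<subseteq> Lhat p U \<and> hat_annihilator p U (L1null q U) \<inter> N = uzero p U \<and>
      subspace_sum p U (hat_annihilator p U (L1null q U)) N = Lhat p U"
    using closed_usub_L1null[OF pq] L1null_Lhat[OF pq] L1null_inter_hat_annihilator[OF pq]
      L1null_plus_hat_annihilator[OF pq]
    by (intro exI[of _ "L1null p U"]) (auto simp: Int_commute subspace_sum_commute[of p U _ "L1null p U"])
  show "\<exists>F\<in>hat_annihilator p U (L1null q U). unorm p U F \<noteq> 0" by (rule hat_annihilator_L1null_nonzero[OF pq])
  obtain v where v: "v \<in> L1null p U" "unorm p U v \<noteq> 0" using L1null_nonzero[OF p_bounds(1)] by blast
  have "v \<notin> hat_annihilator p U (L1null q U)"
    using L1null_inter_hat_annihilator[OF pq] v uzero_iff[OF p_bounds(2), of v] by blast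
  then show "\<exists>F\<in>Lhat p U. F \<notin> hat_annihilator p U (L1null q U)" using L1null_Lhat[OF pq v(1)] by blast
qed

theorem distinguished_subspace_exists:
  assumes "1 < p" "p \<noteq> 2"
  obtains q \<G> where "distinguished_subspace U p q \<G>"
    "2 < p \<Longrightarrow> hat_annihilator p U \<G> = {F \<in> UP p. ((\<lambda>n. lpnorm 2 (F n)) \<longlongrightarrow> 0) U}"
proof -
  note pq = conjugate_exponentsI[OF assms(1)]
  show thesis
  proof (cases "2 < p")
    case True
    then show thesis
      using that[OF distinguished_subspace_gt_2[OF pq]]
      by (simp add: hat_annihilator_Lhat_2[OF pq] L1null_eq_lpnorm_2)
  next
    case False
    then show thesis using that[OF distinguished_subspace_lt_2[OF pq]] assms(2) by simp
  qed
qed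

end

theorem theorem6p1:
  fixes p :: real and U :: "nat filter"
  assumes "1 < p" and "p \<noteq> 2" and "selective_ultrafilter U"
  shows "(\<exists>!M. M_char p U M) \<and>
         (\<forall>M. M_char p U M \<longrightarrow>
            inv_subspaces p U = {LpC p U, Lhat p U, M, subspace_sum p U (LpC p U) M} \<and>
            card (inv_subspaces p U) = 4 \<and>
            (2 < p \<longrightarrow> M = {F \<in> UP p. ((\<lambda>n. lpnorm 2 (F n)) \<longlongrightarrow> 0) U}))"
proof -
  interpret selective_ultrapower U
    using selective_nonprincipal[OF assms(3)] assms(3) by unfold_locales
  obtain q \<G> where subspace: "distinguished_subspace U p q \<G>"
    and M_gt_2: "2 < p \<Longrightarrow> hat_annihilator p U \<G> = {F \<in> UP p. ((\<lambda>n. lpnorm 2 (F n)) \<longlongrightarrow> 0) U}"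
    using distinguished_subspace_exists[OF assms(1,2)] by blast
  interpret distinguished_subspace U p q \<G> by (rule subspace)
  have "\<exists>!M. M_char p U M" using M_char_M M_char_unique by (rule ex1I)
  moreover have "inv_subspaces p U = {LpC p U, Lhat p U, M, subspace_sum p U (LpC p U) M}"
    "card (inv_subspaces p U) = 4" "2 < p \<longrightarrow> M = {F \<in> UP p. ((\<lambda>n. lpnorm 2 (F n)) \<longlongrightarrow> 0) U}"
    if "M_char p U M" for M
    using M_char_unique[OF that] inv_subspaces_eq card_inv_subspaces M_gt_2 by simp_all
  ultimately show ?thesis by blast
qed

end
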